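(* Let $G$ be a finite non-abelian group. Then the commuting graph $\Gamma_c(G)$ is planar if and only if $G$ is isomorphic to one of the following groups: $S_3$, $D_{10}$, $A_4$, $Sz(2)$, $S_4$, $A_5$, $D_8$, $Q_8$, $D_{12}$, $Q_{12}$, $SL(2,3)$, $\mathbb{Z}_2\times D_8$, $\mathbb{Z}_2\times Q_8$, $SG(16,3)$, $\mathbb{Z}_4\rtimes\mathbb{Z}_4$, $D_8*\mathbb{Z}_4$, $M_{16}$.
   Context: For a non-abelian group $G$ with center $Z(G)$, the commuting graph $\Gamma_c(G)$ is the simple undirected graph with vertex set $G\setminus Z(G)$, in which two distinct vertices $x,y$ are adjacent if and only if $xy=yx$. The genus of a graph is the smallest non-negative integer $n$ such that the graph can be embedded on the surface obtained by attaching $n$ handles to a sphere; a graph is planar if its genus is $0$. Notation for groups: $S_n$ and $A_n$ are the symmetric and alternating groups of degree $n$; $\mathbb{Z}_n$ is the cyclic group of order $n$; $D_{2n}=\langle x,y\mid y^n=x^2=1,\ xyx^{-1}=y^{-1}\rangle$ is the dihedral group of order $2n$; $Q_{4n}=\langle x,y\mid y^{2n}=1,\ x^2=y^n,\ xyx^{-1}=y^{-1}\rangle$ is the dicyclic group of order $4n$; $Sz(2)=\langle a,b\mid a^5=b^4=1,\ bab^{-1}=a^2\rangle$; $SL(2,3)=\langle a,b,c\mid a^3=b^3=c^2=abc\rangle$ is the special linear group of degree $2$ over the field with $3$ elements; $SG(16,3)=\langle a,b\mid a^4=b^4=1,\ ab=b^{-1}a^{-1},\ ab^{-1}=ba^{-1}\rangle$;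 $\mathbb{Z}_4\rtimes\mathbb{Z}_4=\langle a,b\mid a^4=b^4=1,\ bab^{-1}=a^{-1}\rangle$; $D_8*\mathbb{Z}_4=\langle a,b,c\mid a^4=b^2=c^2=1,\ ab=ba,\ ac=ca,\ bc=a^2cb\rangle$ (central product); $M_{16}=\langle a,b\mid a^8=b^2=1,\ bab=a^5\rangle$. *)

theory Defs
  imports
    "HOL-Analysis.Analysis"
    "HOL-Algebra.Sym_Groups"
    "HOL-Algebra.Elementary_Groups"
begin

section \<open>Graphs and planarity\<close>

text \<open>A simple undirected graph is a pair of a vertex set and a set of edges, where an edge is a
  set of two distinct vertices.\<close>

type_synonym 'a graph = "'a set \<times> 'a set set"

text \<open>A drawing of a finite simple graph on \<open>S\<close> without crossings: vertices become distinct
  points, edges become simple arcs joining the images of their ends, an arc contains no further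
  vertex, and two arcs meet at most in the images of common end vertices.\<close>

definition embeds_on :: "'a graph \<Rightarrow> 'b::topological_space set \<Rightarrow> bool" where
  "embeds_on \<Gamma> S \<longleftrightarrow>
     (\<exists>(\<phi> :: 'a \<Rightarrow> 'b) (\<gamma> :: 'a set \<Rightarrow> real \<Rightarrow> 'b).
        inj_on \<phi> (fst \<Gamma>) \<and> \<phi> ` fst \<Gamma> \<subseteq> S \<and>
        (\<forall>e\<in>snd \<Gamma>. arc (\<gamma> e) \<and> path_image (\<gamma> e) \<subseteq> S \<and>
           {pathstart (\<gamma> e), pathfinish (\<gamma> e)} = \<phi> ` e \<and>
           path_image (\<gamma> e) \<inter> \<phi> ` fst \<Gamma> = \<phi> ` e) \<and>
        (\<forall>e\<in>snd \<Gamma>. \<forall>e'\<in>snd \<Gamma>. e \<noteq> e' \<longrightarrow>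
           path_image (\<gamma> e) \<inter> path_image (\<gamma> e') \<subseteq> \<phi> ` (e \<inter> e')))"

text \<open>The genus is the least number of handles that have to be attached to the sphere in order to
  embed the graph; it is 0 exactly if the graph embeds on the sphere itself.\<close>

definition planar :: "'a graph \<Rightarrow> bool" where
  "planar \<Gamma> \<longleftrightarrow> embeds_on \<Gamma> (sphere (0 :: real ^ 3) 1)"


section \<open>The commuting graph\<close>

definition group_center :: "('a, 'm) monoid_scheme \<Rightarrow> 'a set" where
  "group_center G = {z \<in> carrier G. \<forall>g\<in>carrier G. z \<otimes>\<^bsub>G\<^esub> g = g \<otimes>\<^bsub>G\<^esub> z}"

definition commuting_graph :: "('a, 'm) monoid_scheme \<Rightarrow> 'a graph" where
  "commuting_graph G =
     (let V = carrier G - group_center G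
      in (V, {{x, y} | x y. x \<in> V \<and> y \<in> V \<and> x \<noteq> y \<and> x \<otimes>\<^bsub>G\<^esub> y = y \<otimes>\<^bsub>G\<^esub> x}))"


section \<open>Groups given by generators and relations\<close>

text \<open>Words in generators and their formal inverses; the letter \<open>(g, True)\<close> stands for the
  inverse of \<open>g\<close>. All elements of the type \<open>'g\<close> are generators.\<close>

type_synonym 'g word = "('g \<times> bool) list"

definition gen :: "'g \<Rightarrow> 'g word" where
  "gen g = [(g, False)]"

definition winv :: "'g word \<Rightarrow> 'g word" where
  "winv w = rev (map (\<lambda>(g, b). (g, \<not> b)) w)"

definition wpow :: "'g word \<Rightarrow> nat \<Rightarrow> 'g word" where
  "wpow w n = concat (replicate n w)"

text \<open>A pair \<open>(u, v)\<close> in \<open>R\<close> is the relation \<open>u = v\<close>; the empty word is 1.\<close>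

inductive word_eq :: "('g word \<times> 'g word) set \<Rightarrow> 'g word \<Rightarrow> 'g word \<Rightarrow> bool"
  for R :: "('g word \<times> 'g word) set" where
  rel: "(u, v) \<in> R \<Longrightarrow> word_eq R u v"
| cancel: "word_eq R [(g, b), (g, \<not> b)] []"
| refl: "word_eq R u u"
| sym: "word_eq R u v \<Longrightarrow> word_eq R v u"
| trans: "word_eq R u v \<Longrightarrow> word_eq R v w \<Longrightarrow> word_eq R u w"
| append: "word_eq R u u' \<Longrightarrow> word_eq R v v' \<Longrightarrow> word_eq R (u @ v) (u' @ v')"

definition word_class :: "('g word \<times> 'g word) set \<Rightarrow> 'g word \<Rightarrow> 'g word set" where
  "word_class R u = {v. word_eq R u v}"

definition presented_group :: "('g word \<times> 'g word) set \<Rightarrow> 'g word set monoid" where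
  "presented_group R =
     \<lparr>carrier = range (word_class R),
      mult = (\<lambda>A B. \<Union>u\<in>A. \<Union>v\<in>B. word_class R (u @ v)),
      one = word_class R []\<rparr>"

lemma word_class_eq_iff: "word_class R u = word_class R v \<longleftrightarrow> word_eq R u v"
  unfolding word_class_def by (blast intro: word_eq.refl word_eq.sym word_eq.trans)

lemma presented_group_mult:
  "word_class R u \<otimes>\<^bsub>presented_group R\<^esub> word_class R v = word_class R (u @ v)"
proof -
  have "word_class R (u' @ v') = word_class R (u @ v)"
    if "u' \<in> word_class R u" "v' \<in> word_class R v" for u' v'
  proof -
    have "word_eq R (u @ v) (u' @ v')"
      using that by (simp add: word_class_def word_eq.append)
    then show ?thesis
      unfolding word_class_eq_iff by (rule word_eq.sym)
  qed
  moreover have "u \<in> word_class R u" "v \<in> word_class R v"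
    by (auto simp: word_class_def intro: word_eq.refl)
  ultimately show ?thesis
    unfolding presented_group_def monoid.simps by blast
qed

lemma winv_left: "word_eq R (winv w @ w) []"
proof (induction w)
  case Nil
  show ?case by (simp add: winv_def word_eq.refl)
next
  case (Cons x w)
  obtain g b where x: "x = (g, b)" by fastforce
  have "word_eq R ([(g, \<not> b)] @ [(g, b)]) []"
    using word_eq.cancel[of R g "\<not> b"] by simp
  from word_eq.append[OF word_eq.append[OF word_eq.refl[of R "winv w"] this] word_eq.refl[of R w]]
  have "word_eq R (winv (x # w) @ x # w) (winv w @ w)"
    by (simp add: x winv_def)
  then show ?case using Cons.IH by (rule word_eq.trans)
qed

lemma group_presented_group: "group (presented_group R)"
proof (rule groupI)
  show "\<one>\<^bsub>presented_group R\<^esub> \<in> carrier (presented_group R)"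
    by (simp add: presented_group_def)
next
  fix A assume "A \<in> carrier (presented_group R)"
  then obtain u where u: "A = word_class R u" by (auto simp: presented_group_def)
  have one: "\<one>\<^bsub>presented_group R\<^esub> = word_class R []" by (simp add: presented_group_def)
  show "\<one>\<^bsub>presented_group R\<^esub> \<otimes>\<^bsub>presented_group R\<^esub> A = A"
    by (simp add: one u presented_group_mult)
  have "word_class R (winv u) \<otimes>\<^bsub>presented_group R\<^esub> A = \<one>\<^bsub>presented_group R\<^esub>"
    by (simp add: one u presented_group_mult word_class_eq_iff winv_left)
  then show "\<exists>B\<in>carrier (presented_group R).
      B \<otimes>\<^bsub>presented_group R\<^esub> A = \<one>\<^bsub>presented_group R\<^esub>"
    by (auto simp: presented_group_def)
next
  fix A B assume "A \<in> carrier (presented_group R)" "B \<in> carrier (presented_group R)"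
  then obtain u v where "A = word_class R u" "B = word_class R v"
    by (auto simp: presented_group_def)
  then show "A \<otimes>\<^bsub>presented_group R\<^esub> B \<in> carrier (presented_group R)"
    by (simp add: presented_group_mult) (simp add: presented_group_def)
next
  fix A B C assume "A \<in> carrier (presented_group R)" "B \<in> carrier (presented_group R)"
    "C \<in> carrier (presented_group R)"
  then obtain u v w where "A = word_class R u" "B = word_class R v" "C = word_class R w"
    by (auto simp: presented_group_def)
  then show "A \<otimes>\<^bsub>presented_group R\<^esub> B \<otimes>\<^bsub>presented_group R\<^esub> C
      = A \<otimes>\<^bsub>presented_group R\<^esub> (B \<otimes>\<^bsub>presented_group R\<^esub> C)"
    by (simp add: presented_group_mult)
qed


section \<open>The groups of the classification\<close>

datatype two_gens = A2 | B2
datatype three_gens = A3 | B3 | C3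

text \<open>The argument of \<open>dihedral_group\<close> and \<open>dicyclic_group\<close> is not the order:
  \<open>dihedral_group n\<close> has order \<open>2 n\<close> and \<open>dicyclic_group n\<close> has order \<open>4 n\<close>.\<close>

definition dihedral_group :: "nat \<Rightarrow> two_gens word set monoid" where
  "dihedral_group n =
     (let x = gen A2; y = gen B2
      in presented_group {(wpow y n, []), (wpow x 2, []), (x @ y @ winv x, winv y)})"

definition dicyclic_group :: "nat \<Rightarrow> two_gens word set monoid" where
  "dicyclic_group n =
     (let x = gen A2; y = gen B2
      in presented_group
           {(wpow y (2 * n), []), (wpow x 2, wpow y n), (x @ y @ winv x, winv y)})"

definition Sz_2 :: "two_gens word set monoid" where
  "Sz_2 =
     (let a = gen A2; b = gen B2
      in presented_group {(wpow a 5, []), (wpow b 4, []), (b @ a @ winv b, wpow a 2)})"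

definition SL_2_3 :: "three_gens word set monoid" where
  "SL_2_3 =
     (let a = gen A3; b = gen B3; c = gen C3
      in presented_group
           {(wpow a 3, wpow b 3), (wpow b 3, wpow c 2), (wpow c 2, a @ b @ c)})"

definition SG_16_3 :: "two_gens word set monoid" where
  "SG_16_3 =
     (let a = gen A2; b = gen B2
      in presented_group
           {(wpow a 4, []), (wpow b 4, []), (a @ b, winv b @ winv a), (a @ winv b, b @ winv a)})"

definition Z4_semidirect_Z4 :: "two_gens word set monoid" where
  "Z4_semidirect_Z4 =
     (let a = gen A2; b = gen B2
      in presented_group {(wpow a 4, []), (wpow b 4, []), (b @ a @ winv b, winv a)})"

definition D8_central_Z4 :: "three_gens word set monoid" where
  "D8_central_Z4 =
     (let a = gen A3; b = gen B3; c = gen C3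
      in presented_group
           {(wpow a 4, []), (wpow b 2, []), (wpow c 2, []),
            (a @ b, b @ a), (a @ c, c @ a), (b @ c, wpow a 2 @ c @ b)})"

definition M_16 :: "two_gens word set monoid" where
  "M_16 =
     (let a = gen A2; b = gen B2
      in presented_group {(wpow a 8, []), (wpow b 2, []), (b @ a @ b, wpow a 5)})"

end

(* A commuting set of noncentral elements spans a clique, and K_5 is not planar: stereographic
   projection from one of its points would give a plane K_4 with all vertices on the outer face,
   against the theta curve theorem. So planarity bounds every such set by 4 elements, and multiplying
   a noncentral element by the center gives |Z(G)| <= 4. The orders 4, 3, 2 of the center are then
   treated by counting inside centralizers: order 4 forces |G| = 16, order 3 is impossible and order 2
   forces |G| in {8, 12, 24}; the group is recovered by generators satisfying the defining relations
   and a comparison of orders. For a trivial center, centralizers of nontrivial elements have order 2, 3, 4,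
   5 or 8, so the class equation 1 = 1/|G| + sum k_d/d, together with divisibility and the fact that
   elements with centralizer of order 3 or 5 come in blocks of 2 or 4, has few solutions; in each of
   them G acts by conjugation on a small set of subgroups, or is found to be metacyclic, or the solution
   is contradictory. Conversely, if centralizers of noncentral elements have at most |Z(G)| + 4
   elements, the graph is a disjoint union of complete graphs on at most 4 vertices. This applies to all
   groups of the list except S_4, which is drawn with an explicit order of its elements on a line;
   S_3 and A_4 are handled as subgroups of S_4. *)
theory Submission
  imports Defs "HOL-Algebra.Sylow"
begin

section \<open>Nonplanarity of the complete graph on five vertices\<close>

text \<open>Relations bound a presented group from above only; excluding a collapse would require a
  model of each group. Both directions are therefore built on upper bounds. For recognition,
  generators of a group of known order \<open>n\<close> that satisfy the relations give a surjection
  from the presented group, and the bound \<open>n\<close> makes it injective. For planarity, the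
  criterion |C(x)| <= |Z| + 4 is used in forms that tolerate collapse: a proper subgroup has at most
  half the elements, so order at most 2(|Z| + 4) suffices, and order at most 16 together with |G| <=
  4|Z| is a special case. The 4 is the same in both directions: excluding K_5 allows commuting sets
  of 4 noncentral elements, and K_4 is still planar. S_4 escapes the criterion because a double
  transposition has a centralizer of order 8 while the center is trivial. The 120 in the class
  equation for a trivial center is the least common multiple of 2, 3, 4, 5 and 8. Centralizers of
  order 8 occur there because excluding cliques bounds only commuting sets.\<close>

definition arc_between :: "'b::topological_space set \<Rightarrow> 'b \<Rightarrow> 'b \<Rightarrow> bool" where
  "arc_between A a b \<longleftrightarrow> (\<exists>g. arc g \<and> path_image g = A \<and> pathstart g = a \<and> pathfinish g = b)"

lemma arc_between_sym: "arc_between A a b \<Longrightarrow> arc_between A b a"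
  unfolding arc_between_def
  by (metis arc_reversepath path_image_reversepath pathfinish_reversepath pathstart_reversepath)

lemma arc_between_join:
  fixes A :: "complex set"
  assumes "arc_between A a b" "arc_between B b c" "A \<inter> B \<subseteq> {b}"
  shows "arc_between (A \<union> B) a c"
proof -
  obtain g h where g: "arc g" "path_image g = A" "pathstart g = a" "pathfinish g = b"
    and h: "arc h" "path_image h = B" "pathstart h = b" "pathfinish h = c"
    using assms unfolding arc_between_def by blast
  have "arc (g +++ h)" using g h assms(3) by (simp add: arc_join)
  moreover have "path_image (g +++ h) = A \<union> B" using g h by (simp add: path_image_join)
  ultimately show ?thesis using g h unfolding arc_between_def
    by (metis pathfinish_join pathstart_join)
qed

lemma arc_between_ends: "arc_between A a b \<Longrightarrow> a \<in> A \<and> b \<in> A \<and> a \<noteq> b"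
  unfolding arc_between_def
  by (metis arc_distinct_ends pathfinish_in_path_image pathstart_in_path_image)

lemma arc_between_connected:
  assumes "arc_between (A :: 'b::t2_space set) a b"
  shows "connected (A - {a})" "connected (A - {b})" "connected (A - {a,b})" "A - {a,b} \<noteq> {}"
    "compact A" "connected A"
proof -
  obtain g where g: "arc g" "path_image g = A" "pathstart g = a" "pathfinish g = b"
    using assms unfolding arc_between_def by blast
  have inj: "inj_on g {0..1}" and cont: "continuous_on {0..1} g"
    using g(1) by (auto simp: arc_def path_def)
  have A: "A = g ` {0..1}" "a = g 0" "b = g 1"
    using g by (auto simp: path_image_def pathstart_def pathfinish_def)
  have "A - {a} = g ` {0<..1}" "A - {b} = g ` {0..<1}" "A - {a,b} = g ` {0<..<1}"
    unfolding A using inj_on_eq_iff[OF inj] by (auto simp: image_iff less_le)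
  moreover have "connected (g ` J)" if "J \<subseteq> {0..1}" "connected J" for J
    using that by (intro connected_continuous_image continuous_on_subset[OF cont])
  then have "connected (g ` {0<..1})" "connected (g ` {0..<1})" "connected (g ` {0<..<1})"
    by (auto simp: subset_iff)
  ultimately show "connected (A - {a})" "connected (A - {b})" "connected (A - {a,b})" "A - {a,b} \<noteq> {}"
    by simp_all
  show "compact A" "connected A" using g compact_arc_image connected_arc_image by blast+
qed

text \<open>Running along \<open>A\<close> and back along \<open>B\<close> is a simple closed curve,
  so this is the Jordan curve theorem in the unparametrized form used for edges.\<close>

lemma Jordan_two_arcs:
  fixes A B :: "complex set"
  assumes "arc_between A a b" "arc_between B a b" "A \<inter> B \<subseteq> {a,b}"
  shows "inside (A \<union> B) \<noteq> {}" "connected (inside (A \<union> B))" "open (inside (A \<union> B))"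
    "bounded (inside (A \<union> B))" "connected (outside (A \<union> B))" "frontier (inside (A \<union> B)) = A \<union> B"
proof -
  obtain g h where g: "arc g" "path_image g = A" "pathstart g = a" "pathfinish g = b"
    and h: "arc h" "path_image h = B" "pathstart h = b" "pathfinish h = a"
    using assms arc_between_sym[OF assms(2)] unfolding arc_between_def by blast
  have "simple_path (g +++ h)"
    using g h assms(3) by (intro simple_path_join_loop) auto
  moreover have "path_image (g +++ h) = A \<union> B" "pathfinish (g +++ h) = pathstart (g +++ h)"
    using g h by (auto simp: path_image_join)
  ultimately show "inside (A \<union> B) \<noteq> {}" "connected (inside (A \<union> B))" "open (inside (A \<union> B))"
    "bounded (inside (A \<union> B))" "connected (outside (A \<union> B))" "frontier (inside (A \<union> B)) = A \<union> B"
    using Jordan_inside_outside by metis+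
qed

text \<open>\<open>inside S\<close> is a union of components of the complement of \<open>S\<close>,
  and a connected set avoiding \<open>S\<close> stays in one of them.\<close>

lemma connected_subset_inside:
  assumes "connected D" "D \<inter> S = {}" "D \<inter> inside S \<noteq> {}"
  shows "D \<subseteq> inside S"
proof
  fix y assume y: "y \<in> D"
  obtain x where x: "x \<in> D" "x \<in> inside S" using assms by blast
  have "connected_component (- S) x y"
    unfolding connected_component_def using assms x y by blast
  then show "y \<in> inside S" using x(2) inside_same_component by blast
qed

text \<open>Suppose that no arc enters the inside of the circle formed by the other two, and take
  \<open>u\<close> inside \<open>A \<union> B\<close>. If \<open>u\<close> were also inside another
  of the circles, each inside would contain the other, and equal insides have equal frontiers. So
  \<open>u\<close> is outside \<open>A \<union> C\<close> and \<open>B \<union> C\<close>, and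
  Janiszewski's theorem connects it to a far point without meeting either, in particular without
  meeting \<open>A \<union> B\<close>.\<close>

lemma theta_curve_inside:
  fixes A B C :: "complex set"
  assumes A: "arc_between A a b" and B: "arc_between B a b" and C: "arc_between C a b"
    and AB: "A \<inter> B \<subseteq> {a,b}" and AC: "A \<inter> C \<subseteq> {a,b}" and BC: "B \<inter> C \<subseteq> {a,b}"
    and CAB: "C \<inter> inside (A \<union> B) = {}" and BAC: "B \<inter> inside (A \<union> C) = {}"
  shows "A \<inter> inside (B \<union> C) \<noteq> {}"
proof
  assume ABC: "A \<inter> inside (B \<union> C) = {}"
  obtain u where u: "u \<in> inside (A \<union> B)" using Jordan_two_arcs(1)[OF A B AB] by blast
  have U: "connected (inside (A \<union> B))" using Jordan_two_arcs[OF A B AB] by blast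
  \<comment> \<open>\<open>D\<close> stands for one of \<open>A\<close> and \<open>B\<close>, and
    \<open>E\<close> for the other, so that one argument serves both circles through
    \<open>C\<close>.\<close>
  have no: "u \<notin> inside (D \<union> C)"
    if D: "D \<union> E = A \<union> B" "arc_between D a b" "arc_between E a b" "D \<inter> C \<subseteq> {a,b}"
      and EDC: "E \<inter> inside (D \<union> C) = {}" for D E
  proof
    assume u': "u \<in> inside (D \<union> C)"
    have "inside (A \<union> B) \<subseteq> inside (D \<union> C)"
      using u u' CAB D(1) inside_no_overlap[of "A \<union> B"]
      by (intro connected_subset_inside[OF U]; blast)
    moreover have "inside (D \<union> C) \<subseteq> inside (A \<union> B)"
    proof (intro connected_subset_inside)
      show "connected (inside (D \<union> C))" using Jordan_two_arcs(2)[OF D(2) C D(4)] .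
      show "inside (D \<union> C) \<inter> (A \<union> B) = {}"
        using EDC inside_no_overlap[of "D \<union> C"] unfolding D(1)[symmetric] by blast
      show "inside (D \<union> C) \<inter> inside (A \<union> B) \<noteq> {}" using u u' by blast
    qed
    ultimately have "inside (A \<union> B) = inside (D \<union> C)" by (rule equalityI)
    then have "A \<union> B = D \<union> C"
      using Jordan_two_arcs(6)[OF A B AB] Jordan_two_arcs(6)[OF D(2) C D(4)] by metis
    then have "C \<subseteq> {a,b}" using AC BC by auto
    then show False using arc_between_connected(4)[OF C] by auto
  qed
  have "u \<notin> inside (A \<union> C)" using A B AC BAC by (intro no[of _ B]) auto
  moreover have "u \<notin> inside (B \<union> C)" using A B BC ABC by (intro no[of _ A]) auto
  moreover have "u \<notin> A \<union> B \<union> C" using u inside_no_overlap[of "A \<union> B"] CAB by blast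
  ultimately have uo: "u \<in> outside (A \<union> C)" "u \<in> outside (B \<union> C)"
    by (auto simp: outside_inside)
  have cpt: "compact A" "compact B" "compact C" using A B C arc_between_connected(5) by blast+
  obtain v where v: "v \<in> outside (A \<union> B \<union> C)"
    using outside_bounded_nonempty[of "A \<union> B \<union> C"] compact_imp_bounded[OF compact_Un[OF compact_Un[OF cpt(1,2)] cpt(3)]]
    by auto
  have vo: "v \<in> outside (A \<union> C)" "v \<in> outside (B \<union> C)" "v \<in> outside (A \<union> B)"
    using v outside_mono[of _ "A \<union> B \<union> C"] by blast+
  have cc: "connected_component (- (A \<union> C)) u v" "connected_component (- (B \<union> C)) u v"
    unfolding connected_component_def
    using uo vo Jordan_two_arcs(5)[OF A C AC] Jordan_two_arcs(5)[OF B C BC] outside_no_overlap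
    by (metis disjoint_eq_subset_Compl inf_commute)+
  \<comment> \<open>Janiszewski's theorem needs a connected intersection of the two closed sets;
    here it is the common arc \<open>C\<close>.\<close>
  have eq: "(A \<union> C) \<inter> (B \<union> C) = C" using AB arc_between_ends[OF C] by blast
  have "connected_component (- ((A \<union> C) \<union> (B \<union> C))) u v"
    using cpt cc arc_between_connected(6)[OF C] eq
    by (intro Janiszewski[of "A \<union> C" "B \<union> C"]) (simp_all add: compact_Un compact_imp_closed del: compl_sup)
  then have "connected_component (- (A \<union> B)) u v"
    by (rule connected_component_of_subset) auto
  then have "u \<in> outside (A \<union> B)"
    using vo(3) outside_same_component connected_component_sym by blast
  then show False using u inside_Int_outside by blast
qed

lemma split_inside_arcs:
  fixes A B C :: "complex set"
  assumes A: "arc_between A a b" and B: "arc_between B a b" and C: "arc_between C a b"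
    and AB: "A \<inter> B \<subseteq> {a,b}" and AC: "A \<inter> C \<subseteq> {a,b}" and BC: "B \<inter> C \<subseteq> {a,b}"
    and "A \<inter> inside (B \<union> C) \<noteq> {}"
  shows "inside (B \<union> C) \<subseteq> inside (B \<union> A) \<union> inside (C \<union> A) \<union> A"
proof -
  obtain f g h where f: "arc f" "path_image f = A" "pathstart f = a" "pathfinish f = b"
    and g: "arc g" "path_image g = B" "pathstart g = a" "pathfinish g = b"
    and h: "arc h" "path_image h = C" "pathstart h = a" "pathfinish h = b"
    using A B C unfolding arc_between_def by blast
  have ends: "a \<in> A" "b \<in> A" "a \<in> B" "b \<in> B" "a \<in> C" "b \<in> C" "a \<noteq> b"
    using A B C arc_between_ends by blast+
  have eqs: "B \<inter> C = {a,b}" "B \<inter> A = {a,b}" "C \<inter> A = {a,b}"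
    using ends AB AC BC by blast+
  have "inside (B \<union> A) \<union> inside (C \<union> A) \<union> (A - {a,b}) = inside (B \<union> C)"
    using split_inside_simple_closed_curve[of g a b h f] f g h eqs ends assms(7) arc_imp_simple_path
    by metis
  then show ?thesis by blast
qed

text \<open>In a plane drawing of \<open>K\<^sub>4\<close> the vertices do not all lie on the outer face.\<close>

lemma K4_vertex_inside:
  fixes p :: "'v \<Rightarrow> complex" and A :: "'v set \<Rightarrow> complex set"
  assumes d: "distinct [x, y, z, w]" and inj: "inj_on p {x, y, z, w}"
    and arcs: "\<And>u v. u \<in> {x,y,z,w} \<Longrightarrow> v \<in> {x,y,z,w} \<Longrightarrow> u \<noteq> v \<Longrightarrow> arc_between (A {u, v}) (p u) (p v)"
    and disj: "\<And>u v u' v'. {u, v, u', v'} \<subseteq> {x,y,z,w} \<Longrightarrow> u \<noteq> v \<Longrightarrow> u' \<noteq> v' \<Longrightarrow> {u, v} \<noteq> {u', v'} \<Longrightarrow>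
       A {u, v} \<inter> A {u', v'} \<subseteq> p ` ({u, v} \<inter> {u', v'})"
    and out: "\<And>u v t s. {u, v, t, s} = {x,y,z,w} \<Longrightarrow> p s \<notin> inside (A {u, v} \<union> A {v, t} \<union> A {u, t})"
  shows False
proof -
  define V where "V = {x,y,z,w}"
  \<comment> \<open>The edge \<open>ab\<close> and the two paths from \<open>a\<close> to
    \<open>b\<close> through \<open>c\<close> and \<open>e\<close> form a theta curve. Since neither
    \<open>c\<close> nor \<open>e\<close> lies inside a triangle, it is the edge \<open>ab\<close>
    that must run inside the 4-cycle, and it cuts this inside into two triangles.\<close>
  have theta: "A {a, b} \<inter> inside (A {a, c} \<union> A {c, b} \<union> (A {a, e} \<union> A {e, b})) \<noteq> {}"
      "inside (A {a, c} \<union> A {c, b} \<union> (A {a, e} \<union> A {e, b}))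
       \<subseteq> inside (A {a, c} \<union> A {c, b} \<union> A {a, b}) \<union> inside (A {a, e} \<union> A {e, b} \<union> A {a, b}) \<union> A {a, b}"
    if abce: "distinct [a, b, c, e]" "{a, b, c, e} = V" for a b c e
  proof -
    have arc: "arc_between (A {u, v}) (p u) (p v)" if "u \<in> V" "v \<in> V" "u \<noteq> v" for u v
      using arcs that unfolding V_def by blast
    have dj: "A {u, v} \<inter> A {u', v'} \<subseteq> p ` ({u, v} \<inter> {u', v'})"
      if "{u, v, u', v'} \<subseteq> V" "u \<noteq> v" "u' \<noteq> v'" "{u, v} \<noteq> {u', v'}" for u v u' v'
      using disj that unfolding V_def by blast
    have mem: "a \<in> V" "b \<in> V" "c \<in> V" "e \<in> V" using abce(2) by auto
    have ne: "a \<noteq> b" "a \<noteq> c" "a \<noteq> e" "b \<noteq> c" "b \<noteq> e" "c \<noteq> e" using abce(1) by auto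
    have sets: "{a,c} \<inter> {c,b} = {c}" "{a,e} \<inter> {e,b} = {e}" "{a,b} \<inter> {a,c} = {a}" "{a,b} \<inter> {c,b} = {b}"
       "{a,b} \<inter> {a,e} = {a}" "{a,b} \<inter> {e,b} = {b}" "{a,c} \<inter> {a,e} = {a}" "{a,c} \<inter> {e,b} = {}"
       "{c,b} \<inter> {a,e} = {}" "{c,b} \<inter> {e,b} = {b}"
      using ne by auto
    note D = dj[of a c c b] dj[of a e e b] dj[of a b a c] dj[of a b c b] dj[of a b a e] dj[of a b e b]
      dj[of a c a e] dj[of a c e b] dj[of c b a e] dj[of c b e b]
    have D': "A {a,c} \<inter> A {c,b} \<subseteq> {p c}" "A {a,e} \<inter> A {e,b} \<subseteq> {p e}"
       "A {a,b} \<inter> A {a,c} \<subseteq> {p a}" "A {a,b} \<inter> A {c,b} \<subseteq> {p b}"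
       "A {a,b} \<inter> A {a,e} \<subseteq> {p a}" "A {a,b} \<inter> A {e,b} \<subseteq> {p b}"
       "A {a,c} \<inter> A {a,e} \<subseteq> {p a}" "A {a,c} \<inter> A {e,b} \<subseteq> {}"
       "A {c,b} \<inter> A {a,e} \<subseteq> {}" "A {c,b} \<inter> A {e,b} \<subseteq> {p b}"
      using D[unfolded sets] mem ne by (auto simp: doubleton_eq_iff)
    have Q: "arc_between (A {a,c} \<union> A {c,b}) (p a) (p b)"
      using mem ne D' by (intro arc_between_join[of _ _ "p c"] arc) auto
    have R: "arc_between (A {a,e} \<union> A {e,b}) (p a) (p b)"
      using mem ne D' by (intro arc_between_join[of _ _ "p e"] arc) auto
    have P: "arc_between (A {a,b}) (p a) (p b)" using mem ne arc by auto
    have PQ: "A {a,b} \<inter> (A {a,c} \<union> A {c,b}) \<subseteq> {p a, p b}"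
      and PR: "A {a,b} \<inter> (A {a,e} \<union> A {e,b}) \<subseteq> {p a, p b}"
      and QR: "(A {a,c} \<union> A {c,b}) \<inter> (A {a,e} \<union> A {e,b}) \<subseteq> {p a, p b}"
      using D' by blast+
    have outc: "p c \<notin> inside (A {a,b} \<union> (A {a,e} \<union> A {e,b}))"
      using out[of a b e c] abce unfolding V_def by (auto simp: insert_commute Un_ac)
    have oute: "p e \<notin> inside (A {a,b} \<union> (A {a,c} \<union> A {c,b}))"
      using out[of a b c e] abce unfolding V_def by (auto simp: insert_commute Un_ac)
    have ends: "p a \<in> A {a,b}" "p b \<in> A {a,b}" "p c \<in> A {a,c}" "p e \<in> A {a,e}"
      using arc_between_ends[OF arc] mem ne by blast+
    have pne: "p c \<noteq> p a" "p c \<noteq> p b" "p e \<noteq> p a" "p e \<noteq> p b"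
      using inj ne mem unfolding V_def inj_on_def by blast+
    \<comment> \<open>A path without its ends is connected, so if it entered the circle at all, the
      whole of it, including its middle vertex \<open>q\<close>, would lie inside.\<close>
    have miss: "X \<inter> inside (A {a,b} \<union> Y) = {}"
      if X: "arc_between X (p a) (p b)" and PX: "A {a,b} \<inter> X \<subseteq> {p a, p b}" and XY: "X \<inter> Y \<subseteq> {p a, p b}" and
        q: "q \<in> X" "q \<noteq> p a" "q \<noteq> p b" "q \<notin> inside (A {a,b} \<union> Y)" for X Y q
    proof (rule ccontr)
      assume "\<not> ?thesis"
      moreover have "p a \<notin> inside (A {a,b} \<union> Y)" "p b \<notin> inside (A {a,b} \<union> Y)"
        using ends inside_no_overlap[of "A {a,b} \<union> Y"] by blast+
      ultimately have "(X - {p a, p b}) \<inter> inside (A {a,b} \<union> Y) \<noteq> {}" by blast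
      then have "X - {p a, p b} \<subseteq> inside (A {a,b} \<union> Y)"
        using PX XY arc_between_connected(3)[OF X] by (intro connected_subset_inside) auto
      then show False using q by blast
    qed
    have th: "A {a,b} \<inter> inside ((A {a,c} \<union> A {c,b}) \<union> (A {a,e} \<union> A {e,b})) \<noteq> {}"
    proof (rule theta_curve_inside[OF P Q R PQ PR QR])
      show "(A {a,e} \<union> A {e,b}) \<inter> inside (A {a,b} \<union> (A {a,c} \<union> A {c,b})) = {}"
        using PR QR ends pne oute by (intro miss[OF R, of _ "p e"]) auto
      show "(A {a,c} \<union> A {c,b}) \<inter> inside (A {a,b} \<union> (A {a,e} \<union> A {e,b})) = {}"
        using PQ QR ends pne outc by (intro miss[OF Q, of _ "p c"]) auto
    qed
    then show "A {a, b} \<inter> inside (A {a, c} \<union> A {c, b} \<union> (A {a, e} \<union> A {e, b})) \<noteq> {}" by simp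
    show "inside (A {a, c} \<union> A {c, b} \<union> (A {a, e} \<union> A {e, b}))
       \<subseteq> inside (A {a, c} \<union> A {c, b} \<union> A {a, b}) \<union> inside (A {a, e} \<union> A {e, b} \<union> A {a, b}) \<union> A {a, b}"
      using split_inside_arcs[OF P Q R PQ PR QR th] by simp
  qed
  have Vd: "distinct [x, y, z, w]" "{x, y, z, w} = V" "distinct [z, w, x, y]" "{z, w, x, y} = V"
    using d unfolding V_def by auto
  have cyc: "A {z, x} \<union> A {x, w} \<union> (A {z, y} \<union> A {y, w}) = A {x, z} \<union> A {z, y} \<union> (A {x, w} \<union> A {w, y})"
    by (auto simp: insert_commute)
  \<comment> \<open>By \<open>theta\<close> both diagonals of the 4-cycle \<open>x z y w\<close> run
    inside it. A point \<open>q\<close> of the diagonal \<open>zw\<close> then lies in one of the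
    triangles cut off by \<open>xy\<close>, and the connected rest of \<open>zw\<close> drags the
    vertex that is not on this triangle inside with it.\<close>
  obtain q where q: "q \<in> A {z, w}" "q \<in> inside (A {x, z} \<union> A {z, y} \<union> (A {x, w} \<union> A {w, y}))"
    using theta(1)[OF Vd(3,4)] cyc by auto
  have zw: "A {x,y} \<inter> A {z,w} = {}"
    using disj[of x y z w] d by (auto simp: doubleton_eq_iff)
  have arczw: "arc_between (A {z,w}) (p z) (p w)" using arcs d by auto
  have zwd: "A {z,w} \<inter> A {x,z} \<subseteq> {p z}" "A {z,w} \<inter> A {z,y} \<subseteq> {p z}"
     "A {z,w} \<inter> A {x,w} \<subseteq> {p w}" "A {z,w} \<inter> A {w,y} \<subseteq> {p w}"
    using disj[of z w x z] disj[of z w z y] disj[of z w x w] disj[of z w w y] d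
    by (auto simp: doubleton_eq_iff)
  have ends: "p z \<in> A {x,z}" "p w \<in> A {x,w}" "p z \<noteq> p w" "p z \<in> A {z,w}" "p w \<in> A {z,w}"
    using arc_between_ends[OF arcs] d by auto
  from theta(2)[OF Vd(1,2)] q zw consider
    "q \<in> inside (A {x, z} \<union> A {z, y} \<union> A {x, y})" | "q \<in> inside (A {x, w} \<union> A {w, y} \<union> A {x, y})"
    by blast
  then show False
  proof cases
    case 1
    have "q \<noteq> p z" using 1 ends inside_no_overlap[of "A {x, z} \<union> A {z, y} \<union> A {x, y}"] by blast
    then have "A {z,w} - {p z} \<subseteq> inside (A {x, z} \<union> A {z, y} \<union> A {x, y})"
      using 1 q(1) zw zwd arc_between_connected(1)[OF arczw] by (intro connected_subset_inside) auto
    then show False using ends out[of x z y w] by (auto simp: insert_commute)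
  next
    case 2
    have "q \<noteq> p w" using 2 ends inside_no_overlap[of "A {x, w} \<union> A {w, y} \<union> A {x, y}"] by blast
    then have "A {z,w} - {p w} \<subseteq> inside (A {x, w} \<union> A {w, y} \<union> A {x, y})"
      using 2 q(1) zw zwd arc_between_connected(2)[OF arczw] by (intro connected_subset_inside) auto
    then show False using ends out[of x w y z] by (auto simp: insert_commute)
  qed
qed


section \<open>From the sphere to the plane: a planar graph has no clique on five vertices\<close>

lemma arc_compose:
  assumes "arc g" "continuous_on (path_image g) f" "inj_on f (path_image g)"
  shows "arc (f \<circ> g)"
  using assms unfolding arc_def path_image_def
  by (simp add: comp_inj_on path_continuous_image path_image_def)

lemma distinct_list_5:
  assumes "card K = 5"
  obtains v x y z w where "K = {v, x, y, z, w}" "distinct [v, x, y, z, w]"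
proof -
  have "finite K" using assms card_ge_0_finite by force
  then obtain xs where xs: "set xs = K" "distinct xs" using finite_distinct_list by blast
  then have "length xs = 5" using assms distinct_card by fastforce
  then obtain v x y z w where "xs = [v, x, y, z, w]" by (auto simp: numeral_eq_Suc length_Suc_conv)
  then show ?thesis using xs that by auto
qed

lemma arc_between_image:
  assumes "arc_between A a b" "continuous_on A f" "inj_on f A"
  shows "arc_between (f ` A) (f a) (f b)"
proof -
  obtain g where g: "arc g" "path_image g = A" "pathstart g = a" "pathfinish g = b"
    using assms(1) unfolding arc_between_def by blast
  have "arc (f \<circ> g)" using g assms by (intro arc_compose) auto
  then show ?thesis using g unfolding arc_between_def
    by (intro exI[of _ "f \<circ> g"]) (simp add: path_image_compose pathfinish_compose pathstart_compose)
qed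

text \<open>If \<open>b\<close> were not in \<open>F\<close>, then \<open>{b}\<close> and
  \<open>F\<close> would disconnect the arc.\<close>

lemma arc_between_end_limit:
  assumes "arc_between (A :: 'b::t2_space set) a b" "A - {b} \<subseteq> F" "closed F"
  shows "b \<in> F"
proof (rule ccontr)
  assume b: "b \<notin> F"
  have "{b} \<inter> F = {}" "A \<subseteq> {b} \<union> F" "{b} \<inter> A \<noteq> {}" "F \<inter> A \<noteq> {}"
    using b assms(2) arc_between_ends[OF assms(1)] by auto
  then show False
    using arc_between_connected(6)[OF assms(1)] \<open>closed F\<close> closed_singleton
    unfolding connected_closed by blast
qed

lemma punctured_sphere_homeomorphic_complex:
  assumes "N \<in> sphere (0 :: real ^ 3) 1"
  obtains h :: "real ^ 3 \<Rightarrow> complex" and k where "homeomorphism (sphere 0 1 - {N}) UNIV h k"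
proof -
  have "(sphere (0 :: real ^ 3) 1 - {N}) homeomorphic (UNIV :: complex set)"
    using assms by (intro homeomorphic_punctured_sphere_affine) auto
  then show ?thesis using that unfolding homeomorphic_def by blast
qed

text \<open>Projecting from one vertex leaves a plane drawing of \<open>K\<^sub>4\<close> in which every vertex escapes to infinity.\<close>

theorem planar_no_K5:
  assumes "planar (V, E)" "K \<subseteq> V" and edges: "\<And>x y. x \<in> K \<Longrightarrow> y \<in> K \<Longrightarrow> x \<noteq> y \<Longrightarrow> {x, y} \<in> E"
  shows "card K \<noteq> 5"
proof
  assume "card K = 5"
  then obtain v x y z w where K: "K = {v, x, y, z, w}" and d: "distinct [v, x, y, z, w]"
    using distinct_list_5 by metis
  let ?S = "sphere (0 :: real ^ 3) 1"
  obtain \<phi> \<gamma> where inj: "inj_on \<phi> V" and \<phi>V: "\<phi> ` V \<subseteq> ?S"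
    and \<gamma>: "\<And>e. e \<in> E \<Longrightarrow> arc (\<gamma> e) \<and> path_image (\<gamma> e) \<subseteq> ?S \<and>
           {pathstart (\<gamma> e), pathfinish (\<gamma> e)} = \<phi> ` e \<and> path_image (\<gamma> e) \<inter> \<phi> ` V = \<phi> ` e"
    and cross: "\<And>e e'. e \<in> E \<Longrightarrow> e' \<in> E \<Longrightarrow> e \<noteq> e' \<Longrightarrow>
           path_image (\<gamma> e) \<inter> path_image (\<gamma> e') \<subseteq> \<phi> ` (e \<inter> e')"
    using assms(1) unfolding planar_def embeds_on_def fst_conv snd_conv by metis
  have arcB: "arc_between (path_image (\<gamma> {a, b})) (\<phi> a) (\<phi> b)" if "a \<in> K" "b \<in> K" "a \<noteq> b" for a b
  proof -
    have "{pathstart (\<gamma> {a,b}), pathfinish (\<gamma> {a,b})} = {\<phi> a, \<phi> b}" "arc (\<gamma> {a,b})"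
      using \<gamma>[OF edges[OF that]] by auto
    then have "arc_between (path_image (\<gamma> {a, b})) (\<phi> a) (\<phi> b) \<or> arc_between (path_image (\<gamma> {a, b})) (\<phi> b) (\<phi> a)"
      unfolding arc_between_def doubleton_eq_iff by blast
    then show ?thesis using arc_between_sym by blast
  qed
  define N where "N = \<phi> v"
  have "N \<in> ?S" using \<phi>V K \<open>K \<subseteq> V\<close> N_def by auto
  then obtain h k where hk: "homeomorphism (?S - {N}) UNIV h (k :: complex \<Rightarrow> real ^ 3)"
    using punctured_sphere_homeomorphic_complex by blast
  have hc: "continuous_on (?S - {N}) h" and hi: "inj_on h (?S - {N})" and kc: "continuous_on UNIV k"
    and kr: "range k = ?S - {N}" and kh: "\<And>u. u \<in> ?S - {N} \<Longrightarrow> k (h u) = u"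
    using hk unfolding homeomorphism_def by (blast, metis inj_on_def, blast+)
  define K4 where "K4 = {x, y, z, w}"
  have K4: "K4 \<subseteq> K" "v \<notin> K4" "K = insert v K4" using d K K4_def by auto
  have sub: "path_image (\<gamma> {a, b}) \<subseteq> ?S - {N}" if "a \<in> K4" "b \<in> K4" "a \<noteq> b" for a b
  proof -
    have e: "{a, b} \<in> E" using that K4 edges by blast
    have V: "a \<in> V" "b \<in> V" "v \<in> V" using that K4 \<open>K \<subseteq> V\<close> by auto
    have "N \<notin> \<phi> ` {a, b}" using inj V that K4 unfolding N_def inj_on_def by blast
    then show ?thesis using \<gamma>[OF e] V N_def by blast
  qed
  define A where "A e = h ` path_image (\<gamma> e)" for e
  define p where "p = h \<circ> \<phi>"
  have \<phi>4: "\<phi> ` K4 \<subseteq> ?S - {N}"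
  proof -
    have "\<phi> ` K4 \<subseteq> ?S" using \<phi>V K4 \<open>K \<subseteq> V\<close> by blast
    moreover have "N \<notin> \<phi> ` K4" using inj K4 \<open>K \<subseteq> V\<close> unfolding N_def inj_on_def by blast
    ultimately show ?thesis by blast
  qed
  have "inj_on p K4" unfolding p_def
    using inj K4 \<open>K \<subseteq> V\<close> \<phi>4 hi by (meson comp_inj_on inj_on_subset subset_trans)
  moreover have arcA: "arc_between (A {a, b}) (p a) (p b)" if "a \<in> K4" "b \<in> K4" "a \<noteq> b" for a b
    unfolding A_def p_def comp_apply using that K4 sub[OF that] hc hi
    by (intro arc_between_image arcB) (auto intro: continuous_on_subset inj_on_subset)
  moreover have "A {a, b} \<inter> A {a', b'} \<subseteq> p ` ({a, b} \<inter> {a', b'})"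
    if "{a, b, a', b'} \<subseteq> K4" "a \<noteq> b" "a' \<noteq> b'" "{a, b} \<noteq> {a', b'}" for a b a' b'
  proof -
    have "A {a, b} \<inter> A {a', b'} = h ` (path_image (\<gamma> {a, b}) \<inter> path_image (\<gamma> {a', b'}))"
      unfolding A_def using that sub by (intro inj_on_image_Int[OF hi, symmetric]) auto
    also have "\<dots> \<subseteq> h ` \<phi> ` ({a, b} \<inter> {a', b'})"
      using that K4 cross[of "{a, b}" "{a', b'}"] edges by (intro image_mono) blast
    finally show ?thesis by (simp add: p_def image_comp)
  qed
  \<comment> \<open>The edge from \<open>s\<close> to the removed vertex \<open>v\<close> avoids the
    triangle of the other three vertices. If \<open>p s\<close> were inside this triangle, that edge
    would stay in a compact part of the plane and could not approach the puncture
    \<open>N\<close>.\<close>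
  moreover have "p s \<notin> inside (A {a, b} \<union> A {b, c} \<union> A {a, c})" if abcs: "{a, b, c, s} = K4" for a b c s
  proof
    define T where "T = A {a, b} \<union> A {b, c} \<union> A {a, c}"
    assume "p s \<in> inside (A {a, b} \<union> A {b, c} \<union> A {a, c})"
    then have ps: "p s \<in> inside T" by (simp add: T_def)
    have "card {a, b, c, s} = 4" using abcs d by (simp add: K4_def)
    then have ne: "a \<noteq> b" "a \<noteq> c" "b \<noteq> c" "s \<noteq> a" "s \<noteq> b" "s \<noteq> c"
      by (auto simp: card_insert_if split: if_splits)
    have mem: "a \<in> K4" "b \<in> K4" "c \<in> K4" "s \<in> K4" using abcs by auto
    define P where "P = path_image (\<gamma> {s, v})"
    have P: "arc_between P (\<phi> s) N" unfolding P_def N_def using arcB mem K4 by auto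
    have PS: "P \<subseteq> ?S" using \<gamma>[OF edges, of s v] mem K4 unfolding P_def by auto
    have miss: "P \<inter> path_image (\<gamma> {f, g}) = {}" if "f \<in> K4" "g \<in> K4" "f \<noteq> g" "s \<noteq> f" "s \<noteq> g" for f g
      using that mem K4 cross[of "{s, v}" "{f, g}"] edges[of s v] edges[of f g] unfolding P_def by auto
    have missA: "h ` (P - {N}) \<inter> A {f, g} = {}" if "f \<in> K4" "g \<in> K4" "f \<noteq> g" "s \<noteq> f" "s \<noteq> g" for f g
      using miss[OF that] sub[of f g] that PS hi unfolding A_def inj_on_def by blast
    have "compact T" unfolding T_def using mem ne arcA arc_between_connected(5) by blast
    have "connected (h ` (P - {N}))"
      using arc_between_connected(2)[OF P] PS
      by (intro connected_continuous_image continuous_on_subset[OF hc]) auto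
    then have "h ` (P - {N}) \<subseteq> inside T"
    proof (rule connected_subset_inside)
      show "h ` (P - {N}) \<inter> T = {}" using missA mem ne unfolding T_def by blast
      have "p s \<in> h ` (P - {N})" using arc_between_ends[OF P] unfolding p_def by auto
      then show "h ` (P - {N}) \<inter> inside T \<noteq> {}" using ps by blast
    qed
    then have "P - {N} \<subseteq> k ` closure (inside T)"
      using PS kh closure_subset[of "inside T"] by (force simp: image_iff subset_iff)
    moreover have "compact (closure (inside T))"
      using \<open>compact T\<close> by (simp add: bounded_inside compact_closure compact_imp_bounded)
    then have "closed (k ` closure (inside T))"
      by (meson compact_continuous_image compact_imp_closed continuous_on_subset kc subset_UNIV)
    ultimately have "N \<in> k ` closure (inside T)" using arc_between_end_limit[OF P] by blast
    then show False using kr by blast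
  qed
  ultimately show False
    using K4_vertex_inside[of x y z w p A] d unfolding K4_def by (auto simp del: insert_iff)
qed

section \<open>Drawings with all vertices on a line\<close>

text \<open>Used to carry plane drawings to the sphere, along the inverse of a homeomorphism from
  the punctured sphere to the plane.\<close>

lemma embeds_on_image:
  assumes "embeds_on \<Gamma> S" "continuous_on S k" "inj_on k S" "k ` S \<subseteq> T" "\<And>e. e \<in> snd \<Gamma> \<Longrightarrow> e \<subseteq> fst \<Gamma>"
  shows "embeds_on \<Gamma> T"
proof -
  obtain \<phi> \<gamma> where inj: "inj_on \<phi> (fst \<Gamma>)" and \<phi>: "\<phi> ` fst \<Gamma> \<subseteq> S"
    and \<gamma>: "\<And>e. e \<in> snd \<Gamma> \<Longrightarrow> arc (\<gamma> e) \<and> path_image (\<gamma> e) \<subseteq> S \<and>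
           {pathstart (\<gamma> e), pathfinish (\<gamma> e)} = \<phi> ` e \<and> path_image (\<gamma> e) \<inter> \<phi> ` fst \<Gamma> = \<phi> ` e"
    and cross: "\<And>e e'. e \<in> snd \<Gamma> \<Longrightarrow> e' \<in> snd \<Gamma> \<Longrightarrow> e \<noteq> e' \<Longrightarrow>
           path_image (\<gamma> e) \<inter> path_image (\<gamma> e') \<subseteq> \<phi> ` (e \<inter> e')"
    using assms(1) unfolding embeds_on_def by metis
  have kint: "k ` A \<inter> k ` B = k ` (A \<inter> B)" if "A \<subseteq> S" "B \<subseteq> S" for A B
    using inj_on_image_Int[OF assms(3) that] by simp
  show ?thesis unfolding embeds_on_def
  proof (intro exI conjI ballI impI)
    show "inj_on (k \<circ> \<phi>) (fst \<Gamma>)" using inj \<phi> assms(3) by (meson comp_inj_on inj_on_subset)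
    show "(k \<circ> \<phi>) ` fst \<Gamma> \<subseteq> T" using \<phi> assms(4) by auto
  next
    fix e assume e: "e \<in> snd \<Gamma>"
    note ge = \<gamma>[OF e]
    show "arc (k \<circ> \<gamma> e)" using ge assms(2,3)
      by (meson arc_compose continuous_on_subset inj_on_subset)
    show "path_image (k \<circ> \<gamma> e) \<subseteq> T" using ge assms(4) by (auto simp: path_image_compose)
    show "{pathstart (k \<circ> \<gamma> e), pathfinish (k \<circ> \<gamma> e)} = (k \<circ> \<phi>) ` e"
      using ge by (metis image_comp image_empty image_insert pathfinish_compose pathstart_compose)
    show "path_image (k \<circ> \<gamma> e) \<inter> (k \<circ> \<phi>) ` fst \<Gamma> = (k \<circ> \<phi>) ` e"
      using ge \<phi> kint by (metis image_comp path_image_compose)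
  next
    fix e e' assume e: "e \<in> snd \<Gamma>" "e' \<in> snd \<Gamma>" "e \<noteq> e'"
    have "path_image (k \<circ> \<gamma> e) \<inter> path_image (k \<circ> \<gamma> e') = k ` (path_image (\<gamma> e) \<inter> path_image (\<gamma> e'))"
      using \<gamma>[OF e(1)] \<gamma>[OF e(2)] kint by (metis path_image_compose)
    then show "path_image (k \<circ> \<gamma> e) \<inter> path_image (k \<circ> \<gamma> e') \<subseteq> (k \<circ> \<phi>) ` (e \<inter> e')"
      using cross[OF e] by (auto simp flip: image_comp)
  qed
qed

text \<open>\<open>(x - a) * (b - x)\<close> is the height over \<open>x\<close> of a parabola with
  zeros \<open>a\<close> and \<open>b\<close>. Intervals that do not interleave are separated or
  nested, and in the nested case the inner parabola is strictly lower over the open inner interval.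
  So equal heights occur only at shared ends.\<close>

lemma parabolas_meet:
  fixes a b c d x :: real
  assumes "a < b" "c < d" "a \<le> x" "x \<le> b" "c \<le> x" "x \<le> d" "(a, b) \<noteq> (c, d)"
    and nc: "\<not> (a < c \<and> c < b \<and> b < d)" "\<not> (c < a \<and> a < d \<and> d < b)"
    and eq: "(x - a) * (b - x) = (x - c) * (d - x)"
  shows "x \<in> {a, b} \<inter> {c, d}"
proof -
  have nested: "x \<in> {a', b'} \<inter> {c', d'}"
    if "a' \<le> c'" "d' \<le> b'" "c' < d'" "(a', b') \<noteq> (c', d')" "c' \<le> x" "x \<le> d'"
      "(x - a') * (b' - x) = (x - c') * (d' - x)" for a' b' c' d' :: real
  proof (cases "c' < x \<and> x < d'")
    case True
    show ?thesis
    proof (cases "a' < c'")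
      case True
      have "(x - c') * (d' - x) < (x - a') * (d' - x)" using True \<open>c' < x \<and> x < d'\<close>
        by (intro mult_strict_right_mono) auto
      also have "\<dots> \<le> (x - a') * (b' - x)" using that True by (intro mult_left_mono) auto
      finally show ?thesis using that by simp
    next
      case False
      then have "d' < b'" using that by auto
      have "(x - c') * (d' - x) < (x - c') * (b' - x)" using \<open>d' < b'\<close> \<open>c' < x \<and> x < d'\<close>
        by (intro mult_strict_left_mono) auto
      also have "\<dots> \<le> (x - a') * (b' - x)" using that by (intro mult_right_mono) auto
      finally show ?thesis using that by simp
    qed
  next
    case False
    then show ?thesis using that by auto
  qed
  consider "b \<le> c" | "d \<le> a" | "a \<le> c" "d \<le> b" | "c \<le> a" "b \<le> d" using nc by linarith
  then show ?thesis
    using nested[of a c d b] nested[of c a b d] assms by cases auto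
qed

text \<open>A book embedding with two pages, drawn with a parabola for each edge.\<close>

lemma planar_two_pages:
  fixes pos :: "'a \<Rightarrow> real" and page :: "'a set \<Rightarrow> bool"
  assumes inj: "inj_on pos V" and E: "E \<subseteq> {{x, y} | x y. x \<in> V \<and> y \<in> V \<and> x \<noteq> y}"
    and nc: "\<And>x y u v. {x, y} \<in> E \<Longrightarrow> {u, v} \<in> E \<Longrightarrow> page {x, y} = page {u, v} \<Longrightarrow>
      pos x < pos u \<Longrightarrow> pos u < pos y \<Longrightarrow> pos y < pos v \<Longrightarrow> False"
  shows "planar (V, E)"
proof -
  define l where "l e = Min (pos ` e)" for e :: "'a set"
  define r where "r e = Max (pos ` e)" for e :: "'a set"
  define s where "s e = (if page e then 1 else -1 :: real)" for e :: "'a set"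
  define \<phi> where "\<phi> x = Complex (pos x) 0" for x
  \<comment> \<open>With x = l + t (r - l), the height t (1 - t) (r - l)^2 equals (x - l)(r - x);
    the sign \<open>s e\<close> places the two pages in opposite half-planes.\<close>
  define \<gamma> where "\<gamma> e t = Complex (l e + t * (r e - l e)) (s e * (t * (1 - t) * (r e - l e)^2))" for e t
  have edge: "\<exists>x y. e = {x, y} \<and> x \<in> V \<and> y \<in> V \<and> pos x < pos y \<and> l e = pos x \<and> r e = pos y" if eE: "e \<in> E" for e
  proof -
    obtain x y where xy: "e = {x, y}" "x \<in> V" "y \<in> V" "x \<noteq> y" using subsetD[OF E eE] by blast
    then have "pos x \<noteq> pos y" using inj unfolding inj_on_def by blast
    then consider "pos x < pos y" | "pos y < pos x" by linarith
    then show ?thesis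
    proof cases
      case 1
      then show ?thesis using xy unfolding l_def r_def by (intro exI[of _ x] exI[of _ y]) auto
    next
      case 2
      then show ?thesis using xy unfolding l_def r_def by (intro exI[of _ y] exI[of _ x]) auto
    qed
  qed
  have pi: "path_image (\<gamma> e) = {Complex x (s e * ((x - l e) * (r e - x))) | x. l e \<le> x \<and> x \<le> r e}"
    if "e \<in> E" for e
  proof -
    have lt: "l e < r e" using edge[OF that] by auto
    have eq: "(l e + t * (r e - l e) - l e) * (r e - (l e + t * (r e - l e))) = t * (1 - t) * (r e - l e)^2" for t
      by (simp add: algebra_simps power2_eq_square)
    show ?thesis unfolding path_image_def
    proof safe
      fix t :: real assume t: "t \<in> {0..1}"
      have "t * (r e - l e) \<le> 1 * (r e - l e)" using t lt by (intro mult_right_mono) auto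
      then have "l e + t * (r e - l e) \<le> r e" unfolding mult_1 by (simp only: le_diff_eq add.commute)
      moreover have "l e \<le> l e + t * (r e - l e)" using t lt by auto
      moreover have "\<gamma> e t = Complex (l e + t * (r e - l e)) (s e * ((l e + t * (r e - l e) - l e) * (r e - (l e + t * (r e - l e)))))"
        unfolding \<gamma>_def eq ..
      ultimately show "\<exists>x. \<gamma> e t = Complex x (s e * ((x - l e) * (r e - x))) \<and> l e \<le> x \<and> x \<le> r e"
        by blast
    next
      fix x assume x: "l e \<le> x" "x \<le> r e"
      define t where "t = (x - l e) / (r e - l e)"
      have "x = l e + t * (r e - l e)" "t \<in> {0..1}" using x lt by (auto simp: t_def)
      then show "Complex x (s e * ((x - l e) * (r e - x))) \<in> \<gamma> e ` {0..1}"
        using eq[of t] by (intro image_eqI[of _ _ t]) (auto simp: \<gamma>_def)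
    qed
  qed
  have "embeds_on (V, E) (UNIV :: complex set)" unfolding embeds_on_def fst_conv snd_conv
  proof (intro exI[of _ \<phi>] exI[of _ \<gamma>] conjI ballI impI)
    show "inj_on \<phi> V" using inj by (auto simp: inj_on_def \<phi>_def)
  next
    fix e assume e: "e \<in> E"
    obtain x y where xy: "e = {x, y}" "x \<in> V" "y \<in> V" "pos x < pos y" "l e = pos x" "r e = pos y"
      using edge[OF e] by blast
    have "inj_on (\<gamma> e) {0..1}" using xy by (auto simp: inj_on_def \<gamma>_def)
    moreover have "continuous_on {0..1} (\<gamma> e)"
      unfolding \<gamma>_def complex_eq Complex_eq by (intro continuous_intros)
    ultimately show "arc (\<gamma> e)" by (simp add: arc_def path_def)
    show "{pathstart (\<gamma> e), pathfinish (\<gamma> e)} = \<phi> ` e"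
      using xy by (auto simp: pathstart_def pathfinish_def \<gamma>_def \<phi>_def)
    show "path_image (\<gamma> e) \<inter> \<phi> ` V = \<phi> ` e"
    proof
      show "\<phi> ` e \<subseteq> path_image (\<gamma> e) \<inter> \<phi> ` V"
        unfolding pi[OF e] using xy by (auto simp: \<phi>_def)
      show "path_image (\<gamma> e) \<inter> \<phi> ` V \<subseteq> \<phi> ` e"
        unfolding pi[OF e] using xy inj by (auto simp: \<phi>_def s_def inj_on_def split: if_splits)
    qed
  next
    fix e e' assume e: "e \<in> E" "e' \<in> E" "e \<noteq> e'"
    obtain x y where xy: "e = {x, y}" "x \<in> V" "y \<in> V" "pos x < pos y" "l e = pos x" "r e = pos y"
      using edge[OF e(1)] by blast
    obtain u v where uv: "e' = {u, v}" "u \<in> V" "v \<in> V" "pos u < pos v" "l e' = pos u" "r e' = pos v"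
      using edge[OF e(2)] by blast
    show "path_image (\<gamma> e) \<inter> path_image (\<gamma> e') \<subseteq> \<phi> ` (e \<inter> e')"
    proof
      fix w assume "w \<in> path_image (\<gamma> e) \<inter> path_image (\<gamma> e')"
      then obtain q where q: "w = Complex q (s e * ((q - pos x) * (pos y - q)))" "pos x \<le> q" "q \<le> pos y"
         "pos u \<le> q" "q \<le> pos v" "s e * ((q - pos x) * (pos y - q)) = s e' * ((q - pos u) * (pos v - q))"
        unfolding pi[OF e(1)] pi[OF e(2)] using xy(5,6) uv(5,6) by auto
      have "q \<in> {pos x, pos y} \<inter> {pos u, pos v}"
      proof (cases "page e = page e'")
        case True
        have "(pos x, pos y) \<noteq> (pos u, pos v)"
          using e(3) xy uv inj unfolding inj_on_def by blast
        moreover have "(q - pos x) * (pos y - q) = (q - pos u) * (pos v - q)"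
          using q(6) True by (auto simp: s_def split: if_splits)
        ultimately show ?thesis
          using q xy(4) uv(4) nc[of x y u v] nc[of u v x y] e xy(1) uv(1) True
          by (intro parabolas_meet) auto
      next
        case False
        \<comment> \<open>On different pages one height is nonnegative and the other nonpositive, so
          a common point lies on the line, where each parabola has only its two ends.\<close>
        define X Y where "X = (q - pos x) * (pos y - q)" and "Y = (q - pos u) * (pos v - q)"
        have "0 \<le> X" "0 \<le> Y" using q unfolding X_def Y_def by auto
        moreover have "s e * X = s e' * Y" using q(6) unfolding X_def Y_def .
        then have "X = - Y" using False unfolding s_def by (cases "page e") auto
        ultimately have "X = 0 \<and> Y = 0" by linarith
        then have "(q - pos x) * (pos y - q) = 0 \<and> (q - pos u) * (pos v - q) = 0"
          unfolding X_def Y_def .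
        then show ?thesis by auto
      qed
      then have "q \<in> pos ` e" "q \<in> pos ` e'" and 0: "(q - pos x) * (pos y - q) = 0"
        unfolding xy(1) uv(1) by auto
      then obtain m n where mn: "m \<in> e" "n \<in> e'" "q = pos m" "q = pos n" by blast
      have "m = n"
        using mn xy uv by (intro inj_onD[OF inj]) auto
      then show "w \<in> \<phi> ` (e \<inter> e')"
        using q(1) mn unfolding 0 \<phi>_def by auto
    qed
  qed auto
  moreover obtain N :: "real ^ 3" where "N \<in> sphere 0 1"
    using vector_choose_size[of 1] by auto
  then obtain h k where "homeomorphism (sphere 0 1 - {N}) UNIV h (k :: complex \<Rightarrow> real ^ 3)"
    using punctured_sphere_homeomorphic_complex by blast
  then have "continuous_on UNIV k" "inj k" "range k \<subseteq> sphere 0 1"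
    unfolding homeomorphism_def by (blast, metis inj_on_def, blast)
  ultimately show ?thesis
    unfolding planar_def using E by (intro embeds_on_image[of "(V,E)" UNIV k]) auto
qed

section \<open>Finite groups\<close>

definition centralizer :: "('a, 'm) monoid_scheme \<Rightarrow> 'a \<Rightarrow> 'a set" where
  "centralizer G x = {y \<in> carrier G. x \<otimes>\<^bsub>G\<^esub> y = y \<otimes>\<^bsub>G\<^esub> x}"

definition conj_class :: "('a, 'm) monoid_scheme \<Rightarrow> 'a \<Rightarrow> 'a set" where
  "conj_class G x = (\<lambda>g. g \<otimes>\<^bsub>G\<^esub> x \<otimes>\<^bsub>G\<^esub> inv\<^bsub>G\<^esub> g) ` carrier G"

context group
begin

lemma inv_mult_cancel [simp]:
  assumes "x \<in> carrier G" "y \<in> carrier G"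
  shows "inv x \<otimes> (x \<otimes> y) = y" "x \<otimes> (inv x \<otimes> y) = y"
  using assms by (simp_all add: m_assoc[symmetric])

lemma commute_inv:
  assumes "x \<in> carrier G" "y \<in> carrier G" "x \<otimes> y = y \<otimes> x"
  shows "x \<otimes> inv y = inv y \<otimes> x"
proof -
  have "inv y \<otimes> (x \<otimes> y) \<otimes> inv y = inv y \<otimes> (y \<otimes> x) \<otimes> inv y" using assms by simp
  then show ?thesis using assms(1,2) by (simp add: m_assoc)
qed

lemma commute_mult:
  assumes "x \<in> carrier G" "y \<in> carrier G" "z \<in> carrier G" "x \<otimes> y = y \<otimes> x" "x \<otimes> z = z \<otimes> x"
  shows "x \<otimes> (y \<otimes> z) = (y \<otimes> z) \<otimes> x"
  using assms by (metis m_assoc m_closed)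

lemma centralizer_subgroup:
  assumes "x \<in> carrier G" shows "subgroup (centralizer G x) G"
  using assms by unfold_locales (auto simp: centralizer_def commute_inv commute_mult)

lemma center_commute: "z \<in> group_center G \<Longrightarrow> g \<in> carrier G \<Longrightarrow> z \<otimes> g = g \<otimes> z"
  by (simp add: group_center_def)

lemma center_carrier: "z \<in> group_center G \<Longrightarrow> z \<in> carrier G"
  by (simp add: group_center_def)

lemma center_subgroup: "subgroup (group_center G) G"
proof (unfold_locales)
  show "x \<otimes> y \<in> group_center G" if "x \<in> group_center G" "y \<in> group_center G" for x y
  proof -
    have c: "x \<in> carrier G" "y \<in> carrier G" using that by (simp_all add: center_carrier)
    have "x \<otimes> y \<otimes> g = g \<otimes> (x \<otimes> y)" if "g \<in> carrier G" for g
      using commute_mult[of g x y] that c center_commute \<open>x \<in> group_center G\<close> \<open>y \<in> group_center G\<close> by metis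
    then show ?thesis using c by (auto simp: group_center_def)
  qed
  show "inv x \<in> group_center G" if "x \<in> group_center G" for x
    using that commute_inv[of _ x] by (simp add: group_center_def)
qed (auto simp: group_center_def)

lemma noncentral_iff: "x \<in> carrier G \<Longrightarrow> x \<notin> group_center G \<longleftrightarrow> centralizer G x \<noteq> carrier G"
  by (auto simp: group_center_def centralizer_def)

lemma centralizer_mem: "y \<in> centralizer G x \<longleftrightarrow> y \<in> carrier G \<and> x \<otimes> y = y \<otimes> x"
  by (simp add: centralizer_def)

lemma center_subset_centralizer: "x \<in> carrier G \<Longrightarrow> group_center G \<subseteq> centralizer G x"
  by (auto simp: group_center_def centralizer_def)

lemma subgroup_card_dvd: "subgroup H G \<Longrightarrow> card H dvd order G"
  using lagrange by (metis dvd_triv_right)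

lemma conj_eq_iff:
  assumes "x \<in> carrier G" "g \<in> carrier G" "h \<in> carrier G"
  shows "g \<otimes> x \<otimes> inv g = h \<otimes> x \<otimes> inv h \<longleftrightarrow> inv g \<otimes> h \<in> centralizer G x"
proof
  assume "g \<otimes> x \<otimes> inv g = h \<otimes> x \<otimes> inv h"
  then have "inv g \<otimes> (g \<otimes> x \<otimes> inv g) \<otimes> h = inv g \<otimes> (h \<otimes> x \<otimes> inv h) \<otimes> h" by simp
  then show "inv g \<otimes> h \<in> centralizer G x" using assms by (simp add: centralizer_def m_assoc)
next
  assume "inv g \<otimes> h \<in> centralizer G x"
  then have "x \<otimes> (inv g \<otimes> h) = (inv g \<otimes> h) \<otimes> x" by (simp add: centralizer_def)
  then have "g \<otimes> (x \<otimes> (inv g \<otimes> h)) \<otimes> inv h = g \<otimes> ((inv g \<otimes> h) \<otimes> x) \<otimes> inv h" by simp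
  then show "g \<otimes> x \<otimes> inv g = h \<otimes> x \<otimes> inv h" using assms by (simp add: m_assoc)
qed

lemma conj_class_self: "x \<in> carrier G \<Longrightarrow> x \<in> conj_class G x"
  unfolding conj_class_def by (rule image_eqI[of _ _ \<one>]) auto

lemma conj_conj:
  assumes "x \<in> carrier G" "g \<in> carrier G" "h \<in> carrier G"
  shows "h \<otimes> (g \<otimes> x \<otimes> inv g) \<otimes> inv h = (h \<otimes> g) \<otimes> x \<otimes> inv (h \<otimes> g)"
  using assms by (simp add: m_assoc inv_mult_group)

lemma conj_class_eq:
  assumes "x \<in> carrier G" "y \<in> conj_class G x"
  shows "conj_class G y = conj_class G x"
proof -
  obtain g where g: "g \<in> carrier G" "y = g \<otimes> x \<otimes> inv g" using assms by (auto simp: conj_class_def)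
  have "conj_class G y = (\<lambda>h. (h \<otimes> g) \<otimes> x \<otimes> inv (h \<otimes> g)) ` carrier G"
    unfolding conj_class_def g(2) using assms(1) g(1) by (intro image_cong) (simp_all add: conj_conj)
  also have "\<dots> = (\<lambda>h. h \<otimes> x \<otimes> inv h) ` (\<lambda>h. h \<otimes> g) ` carrier G" by (simp add: image_image)
  also have "(\<lambda>h. h \<otimes> g) ` carrier G = carrier G"
  proof
    show "carrier G \<subseteq> (\<lambda>h. h \<otimes> g) ` carrier G"
    proof
      fix y assume "y \<in> carrier G"
      then show "y \<in> (\<lambda>h. h \<otimes> g) ` carrier G"
        using g(1) by (intro image_eqI[of _ _ "y \<otimes> inv g"]) (simp_all add: m_assoc)
    qed
  qed (use g(1) in auto)
  finally show ?thesis by (simp add: conj_class_def)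
qed

text \<open>Orbit-stabilizer by counting: the fibres of the map sending \<open>g\<close> to the
  conjugate of \<open>x\<close> by \<open>g\<close> are left cosets of the centralizer.\<close>

lemma card_conj_class:
  assumes fin: "finite (carrier G)" and x: "x \<in> carrier G"
  shows "card (conj_class G x) * card (centralizer G x) = order G"
proof -
  have fib: "card {g \<in> carrier G. g \<otimes> x \<otimes> inv g = y} = card (centralizer G x)" if "y \<in> conj_class G x" for y
  proof -
    obtain h where h: "h \<in> carrier G" "y = h \<otimes> x \<otimes> inv h" using \<open>y \<in> conj_class G x\<close> by (auto simp: conj_class_def)
    have "{g \<in> carrier G. g \<otimes> x \<otimes> inv g = y} = (\<lambda>c. h \<otimes> c) ` centralizer G x"
    proof (intro equalityI subsetI)
      fix g assume g: "g \<in> {g \<in> carrier G. g \<otimes> x \<otimes> inv g = y}"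
      then have "h \<otimes> x \<otimes> inv h = g \<otimes> x \<otimes> inv g" "g \<in> carrier G" using h(2) by simp_all
      then have "inv h \<otimes> g \<in> centralizer G x" using conj_eq_iff[OF x h(1)] by blast
      then show "g \<in> (\<lambda>c. h \<otimes> c) ` centralizer G x" using g h(1) by (intro image_eqI[of _ _ "inv h \<otimes> g"]) auto
    next
      fix g assume "g \<in> (\<lambda>c. h \<otimes> c) ` centralizer G x"
      then obtain c where c: "c \<in> centralizer G x" "g = h \<otimes> c" by auto
      then have "inv h \<otimes> g \<in> centralizer G x" "g \<in> carrier G" using h(1) by (auto simp: centralizer_def)
      then show "g \<in> {g \<in> carrier G. g \<otimes> x \<otimes> inv g = y}" using conj_eq_iff[OF x h(1), of g] h(2) by simp
    qed
    moreover have "inj_on (\<lambda>c. h \<otimes> c) (centralizer G x)"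
      using h(1) by (auto simp: inj_on_def centralizer_def)
    ultimately show ?thesis by (simp add: card_image)
  qed
  have "order G = (\<Sum>y\<in>conj_class G x. card {g \<in> carrier G. g \<otimes> x \<otimes> inv g = y})"
    unfolding order_def conj_class_def card_eq_sum using fin by (rule sum.image_gen)
  then show ?thesis using fib by simp
qed

text \<open>The witness \<open>k\<close> is the number of conjugacy classes in \<open>X\<close>,
  each of size |G|/d. The clause for \<open>k = 1\<close> is kept because a single class later
  forces given elements to be conjugate.\<close>

lemma card_conj_closed:
  assumes fin: "finite (carrier G)" and X: "X \<subseteq> carrier G"
    and closed: "\<And>x g. x \<in> X \<Longrightarrow> g \<in> carrier G \<Longrightarrow> g \<otimes> x \<otimes> inv g \<in> X"
    and d: "\<And>x. x \<in> X \<Longrightarrow> card (centralizer G x) = d"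
  shows "\<exists>k. card X * d = k * order G \<and> (\<forall>x. k = 1 \<longrightarrow> x \<in> X \<longrightarrow> X = conj_class G x)"
proof -
  let ?C = "conj_class G ` X"
  have sub: "conj_class G x \<subseteq> X" if "x \<in> X" for x
    using that closed by (auto simp: conj_class_def)
  have UX: "\<Union> ?C = X" using sub X conj_class_self by blast
  have finX: "finite X" using fin X finite_subset by blast
  have d0: "d > 0" if ne: "X \<noteq> {}"
  proof -
    obtain x where x: "x \<in> X" using ne by blast
    then have "\<one> \<in> centralizer G x" "finite (centralizer G x)" using X fin by (auto simp: centralizer_def)
    then show ?thesis using d[OF x] by (metis card_gt_0_iff empty_iff)
  qed
  have cc: "card c * d = order G" if "c \<in> ?C" for c
    using that d X card_conj_class[OF fin] by blast
  have "card (\<Union> ?C) = sum card ?C"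
  proof (rule card_Union_disjoint)
    show "pairwise disjnt ?C"
      unfolding pairwise_def disjnt_def using X conj_class_eq by (smt (verit, best) disjoint_iff imageE subsetD)
    show "\<And>A. A \<in> ?C \<Longrightarrow> finite A" using sub finX finite_subset by blast
  qed
  then have "card X * d = (\<Sum>c\<in>?C. card c * d)" using UX by (simp add: sum_distrib_right)
  also have "\<dots> = card ?C * order G" using cc by simp
  finally have 1: "card X * d = card ?C * order G" .
  have "X = conj_class G x" if "card ?C = 1" "x \<in> X" for x
  proof -
    have "?C = {conj_class G x}" using that by (metis card_1_singletonE image_eqI singletonD)
    then show ?thesis using UX by simp
  qed
  then show ?thesis using 1 by blast
qed

text \<open>The elements that map \<open>T\<close> into itself by left multiplication form a
  subgroup, since a translation of a finite set into itself is onto. It contains the generators,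
  hence everything, and \<open>g = g \<otimes> \<one>\<close> lies in \<open>T\<close>. Thus a
  normal form is established by multiplying it with the generators.\<close>

lemma generate_closed_eq:
  assumes S: "S \<subseteq> carrier G" "generate G S = carrier G"
    and T: "finite T" "T \<subseteq> carrier G" "\<one> \<in> T" and closed: "\<And>s t. s \<in> S \<Longrightarrow> t \<in> T \<Longrightarrow> s \<otimes> t \<in> T"
  shows "carrier G = T"
proof -
  define H where "H = {g \<in> carrier G. (\<lambda>t. g \<otimes> t) ` T \<subseteq> T}"
  have surj: "(\<lambda>t. g \<otimes> t) ` T = T" if "g \<in> H" for g
  proof -
    have "inj_on (\<lambda>t. g \<otimes> t) T" using that T(2) by (auto simp: inj_on_def H_def subset_iff)
    then show ?thesis using that T(1) unfolding H_def by (simp add: endo_inj_surj)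
  qed
  have "subgroup H G"
  proof
    show "H \<subseteq> carrier G" "\<one> \<in> H" using T(2) by (auto simp: H_def)
    show "x \<otimes> y \<in> H" if "x \<in> H" "y \<in> H" for x y
    proof -
      have xy: "x \<in> carrier G" "y \<in> carrier G" "\<And>t. t \<in> T \<Longrightarrow> x \<otimes> (y \<otimes> t) \<in> T"
        using that unfolding H_def by blast+
      then have "\<And>t. t \<in> T \<Longrightarrow> (x \<otimes> y) \<otimes> t \<in> T" using T(2) m_assoc by (metis subsetD)
      then show ?thesis using xy unfolding H_def by blast
    qed
    show "inv x \<in> H" if "x \<in> H" for x
    proof -
      have "inv x \<otimes> t \<in> T" if t: "t \<in> T" for t
      proof -
        obtain s where "s \<in> T" "t = x \<otimes> s" using surj[OF \<open>x \<in> H\<close>] t by blast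
        then show ?thesis using \<open>x \<in> H\<close> T(2) by (auto simp: H_def)
      qed
      then show ?thesis using \<open>x \<in> H\<close> by (auto simp: H_def)
    qed
  qed
  moreover have "S \<subseteq> H" using S(1) closed by (auto simp: H_def)
  ultimately have "carrier G \<subseteq> H" using generate_subgroup_incl S(2) by blast
  have "g \<in> T" if "g \<in> carrier G" for g
  proof -
    have "g \<in> H" using \<open>carrier G \<subseteq> H\<close> that by (rule subsetD)
    then have "g \<otimes> \<one> \<in> T" using T(3) unfolding H_def by auto
    then show ?thesis using that by simp
  qed
  then show ?thesis using T(2) by blast
qed

lemma pow_mod_exponent:
  assumes "a \<in> carrier G" "a [^] (m::nat) = \<one>"
  shows "a [^] (i::nat) = a [^] (i mod m)"
proof -
  have "a [^] i = a [^] (m * (i div m) + i mod m)" by simp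
  also have "\<dots> = (a [^] m) [^] (i div m) \<otimes> a [^] (i mod m)"
    using assms(1) by (metis nat_pow_mult nat_pow_pow)
  finally show ?thesis using assms by simp
qed

lemma twisted_pow:
  assumes "a \<in> carrier G" "b \<in> carrier G" "b \<otimes> a = a [^] (k::nat) \<otimes> b"
  shows "b \<otimes> a [^] (i::nat) = a [^] (k * i) \<otimes> b"
proof (induction i)
  case (Suc i)
  have "b \<otimes> a [^] Suc i = (b \<otimes> a [^] i) \<otimes> a" using assms by (simp add: m_assoc)
  also have "\<dots> = a [^] (k * i) \<otimes> (b \<otimes> a)" using assms Suc by (simp add: m_assoc)
  also have "\<dots> = a [^] (k * i) \<otimes> a [^] k \<otimes> b" using assms by (simp add: m_assoc)
  finally show ?case using assms(1) by (simp add: nat_pow_mult add.commute)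
qed (use assms in simp)

text \<open>Every product can be sorted into the form a^i b^j: the twist \<open>ba\<close> moves
  \<open>b\<close> past powers of \<open>a\<close>, and b^n is absorbed as a^r. Different exponents
  may give the same element, so the order is only bounded from above.\<close>

lemma metacyclic_carrier:
  assumes a: "a \<in> carrier G" and b: "b \<in> carrier G" and gen: "generate G {a, b} = carrier G"
    and am: "a [^] (m::nat) = \<one>" "m > 0" and ba: "b \<otimes> a = a [^] (k::nat) \<otimes> b"
    and bn: "b [^] (n::nat) = a [^] (r::nat)" "n > 0"
  shows "carrier G = (\<lambda>(i, j). a [^] i \<otimes> b [^] j) ` ({..<m} \<times> {..<n})"
    "finite (carrier G)" "order G \<le> m * n"
proof -
  let ?T = "(\<lambda>(i, j). a [^] i \<otimes> b [^] j) ` ({..<m} \<times> {..<n})"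
  have mem: "a [^] (i::nat) \<otimes> b [^] (j::nat) \<in> ?T" if "j < n" for i j
  proof -
    have "a [^] i \<otimes> b [^] j = a [^] (i mod m) \<otimes> b [^] j" using pow_mod_exponent[OF a am(1), of i] by simp
    then show ?thesis using that am(2) by (intro image_eqI[of _ _ "(i mod m, j)"]) auto
  qed
  show eq: "carrier G = ?T"
  proof (rule generate_closed_eq[OF _ gen])
    show "\<one> \<in> ?T" using mem[of 0 0] bn(2) by simp
    fix s t assume "s \<in> {a, b}" "t \<in> ?T"
    then have s: "s = a \<or> s = b" and "t \<in> ?T" by auto
    then obtain i j :: nat where t: "t = a [^] i \<otimes> b [^] j" "j < n" by auto
    have "a \<otimes> t = a [^] Suc i \<otimes> b [^] j"
      unfolding t(1) using a b nat_pow_Suc2[OF a] by (simp add: m_assoc)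
    moreover have "b \<otimes> t = a [^] (k * i) \<otimes> b [^] Suc j"
    proof -
      have "b \<otimes> t = (b \<otimes> a [^] i) \<otimes> b [^] j" unfolding t(1) using a b by (simp add: m_assoc)
      also have "\<dots> = a [^] (k * i) \<otimes> (b \<otimes> b [^] j)"
        unfolding twisted_pow[OF a b ba] using a b by (simp add: m_assoc)
      finally show ?thesis using nat_pow_Suc2[OF b] by simp
    qed
    moreover have "a [^] (k * i) \<otimes> b [^] Suc j \<in> ?T"
    proof (cases "Suc j < n")
      case False
      then have "Suc j = n" using t(2) by simp
      then have "a [^] (k * i) \<otimes> b [^] Suc j = a [^] (k * i + r) \<otimes> b [^] (0::nat)"
        using bn a by (simp add: nat_pow_mult)
      then show ?thesis using mem[of 0] bn(2) by metis
    qed (rule mem)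
    ultimately show "s \<otimes> t \<in> ?T" using mem[OF t(2)] s by metis
  qed (use a b in auto)
  show "finite (carrier G)" unfolding eq by simp
  have "card ?T \<le> card ({..<m} \<times> {..<n})" by (rule card_image_le) simp
  then show "order G \<le> m * n" unfolding order_def eq by simp
qed

end

section \<open>Presented groups\<close>

fun word_val :: "('a, 'm) monoid_scheme \<Rightarrow> ('g \<Rightarrow> 'a) \<Rightarrow> 'g word \<Rightarrow> 'a" where
  "word_val G f [] = \<one>\<^bsub>G\<^esub>"
| "word_val G f ((g, b) # w) = (if b then inv\<^bsub>G\<^esub> f g else f g) \<otimes>\<^bsub>G\<^esub> word_val G f w"

text \<open>By von Dyck's theorem this says that \<open>G\<close> is a quotient of
  \<open>presented_group R\<close>, with \<open>f\<close> giving the images of the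
  generators.\<close>

definition satisfies :: "('a, 'm) monoid_scheme \<Rightarrow> ('g \<Rightarrow> 'a) \<Rightarrow> ('g word \<times> 'g word) set \<Rightarrow> bool" where
  "satisfies G f R \<longleftrightarrow> range f \<subseteq> carrier G \<and> generate G (range f) = carrier G \<and>
     (\<forall>(u, v) \<in> R. word_val G f u = word_val G f v)"

context group
begin

lemma word_val_closed [simp]: "range f \<subseteq> carrier G \<Longrightarrow> word_val G f w \<in> carrier G"
  by (induction w) (auto simp: image_subset_iff)

lemma word_val_append: "range f \<subseteq> carrier G \<Longrightarrow> word_val G f (u @ v) = word_val G f u \<otimes> word_val G f v"
proof (induction u)
  case (Cons x u)
  then show ?case by (cases x) (auto simp: m_assoc image_subset_iff)
qed simp

lemma word_val_gen: "range f \<subseteq> carrier G \<Longrightarrow> word_val G f (gen g) = f g"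
  by (auto simp: gen_def image_subset_iff)

lemma word_val_wpow: "range f \<subseteq> carrier G \<Longrightarrow> word_val G f (wpow u n) = word_val G f u [^] n"
proof (induction n)
  case (Suc n)
  have "word_val G f (wpow u (Suc n)) = word_val G f u \<otimes> word_val G f (wpow u n)"
    using Suc.prems by (simp add: wpow_def word_val_append)
  then show ?case using Suc nat_pow_Suc2[of "word_val G f u" n] by simp
qed (simp add: wpow_def)

lemma word_val_winv: "range f \<subseteq> carrier G \<Longrightarrow> word_val G f (winv u) = inv (word_val G f u)"
proof (induction u)
  case (Cons x u)
  obtain g b where x: "x = (g, b)" by fastforce
  have "winv (x # u) = winv u @ [(g, \<not> b)]" by (simp add: winv_def x)
  then show ?case using Cons by (auto simp: word_val_append x inv_mult_group image_subset_iff)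
qed (simp add: winv_def)

lemmas word_val_simps = word_val_append word_val_gen word_val_wpow word_val_winv

lemma word_val_word_eq:
  assumes "word_eq R u v" "range f \<subseteq> carrier G" "\<And>u v. (u, v) \<in> R \<Longrightarrow> word_val G f u = word_val G f v"
  shows "word_val G f u = word_val G f v"
  using assms(1) assms(2,3) by induction (auto simp: word_val_append image_subset_iff)

lemma generate_word_val:
  assumes "range f \<subseteq> carrier G" shows "generate G (range f) = range (word_val G f)"
proof
  have "subgroup (range (word_val G f)) G"
    using assms word_val_append[OF assms, symmetric] word_val_winv[OF assms, symmetric]
    by unfold_locales (auto intro: range_eqI[of _ _ "[]"])
  moreover have "range f \<subseteq> range (word_val G f)"
    using word_val_gen[OF assms, symmetric] by auto
  ultimately show "generate G (range f) \<subseteq> range (word_val G f)" by (simp add: generate_subgroup_incl)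
  have "word_val G f w \<in> generate G (range f)" for w
  proof (induction w)
    case (Cons x w)
    obtain g b where x: "x = (g, b)" by fastforce
    have "(if b then inv f g else f g) \<in> generate G (range f)"
      using generate.incl[of "f g" "range f" G] generate.inv[of "f g" "range f" G] by simp
    from generate.eng[OF this Cons] show ?case by (simp add: x)
  qed (simp add: generate.one)
  then show "range (word_val G f) \<subseteq> generate G (range f)" by auto
qed

end

text \<open>Evaluating a word at the images of the generators is the same as applying the
  isomorphism to the class of the word. Used with the identity, the lemma makes
  \<open>presented_group R\<close> itself subject to every statement about
  \<open>satisfies\<close>.\<close>

lemma iso_presented_satisfies:
  assumes "group G" "G \<cong> presented_group R"
  obtains f where "satisfies G f R"
proof -
  interpret G: group G by fact
  interpret P: group "presented_group R" by (rule group_presented_group)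
  have "presented_group R \<cong> G" using assms by (simp add: G.iso_sym)
  then obtain h where h: "h \<in> iso (presented_group R) G" unfolding is_iso_def by blast
  then have hh: "h \<in> hom (presented_group R) G" and bij: "bij_betw h (carrier (presented_group R)) (carrier G)"
    by (auto simp: iso_def)
  interpret h: group_hom "presented_group R" G h
    using hh by unfold_locales
  define f where "f g = h (word_class R (gen g))" for g
  have cl: "word_class R w \<in> carrier (presented_group R)" for w by (simp add: presented_group_def)
  have rf: "range f \<subseteq> carrier G" using cl h.hom_closed unfolding f_def by blast
  have inv: "word_class R [(g, True)] = inv\<^bsub>presented_group R\<^esub> word_class R [(g, False)]" for g
  proof (rule P.inv_equality[symmetric])
    show "word_class R [(g, True)] \<otimes>\<^bsub>presented_group R\<^esub> word_class R [(g, False)] = \<one>\<^bsub>presented_group R\<^esub>"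
    proof -
      have "word_class R [(g, True), (g, False)] = word_class R []"
        using word_eq.cancel[of R g True] by (simp add: word_class_eq_iff)
      then show ?thesis unfolding presented_group_mult by (simp add: presented_group_def)
    qed
  qed (rule cl)+
  have ev: "word_val G f w = h (word_class R w)" for w
  proof (induction w)
    case Nil
    have "\<one>\<^bsub>presented_group R\<^esub> = word_class R []" by (simp add: presented_group_def)
    then show ?case using h.hom_one by simp
  next
    case (Cons x w)
    obtain g b where x: "x = (g, b)" by fastforce
    have "word_class R (x # w) = word_class R [(g, b)] \<otimes>\<^bsub>presented_group R\<^esub> word_class R w"
      by (simp add: presented_group_mult x)
    moreover have "h (word_class R [(g, b)]) = (if b then inv\<^bsub>G\<^esub> f g else f g)"
      using inv cl by (auto simp: f_def gen_def)
    ultimately show ?case using Cons cl by (simp add: x)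
  qed
  have "generate G (range f) = h ` range (word_class R)"
    unfolding G.generate_word_val[OF rf] using ev by (simp add: image_image)
  also have "\<dots> = carrier G" using bij by (simp add: bij_betw_def presented_group_def)
  finally have "satisfies G f R"
    unfolding satisfies_def using rf by (auto simp: ev word_class_eq_iff[THEN iffD2, OF word_eq.rel])
  then show ?thesis by (rule that)
qed

text \<open>Von Dyck: the evaluation map onto \<open>G\<close> is injective as soon as the presented group is not larger than \<open>G\<close>.\<close>

lemma satisfies_iso_presented:
  assumes "group G" "finite (carrier G)" "satisfies G f R"
    and bound: "\<And>f. satisfies (presented_group R) f R \<Longrightarrow>
      finite (carrier (presented_group R)) \<and> order (presented_group R) \<le> order G"
  shows "G \<cong> presented_group R"
proof -
  interpret G: group G by fact
  interpret P: group "presented_group R" by (rule group_presented_group)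
  \<comment> \<open>The hypothesis \<open>bound\<close> speaks about arbitrary generating
    assignments; this supplies one for the presented group itself.\<close>
  obtain f' where "satisfies (presented_group R) f' R"
    using iso_presented_satisfies[OF group_presented_group iso_refl] by blast
  then have b: "finite (carrier (presented_group R))" "order (presented_group R) \<le> order G" using bound by auto
  have rf: "range f \<subseteq> carrier G" and gen: "generate G (range f) = carrier G"
    and rel: "\<And>u v. (u, v) \<in> R \<Longrightarrow> word_val G f u = word_val G f v"
    using assms(3) unfolding satisfies_def by auto
  define h where "h A = word_val G f (SOME w. A = word_class R w)" for A
  have h: "h (word_class R w) = word_val G f w" for w
  proof -
    have "word_class R w = word_class R (SOME w'. word_class R w = word_class R w')"
      by (rule someI[of "\<lambda>w'. word_class R w = word_class R w'" w]) simp
    then show ?thesis unfolding h_def word_class_eq_iff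
      using G.word_val_word_eq[OF _ rf rel] word_eq.sym by metis
  qed
  have c: "carrier (presented_group R) = range (word_class R)" by (simp add: presented_group_def)
  have surj: "h ` carrier (presented_group R) = carrier G"
    using G.generate_word_val[OF rf] gen h by (simp add: c image_image)
  have "inj_on h (carrier (presented_group R))"
    using b surj card_image_le[OF b(1), of h] unfolding order_def by (intro eq_card_imp_inj_on) auto
  moreover have "h \<in> hom (presented_group R) G"
    using rf by (auto simp: hom_def c h presented_group_mult G.word_val_append)
  ultimately have "h \<in> iso (presented_group R) G" using surj by (simp add: iso_def bij_betw_def)
  then have "presented_group R \<cong> G" unfolding is_iso_def by blast
  then show ?thesis by (rule P.iso_sym)
qed

lemma range_two_gens: "range (f :: two_gens \<Rightarrow> 'a) = {f A2, f B2}"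
  by (auto simp: image_iff) (metis two_gens.exhaust)

lemma range_three_gens: "range (f :: three_gens \<Rightarrow> 'a) = {f A3, f B3, f C3}"
  by (auto simp: image_iff) (metis three_gens.exhaust)

section \<open>Planarity of commuting graphs with small centralizers\<close>

lemma embeds_on_subgraph:
  assumes "embeds_on (V', E') S" "inj_on f V" "f ` V \<subseteq> V'" "\<And>e. e \<in> E \<Longrightarrow> e \<subseteq> V \<and> f ` e \<in> E'"
  shows "embeds_on (V, E) S"
proof -
  obtain \<phi> \<gamma> where inj: "inj_on \<phi> V'" and \<phi>: "\<phi> ` V' \<subseteq> S"
    and \<gamma>: "\<And>e. e \<in> E' \<Longrightarrow> arc (\<gamma> e) \<and> path_image (\<gamma> e) \<subseteq> S \<and>
           {pathstart (\<gamma> e), pathfinish (\<gamma> e)} = \<phi> ` e \<and> path_image (\<gamma> e) \<inter> \<phi> ` V' = \<phi> ` e"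
    and cross: "\<And>e e'. e \<in> E' \<Longrightarrow> e' \<in> E' \<Longrightarrow> e \<noteq> e' \<Longrightarrow>
           path_image (\<gamma> e) \<inter> path_image (\<gamma> e') \<subseteq> \<phi> ` (e \<inter> e')"
    using assms(1) unfolding embeds_on_def fst_conv snd_conv by metis
  show ?thesis unfolding embeds_on_def fst_conv snd_conv
  proof (intro exI[of _ "\<phi> \<circ> f"] exI[of _ "\<lambda>e. \<gamma> (f ` e)"] conjI ballI impI)
    show "inj_on (\<phi> \<circ> f) V" using inj assms(2,3) by (meson comp_inj_on inj_on_subset)
    show "(\<phi> \<circ> f) ` V \<subseteq> S" using \<phi> assms(3) by auto
  next
    fix e assume "e \<in> E"
    note e = assms(4)[OF this]
    note ge = \<gamma>[OF conjunct2[OF e]]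
    show "arc (\<gamma> (f ` e))" "path_image (\<gamma> (f ` e)) \<subseteq> S" using ge by blast+
    show "{pathstart (\<gamma> (f ` e)), pathfinish (\<gamma> (f ` e))} = (\<phi> \<circ> f) ` e" using ge by (simp add: image_comp)
    have A: "path_image (\<gamma> (f ` e)) \<inter> \<phi> ` V' = \<phi> ` f ` e" using ge by blast
    have B: "\<phi> ` f ` e \<subseteq> \<phi> ` f ` V" by (rule image_mono, rule image_mono, rule conjunct1[OF e])
    have C: "\<phi> ` f ` V \<subseteq> \<phi> ` V'" by (rule image_mono, rule assms(3))
    show "path_image (\<gamma> (f ` e)) \<inter> (\<phi> \<circ> f) ` V = (\<phi> \<circ> f) ` e"
    proof
      show "path_image (\<gamma> (f ` e)) \<inter> (\<phi> \<circ> f) ` V \<subseteq> (\<phi> \<circ> f) ` e"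
        using Int_mono[OF subset_refl C, of "path_image (\<gamma> (f ` e))"] unfolding A image_comp .
      show "(\<phi> \<circ> f) ` e \<subseteq> path_image (\<gamma> (f ` e)) \<inter> (\<phi> \<circ> f) ` V"
        using B A unfolding image_comp[symmetric] by (metis Int_greatest inf.cobounded1)
    qed
  next
    fix e e' assume "e \<in> E" "e' \<in> E" "e \<noteq> e'"
    note e = assms(4)[OF \<open>e \<in> E\<close>] assms(4)[OF \<open>e' \<in> E\<close>]
    have "f ` e \<noteq> f ` e'" using e \<open>e \<noteq> e'\<close> inj_on_image_eq_iff[OF assms(2)] by blast
    then have "path_image (\<gamma> (f ` e)) \<inter> path_image (\<gamma> (f ` e')) \<subseteq> \<phi> ` (f ` e \<inter> f ` e')"
      using e by (intro cross) auto
    also have "f ` e \<inter> f ` e' = f ` (e \<inter> e')"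
      using e inj_on_image_Int[OF assms(2)] by blast
    finally show "path_image (\<gamma> (f ` e)) \<inter> path_image (\<gamma> (f ` e')) \<subseteq> (\<phi> \<circ> f) ` (e \<inter> e')"
      by (simp add: image_comp)
  qed
qed

text \<open>An injective homomorphism reflects commutation, so a noncentral element keeps a
  noncommuting partner, and the commuting graph of \<open>G\<close> becomes a subgraph of that of
  \<open>H\<close>.\<close>

lemma planar_inj_hom:
  assumes "group G" "group H" "h \<in> hom G H" "inj_on h (carrier G)" "planar (commuting_graph H)"
  shows "planar (commuting_graph G)"
proof -
  interpret G: group G by fact
  interpret H: group H by fact
  have hc: "h x \<in> carrier H" if "x \<in> carrier G" for x using assms(3) that by (auto simp: hom_def)
  have hm: "h (x \<otimes>\<^bsub>G\<^esub> y) = h x \<otimes>\<^bsub>H\<^esub> h y" if "x \<in> carrier G" "y \<in> carrier G" for x y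
    using assms(3) that by (auto simp: hom_def)
  have comm: "h x \<otimes>\<^bsub>H\<^esub> h y = h y \<otimes>\<^bsub>H\<^esub> h x \<longleftrightarrow> x \<otimes>\<^bsub>G\<^esub> y = y \<otimes>\<^bsub>G\<^esub> x"
    if "x \<in> carrier G" "y \<in> carrier G" for x y
    using that inj_on_eq_iff[OF assms(4), of "x \<otimes>\<^bsub>G\<^esub> y" "y \<otimes>\<^bsub>G\<^esub> x"] by (simp add: hm[symmetric])
  define V where "V = carrier G - group_center G"
  define V' where "V' = carrier H - group_center H"
  have inj: "inj_on h V" using assms(4) by (rule inj_on_subset) (auto simp: V_def)
  have VV: "h x \<in> V'" if "x \<in> V" for x
  proof -
    have x: "x \<in> carrier G" "x \<notin> group_center G" using that by (auto simp: V_def)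
    then obtain y where y: "y \<in> carrier G" "x \<otimes>\<^bsub>G\<^esub> y \<noteq> y \<otimes>\<^bsub>G\<^esub> x" by (auto simp: group_center_def)
    then have "h x \<otimes>\<^bsub>H\<^esub> h y \<noteq> h y \<otimes>\<^bsub>H\<^esub> h x" using comm x by blast
    then show ?thesis using hc x y by (auto simp: V'_def group_center_def)
  qed
  show ?thesis
    using assms(5) unfolding planar_def commuting_graph_def Let_def V_def[symmetric] V'_def[symmetric]
  proof (rule embeds_on_subgraph[OF _ inj])
    show "h ` V \<subseteq> V'" using VV by blast
    fix e assume "e \<in> {{x, y} | x y. x \<in> V \<and> y \<in> V \<and> x \<noteq> y \<and> x \<otimes>\<^bsub>G\<^esub> y = y \<otimes>\<^bsub>G\<^esub> x}"
    then obtain x y where e: "e = {x, y}" "x \<in> V" "y \<in> V" "x \<noteq> y" "x \<otimes>\<^bsub>G\<^esub> y = y \<otimes>\<^bsub>G\<^esub> x" by blast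
    have "h x \<noteq> h y" using e inj by (auto simp: inj_on_def)
    moreover have "h x \<otimes>\<^bsub>H\<^esub> h y = h y \<otimes>\<^bsub>H\<^esub> h x" using e comm by (auto simp: V_def)
    ultimately show "e \<subseteq> V \<and> h ` e \<in> {{x, y} | x y. x \<in> V' \<and> y \<in> V' \<and> x \<noteq> y \<and> x \<otimes>\<^bsub>H\<^esub> y = y \<otimes>\<^bsub>H\<^esub> x}"
      using e VV by auto
  qed
qed

lemma planar_iso:
  assumes "group G" "group H" "G \<cong> H" "planar (commuting_graph H)"
  shows "planar (commuting_graph G)"
proof -
  obtain h where "h \<in> iso G H" using assms(3) unfolding is_iso_def by blast
  then show ?thesis using planar_inj_hom[OF assms(1,2) _ _ assms(4)] by (auto simp: iso_def bij_betw_def)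
qed

text \<open>A disjoint union of complete graphs on at most four vertices: each block is drawn on four
  consecutive points of the line, and only the edge between the second and fourth point needs the
  second page.\<close>

lemma planar_small_blocks:
  fixes N :: "'a \<Rightarrow> 'a set"
  assumes fin: "finite V" and N: "\<And>x. x \<in> V \<Longrightarrow> x \<in> N x" "\<And>x y. x \<in> V \<Longrightarrow> y \<in> V \<Longrightarrow> y \<in> N x \<Longrightarrow> N y = N x"
    and card: "\<And>x. x \<in> V \<Longrightarrow> finite (N x) \<and> card (N x) \<le> 4"
    and E: "E \<subseteq> {{x, y} | x y. x \<in> V \<and> y \<in> V \<and> x \<noteq> y \<and> y \<in> N x}"
  shows "planar (V, E)"
proof -
  obtain idx :: "'a set \<Rightarrow> nat" where idx: "inj_on idx (N ` V)"
    using finite_imp_inj_to_nat_seg[of "N ` V"] fin by blast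
  have "\<exists>r. inj_on r c \<and> r ` c \<subseteq> {..<4::nat}" if "c \<in> N ` V" for c
  proof -
    have c: "finite c" "card c \<le> 4" using that card by auto
    then obtain r n where "r ` c = {i. i < (n::nat)}" "inj_on r c" using finite_imp_inj_to_nat_seg[OF c(1)] by metis
    moreover from this have "n = card c" using card_image[of r c] by simp
    ultimately show ?thesis using c by (intro exI[of _ r]) auto
  qed
  then obtain rk where rk: "\<And>c. c \<in> N ` V \<Longrightarrow> inj_on (rk c) c \<and> rk c ` c \<subseteq> {..<4::nat}" by metis
  define r where "r x = rk (N x) x" for x
  define p where "p x = 4 * idx (N x) + r x" for x
  have r4: "r x < 4" if "x \<in> V" for x
    using rk[of "N x"] N(1)[OF that] that unfolding r_def by auto
  have same: "N x = N y" if "x \<in> V" "y \<in> V" "idx (N x) = idx (N y)" for x y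
    using idx that unfolding inj_on_def by blast
  have pinj: "x = y" if "x \<in> V" "y \<in> V" "p x = p y" for x y
  proof -
    have "p x div 4 = idx (N x)" "p x mod 4 = r x" "p y div 4 = idx (N y)" "p y mod 4 = r y"
      using r4[OF that(1)] r4[OF that(2)] unfolding p_def by simp_all
    then have "idx (N x) = idx (N y)" "r x = r y" using that(3) by simp_all
    then have "N x = N y" using same that by blast
    then show ?thesis using \<open>r x = r y\<close> rk[of "N x"] N(1) that unfolding r_def inj_on_def by auto
  qed
  define page where "page e \<longleftrightarrow> (\<exists>x\<in>e. \<exists>y\<in>e. r x = 1 \<and> r y = 3)" for e
  have ed: "x \<in> V \<and> y \<in> V \<and> N y = N x" if e: "{x, y} \<in> E" for x y
  proof -
    obtain u v where "{x, y} = {u, v}" "u \<in> V" "v \<in> V" "v \<in> N u" using subsetD[OF E e] by blast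
    then show ?thesis using N(2)[of u v] by (auto simp: doubleton_eq_iff)
  qed
  show ?thesis
  proof (rule planar_two_pages[of "\<lambda>x. real (p x)" _ _ page])
    show "inj_on (\<lambda>x. real (p x)) V" using pinj by (auto simp: inj_on_def)
    show "E \<subseteq> {{x, y} | x y. x \<in> V \<and> y \<in> V \<and> x \<noteq> y}" using E by blast
    fix x y u v assume e: "{x, y} \<in> E" "{u, v} \<in> E" and pg: "page {x, y} = page {u, v}"
      and lt: "real (p x) < real (p u)" "real (p u) < real (p y)" "real (p y) < real (p v)"
    have xy: "x \<in> V" "y \<in> V" "N y = N x" "u \<in> V" "v \<in> V" "N v = N u" using ed e by blast+
    have lt': "p x < p u" "p u < p y" "p y < p v" using lt by auto
    \<comment> \<open>Blocks occupy disjoint ranges of positions, so interleaving edges belong to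
      the same block.\<close>
    have i: "idx (N u) = idx (N x)"
    proof -
      have "4 * idx (N x) < 4 * idx (N u) + 4" "4 * idx (N u) < 4 * idx (N x) + 4"
        using lt' r4[OF xy(1)] r4[OF xy(2)] r4[OF xy(4)] unfolding p_def xy(3) by linarith+
      then show ?thesis by simp
    qed
    then have "r x < r u" "r u < r y" "r y < r v" using lt' xy unfolding p_def by simp_all
    then have "r x = 0" "r u = 1" "r y = 2" "r v = 3" using r4[OF xy(5)] by linarith+
    then show False using pg unfolding page_def by auto
  qed
qed

context group
begin

text \<open>If \<open>y\<close> and \<open>w\<close> in C(x) did not commute, then \<open>x\<close>,
  \<open>y\<close>, \<open>w\<close>, \<open>yw\<close>, \<open>wy\<close> would be five distinct
  noncentral elements of C(x). So centralizers of noncentral elements are abelian, commuting is an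
  equivalence relation on the noncentral elements, and its classes have at most 4 elements.\<close>

theorem planar_commuting_graph:
  assumes fin: "finite (carrier G)"
    and small: "\<And>x. x \<in> carrier G \<Longrightarrow> x \<notin> group_center G \<Longrightarrow> card (centralizer G x) \<le> card (group_center G) + 4"
  shows "planar (commuting_graph G)"
proof -
  let ?Z = "group_center G"
  define N where "N x = centralizer G x - ?Z" for x
  have card: "finite (N x) \<and> card (N x) \<le> 4" if "x \<in> carrier G" "x \<notin> ?Z" for x
  proof -
    have f: "finite (centralizer G x)" using fin by (auto simp: centralizer_def)
    then have "card (N x) = card (centralizer G x) - card ?Z" unfolding N_def
      using center_subset_centralizer[OF that(1)] finite_subset by (intro card_Diff_subset) auto
    then show ?thesis using small[OF that] f N_def by simp
  qed
  have comm: "y \<otimes> w = w \<otimes> y" if x: "x \<in> carrier G" "x \<notin> ?Z" and y: "y \<in> centralizer G x" and w: "w \<in> centralizer G x" for x y w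
  proof (rule ccontr)
    assume ne: "y \<otimes> w \<noteq> w \<otimes> y"
    have c: "y \<in> carrier G" "w \<in> carrier G" "x \<otimes> y = y \<otimes> x" "x \<otimes> w = w \<otimes> x" using y w by (auto simp: centralizer_def)
    have yw: "y \<otimes> (y \<otimes> w) \<noteq> (y \<otimes> w) \<otimes> y" using ne c by (simp add: m_assoc)
    have wy: "w \<otimes> (w \<otimes> y) \<noteq> (w \<otimes> y) \<otimes> w" using ne c by (simp add: m_assoc)
    have nz: "y \<notin> ?Z" "w \<notin> ?Z" "y \<otimes> w \<notin> ?Z" "w \<otimes> y \<notin> ?Z"
      using ne c yw wy center_commute by metis+
    have "{x, y, w, y \<otimes> w, w \<otimes> y} \<subseteq> N x"
      using x y w nz subgroup.m_closed[OF centralizer_subgroup[OF x(1)]] by (auto simp: N_def centralizer_def)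
    moreover have "card {x, y, w, y \<otimes> w, w \<otimes> y} = 5"
    proof -
      have "x \<noteq> y" "x \<noteq> w" using ne c by auto
      moreover have "x \<noteq> y \<otimes> w" "x \<noteq> w \<otimes> y" using yw wy c by auto
      moreover have "y \<noteq> w" "y \<noteq> y \<otimes> w" "y \<noteq> w \<otimes> y" "w \<noteq> y \<otimes> w" "w \<noteq> w \<otimes> y"
        using ne yw wy c by auto
      ultimately show ?thesis using ne by (simp add: card_insert_if)
    qed
    ultimately have "5 \<le> card (N x)" using card[OF x] card_mono by metis
    then show False using card[OF x] by simp
  qed
  show ?thesis unfolding commuting_graph_def Let_def
  proof (rule planar_small_blocks[where N = N])
    show "finite (carrier G - ?Z)" using fin by simp
    show "x \<in> N x" if "x \<in> carrier G - ?Z" for x using that by (auto simp: N_def centralizer_def)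
    show "finite (N x) \<and> card (N x) \<le> 4" if "x \<in> carrier G - ?Z" for x using that card by blast
    show "N y = N x" if "x \<in> carrier G - ?Z" "y \<in> carrier G - ?Z" "y \<in> N x" for x y
    proof -
      have xy: "x \<in> carrier G" "y \<in> carrier G" "x \<notin> ?Z" "y \<notin> ?Z" "y \<in> centralizer G x" "x \<in> centralizer G y"
        using that unfolding N_def centralizer_def by auto
      have "w \<in> centralizer G x" if "w \<in> centralizer G y" for w
        using comm[OF xy(2,4,6) that] that xy(1) by (simp add: centralizer_def)
      moreover have "w \<in> centralizer G y" if "w \<in> centralizer G x" for w
        using comm[OF xy(1,3,5) that] that xy(2) by (simp add: centralizer_def)
      ultimately show ?thesis unfolding N_def by blast
    qed
    show "{{x, y} |x y. x \<in> carrier G - ?Z \<and> y \<in> carrier G - ?Z \<and> x \<noteq> y \<and> x \<otimes> y = y \<otimes> x}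
      \<subseteq> {{x, y} |x y. x \<in> carrier G - ?Z \<and> y \<in> carrier G - ?Z \<and> x \<noteq> y \<and> y \<in> N x}"
      by (auto simp: N_def centralizer_def)
  qed
qed

section \<open>Planarity from bounds on the order\<close>

lemma proper_subgroup_card:
  assumes "finite (carrier G)" "subgroup H G" "H \<noteq> carrier G"
  shows "2 * card H \<le> order G"
proof -
  obtain k where k: "order G = card H * k" using subgroup_card_dvd[OF assms(2)] by blast
  have "card H < order G" unfolding order_def
    using psubset_card_mono[OF assms(1), of H] subgroup.subset[OF assms(2)] assms(3) by blast
  then have "k \<noteq> 0" "k \<noteq> 1" using k by auto
  then have "card H * 2 \<le> card H * k" by (intro mult_le_mono2) auto
  then show ?thesis using k by simp
qed

text \<open>The centralizer of a noncentral element is a proper subgroup and has at most half the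
  elements of the group.\<close>

lemma planar_order_bound:
  assumes fin: "finite (carrier G)" and ord: "order G \<le> 2 * (card (group_center G) + 4)"
  shows "planar (commuting_graph G)"
proof (rule planar_commuting_graph[OF fin])
  fix x assume "x \<in> carrier G" "x \<notin> group_center G"
  then have "2 * card (centralizer G x) \<le> order G"
    using proper_subgroup_card[OF fin] centralizer_subgroup noncentral_iff by blast
  then show "card (centralizer G x) \<le> card (group_center G) + 4" using ord by simp
qed

lemma card_center_pos: "finite (carrier G) \<Longrightarrow> card (group_center G) > 0"
  using center_subgroup subgroup.finite_imp_card_positive by blast

lemma center_generators:
  assumes "generate G S = carrier G" "S \<subseteq> carrier G" "z \<in> carrier G" "\<And>s. s \<in> S \<Longrightarrow> z \<otimes> s = s \<otimes> z"
  shows "z \<in> group_center G"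
proof -
  have "S \<subseteq> centralizer G z" using assms by (auto simp: centralizer_def)
  then have "carrier G \<subseteq> centralizer G z"
    using generate_subgroup_incl[OF _ centralizer_subgroup] assms by metis
  then show ?thesis using assms(3) by (auto simp: centralizer_def group_center_def)
qed

text \<open>Modulo the central set \<open>W\<close> the elements \<open>a\<close> and
  \<open>b\<close> commute and have trivial squares, so \<open>\<one>\<close>, \<open>a\<close>,
  \<open>b\<close>, \<open>a \<otimes> b\<close> represent all cosets. A \<open>W\<close> with an
  explicit list of elements gives an absolute bound; taking the whole center relates the order to
  |Z|.\<close>

lemma order_le_4_central:
  assumes finZ: "finite W" and W: "W \<subseteq> group_center G" "\<one> \<in> W" "\<And>u v. u \<in> W \<Longrightarrow> v \<in> W \<Longrightarrow> u \<otimes> v \<in> W"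
    and S: "generate G S = carrier G" "S \<subseteq> W \<union> {a, b}"
    and a: "a \<in> carrier G" and b: "b \<in> carrier G" and z: "a \<otimes> a \<in> W" "b \<otimes> b \<in> W"
    and ba: "b \<otimes> a = (a \<otimes> b) \<otimes> c" "c \<in> W"
  shows "finite (carrier G)" "order G \<le> 4 * card W"
proof -
  let ?T = "(\<lambda>(t, z). t \<otimes> z) ` ({\<one>, a, b, a \<otimes> b} \<times> W)"
  have cc: "w \<in> carrier G" if "w \<in> W" for w using that W(1) center_carrier by blast
  have center_commute: "w \<otimes> g = g \<otimes> w" if "w \<in> W" "g \<in> carrier G" for w g
    using that W(1) center_commute by blast
  have mem: "t \<otimes> z \<in> ?T" if "t \<in> {\<one>, a, b, a \<otimes> b}" "z \<in> W" for t z
    using that by (intro image_eqI[of _ _ "(t, z)"]) auto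
  note zz = W(3)
  have eq: "carrier G = ?T"
  proof (rule generate_closed_eq[OF _ S(1)])
    show "S \<subseteq> carrier G" using S(2) a b cc by blast
    show "finite ?T" using finZ by simp
    show "?T \<subseteq> carrier G" using a b cc by auto
    show "\<one> \<in> ?T" using mem[of \<one> \<one>] W(2) by simp
    fix s t assume s: "s \<in> S" and "t \<in> ?T"
    then obtain u z' where t: "t = u \<otimes> z'" "z' \<in> W" "u \<in> {\<one>, a, b, a \<otimes> b}" by auto
    have uc: "u \<in> carrier G" "z' \<in> carrier G" using t a b cc by auto
    consider "s \<in> W" | "s = a" | "s = b" using s S(2) by blast
    then show "s \<otimes> t \<in> ?T"
    proof cases
      case 1
      have "s \<otimes> t = u \<otimes> (s \<otimes> z')" unfolding t(1) using uc cc[OF 1] center_commute[OF 1 uc(1)]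
        by (simp add: m_assoc[symmetric])
      then show ?thesis using mem[OF t(3) zz[OF 1 t(2)]] by simp
    next
      case 2
      have "a \<otimes> (\<one> \<otimes> z') = a \<otimes> z'" "a \<otimes> (b \<otimes> z') = (a \<otimes> b) \<otimes> z'" using a b uc by (simp_all add: m_assoc)
      moreover have "a \<otimes> (a \<otimes> z') = \<one> \<otimes> ((a \<otimes> a) \<otimes> z')" using a uc by (simp add: m_assoc)
      moreover have "a \<otimes> (a \<otimes> b \<otimes> z') = b \<otimes> ((a \<otimes> a) \<otimes> z')"
      proof -
        have "a \<otimes> (a \<otimes> b \<otimes> z') = ((a \<otimes> a) \<otimes> b) \<otimes> z'" using a b uc by (simp add: m_assoc)
        also have "\<dots> = b \<otimes> (a \<otimes> a) \<otimes> z'" using center_commute[OF z(1) b] by simp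
        finally show ?thesis using a b uc by (simp add: m_assoc)
      qed
      ultimately have "a \<otimes> (v \<otimes> z') \<in> ?T" if "v \<in> {\<one>, a, b, a \<otimes> b}" for v
        using that mem[OF _ t(2)] mem[OF _ zz[OF z(1) t(2)]]
        by (elim insertE emptyE) (simp_all only: insertI1 insertI2)
      then show ?thesis using t 2 by blast
    next
      case 3
      have "b \<otimes> (\<one> \<otimes> z') = b \<otimes> z'" using b uc by simp
      moreover have "b \<otimes> (b \<otimes> z') = \<one> \<otimes> ((b \<otimes> b) \<otimes> z')" using b uc by (simp add: m_assoc)
      moreover have "b \<otimes> (a \<otimes> z') = (a \<otimes> b) \<otimes> (c \<otimes> z')"
        using a b uc cc[OF ba(2)] ba(1) by (simp add: m_assoc[symmetric])
      moreover have "b \<otimes> (a \<otimes> b \<otimes> z') = a \<otimes> ((b \<otimes> b) \<otimes> (c \<otimes> z'))"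
      proof -
        have "b \<otimes> (a \<otimes> b \<otimes> z') = (b \<otimes> a) \<otimes> b \<otimes> z'" using a b uc by (simp add: m_assoc)
        also have "\<dots> = a \<otimes> b \<otimes> (c \<otimes> b) \<otimes> z'" using ba a b cc by (simp add: m_assoc)
        also have "c \<otimes> b = b \<otimes> c" using center_commute[OF ba(2) b] .
        finally show ?thesis using a b uc cc[OF ba(2)] by (simp add: m_assoc)
      qed
      ultimately have "b \<otimes> (v \<otimes> z') \<in> ?T" if "v \<in> {\<one>, a, b, a \<otimes> b}" for v
        using that mem[OF _ t(2)] mem[OF _ zz[OF z(2) t(2)]] mem[OF _ zz[OF ba(2) t(2)]]
          mem[OF _ zz[OF z(2) zz[OF ba(2) t(2)]]]
        by (elim insertE emptyE) (simp_all only: insertI1 insertI2)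
      then show ?thesis using t 3 by blast
    qed
  qed
  show "finite (carrier G)" unfolding eq using finZ by simp
  have "order G = card ?T" by (simp add: order_def eq)
  also have "\<dots> \<le> card ({\<one>, a, b, a \<otimes> b} \<times> W)" using finZ by (intro card_image_le) simp
  also have "\<dots> = card {\<one>, a, b, a \<otimes> b} * card W" by (rule card_cartesian_product)
  also have "\<dots> \<le> 4 * card W" by (intro mult_le_mono1) (simp add: card_insert_if)
  finally show "order G \<le> 4 * card W" .
qed

lemma order_le_4_center:
  assumes fin: "finite (carrier G)" and S: "generate G S = carrier G" "S \<subseteq> group_center G \<union> {a, b}"
    and a: "a \<in> carrier G" and b: "b \<in> carrier G" and z: "a \<otimes> a \<in> group_center G" "b \<otimes> b \<in> group_center G"
    and ba: "b \<otimes> a = (a \<otimes> b) \<otimes> c" "c \<in> group_center G"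
  shows "order G \<le> 4 * card (group_center G)"
proof (rule order_le_4_central(2)[OF _ _ _ _ S a b z ba])
  show "finite (group_center G)" by (rule finite_subset[OF _ fin]) (use center_carrier in blast)
qed (auto intro: subgroup.one_closed[OF center_subgroup] subgroup.m_closed[OF center_subgroup])

text \<open>For |Z| >= 4 the bound 2(|Z| + 4) is at least 16; for smaller centers it is at least
  4|Z|. In this form the criterion applies to a presented group that might be smaller than
  expected.\<close>

lemma planar_order_16:
  assumes "finite (carrier G)" "order G \<le> 16" "order G \<le> 4 * card (group_center G)"
  shows "planar (commuting_graph G)"
proof (rule planar_order_bound[OF assms(1)])
  show "order G \<le> 2 * (card (group_center G) + 4)"
    using assms(2,3) by (cases "card (group_center G) \<le> 3") auto
qed

end

section \<open>Orders and centers of the presented groups\<close>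

context group
begin

lemma inv_eq_pow:
  assumes "a \<in> carrier G" "a [^] (n::nat) = \<one>" "n > 0"
  shows "inv a = a [^] (n - 1)"
proof (rule inv_equality)
  have "a [^] (n - 1) \<otimes> a = a [^] Suc (n - 1)" by simp
  then show "a [^] (n - 1) \<otimes> a = \<one>" using assms by (simp del: nat_pow_Suc)
qed (use assms in auto)

lemma subgroup_nat_pow_closed: "subgroup H G \<Longrightarrow> x \<in> H \<Longrightarrow> x [^] (n::nat) \<in> H"
  by (induction n) (auto intro: subgroup.one_closed subgroup.m_closed)

lemma conj_eq_twist:
  assumes "a \<in> carrier G" "b \<in> carrier G" "b \<otimes> a \<otimes> inv b = c" "c \<in> carrier G"
  shows "b \<otimes> a = c \<otimes> b"
  using assms(1,2,4) assms(3)[symmetric] by (simp add: m_assoc)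

lemma metacyclic_center:
  assumes a: "a \<in> carrier G" and b: "b \<in> carrier G" and gen: "generate G {a, b} = carrier G"
    and ba: "b \<otimes> a = a [^] (k::nat) \<otimes> b" and ak: "a [^] (k * i) = a [^] (i::nat)"
  shows "a [^] i \<in> group_center G"
proof (rule center_generators[OF gen])
  fix s assume "s \<in> {a, b}"
  moreover have "a [^] i \<otimes> a = a \<otimes> a [^] i" using nat_pow_Suc2[OF a, of i] by simp
  moreover have "a [^] i \<otimes> b = b \<otimes> a [^] i" using twisted_pow[OF a b ba, of i] ak by simp
  ultimately show "a [^] i \<otimes> s = s \<otimes> a [^] i" by auto
qed (use a b in auto)

text \<open>With k = 2q + 1 the twist reads ba = (ab) a^(2q), and a^(2q) is a power of the central
  square a^2. So the squares and the commutator of the generators are central.\<close>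

lemma metacyclic_order_le_4_center:
  assumes a: "a \<in> carrier G" and b: "b \<in> carrier G" and gen: "generate G {a, b} = carrier G"
    and fin: "finite (carrier G)"
    and ba: "b \<otimes> a = a [^] (k::nat) \<otimes> b" and k: "odd k" "a [^] (2 * k) = a [^] (2::nat)" and b2: "b \<otimes> b \<in> group_center G"
  shows "order G \<le> 4 * card (group_center G)"
proof -
  have a2: "a [^] (2::nat) \<in> group_center G"
    using metacyclic_center[OF a b gen ba, of 2] k(2) by (simp add: mult.commute)
  obtain q where q: "k = Suc (2 * q)" using k(1) by (auto elim: oddE)
  have c: "a [^] (2 * q) \<in> group_center G"
  proof -
    have "a [^] (2 * q) = (a [^] (2::nat)) [^] q" using a by (simp add: nat_pow_pow)
    also have "\<dots> \<in> group_center G"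
      using a2 by (rule subgroup_nat_pow_closed[OF center_subgroup])
    finally show ?thesis .
  qed
  have "b \<otimes> a = a \<otimes> a [^] (2 * q) \<otimes> b" unfolding ba q using nat_pow_Suc2[OF a] by simp
  also have "\<dots> = (a \<otimes> b) \<otimes> a [^] (2 * q)" using center_commute[OF c b] a b by (simp add: m_assoc)
  finally show ?thesis
    using a b a2 b2 gen c by (intro order_le_4_center[OF fin gen, of a b "a [^] (2 * q)"]) (auto simp: numeral_2_eq_2)
qed

end

lemma two_gens_satisfies:
  assumes "group G"
  shows "satisfies G f R \<longleftrightarrow> f A2 \<in> carrier G \<and> f B2 \<in> carrier G \<and> generate G {f A2, f B2} = carrier G \<and>
     (\<forall>(u, v) \<in> R. word_val G f u = word_val G f v)"
  unfolding satisfies_def range_two_gens by auto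

lemma three_gens_satisfies:
  assumes "group G"
  shows "satisfies G f R \<longleftrightarrow> f A3 \<in> carrier G \<and> f B3 \<in> carrier G \<and> f C3 \<in> carrier G \<and>
     generate G {f A3, f B3, f C3} = carrier G \<and> (\<forall>(u, v) \<in> R. word_val G f u = word_val G f v)"
  unfolding satisfies_def range_three_gens by auto

text \<open>The relation sets get names of their own so that \<open>satisfies G f R\<close> can
  refer to them for arbitrary groups \<open>G\<close>; \<open>presented_defs\<close> links them with
  the groups of the classification.\<close>

definition dihedral_rels :: "nat \<Rightarrow> (two_gens word \<times> two_gens word) set" where
  "dihedral_rels n = (let x = gen A2; y = gen B2
      in {(wpow y n, []), (wpow x 2, []), (x @ y @ winv x, winv y)})"

definition dicyclic_rels :: "nat \<Rightarrow> (two_gens word \<times> two_gens word) set" where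
  "dicyclic_rels n = (let x = gen A2; y = gen B2
      in {(wpow y (2 * n), []), (wpow x 2, wpow y n), (x @ y @ winv x, winv y)})"

definition Sz_2_rels :: "(two_gens word \<times> two_gens word) set" where
  "Sz_2_rels = (let a = gen A2; b = gen B2
      in {(wpow a 5, []), (wpow b 4, []), (b @ a @ winv b, wpow a 2)})"

definition SL_2_3_rels :: "(three_gens word \<times> three_gens word) set" where
  "SL_2_3_rels = (let a = gen A3; b = gen B3; c = gen C3
      in {(wpow a 3, wpow b 3), (wpow b 3, wpow c 2), (wpow c 2, a @ b @ c)})"

definition SG_16_3_rels :: "(two_gens word \<times> two_gens word) set" where
  "SG_16_3_rels = (let a = gen A2; b = gen B2
      in {(wpow a 4, []), (wpow b 4, []), (a @ b, winv b @ winv a), (a @ winv b, b @ winv a)})"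

definition Z4_semidirect_Z4_rels :: "(two_gens word \<times> two_gens word) set" where
  "Z4_semidirect_Z4_rels = (let a = gen A2; b = gen B2
      in {(wpow a 4, []), (wpow b 4, []), (b @ a @ winv b, winv a)})"

definition D8_central_Z4_rels :: "(three_gens word \<times> three_gens word) set" where
  "D8_central_Z4_rels = (let a = gen A3; b = gen B3; c = gen C3
      in {(wpow a 4, []), (wpow b 2, []), (wpow c 2, []),
            (a @ b, b @ a), (a @ c, c @ a), (b @ c, wpow a 2 @ c @ b)})"

definition M_16_rels :: "(two_gens word \<times> two_gens word) set" where
  "M_16_rels = (let a = gen A2; b = gen B2
      in {(wpow a 8, []), (wpow b 2, []), (b @ a @ b, wpow a 5)})"

lemma presented_defs:
  "dihedral_group n = presented_group (dihedral_rels n)"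
  "dicyclic_group n = presented_group (dicyclic_rels n)"
  "Sz_2 = presented_group Sz_2_rels" "SL_2_3 = presented_group SL_2_3_rels"
  "SG_16_3 = presented_group SG_16_3_rels" "Z4_semidirect_Z4 = presented_group Z4_semidirect_Z4_rels"
  "D8_central_Z4 = presented_group D8_central_Z4_rels" "M_16 = presented_group M_16_rels"
  by (simp_all add: dihedral_group_def dihedral_rels_def dicyclic_group_def dicyclic_rels_def
    Sz_2_def Sz_2_rels_def SL_2_3_def SL_2_3_rels_def SG_16_3_def SG_16_3_rels_def Z4_semidirect_Z4_def
    Z4_semidirect_Z4_rels_def D8_central_Z4_def D8_central_Z4_rels_def M_16_def M_16_rels_def Let_def)

context group
begin

lemma word_val_simps2:
  "f A2 \<in> carrier G \<Longrightarrow> f B2 \<in> carrier G \<Longrightarrow> range f \<subseteq> carrier G"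
  by (auto simp: range_two_gens)

lemma word_val_simps3:
  "f A3 \<in> carrier G \<Longrightarrow> f B3 \<in> carrier G \<Longrightarrow> f C3 \<in> carrier G \<Longrightarrow> range f \<subseteq> carrier G"
  by (auto simp: range_three_gens)

lemma satisfies_rels:
  fixes f :: "two_gens \<Rightarrow> 'a"
  defines "a \<equiv> f A2" and "b \<equiv> f B2"
  shows "satisfies G f (dihedral_rels n) \<longleftrightarrow> a \<in> carrier G \<and> b \<in> carrier G \<and> generate G {a, b} = carrier G \<and>
      b [^] n = \<one> \<and> a [^] (2::nat) = \<one> \<and> a \<otimes> (b \<otimes> inv a) = inv b"
    "satisfies G f (dicyclic_rels n) \<longleftrightarrow> a \<in> carrier G \<and> b \<in> carrier G \<and> generate G {a, b} = carrier G \<and>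
      b [^] (2 * n) = \<one> \<and> a [^] (2::nat) = b [^] n \<and> a \<otimes> (b \<otimes> inv a) = inv b"
    "satisfies G f Sz_2_rels \<longleftrightarrow> a \<in> carrier G \<and> b \<in> carrier G \<and> generate G {a, b} = carrier G \<and>
      a [^] (5::nat) = \<one> \<and> b [^] (4::nat) = \<one> \<and> b \<otimes> (a \<otimes> inv b) = a [^] (2::nat)"
    "satisfies G f SG_16_3_rels \<longleftrightarrow> a \<in> carrier G \<and> b \<in> carrier G \<and> generate G {a, b} = carrier G \<and>
      a [^] (4::nat) = \<one> \<and> b [^] (4::nat) = \<one> \<and> a \<otimes> b = inv b \<otimes> inv a \<and> a \<otimes> inv b = b \<otimes> inv a"
    "satisfies G f Z4_semidirect_Z4_rels \<longleftrightarrow> a \<in> carrier G \<and> b \<in> carrier G \<and> generate G {a, b} = carrier G \<and>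
      a [^] (4::nat) = \<one> \<and> b [^] (4::nat) = \<one> \<and> b \<otimes> (a \<otimes> inv b) = inv a"
    "satisfies G f M_16_rels \<longleftrightarrow> a \<in> carrier G \<and> b \<in> carrier G \<and> generate G {a, b} = carrier G \<and>
      a [^] (8::nat) = \<one> \<and> b [^] (2::nat) = \<one> \<and> b \<otimes> (a \<otimes> b) = a [^] (5::nat)"
  unfolding two_gens_satisfies[OF is_group] a_def b_def
    dihedral_rels_def dicyclic_rels_def Sz_2_rels_def SG_16_3_rels_def Z4_semidirect_Z4_rels_def M_16_rels_def Let_def
  by (auto simp: word_val_simps word_val_simps2)

lemma satisfies_rels3:
  fixes f :: "three_gens \<Rightarrow> 'a"
  defines "a \<equiv> f A3" and "b \<equiv> f B3" and "c \<equiv> f C3"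
  shows "satisfies G f SL_2_3_rels \<longleftrightarrow> a \<in> carrier G \<and> b \<in> carrier G \<and> c \<in> carrier G \<and>
      generate G {a, b, c} = carrier G \<and>
      a [^] (3::nat) = b [^] (3::nat) \<and> b [^] (3::nat) = c [^] (2::nat) \<and> c [^] (2::nat) = a \<otimes> (b \<otimes> c)"
    "satisfies G f D8_central_Z4_rels \<longleftrightarrow> a \<in> carrier G \<and> b \<in> carrier G \<and> c \<in> carrier G \<and>
      generate G {a, b, c} = carrier G \<and>
      a [^] (4::nat) = \<one> \<and> b [^] (2::nat) = \<one> \<and> c [^] (2::nat) = \<one> \<and> a \<otimes> b = b \<otimes> a \<and> a \<otimes> c = c \<otimes> a \<and>
      b \<otimes> c = a [^] (2::nat) \<otimes> (c \<otimes> b)"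
  unfolding three_gens_satisfies[OF is_group] a_def b_def c_def SL_2_3_rels_def D8_central_Z4_rels_def Let_def
  by (auto simp: word_val_simps word_val_simps3)

section \<open>Consequences of the defining relations\<close>

lemma dihedral_metacyclic:
  assumes "a \<in> carrier G" "b \<in> carrier G" "b [^] (n::nat) = \<one>" "n > 0" "a \<otimes> (b \<otimes> inv a) = inv b"
  shows "a \<otimes> b = b [^] (n - 1) \<otimes> a"
  using conj_eq_twist[of b a "inv b"] inv_eq_pow[of b n] assms by (simp add: m_assoc)

lemma dihedral_order:
  assumes "satisfies G f (dihedral_rels n)" "n > 0"
  shows "finite (carrier G)" "order G \<le> 2 * n"
proof -
  note s = assms(1)[unfolded satisfies_rels]
  have g: "generate G {f B2, f A2} = carrier G" using s by (simp add: insert_commute)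
  have "f A2 [^] (2::nat) = f B2 [^] (0::nat)" using s by simp
  from metacyclic_carrier(2,3)[OF _ _ g _ assms(2) dihedral_metacyclic[OF _ _ _ assms(2)] this] s
  show "finite (carrier G)" "order G \<le> 2 * n" by auto
qed

lemma dicyclic_order:
  assumes "satisfies G f (dicyclic_rels n)" "n > 0"
  shows "finite (carrier G)" "order G \<le> 4 * n"
proof -
  note s = assms(1)[unfolded satisfies_rels]
  have g: "generate G {f B2, f A2} = carrier G" using s by (simp add: insert_commute)
  have n2: "2 * n > 0" using assms(2) by simp
  have "f A2 [^] (2::nat) = f B2 [^] n" using s by simp
  from metacyclic_carrier(2,3)[OF _ _ g _ n2 dihedral_metacyclic[OF _ _ _ n2] this] s
  show "finite (carrier G)" "order G \<le> 4 * n" by auto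
qed

text \<open>The square of \<open>f B2\<close> is central, the square of \<open>f A2\<close> is
  trivial or equal to it, and inversion of \<open>f B2\<close> is the twist by the odd exponent 3.
  The bound is meant for the direct products with Z_2, where the order may reach 16 and the center
  has to grow with it.\<close>

lemma dihedral_4_dicyclic_2_center:
  assumes "satisfies G f (dihedral_rels 4) \<or> satisfies G f (dicyclic_rels 2)"
  shows "order G \<le> 4 * card (group_center G)"
proof -
  have fin: "finite (carrier G)" using assms dihedral_order(1)[of f 4] dicyclic_order(1)[of f 2] by auto
  have c: "f A2 \<in> carrier G" "f B2 \<in> carrier G" and g: "generate G {f B2, f A2} = carrier G"
    and b4: "f B2 [^] (4::nat) = \<one>" and r: "f A2 [^] (2::nat) = \<one> \<or> f A2 [^] (2::nat) = f B2 [^] (2::nat)"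
    and i: "f A2 \<otimes> (f B2 \<otimes> inv f A2) = inv f B2"
    using assms unfolding satisfies_rels by (auto simp: insert_commute)
  have t: "f A2 \<otimes> f B2 = f B2 [^] (3::nat) \<otimes> f A2" using dihedral_metacyclic[OF c b4 _ i] by simp
  have "f B2 [^] (6::nat) = f B2 [^] (2::nat)" using pow_mod_exponent[OF c(2) b4, of 6] by simp
  moreover from this have "f B2 [^] (2::nat) \<in> group_center G" using metacyclic_center[OF c(2,1) g t, of 2] by simp
  then have "f A2 \<otimes> f A2 \<in> group_center G"
    using r subgroup.one_closed[OF center_subgroup] c by (auto simp: numeral_2_eq_2)
  ultimately show ?thesis using metacyclic_order_le_4_center[OF c(2,1) g fin t] by simp
qed

text \<open>If a^3 = 1, the group has collapsed to order at most 6. Otherwise a^3 is a second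
  central element, because 15 = 3 modulo 6, and 2(2 + 4) = 12.\<close>

lemma order_12_planar:
  assumes a: "a \<in> carrier G" and b: "b \<in> carrier G" and gen: "generate G {a, b} = carrier G"
    and a6: "a [^] (6::nat) = \<one>" and ba: "b \<otimes> a = a [^] (5::nat) \<otimes> b" and b2: "b [^] (2::nat) = a [^] (r::nat)"
  shows "planar (commuting_graph G)"
proof -
  have fin: "finite (carrier G)" and ord: "order G \<le> 12"
    using metacyclic_carrier[OF a b gen a6 _ ba b2] by auto
  show ?thesis
  proof (rule planar_order_bound[OF fin])
    show "order G \<le> 2 * (card (group_center G) + 4)"
    proof (cases "a [^] (3::nat) = \<one>")
      case True
      have "order G \<le> 6" using metacyclic_carrier(3)[OF a b gen True _ ba b2] by simp
      then show ?thesis by simp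
    next
      case False
      have "a [^] (15::nat) = a [^] (3::nat)" using pow_mod_exponent[OF a a6, of 15] by simp
      then have "{\<one>, a [^] (3::nat)} \<subseteq> group_center G"
        using metacyclic_center[OF a b gen ba, of 3] subgroup.one_closed[OF center_subgroup] by simp
      moreover have "finite (group_center G)" by (rule finite_subset[OF _ fin]) (use center_carrier in blast)
      ultimately have "card {\<one>, a [^] (3::nat)} \<le> card (group_center G)" by (simp add: card_mono)
      then show ?thesis using False ord by simp
    qed
  qed
qed

lemma Sz_2_order:
  assumes "satisfies G f Sz_2_rels"
  shows "finite (carrier G)" "order G \<le> 20"
    "carrier G = (\<lambda>(i, j). f A2 [^] i \<otimes> f B2 [^] j) ` ({..<5::nat} \<times> {..<4::nat})"
    "f B2 \<otimes> f A2 = f A2 [^] (2::nat) \<otimes> f B2"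
proof -
  note s = assms[unfolded satisfies_rels]
  show t: "f B2 \<otimes> f A2 = f A2 [^] (2::nat) \<otimes> f B2" using s by (intro conj_eq_twist) (auto simp: m_assoc)
  have "f B2 [^] (4::nat) = f A2 [^] (0::nat)" using s by simp
  from metacyclic_carrier[OF _ _ _ _ _ t this, of 5] s
  show "finite (carrier G)" "order G \<le> 20"
    "carrier G = (\<lambda>(i, j). f A2 [^] i \<otimes> f B2 [^] j) ` ({..<5::nat} \<times> {..<4::nat})" by auto
qed

text \<open>Suppose that C(x) has at least 6 elements. The products a^i c with i < 4 and c in C(x)
  number at least 24, too many to be distinct in a group of order at most 20. So a power a^d with 0
  < d < 4, and with it \<open>a\<close>, commutes with \<open>x\<close>. As \<open>b\<close> acts on
  the powers of \<open>a\<close> by squaring, C(a) consists of powers of \<open>a\<close>; hence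
  \<open>x\<close> is such a power, and so is every element of C(x), which leaves at most 5
  elements.\<close>

lemma Sz_2_planar:
  assumes "satisfies G f Sz_2_rels"
  shows "planar (commuting_graph G)"
proof (rule planar_commuting_graph[OF Sz_2_order(1)[OF assms]])
  fix x assume x: "x \<in> carrier G" "x \<notin> group_center G"
  define a b where "a = f A2" and "b = f B2"
  note s = assms[unfolded satisfies_rels, folded a_def b_def]
  have fin: "finite (carrier G)" and ord: "order G \<le> 20"
    and car: "carrier G = (\<lambda>(i, j). a [^] i \<otimes> b [^] j) ` ({..<5::nat} \<times> {..<4::nat})"
    and ba: "b \<otimes> a = a [^] (2::nat) \<otimes> b"
    using Sz_2_order[OF assms, folded a_def b_def] by auto
  have a: "a \<in> carrier G" and b: "b \<in> carrier G" and gen: "generate G {a, b} = carrier G" and a5: "a [^] (5::nat) = \<one>"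
    and b4: "b [^] (4::nat) = \<one>" using s by auto
  \<comment> \<open>The exponents 1, 3, 2, 4 are the inverses of 1, 2, 3, 4 modulo 5.\<close>
  have root: "a = (a [^] d) [^] (if d = 1 then 1 else if d = 2 then 3 else if d = 3 then 2 else 4::nat)"
    if "d \<in> {1,2,3,4::nat}" for d
    using that pow_mod_exponent[OF a a5, of 6] pow_mod_exponent[OF a a5, of 16] a by (auto simp: nat_pow_pow)
  have root': "a \<in> H" if "d \<in> {1,2,3,4::nat}" "a [^] d \<in> H" "subgroup H G" for d H
    using root[OF that(1)] that(2,3) by (metis subgroup_nat_pow_closed)
  show "card (centralizer G x) \<le> card (group_center G) + 4"
  proof (rule ccontr)
    assume "\<not> ?thesis"
    then have c6: "card (centralizer G x) \<ge> 6" using card_center_pos[OF fin] by simp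
    note sub = centralizer_subgroup[OF x(1)]
    have finC: "finite (centralizer G x)" using fin by (auto simp: centralizer_def)
    have aC: "a \<in> centralizer G x"
    proof -
      have "\<not> inj_on (\<lambda>(i, c). a [^] i \<otimes> c) ({..<4::nat} \<times> centralizer G x)"
      proof
        assume inj: "inj_on (\<lambda>(i, c). a [^] i \<otimes> c) ({..<4::nat} \<times> centralizer G x)"
        have "card ({..<4::nat} \<times> centralizer G x) \<le> card (carrier G)"
          using inj fin a by (intro card_inj_on_le) (auto simp: centralizer_def)
        then show False using c6 ord by (simp add: order_def card_cartesian_product)
      qed
      then obtain i j c d where ij: "i < 4" "j < (4::nat)" "c \<in> centralizer G x" "d \<in> centralizer G x"
        "a [^] i \<otimes> c = a [^] j \<otimes> d" "(i, c) \<noteq> (j, d)" unfolding inj_on_def by auto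
      have key: "a [^] (j - i) \<in> centralizer G x" if "i < j" "a [^] i \<otimes> c = a [^] j \<otimes> d"
        "c \<in> centralizer G x" "d \<in> centralizer G x" for i j :: nat and c d
      proof -
        have cd: "c \<in> carrier G" "d \<in> carrier G" using that by (auto simp: centralizer_def)
        have "a [^] i \<otimes> c = a [^] i \<otimes> (a [^] (j - i) \<otimes> d)"
          using that(1,2) a cd by (simp add: m_assoc[symmetric] nat_pow_mult)
        then have "c = a [^] (j - i) \<otimes> d" using a cd by simp
        then have "c \<otimes> inv d = a [^] (j - i)" using a cd by (simp add: m_assoc)
        then show ?thesis using that sub by (metis subgroup.m_closed subgroup.m_inv_closed)
      qed
      have "i \<noteq> j"
      proof
        assume "i = j"
        moreover from this have "c = d" using ij a by (auto simp: centralizer_def)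
        ultimately show False using ij by simp
      qed
      then consider "i < j" | "j < i" by linarith
      then show ?thesis
      proof cases
        case 1 then show ?thesis using key[OF 1 ij(5,3,4)] ij(1,2) by (intro root'[OF _ _ sub, of "j - i"]) auto
      next
        case 2 then show ?thesis using key[OF 2 ij(5)[symmetric] ij(4,3)] ij(1,2) by (intro root'[OF _ _ sub, of "i - j"]) auto
      qed
    qed
    have bj: "b [^] j \<otimes> a = a [^] ((2::nat) ^ j) \<otimes> b [^] j" for j :: nat
    proof (induction j)
      case (Suc j)
      have "b [^] Suc j \<otimes> a = b \<otimes> (b [^] j \<otimes> a)" using nat_pow_Suc2[OF b] a b by (simp add: m_assoc)
      also have "\<dots> = b \<otimes> a [^] ((2::nat) ^ j) \<otimes> b [^] j" unfolding Suc using a b by (simp add: m_assoc)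
      also have "\<dots> = a [^] ((2::nat) ^ Suc j) \<otimes> (b \<otimes> b [^] j)"
        unfolding twisted_pow[OF a b ba] using a b by (simp add: m_assoc)
      finally show ?case using nat_pow_Suc2[OF b] by simp
    qed (use a in simp)
    have Ca: "\<exists>i<5. y = a [^] (i::nat)" if y: "y \<in> carrier G" "a \<otimes> y = y \<otimes> a" for y
    proof -
      obtain i j :: nat where ij: "y = a [^] i \<otimes> b [^] j" "i < 5" "j < 4" using y(1) unfolding car by auto
      have "a [^] i \<otimes> (a \<otimes> b [^] j) = (a [^] i \<otimes> a) \<otimes> b [^] j" using a b by (simp add: m_assoc)
      also have "\<dots> = (a \<otimes> a [^] i) \<otimes> b [^] j" using nat_pow_Suc2[OF a, of i] by simp
      also have "\<dots> = a \<otimes> y" using a b ij(1) by (simp add: m_assoc)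
      also have "\<dots> = a [^] i \<otimes> (b [^] j \<otimes> a)" using y(2) ij(1) a b by (simp add: m_assoc)
      finally have "a \<otimes> b [^] j = b [^] j \<otimes> a" using a b by simp
      then have p: "a [^] (1::nat) = a [^] ((2::nat) ^ j)" unfolding bj using a b by simp
      \<comment> \<open>If \<open>a\<close> were trivial, every element would be a power of
        \<open>b\<close> and the group abelian, contrary to the noncentral \<open>x\<close>.\<close>
      have "a \<noteq> \<one>"
      proof
        assume a1: "a = \<one>"
        have pb: "b [^] m \<otimes> b [^] n = b [^] n \<otimes> b [^] m" for m n :: nat
          using b by (simp add: nat_pow_mult add.commute)
        have "\<exists>n::nat. y = b [^] n" if "y \<in> carrier G" for y using that unfolding car a1 using b by auto
        then have "x \<in> group_center G" using x(1) pb unfolding group_center_def by auto metis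
        then show False using x(2) by simp
      qed
      \<comment> \<open>For 0 < j < 4 the number 2^j - 1 is 1, 3 or 7, none of them divisible by 5,
        so a^(2^j) = a forces \<open>a\<close> to be trivial.\<close>
      moreover have "a [^] (1::nat) = \<one>" if "j \<noteq> 0"
      proof -
        have "j \<in> {1,2,3}" using that ij(3) by auto
        then have "(2::nat) ^ j \<in> {2,4,8}" by auto
        then have "a [^] (2::nat) = a \<or> a [^] (4::nat) = a \<or> a [^] (8::nat) = a" using p a by auto
        moreover have "a [^] (8::nat) = a [^] (3::nat)" using pow_mod_exponent[OF a a5, of 8] by simp
        moreover have k: "a = \<one>" if "a [^] (n + 1) = a" "n \<in> {1,2,3::nat}" for n
        proof -
          have "a [^] n \<otimes> a = \<one> \<otimes> a" using that a by simp
          then have an: "a [^] n = \<one>" using a by simp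
          have "n \<in> {1,2,3,4}" using that by auto
          from root[OF this] an show ?thesis by simp
        qed
        moreover have "1 + 1 = (2::nat)" "2 + 1 = (3::nat)" "3 + 1 = (4::nat)" by simp_all
        ultimately have "a = \<one>" by (metis insertCI)
        then show ?thesis by simp
      qed
      ultimately have "j = 0" using a by auto
      then show ?thesis using ij a by auto
    qed
    have "a \<otimes> x = x \<otimes> a" using aC by (simp add: centralizer_def)
    then obtain i where i: "i < 5" "x = a [^] (i::nat)" using Ca[OF x(1)] by auto
    have "i \<noteq> 0" using x(2) i(2) subgroup.one_closed[OF center_subgroup] by (intro notI) simp
    have "centralizer G x \<subseteq> (\<lambda>i. a [^] i) ` {..<5::nat}"
    proof
      fix y assume y: "y \<in> centralizer G x"
      then have yc: "y \<in> carrier G" by (simp add: centralizer_def)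
      have "x \<in> centralizer G y" using y x(1) by (simp add: centralizer_def)
      then have "a \<in> centralizer G y"
        using i \<open>i \<noteq> 0\<close> by (intro root'[OF _ _ centralizer_subgroup[OF yc], of i]) auto
      then show "y \<in> (\<lambda>i. a [^] i) ` {..<5::nat}" using Ca[OF yc] by (auto simp: centralizer_def)
    qed
    then have "card (centralizer G x) \<le> card ((\<lambda>i. a [^] i) ` {..<5::nat})" by (intro card_mono) auto
    also have "\<dots> \<le> 5" using card_image_le[of "{..<5::nat}" "\<lambda>i. a [^] i"] by simp
    finally show False using c6 by simp
  qed
qed

lemma Z4_semidirect_Z4_order:
  assumes "satisfies G f Z4_semidirect_Z4_rels"
  shows "finite (carrier G)" "order G \<le> 16" "order G \<le> 4 * card (group_center G)"
proof -
  define a b where "a = f A2" and "b = f B2"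
  have a: "a \<in> carrier G" and b: "b \<in> carrier G" and gen: "generate G {a, b} = carrier G" and a4: "a [^] (4::nat) = \<one>"
    and b4: "b [^] (4::nat) = a [^] (0::nat)" and bab: "b \<otimes> (a \<otimes> inv b) = inv a"
    using assms unfolding satisfies_rels a_def b_def by auto
  have ba: "b \<otimes> a = a [^] (3::nat) \<otimes> b" using dihedral_metacyclic[OF b a a4 _ bab] by simp
  show fin: "finite (carrier G)" "order G \<le> 16" using metacyclic_carrier(2,3)[OF a b gen a4 _ ba b4] by auto
  have a6: "a [^] (6::nat) = a [^] (2::nat)" and a9: "a [^] (9::nat) = a"
    using pow_mod_exponent[OF a a4, of 6] pow_mod_exponent[OF a a4, of 9] a by simp_all
  have "b \<otimes> b \<in> group_center G"
  proof (rule center_generators[OF gen])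
    have "b \<otimes> b \<otimes> a = (b \<otimes> a [^] (3::nat)) \<otimes> b" using ba a b by (simp add: m_assoc)
    also have "\<dots> = a \<otimes> (b \<otimes> b)" using twisted_pow[OF a b ba, of 3] a9 a b by (simp add: m_assoc)
    finally show "b \<otimes> b \<otimes> s = s \<otimes> (b \<otimes> b)" if "s \<in> {a, b}" for s using that b by (auto simp: m_assoc)
  qed (use a b in auto)
  then show "order G \<le> 4 * card (group_center G)"
    using metacyclic_order_le_4_center[OF a b gen fin(1) ba] a6 by simp
qed

lemma M_16_order:
  assumes "satisfies G f M_16_rels"
  shows "finite (carrier G)" "order G \<le> 16" "order G \<le> 4 * card (group_center G)"
proof -
  define a b where "a = f A2" and "b = f B2"
  have a: "a \<in> carrier G" and b: "b \<in> carrier G" and gen: "generate G {a, b} = carrier G" and a8: "a [^] (8::nat) = \<one>"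
    and b2: "b [^] (2::nat) = a [^] (0::nat)" and bab: "b \<otimes> (a \<otimes> b) = a [^] (5::nat)"
    using assms unfolding satisfies_rels a_def b_def by auto
  have bb: "b \<otimes> b = \<one>" using b2 b by (simp add: numeral_2_eq_2)
  have "b \<otimes> a = (b \<otimes> (a \<otimes> b)) \<otimes> b" using a b bb by (simp add: m_assoc)
  then have ba: "b \<otimes> a = a [^] (5::nat) \<otimes> b" unfolding bab .
  show fin: "finite (carrier G)" "order G \<le> 16" using metacyclic_carrier(2,3)[OF a b gen a8 _ ba b2] by auto
  have "a [^] (10::nat) = a [^] (2::nat)" using pow_mod_exponent[OF a a8, of 10] by simp
  then show "order G \<le> 4 * card (group_center G)"
    using metacyclic_order_le_4_center[OF a b gen fin(1) ba] bb subgroup.one_closed[OF center_subgroup] by simp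
qed

text \<open>The relations turn a(ab) into a b^-1 a^-1 and then into b a^-2, and a^-2 = a^2. The
  lemma is also applied with the generators exchanged.\<close>

lemma SG_16_3_square:
  assumes a: "a \<in> carrier G" and b: "b \<in> carrier G" and a4: "a [^] (4::nat) = \<one>"
    and r1: "a \<otimes> b = inv b \<otimes> inv a" and r2: "a \<otimes> inv b = b \<otimes> inv a"
  shows "(a \<otimes> a) \<otimes> b = b \<otimes> (a \<otimes> a)"
proof -
  have "(a \<otimes> a) \<otimes> b = a \<otimes> (inv b \<otimes> inv a)" using a b r1 by (simp add: m_assoc)
  also have "\<dots> = b \<otimes> inv a \<otimes> inv a" using a b r2 by (simp add: m_assoc[symmetric])
  also have "inv a = a [^] (3::nat)" using inv_eq_pow[OF a a4] by simp
  also have "b \<otimes> a [^] (3::nat) \<otimes> a [^] (3::nat) = b \<otimes> a [^] (6::nat)" using a b by (simp add: m_assoc nat_pow_mult)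
  also have "a [^] (6::nat) = a \<otimes> a" using pow_mod_exponent[OF a a4, of 6] a by (simp add: numeral_2_eq_2)
  finally show ?thesis .
qed

lemma four_pow: "x \<in> carrier G \<Longrightarrow> x [^] (4::nat) = (x \<otimes> x) \<otimes> (x \<otimes> x)"
  by (simp add: numeral_eq_Suc m_assoc)

lemma SG_16_3_order:
  assumes "satisfies G f SG_16_3_rels"
  shows "finite (carrier G)" "order G \<le> 16" "order G \<le> 4 * card (group_center G)"
proof -
  define a b where "a = f A2" and "b = f B2"
  have a: "a \<in> carrier G" and b: "b \<in> carrier G" and gen: "generate G {a, b} = carrier G" and a4: "a [^] (4::nat) = \<one>"
    and b4: "b [^] (4::nat) = \<one>" and r1: "a \<otimes> b = inv b \<otimes> inv a" and r2: "a \<otimes> inv b = b \<otimes> inv a"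
    using assms unfolding satisfies_rels a_def b_def by auto
  have ba: "b \<otimes> a = inv a \<otimes> inv b"
  proof -
    have "inv (a \<otimes> b) = inv (inv b \<otimes> inv a)" using r1 by simp
    then have "inv b \<otimes> inv a = a \<otimes> b" using a b by (simp add: inv_mult_group)
    then have "b \<otimes> (a \<otimes> b) = inv a" using a b by (metis inv_closed inv_mult_cancel(2))
    then have "b \<otimes> (a \<otimes> b) \<otimes> inv b = inv a \<otimes> inv b" by simp
    then show ?thesis using a b by (simp add: m_assoc)
  qed
  define A B where "A = a \<otimes> a" and "B = b \<otimes> b"
  have A: "A \<in> group_center G" unfolding A_def
    using SG_16_3_square[OF a b a4 r1 r2] a b by (intro center_generators[OF gen]) (auto simp: m_assoc)
  have B: "B \<in> group_center G" unfolding B_def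
    using SG_16_3_square[OF b a b4 ba r2[symmetric]] a b by (intro center_generators[OF gen]) (auto simp: m_assoc)
  have c: "A \<in> carrier G" "B \<in> carrier G" and AA: "A \<otimes> A = \<one>" "B \<otimes> B = \<one>" and AB: "B \<otimes> A = A \<otimes> B"
    using A B a b a4 b4 center_carrier center_commute unfolding A_def B_def by (auto simp: four_pow)
  have ba': "b \<otimes> a = (a \<otimes> b) \<otimes> (A \<otimes> B)"
  proof -
    have "inv a = a \<otimes> A" using AA(1) a c by (intro inv_equality) (auto simp: A_def m_assoc)
    moreover have "inv b = b \<otimes> B" using AA(2) b c by (intro inv_equality) (auto simp: B_def m_assoc)
    ultimately have "b \<otimes> a = a \<otimes> (A \<otimes> b) \<otimes> B" using ba a b c by (simp add: m_assoc)
    also have "A \<otimes> b = b \<otimes> A" using center_commute[OF A b] .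
    finally show ?thesis using a b c by (simp add: m_assoc)
  qed
  \<comment> \<open>The squares \<open>A\<close>, \<open>B\<close> of the generators and their
    commutator \<open>A \<otimes> B\<close> lie in this central set, which is closed because its
    elements square to the identity.\<close>
  define W where "W = {\<one>, A, B, A \<otimes> B}"
  have WZ: "W \<subseteq> group_center G"
    using A B subgroup.one_closed[OF center_subgroup] subgroup.m_closed[OF center_subgroup] unfolding W_def by auto
  have x: "A \<otimes> (A \<otimes> B) = B" "B \<otimes> (A \<otimes> B) = A" "A \<otimes> B \<otimes> A = B" "A \<otimes> B \<otimes> B = A" "A \<otimes> B \<otimes> (A \<otimes> B) = \<one>"
  proof -
    show 1: "A \<otimes> (A \<otimes> B) = B" using c AA by (simp add: m_assoc[symmetric])
    show 2: "B \<otimes> (A \<otimes> B) = A" using c AA AB by (metis m_assoc r_one)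
    show "A \<otimes> B \<otimes> A = B" using c AA AB by (metis m_assoc l_one)
    show "A \<otimes> B \<otimes> B = A" using c AA by (simp add: m_assoc)
    show "A \<otimes> B \<otimes> (A \<otimes> B) = \<one>" using c AA 2 by (simp add: m_assoc)
  qed
  have Wm: "u \<otimes> v \<in> W" if "u \<in> W" "v \<in> W" for u v
    using that c AA AB x unfolding W_def by auto
  have "card W \<le> 4" unfolding W_def by (simp add: card_insert_if)
  moreover note o = order_le_4_central[of W, OF _ WZ _ Wm gen _ a b _ _ ba']
  have "finite (carrier G)" "order G \<le> 4 * card W"
    by (rule o; simp add: W_def flip: A_def B_def)+
  ultimately show fin: "finite (carrier G)" "order G \<le> 16" by auto
  show "order G \<le> 4 * card (group_center G)"
    using A B subgroup.m_closed[OF center_subgroup A B]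
    by (intro order_le_4_center[OF fin(1) gen _ a b _ _ ba']) (auto simp flip: A_def B_def)
qed

lemma D8_central_Z4_order:
  assumes "satisfies G f D8_central_Z4_rels"
  shows "finite (carrier G)" "order G \<le> 16" "order G \<le> 4 * card (group_center G)"
proof -
  define a b c where "a = f A3" and "b = f B3" and "c = f C3"
  have a: "a \<in> carrier G" and b: "b \<in> carrier G" and c: "c \<in> carrier G" and gen: "generate G {a, b, c} = carrier G"
    and a4: "a [^] (4::nat) = \<one>" and b2: "b [^] (2::nat) = \<one>" and c2: "c [^] (2::nat) = \<one>"
    and ab: "a \<otimes> b = b \<otimes> a" and ac: "a \<otimes> c = c \<otimes> a" and bc: "b \<otimes> c = a [^] (2::nat) \<otimes> (c \<otimes> b)"
    using assms unfolding satisfies_rels3 a_def b_def c_def by auto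
  have aZ: "a \<in> group_center G"
    using a b c ab ac by (intro center_generators[OF gen]) auto
  have pZ: "a [^] (i::nat) \<in> group_center G" for i
    using aZ by (induction i) (auto intro: subgroup.one_closed[OF center_subgroup] subgroup.m_closed[OF center_subgroup])
  have bb: "b \<otimes> b = \<one>" "c \<otimes> c = \<one>" using b2 c2 b c by (simp_all add: numeral_2_eq_2)
  have "a [^] (2::nat) \<otimes> (b \<otimes> c) = (a [^] (2::nat) \<otimes> a [^] (2::nat)) \<otimes> (c \<otimes> b)" using a b c bc by (simp add: m_assoc)
  then have "c \<otimes> b = a [^] (2::nat) \<otimes> (b \<otimes> c)" using a4 a b c by (simp add: nat_pow_mult)
  then have cb: "c \<otimes> b = (b \<otimes> c) \<otimes> a [^] (2::nat)" using center_commute[OF pZ[of 2], of "b \<otimes> c"] b c by simp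
  define W where "W = (\<lambda>i. a [^] i) ` {..<4::nat}"
  have mem: "a [^] (i::nat) \<in> W" for i
    unfolding W_def using pow_mod_exponent[OF a a4, of i] by (intro image_eqI[of _ _ "i mod 4"]) auto
  have W: "W \<subseteq> group_center G" "\<one> \<in> W" "a \<in> W"
    using pZ mem[of 0] mem[of 1] a unfolding W_def by auto
  have Wm: "u \<otimes> v \<in> W" if uv: "u \<in> W" "v \<in> W" for u v
  proof -
    obtain i j :: nat where "u = a [^] i" "v = a [^] j" using uv unfolding W_def by blast
    then show ?thesis using mem[of "i + j"] a by (simp add: nat_pow_mult)
  qed
  have fW: "finite W" "card W \<le> 4" unfolding W_def using card_image_le[of "{..<4::nat}"] by auto
  have "finite (carrier G)" "order G \<le> 4 * card W"
    using W bb mem by (intro order_le_4_central[of W, OF fW(1) W(1,2) Wm gen _ b c _ _ cb]; simp)+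
  then show fin: "finite (carrier G)" "order G \<le> 16" using fW by auto
  show "order G \<le> 4 * card (group_center G)"
    using W bb pZ subsetD[OF W(1,2)] aZ by (intro order_le_4_center[OF fin(1) gen _ b c _ _ cb]) auto
qed

end

lemma group_center_DirProd_superset:
  assumes "comm_group A" "group H"
  shows "carrier A \<times> group_center H \<subseteq> group_center (A \<times>\<times> H)"
proof -
  interpret A: comm_group A by fact
  show ?thesis by (auto simp: group_center_def A.m_comm)
qed

text \<open>The center of the product contains Z_2 times the center of \<open>H\<close>, so the
  order doubles and the center at least doubles, which leads to the criterion for order at most
  16.\<close>

lemma planar_Z2_DirProd:
  assumes "group H" "finite (carrier H)" "order H \<le> 8" "order H \<le> 4 * card (group_center H)"
  shows "planar (commuting_graph (integer_mod_group 2 \<times>\<times> H))"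
proof -
  let ?A = "integer_mod_group 2"
  have cA: "finite (carrier ?A)" "card (carrier ?A) = 2" by (simp_all add: carrier_integer_mod_group)
  interpret D: group "?A \<times>\<times> H" using assms(1) by (simp add: DirProd_group)
  have fin: "finite (carrier (?A \<times>\<times> H))" using cA assms(2) by simp
  have ord: "order (?A \<times>\<times> H) = 2 * order H" using cA by (simp add: order_def card_cartesian_product)
  have "group_center (?A \<times>\<times> H) \<subseteq> carrier (?A \<times>\<times> H)" by (auto simp: group_center_def)
  then have "card (carrier ?A \<times> group_center H) \<le> card (group_center (?A \<times>\<times> H))"
    using group_center_DirProd_superset[of ?A H] assms(1) fin finite_subset by (intro card_mono) auto
  then have "2 * card (group_center H) \<le> card (group_center (?A \<times>\<times> H))"
    using cA by (simp add: card_cartesian_product)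
  then show ?thesis using ord assms(3,4) by (intro D.planar_order_16[OF fin]) auto
qed

section \<open>The binary tetrahedral group\<close>

text \<open>\<open>c\<close>, \<open>d\<close>, \<open>e\<close> play the roles of the quaternions
  i, j, k and \<open>z\<close> that of -1; conjugation by \<open>a\<close> rotates them. The case
  \<open>z = \<one>\<close> is included, where the relations describe a quotient of A_4.\<close>

locale binary_tetrahedral = group G for G (structure) +
  fixes a c d e z
  assumes mem: "a \<in> carrier G" "c \<in> carrier G" "d \<in> carrier G" "e \<in> carrier G"
    and z: "z \<in> group_center G" and zz: "z \<otimes> z = \<one>" and a3: "a [^] (3::nat) = z"
    and ac: "a \<otimes> c = d \<otimes> a" and ad: "a \<otimes> d = e \<otimes> a" and ae: "a \<otimes> e = c \<otimes> a"
    and sq: "c \<otimes> c = z" "d \<otimes> d = z" "e \<otimes> e = z"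
    and prods: "c \<otimes> d = e" "d \<otimes> e = c" "e \<otimes> c = d" "d \<otimes> c = z \<otimes> e" "e \<otimes> d = z \<otimes> c" "c \<otimes> e = z \<otimes> d"
    and gen: "generate G {a, c} = carrier G"
begin

lemma z_mem: "z \<in> carrier G" using z center_carrier by blast

lemma z_comm: "g \<in> carrier G \<Longrightarrow> g \<otimes> z = z \<otimes> g" using z center_commute by simp

lemma gen_d: "generate G {a, d} = carrier G"
proof
  have sub: "subgroup (generate G {a, d}) G" using mem by (intro generate_is_subgroup) auto
  have A: "a \<in> generate G {a, d}" "d \<in> generate G {a, d}" by (auto intro: generate.incl)
  have "c = inv a \<otimes> (d \<otimes> a)" using ac mem by (metis inv_mult_cancel(1))
  then have "c \<in> generate G {a, d}" using A sub by (metis subgroup.m_closed subgroup.m_inv_closed)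
  then have "generate G {a, c} \<subseteq> generate G {a, d}" using A by (intro generate_subgroup_incl[OF _ sub]) auto
  then show "carrier G \<subseteq> generate G {a, d}" using gen by simp
  show "generate G {a, d} \<subseteq> carrier G" using sub by (rule subgroup.subset)
qed

text \<open>The cyclic symmetry lets every statement about \<open>c\<close> be used for
  \<open>d\<close> and \<open>e\<close>.\<close>

lemma rotate: "binary_tetrahedral G a d e c z"
  using mem z zz a3 ac ad ae sq prods gen_d by unfold_locales auto

lemma carrier_eq: "carrier G = (\<lambda>(h, q, k). h \<otimes> (q \<otimes> a [^] k)) ` ({\<one>, z} \<times> {\<one>, c, d, e} \<times> {..<3::nat})"
proof (rule generate_closed_eq[OF _ gen])
  let ?T = "(\<lambda>(h, q, k). h \<otimes> (q \<otimes> a [^] k)) ` ({\<one>, z} \<times> {\<one>, c, d, e} \<times> {..<3::nat})"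
  note m = mem z_mem
  have T: "h \<otimes> (q \<otimes> a [^] k) \<in> ?T" if "h \<in> {\<one>, z}" "q \<in> {\<one>, c, d, e}" "k < 3" for h q and k :: nat
    using that by (intro image_eqI[of _ _ "(h, q, k)"]) auto
  have T3: "h \<otimes> (q \<otimes> a [^] k) \<in> ?T" if "h \<in> {\<one>, z}" "q \<in> {\<one>, c, d, e}" "k \<le> 3" for h q and k :: nat
  proof (cases "k = 3")
    case True
    have "h \<otimes> (q \<otimes> a [^] k) = (h \<otimes> z) \<otimes> (q \<otimes> a [^] (0::nat))"
      using that m z_comm[of q] a3 True by (auto simp: m_assoc)
    moreover have "h \<otimes> z \<in> {\<one>, z}" using that zz m by auto
    ultimately show ?thesis using T[of "h \<otimes> z" q 0] that by simp
  qed (use T that in auto)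
  show "{a, c} \<subseteq> carrier G" "finite ?T" using mem by auto
  show "?T \<subseteq> carrier G" using m by auto
  show "\<one> \<in> ?T" using T[of \<one> \<one> 0] by simp
  fix s t assume s: "s \<in> {a, c}" and "t \<in> ?T"
  then obtain h q and k :: nat where t: "t = h \<otimes> (q \<otimes> a [^] k)" "h \<in> {\<one>, z}" "q \<in> {\<one>, c, d, e}" "k < 3" by auto
  have hq: "h \<in> carrier G" "q \<in> carrier G" using t m by auto
  have hc: "g \<otimes> h = h \<otimes> g" if "g \<in> carrier G" for g using t(2) z_comm that by auto
  show "s \<otimes> t \<in> ?T"
  proof (cases "s = a")
    case True
    obtain q' where q': "a \<otimes> q = q' \<otimes> a" "q' \<in> {\<one>, c, d, e}" using t(3) ac ad ae mem by force
    have q'c: "q' \<in> carrier G" using q'(2) m by auto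
    have "s \<otimes> t = h \<otimes> ((a \<otimes> q) \<otimes> a [^] k)" unfolding True t(1) using hq mem hc[of a]
      by (simp add: m_assoc[symmetric])
    also have "\<dots> = h \<otimes> (q' \<otimes> a [^] Suc k)" unfolding q'(1) nat_pow_Suc2[OF mem(1)] using hq q'c mem by (simp add: m_assoc)
    finally show ?thesis using T3[OF t(2) q'(2), of "Suc k"] t(4) by simp
  next
    case False
    then have sc: "s = c" using s by simp
    obtain w q' where q': "c \<otimes> q = w \<otimes> q'" "w \<in> {\<one>, z}" "q' \<in> {\<one>, c, d, e}"
    proof -
      consider "q = \<one>" | "q = c" | "q = d" | "q = e" using t(3) by auto
      then show ?thesis
      proof cases
        case 1 then show ?thesis using that[of \<one> c] mem by simp
      next
        case 2 then show ?thesis using that[of z \<one>] m sq by simp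
      next
        case 3 then show ?thesis using that[of \<one> e] m prods by simp
      next
        case 4 then show ?thesis using that[of z d] m prods by simp
      qed
    qed
    have wc: "w \<in> carrier G" "q' \<in> carrier G" using q' m by auto
    have "s \<otimes> t = h \<otimes> ((c \<otimes> q) \<otimes> a [^] k)" unfolding sc t(1) using hq mem hc[of c]
      by (simp add: m_assoc[symmetric])
    also have "\<dots> = (h \<otimes> w) \<otimes> (q' \<otimes> a [^] k)" unfolding q'(1) using hq wc mem by (simp add: m_assoc)
    finally have "s \<otimes> t = (h \<otimes> w) \<otimes> (q' \<otimes> a [^] k)" .
    moreover have "h \<otimes> w \<in> {\<one>, z}" using t(2) q'(2) zz m by auto
    ultimately show ?thesis using T[OF _ q'(3) t(4)] by simp
  qed
qed

lemma finite_carrier: "finite (carrier G)"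
  unfolding carrier_eq by simp

lemma order_le: "order G \<le> card {\<one>, z} * 12"
proof -
  have "order G \<le> card ({\<one>, z} \<times> {\<one>, c, d, e} \<times> {..<3::nat})"
    unfolding order_def carrier_eq by (intro card_image_le) simp
  also have "\<dots> = card {\<one>, z} * (card {\<one>, c, d, e} * 3)" by (simp only: card_cartesian_product card_lessThan)
  also have "\<dots> \<le> card {\<one>, z} * 12"
    using card_insert_le_m1[of 4 "{c, d, e}" \<one>] by (intro mult_le_mono2) (simp add: card_insert_if)
  finally show ?thesis .
qed

text \<open>The element \<open>x\<close> serves as a witness that the group is not abelian. If c =
  d, the rotation gives e = c, and cd = e makes \<open>c\<close> trivial; but then \<open>a\<close>
  alone generates the group.\<close>

lemma c_ne_1:
  assumes "x \<in> carrier G" "x \<notin> group_center G"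
  shows "c \<noteq> d" "c \<noteq> e"
proof -
  have c1: "c \<noteq> \<one>"
  proof
    assume "c = \<one>"
    then have "c \<in> group_center G" using subgroup.one_closed[OF center_subgroup] by simp
    moreover have "a \<in> group_center G" using mem \<open>c = \<one>\<close> by (intro center_generators[OF gen]) auto
    ultimately have "generate G {a, c} \<subseteq> group_center G"
      by (intro generate_subgroup_incl center_subgroup) auto
    then show False using gen assms by auto
  qed
  show cd: "c \<noteq> d"
  proof
    assume "c = d"
    then have "e = c" using ac ad mem by (metis right_cancel)
    then have "c \<otimes> c = c" using prods(1) \<open>c = d\<close> by simp
    then show False using c1 mem by simp
  qed
  show "c \<noteq> e"
  proof
    assume "c = e"
    then have "c = d" using ac ae mem by (metis right_cancel)
    then show False using cd by simp
  qed
qed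

text \<open>In the normal form h q a^k, conjugation by a^k with k > 0 moves \<open>c\<close> to
  \<open>d\<close> or \<open>e\<close>. Commuting with \<open>c\<close> then requires c q = q r with
  \<open>r\<close> equal to \<open>d\<close> or \<open>e\<close>, and the quaternion products turn
  this into an equality of \<open>c\<close> with \<open>d\<close> or \<open>e\<close>.\<close>

lemma commute_c:
  assumes x: "x \<in> carrier G" "x \<notin> group_center G" and y: "y \<in> centralizer G c"
  obtains h q where "y = h \<otimes> q" "h \<in> {\<one>, z}" "q \<in> {\<one>, c, d, e}"
proof -
  note m = mem z_mem
  have yc: "y \<in> carrier G" "c \<otimes> y = y \<otimes> c" using y by (auto simp: centralizer_def)
  obtain h q and k :: nat where t: "y = h \<otimes> (q \<otimes> a [^] k)" "h \<in> {\<one>, z}" "q \<in> {\<one>, c, d, e}" "k < 3"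
    using yc(1) unfolding carrier_eq by auto
  have hq: "h \<in> carrier G" "q \<in> carrier G" using t m by auto
  have hc: "g \<otimes> h = h \<otimes> g" if "g \<in> carrier G" for g using t(2) z_comm that by auto
  have "h \<otimes> (c \<otimes> q \<otimes> a [^] k) = h \<otimes> (q \<otimes> (a [^] k \<otimes> c))"
  proof -
    have "h \<otimes> (c \<otimes> q \<otimes> a [^] k) = c \<otimes> y" unfolding t(1) using hq mem hc[of c] by (simp add: m_assoc[symmetric])
    also have "\<dots> = h \<otimes> (q \<otimes> (a [^] k \<otimes> c))" unfolding yc(2) unfolding t(1) using hq mem by (simp add: m_assoc)
    finally show ?thesis .
  qed
  then have key: "c \<otimes> q \<otimes> a [^] k = q \<otimes> (a [^] k \<otimes> c)" using hq mem by simp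
  have "k = 0"
  proof (rule ccontr)
    assume "k \<noteq> 0"
    then consider "k = 1" | "k = 2" using t(4) by linarith
    then obtain r where r: "r \<in> {d, e}" "c \<otimes> q = q \<otimes> r"
    proof cases
      case 1
      have "c \<otimes> q \<otimes> a = q \<otimes> d \<otimes> a" using key ac hq mem 1 by (simp add: m_assoc)
      then show ?thesis using that[of d] hq mem by simp
    next
      case 2
      have "a \<otimes> a \<otimes> c = e \<otimes> (a \<otimes> a)" using ac ad mem by (metis m_assoc)
      then have "c \<otimes> q \<otimes> (a \<otimes> a) = q \<otimes> e \<otimes> (a \<otimes> a)" using key hq mem 2 by (simp add: m_assoc numeral_2_eq_2)
      then show ?thesis using that[of e] hq mem by simp
    qed
    have "r \<in> carrier G" using r mem by auto
    have zc: "z \<otimes> u = z \<otimes> v \<longleftrightarrow> u = v" if "u \<in> carrier G" "v \<in> carrier G" for u v using that z_mem by simp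
    consider "q = \<one>" | "q = c" | "q = d" | "q = e" using t(3) by auto
    then have "c = r"
    proof cases
      case 3
      have "r = e \<Longrightarrow> c = e" using r(2) 3 prods by simp
      moreover have "r = d \<Longrightarrow> c = d" using r(2) 3 mem by simp
      ultimately show ?thesis using r(1) by auto
    next
      case 4
      have "r = e \<Longrightarrow> c = e" using r(2) 4 mem by simp
      moreover have "r = d \<Longrightarrow> z \<otimes> d = z \<otimes> c" using r(2) 4 prods by simp
      ultimately show ?thesis using r(1) zc mem by auto
    qed (use r mem in auto)
    then show False using r(1) c_ne_1[OF x] by auto
  qed
  then show ?thesis using that[of h q] t hq by simp
qed

text \<open>The candidates are those of \<open>commute_c\<close>. For trivial \<open>z\<close> these
  are four elements; otherwise \<open>d\<close> and \<open>e\<close> commute with \<open>c\<close>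
  only up to the factor \<open>z\<close> and drop out, which again leaves four.\<close>

lemma centralizer_c:
  assumes x: "x \<in> carrier G" "x \<notin> group_center G"
  shows "card (centralizer G c) \<le> 4"
proof (cases "z = \<one>")
  case True
  have "centralizer G c \<subseteq> {\<one>, c, d, e}"
    using commute_c[OF x] True mem by (auto elim!: commute_c[OF x])
  then have "card (centralizer G c) \<le> card {\<one>, c, d, e}" by (intro card_mono) auto
  also have "\<dots> \<le> 4" by (simp add: card_insert_if)
  finally show ?thesis .
next
  case False
  have "centralizer G c \<subseteq> {\<one>, c, z, z \<otimes> c}"
  proof
    fix y assume y: "y \<in> centralizer G c"
    obtain h q where t: "y = h \<otimes> q" "h \<in> {\<one>, z}" "q \<in> {\<one>, c, d, e}" using commute_c[OF x y] .
    have hq: "h \<in> carrier G" "q \<in> carrier G" using t mem z_mem by auto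
    have hc: "g \<otimes> h = h \<otimes> g" if "g \<in> carrier G" for g using t(2) z_comm that by auto
    have "h \<otimes> (c \<otimes> q) = c \<otimes> (h \<otimes> q)" using hc[of c] mem hq by (simp add: m_assoc[symmetric])
    also have "\<dots> = h \<otimes> (q \<otimes> c)" using y t(1) hq mem by (simp add: centralizer_def m_assoc)
    finally have cq: "c \<otimes> q = q \<otimes> c" using hq mem by simp
    have "q \<noteq> d"
    proof
      assume "q = d"
      then have "\<one> \<otimes> e = z \<otimes> e" using cq prods mem by simp
      then show False using False mem z_mem by (metis right_cancel one_closed)
    qed
    moreover have "q \<noteq> e"
    proof
      assume "q = e"
      then have "z \<otimes> d = \<one> \<otimes> d" using cq prods mem by simp
      then show False using False mem z_mem by (metis right_cancel one_closed)
    qed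
    ultimately have "q = \<one> \<or> q = c" using t(3) by auto
    then show "y \<in> {\<one>, c, z, z \<otimes> c}" using t mem z_mem by auto
  qed
  then have "card (centralizer G c) \<le> card {\<one>, c, z, z \<otimes> c}" by (intro card_mono) auto
  also have "\<dots> \<le> 4" by (simp add: card_insert_if)
  finally show ?thesis .
qed

lemma centralizer_central_mult:
  assumes "h \<in> group_center G" "q \<in> carrier G"
  shows "centralizer G (h \<otimes> q) = centralizer G q"
proof -
  have h: "h \<in> carrier G" using assms center_carrier by blast
  have "(h \<otimes> q) \<otimes> y = y \<otimes> (h \<otimes> q) \<longleftrightarrow> q \<otimes> y = y \<otimes> q" if "y \<in> carrier G" for y
  proof -
    have "y \<otimes> (h \<otimes> q) = h \<otimes> (y \<otimes> q)" using center_commute[OF assms(1) that] h assms that by (simp add: m_assoc[symmetric])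
    then show ?thesis using h assms that by (simp add: m_assoc)
  qed
  then show ?thesis by (auto simp: centralizer_def)
qed

text \<open>A noncentral element commuting with \<open>c\<close> is, up to a central factor, one of
  \<open>c\<close>, \<open>d\<close>, \<open>e\<close>, so it shares its centralizer with one of
  these.\<close>

lemma centralizer_of_commuting:
  assumes x: "x \<in> carrier G" "x \<notin> group_center G" and "c \<in> centralizer G x"
  shows "card (centralizer G x) \<le> 4"
proof -
  interpret r: binary_tetrahedral G a d e c z by (rule rotate)
  interpret rr: binary_tetrahedral G a e c d z by (rule r.rotate)
  have "x \<in> centralizer G c" using assms mem by (auto simp: centralizer_def)
  then obtain h q where hq: "x = h \<otimes> q" "h \<in> {\<one>, z}" "q \<in> {\<one>, c, d, e}" using commute_c[OF x] by metis
  have hZ: "h \<in> group_center G" using hq z subgroup.one_closed[OF center_subgroup] by auto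
  then have "q \<noteq> \<one>" using x hq(1) by (auto simp: center_carrier)
  then have "card (centralizer G q) \<le> 4"
    using hq(3) centralizer_c[OF x] r.centralizer_c[OF x] rr.centralizer_c[OF x] by auto
  then show ?thesis using centralizer_central_mult[OF hZ, of q] hq mem by auto
qed

text \<open>An \<open>x\<close> commuting with none of \<open>c\<close>, \<open>d\<close>,
  \<open>e\<close> has four different conjugates under \<open>\<one>\<close>, \<open>c\<close>,
  \<open>d\<close>, \<open>e\<close>. With m = |{1, z}| <= 2 and order at most 12 m, its centralizer
  has at most 3 m <= m + 4 elements, and m <= |Z|.\<close>

lemma planar: "planar (commuting_graph G)"
proof (rule planar_commuting_graph[OF finite_carrier])
  fix x assume x: "x \<in> carrier G" "x \<notin> group_center G"
  interpret r: binary_tetrahedral G a d e c z by (rule rotate)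
  interpret rr: binary_tetrahedral G a e c d z by (rule r.rotate)
  note m = mem z_mem
  note C = centralizer_subgroup[OF x(1)]
  show "card (centralizer G x) \<le> card (group_center G) + 4"
  proof (cases "c \<in> centralizer G x \<or> d \<in> centralizer G x \<or> e \<in> centralizer G x")
    case True
    then have "card (centralizer G x) \<le> 4"
      using centralizer_of_commuting[OF x] r.centralizer_of_commuting[OF x] rr.centralizer_of_commuting[OF x] by blast
    then show ?thesis by simp
  next
    case False
    define K where "K g = g \<otimes> x \<otimes> inv g" for g
    have zC: "z \<in> centralizer G x" using z center_subset_centralizer[OF x(1)] by blast
    have zq: "q \<in> centralizer G x" if "z \<otimes> q \<in> centralizer G x" "q \<in> carrier G" for q
    proof -
      have "z \<otimes> (z \<otimes> q) \<in> centralizer G x" using zC that subgroup.m_closed[OF C] by blast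
      then show ?thesis using zz that z_mem by (simp add: m_assoc[symmetric])
    qed
    have inv: "inv c = z \<otimes> c" "inv d = z \<otimes> d"
      using m sq zz by (auto intro!: inv_equality simp: m_assoc)
    have K: "K g = K h \<longleftrightarrow> inv g \<otimes> h \<in> centralizer G x" if "g \<in> carrier G" "h \<in> carrier G" for g h
      unfolding K_def using conj_eq_iff[OF x(1) that] .
    have p: "inv c \<otimes> d = z \<otimes> e" "inv c \<otimes> e = d" "inv d \<otimes> e = z \<otimes> c"
      unfolding inv using m prods zz by (simp_all add: m_assoc) (simp add: m_assoc[symmetric])
    have "card {K \<one>, K c, K d, K e} = 4"
      using K[of \<one> c] K[of \<one> d] K[of \<one> e] K[of c d] K[of c e] K[of d e] p False zq m by (auto simp: card_insert_if)
    moreover have "{K \<one>, K c, K d, K e} \<subseteq> conj_class G x"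
      unfolding K_def conj_class_def by (intro insert_subsetI empty_subsetI image_eqI[OF HOL.refl]) (use mem in auto)
    moreover have "finite (conj_class G x)" using finite_carrier by (simp add: conj_class_def)
    ultimately have "4 \<le> card (conj_class G x)" by (metis card_mono)
    then have "4 * card (centralizer G x) \<le> order G"
      using card_conj_class[OF finite_carrier x(1)] by (metis mult_le_mono1)
    also note order_le
    finally have 3: "card (centralizer G x) \<le> 3 * card {\<one>, z}" by simp
    have "finite (group_center G)" by (rule finite_subset[OF _ finite_carrier]) (use center_carrier in blast)
    then have "card {\<one>, z} \<le> card (group_center G)"
      using z subgroup.one_closed[OF center_subgroup] by (intro card_mono) auto
    moreover have "card {\<one>, z} \<le> 2" by (simp add: card_insert_if)
    ultimately show ?thesis using 3 by linarith
  qed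
qed

end

text \<open>The relations make the common value \<open>z\<close> of a^3, b^3 and c^2 central at
  once, but z^2 = 1 has to be derived. The conjugates \<open>d\<close>, \<open>e\<close> of
  \<open>c\<close> under \<open>a\<close> satisfy e d c = z^2, and conjugation by \<open>a\<close>
  permutes the factors cyclically. This determines products of two of them, and the value of e c e
  then yields z^2 = 1.\<close>

lemma (in group) SL_2_3_binary_tetrahedral:
  assumes "satisfies G f SL_2_3_rels"
  obtains a c d e z where "binary_tetrahedral G a c d e z"
proof -
  define a b c where "a = f A3" and "b = f B3" and "c = f C3"
  have a: "a \<in> carrier G" and b: "b \<in> carrier G" and c: "c \<in> carrier G" and gen: "generate G {a, b, c} = carrier G"
    and ab3: "a [^] (3::nat) = b [^] (3::nat)" and b3: "b [^] (3::nat) = c [^] (2::nat)" and abc: "c [^] (2::nat) = a \<otimes> (b \<otimes> c)"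
    using assms unfolding satisfies_rels3 a_def b_def c_def by auto
  define z where "z = c \<otimes> c"
  have zc: "z \<in> carrier G" using c z_def by simp
  have c2: "c [^] (2::nat) = z" using c by (simp add: z_def numeral_2_eq_2)
  have "c \<otimes> c = (a \<otimes> b) \<otimes> c" using abc a b c c2 unfolding z_def by (simp add: m_assoc)
  then have cab: "c = a \<otimes> b" using a b c by simp
  have pc: "x [^] (n::nat) \<otimes> x = x \<otimes> x [^] n" if "x \<in> carrier G" for x n
    using nat_pow_Suc2[OF that, of n] by simp
  have zZ: "z \<in> group_center G"
  proof (rule center_generators[OF gen _ zc])
    fix s assume "s \<in> {a, b, c}"
    moreover have "z \<otimes> a = a \<otimes> z" using pc[OF a, of 3] ab3 b3 c2 by simp
    moreover have "z \<otimes> b = b \<otimes> z" using pc[OF b, of 3] b3 c2 by simp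
    moreover have "z \<otimes> c = c \<otimes> z" using c by (simp add: z_def m_assoc)
    ultimately show "z \<otimes> s = s \<otimes> z" by auto
  qed (use a b c in auto)
  define d where "d = a \<otimes> (c \<otimes> inv a)"
  define e where "e = a \<otimes> (d \<otimes> inv a)"
  have m: "a \<in> carrier G" "c \<in> carrier G" "d \<in> carrier G" "e \<in> carrier G" using a c by (auto simp: d_def e_def)
  have zq: "q \<otimes> z = z \<otimes> q" if "q \<in> carrier G" for q using center_commute[OF zZ that] by simp
  have zq': "q \<otimes> (z \<otimes> r) = z \<otimes> (q \<otimes> r)" if "q \<in> carrier G" "r \<in> carrier G" for q r
    using zq[OF that(1)] that zc by (simp add: m_assoc[symmetric])
  have a3: "a \<otimes> (a \<otimes> a) = z" using ab3 b3 c2 a by (simp add: numeral_eq_Suc m_assoc)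
  have bbb: "b \<otimes> (b \<otimes> b) = z" using b3 c2 b by (simp add: numeral_eq_Suc m_assoc)
  have ac: "a \<otimes> c = d \<otimes> a" and ad: "a \<otimes> d = e \<otimes> a" using m by (simp_all add: d_def e_def m_assoc)
  have ae: "a \<otimes> e = c \<otimes> a"
  proof -
    have "(a \<otimes> e) \<otimes> (a \<otimes> a) = a \<otimes> ((e \<otimes> a) \<otimes> a)" using m by (simp add: m_assoc)
    also have "\<dots> = a \<otimes> (a \<otimes> (d \<otimes> a))" unfolding ad[symmetric] using m by (simp add: m_assoc)
    also have "\<dots> = (a \<otimes> (a \<otimes> a)) \<otimes> c" unfolding ac[symmetric] using m by (simp add: m_assoc)
    also have "\<dots> = c \<otimes> (a \<otimes> (a \<otimes> a))" unfolding a3 using zq m by simp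
    also have "\<dots> = (c \<otimes> a) \<otimes> (a \<otimes> a)" using m by (simp add: m_assoc)
    finally show ?thesis using m by simp
  qed
  have sq: "c \<otimes> c = z" "d \<otimes> d = z" "e \<otimes> e = z"
  proof -
    show cc: "c \<otimes> c = z" by (simp add: z_def)
    have "x \<otimes> x = z" if "y \<otimes> y = z" "a \<otimes> y = x \<otimes> a" "x \<in> carrier G" "y \<in> carrier G" for x y
    proof -
      have "(x \<otimes> x) \<otimes> a = x \<otimes> (x \<otimes> a)" using that(3) a by (simp add: m_assoc)
      also have "\<dots> = x \<otimes> (a \<otimes> y)" using that(2) by simp
      also have "\<dots> = (x \<otimes> a) \<otimes> y" using that(3,4) a by (simp add: m_assoc)
      also have "\<dots> = a \<otimes> (y \<otimes> y)" unfolding that(2)[symmetric] using that(3,4) a by (simp add: m_assoc)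
      also have "\<dots> = z \<otimes> a" using that(1) zq a by simp
      finally show ?thesis using that a zc by simp
    qed
    then show "d \<otimes> d = z" "e \<otimes> e = z" using cc ac ad m by metis+
  qed
  \<comment> \<open>With c = ab, the product e d c telescopes to a^3 b^3.\<close>
  have edc: "e \<otimes> (d \<otimes> c) = z \<otimes> z"
  proof -
    have 1: "d \<otimes> a = a \<otimes> (a \<otimes> b)" using ac cab by simp
    have "e \<otimes> (d \<otimes> c) = e \<otimes> (d \<otimes> a) \<otimes> b" using cab m b by (simp add: m_assoc)
    also have "\<dots> = (e \<otimes> a) \<otimes> (a \<otimes> b) \<otimes> b" unfolding 1 using m b by (simp add: m_assoc)
    also have "\<dots> = a \<otimes> (d \<otimes> a) \<otimes> b \<otimes> b" unfolding ad[symmetric] using m b by (simp add: m_assoc)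
    also have "\<dots> = (a \<otimes> (a \<otimes> a)) \<otimes> (b \<otimes> (b \<otimes> b))" unfolding 1 using m b by (simp add: m_assoc)
    finally show ?thesis unfolding a3 bbb .
  qed
  \<comment> \<open>Conjugation by \<open>a\<close> permutes \<open>c\<close>, \<open>d\<close>,
    \<open>e\<close> cyclically and fixes z^2, so one relation yields its two rotations.\<close>
  have rot: "r' \<otimes> (q' \<otimes> p') = z \<otimes> z"
    if "r \<otimes> (q \<otimes> p) = z \<otimes> z" "a \<otimes> p = p' \<otimes> a" "a \<otimes> q = q' \<otimes> a" "a \<otimes> r = r' \<otimes> a"
      "p \<in> carrier G" "q \<in> carrier G" "r \<in> carrier G" "p' \<in> carrier G" "q' \<in> carrier G" "r' \<in> carrier G" for p q r p' q' r'
  proof -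
    note cl = that(5-10) a
    have "(r' \<otimes> (q' \<otimes> p')) \<otimes> a = r' \<otimes> (q' \<otimes> (p' \<otimes> a))" using cl by (simp add: m_assoc)
    also have "\<dots> = r' \<otimes> ((q' \<otimes> a) \<otimes> p)" unfolding that(2)[symmetric] using cl by (simp add: m_assoc)
    also have "\<dots> = (r' \<otimes> a) \<otimes> (q \<otimes> p)" unfolding that(3)[symmetric] using cl by (simp add: m_assoc)
    also have "\<dots> = a \<otimes> (r \<otimes> (q \<otimes> p))" unfolding that(4)[symmetric] using cl by (simp add: m_assoc)
    also have "\<dots> = a \<otimes> (z \<otimes> z)" using that(1) by simp
    also have "\<dots> = (z \<otimes> z) \<otimes> a" using center_commute[OF subgroup.m_closed[OF center_subgroup zZ zZ] a] by simp
    finally show ?thesis using that a zc by (simp only: right_cancel m_closed)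
  qed
  have ced: "c \<otimes> (e \<otimes> d) = z \<otimes> z" using rot[OF edc ac ad ae] m by simp
  have dce: "d \<otimes> (c \<otimes> e) = z \<otimes> z" using rot[OF ced ad ae ac] m by simp
  have half: "r \<otimes> q = z \<otimes> p" if "r \<otimes> (q \<otimes> p) = z \<otimes> z" "p \<otimes> p = z" "p \<in> carrier G" "q \<in> carrier G" "r \<in> carrier G" for p q r
  proof -
    have "(r \<otimes> q) \<otimes> p = z \<otimes> (p \<otimes> p)" using that by (simp add: m_assoc)
    also have "\<dots> = (z \<otimes> p) \<otimes> p" using that zc by (simp add: m_assoc)
    finally show ?thesis using that zc by (simp only: right_cancel m_closed)
  qed
  have ed: "e \<otimes> d = z \<otimes> c" by (rule half[OF edc sq(1) m(2,3,4)])
  have ce: "c \<otimes> e = z \<otimes> d" by (rule half[OF ced sq(2) m(3,4,2)])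
  have dc: "d \<otimes> c = z \<otimes> e" by (rule half[OF dce sq(3) m(4,2,3)])
  \<comment> \<open>The value e c e = z^2 c is used twice: to get c e = z (e c), and then to
    evaluate (c e) e, which gives z c = z^3 c.\<close>
  have ece: "e \<otimes> (c \<otimes> e) = z \<otimes> (z \<otimes> c)"
    unfolding ce using zq'[OF m(4,3)] ed by simp
  have "z \<otimes> (c \<otimes> e) = (e \<otimes> e) \<otimes> (c \<otimes> e)" using sq by simp
  also have "\<dots> = e \<otimes> (z \<otimes> (z \<otimes> c))" using ece m by (simp add: m_assoc)
  also have "\<dots> = z \<otimes> (z \<otimes> (e \<otimes> c))"
    using zq'[OF m(4), of "z \<otimes> c"] zq'[OF m(4,2)] m zc by simp
  finally have "z \<otimes> (c \<otimes> e) = z \<otimes> (z \<otimes> (e \<otimes> c))" .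
  then have cez: "c \<otimes> e = z \<otimes> (e \<otimes> c)" using m zc by simp
  have "z \<otimes> c = (c \<otimes> e) \<otimes> e" using sq m zq[OF m(2)] by (simp add: m_assoc)
  also have "\<dots> = (z \<otimes> (e \<otimes> c)) \<otimes> e" by (simp only: cez)
  also have "\<dots> = z \<otimes> (e \<otimes> (c \<otimes> e))" using m zc by (simp add: m_assoc)
  also have "\<dots> = z \<otimes> (z \<otimes> (z \<otimes> c))" unfolding ece ..
  finally have "\<one> \<otimes> c = (z \<otimes> z) \<otimes> c" using m zc by (simp add: m_assoc)
  then have zz: "z \<otimes> z = \<one>" using m zc by (metis m_closed one_closed right_cancel)
  have ec: "e \<otimes> c = d"
  proof -
    have "z \<otimes> (e \<otimes> c) = z \<otimes> d" using cez ce by simp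
    then show ?thesis using m zc by simp
  qed
  have rot2: "q' \<otimes> p' = r'" if "q \<otimes> p = r" "a \<otimes> p = p' \<otimes> a" "a \<otimes> q = q' \<otimes> a" "a \<otimes> r = r' \<otimes> a"
      "p \<in> carrier G" "q \<in> carrier G" "r \<in> carrier G" "p' \<in> carrier G" "q' \<in> carrier G" "r' \<in> carrier G" for p q r p' q' r'
  proof -
    note cl = that(5-10) a
    have "(q' \<otimes> p') \<otimes> a = q' \<otimes> (p' \<otimes> a)" using cl by (simp add: m_assoc)
    also have "\<dots> = (q' \<otimes> a) \<otimes> p" unfolding that(2)[symmetric] using cl by (simp add: m_assoc)
    also have "\<dots> = a \<otimes> (q \<otimes> p)" unfolding that(3)[symmetric] using cl by (simp add: m_assoc)
    also have "\<dots> = r' \<otimes> a" using that(1,4) by simp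
    finally show ?thesis using that a by (simp only: right_cancel m_closed)
  qed
  have cd: "c \<otimes> d = e" using rot2[OF ec ac ae ad] m by simp
  have de: "d \<otimes> e = c" using rot2[OF cd ad ac ae] m by simp
  have "generate G {a, c} = carrier G"
  proof
    have sub: "subgroup (generate G {a, c}) G" using m by (intro generate_is_subgroup) auto
    have A: "a \<in> generate G {a, c}" "c \<in> generate G {a, c}" by (auto intro: generate.incl)
    have "b = inv a \<otimes> c" using cab a b by simp
    then have "b \<in> generate G {a, c}" using A sub by (metis subgroup.m_closed subgroup.m_inv_closed)
    then have "generate G {a, b, c} \<subseteq> generate G {a, c}" using A by (intro generate_subgroup_incl[OF _ sub]) auto
    then show "carrier G \<subseteq> generate G {a, c}" using gen by simp
    show "generate G {a, c} \<subseteq> carrier G" using sub by (rule subgroup.subset)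
  qed
  moreover have "a [^] (3::nat) = z" using ab3 b3 c2 by simp
  ultimately have "binary_tetrahedral G a c d e z"
    using m zZ zz ac ad ae sq cd de ec dc ed ce by unfold_locales auto
  then show ?thesis by (rule that)
qed

section \<open>Recognizing the presented groups\<close>

context group
begin

lemma subgroup_eq_carrier:
  assumes "finite (carrier G)" "subgroup H G" "order G < 2 * card H"
  shows "H = carrier G"
  using proper_subgroup_card[OF assms(1,2)] assms(3) by auto

lemma iso_two_gens:
  assumes fin: "finite (carrier G)"
    and s: "satisfies G (case_two_gens a b) R"
    and bound: "\<And>f :: two_gens \<Rightarrow> two_gens word set. satisfies (presented_group R) f R \<Longrightarrow>
      finite (carrier (presented_group R)) \<and> order (presented_group R) \<le> order G"
  shows "G \<cong> presented_group R"
  using satisfies_iso_presented[OF is_group fin s bound] .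

lemma iso_dihedral:
  assumes "finite (carrier G)" "order G = 2 * n" "n > 0" "a \<in> carrier G" "b \<in> carrier G" "generate G {a, b} = carrier G"
    "b [^] n = \<one>" "a [^] (2::nat) = \<one>" "a \<otimes> (b \<otimes> inv a) = inv b"
  shows "G \<cong> dihedral_group n"
  unfolding presented_defs
proof (rule iso_two_gens[OF assms(1), of a b])
  show "satisfies G (case_two_gens a b) (dihedral_rels n)" using assms by (simp add: satisfies_rels)
qed (use group.dihedral_order[OF group_presented_group _ assms(3)] assms(2) in auto)

lemma iso_dicyclic:
  assumes "finite (carrier G)" "order G = 4 * n" "n > 0" "a \<in> carrier G" "b \<in> carrier G" "generate G {a, b} = carrier G"
    "b [^] (2 * n) = \<one>" "a [^] (2::nat) = b [^] n" "a \<otimes> (b \<otimes> inv a) = inv b"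
  shows "G \<cong> dicyclic_group n"
  unfolding presented_defs
proof (rule iso_two_gens[OF assms(1), of a b])
  show "satisfies G (case_two_gens a b) (dicyclic_rels n)" using assms by (simp add: satisfies_rels)
qed (use group.dicyclic_order[OF group_presented_group _ assms(3)] assms(2) in auto)

lemma iso_Sz_2:
  assumes "finite (carrier G)" "order G = 20" "a \<in> carrier G" "b \<in> carrier G" "generate G {a, b} = carrier G"
    "a [^] (5::nat) = \<one>" "b [^] (4::nat) = \<one>" "b \<otimes> (a \<otimes> inv b) = a [^] (2::nat)"
  shows "G \<cong> Sz_2"
  unfolding presented_defs
proof (rule iso_two_gens[OF assms(1), of a b])
  show "satisfies G (case_two_gens a b) Sz_2_rels" using assms by (simp add: satisfies_rels)
qed (use group.Sz_2_order[OF group_presented_group] assms(2) in auto)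

lemma iso_SG_16_3:
  assumes "finite (carrier G)" "order G = 16" "a \<in> carrier G" "b \<in> carrier G" "generate G {a, b} = carrier G"
    "a [^] (4::nat) = \<one>" "b [^] (4::nat) = \<one>" "a \<otimes> b = inv b \<otimes> inv a" "a \<otimes> inv b = b \<otimes> inv a"
  shows "G \<cong> SG_16_3"
  unfolding presented_defs
proof (rule iso_two_gens[OF assms(1), of a b])
  show "satisfies G (case_two_gens a b) SG_16_3_rels" using assms by (simp add: satisfies_rels)
qed (use group.SG_16_3_order[OF group_presented_group] assms(2) in auto)

lemma iso_Z4_semidirect_Z4:
  assumes "finite (carrier G)" "order G = 16" "a \<in> carrier G" "b \<in> carrier G" "generate G {a, b} = carrier G"
    "a [^] (4::nat) = \<one>" "b [^] (4::nat) = \<one>" "b \<otimes> (a \<otimes> inv b) = inv a"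
  shows "G \<cong> Z4_semidirect_Z4"
  unfolding presented_defs
proof (rule iso_two_gens[OF assms(1), of a b])
  show "satisfies G (case_two_gens a b) Z4_semidirect_Z4_rels" using assms by (simp add: satisfies_rels)
qed (use group.Z4_semidirect_Z4_order[OF group_presented_group] assms(2) in auto)

lemma iso_M_16:
  assumes "finite (carrier G)" "order G = 16" "a \<in> carrier G" "b \<in> carrier G" "generate G {a, b} = carrier G"
    "a [^] (8::nat) = \<one>" "b [^] (2::nat) = \<one>" "b \<otimes> (a \<otimes> b) = a [^] (5::nat)"
  shows "G \<cong> M_16"
  unfolding presented_defs
proof (rule iso_two_gens[OF assms(1), of a b])
  show "satisfies G (case_two_gens a b) M_16_rels" using assms by (simp add: satisfies_rels)
qed (use group.M_16_order[OF group_presented_group] assms(2) in auto)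

lemma iso_D8_central_Z4:
  assumes "finite (carrier G)" "order G = 16" "a \<in> carrier G" "b \<in> carrier G" "c \<in> carrier G" "generate G {a, b, c} = carrier G"
    "a [^] (4::nat) = \<one>" "b [^] (2::nat) = \<one>" "c [^] (2::nat) = \<one>" "a \<otimes> b = b \<otimes> a" "a \<otimes> c = c \<otimes> a"
    "b \<otimes> c = a [^] (2::nat) \<otimes> (c \<otimes> b)"
  shows "G \<cong> D8_central_Z4"
  unfolding presented_defs
proof (rule satisfies_iso_presented[OF is_group assms(1)])
  show "satisfies G (case_three_gens a b c) D8_central_Z4_rels" using assms by (simp add: satisfies_rels3)
qed (use group.D8_central_Z4_order[OF group_presented_group] assms(2) in auto)

lemma iso_SL_2_3:
  assumes "finite (carrier G)" "order G = 24" "a \<in> carrier G" "b \<in> carrier G" "c \<in> carrier G" "generate G {a, b, c} = carrier G"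
    "a [^] (3::nat) = b [^] (3::nat)" "b [^] (3::nat) = c [^] (2::nat)" "c [^] (2::nat) = a \<otimes> (b \<otimes> c)"
  shows "G \<cong> SL_2_3"
  unfolding presented_defs
proof (rule satisfies_iso_presented[OF is_group assms(1)])
  show "satisfies G (case_three_gens a b c) SL_2_3_rels" using assms by (simp add: satisfies_rels3)
  fix f :: "three_gens \<Rightarrow> three_gens word set" assume "satisfies (presented_group SL_2_3_rels) f SL_2_3_rels"
  then obtain a c d e z where "binary_tetrahedral (presented_group SL_2_3_rels) a c d e z"
    using group.SL_2_3_binary_tetrahedral[OF group_presented_group] by blast
  then interpret binary_tetrahedral "presented_group SL_2_3_rels" a c d e z .
  have "card {\<one>\<^bsub>presented_group SL_2_3_rels\<^esub>, z} \<le> 2" by (simp add: card_insert_if)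
  then show "finite (carrier (presented_group SL_2_3_rels)) \<and> order (presented_group SL_2_3_rels) \<le> order G"
    using finite_carrier order_le assms(2) by auto
qed

text \<open>An internal direct product: a central involution outside a subgroup of index 2. The
  function \<open>p\<close> sends the carrier {0, 1} of \<open>integer_mod_group 2\<close> to the
  powers of \<open>d\<close>.\<close>

lemma iso_Z2_DirProd:
  assumes fin: "finite (carrier G)" and H: "subgroup H G" and ord: "order G = 2 * card H"
    and d: "d \<in> group_center G" "d \<otimes> d = \<one>" "d \<notin> H"
  shows "G \<cong> integer_mod_group 2 \<times>\<times> (G\<lparr>carrier := H\<rparr>)"
proof -
  let ?A = "integer_mod_group 2"
  have dc: "d \<in> carrier G" using d center_carrier by blast
  have HG: "H \<subseteq> carrier G" using H by (rule subgroup.subset)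
  define p where "p i = (if i = 0 then \<one> else d)" for i :: int
  define f where "f = (\<lambda>(i, h). p i \<otimes> h)"
  have pc: "p i \<in> carrier G" "h \<in> carrier G \<Longrightarrow> h \<otimes> p i = p i \<otimes> h" for i h
    using dc center_commute[OF d(1)] by (auto simp: p_def)
  have cA: "carrier ?A = {0, 1}" by (auto simp: carrier_integer_mod_group)
  have pm: "p ((i + j) mod 2) = p i \<otimes> p j" if "i \<in> {0, 1}" "j \<in> {0, 1}" for i j
    using that d(2) dc by (auto simp: p_def)
  have inj: "inj_on f (carrier ?A \<times> H)"
  proof (rule inj_onI, clarify)
    fix i h j k assume "i \<in> carrier ?A" "j \<in> carrier ?A" and hk: "h \<in> H" "k \<in> H" and eq: "f (i, h) = f (j, k)"
    then have ij: "i \<in> {0, 1}" "j \<in> {0, 1}" by (simp_all only: cA)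
    have hkc: "h \<in> carrier G" "k \<in> carrier G" using hk HG by auto
    have e: "p i \<otimes> h = p j \<otimes> k" using eq by (simp add: f_def)
    have no: "d \<otimes> u \<noteq> v" if "u \<in> H" "v \<in> H" for u v
    proof
      assume "d \<otimes> u = v"
      then have "d = v \<otimes> inv u" using that HG dc by (auto simp: m_assoc subset_iff)
      then show False using that d(3) H by (simp add: subgroup.m_closed subgroup.m_inv_closed)
    qed
    have "i = j"
    proof (rule ccontr)
      assume "i \<noteq> j"
      then consider "i = 0" "j = 1" | "i = 1" "j = 0" using ij by auto
      then show False
      proof cases
        case 1 then show False using e hkc no[of k h] hk by (simp add: p_def)
      next
        case 2 then show False using e hkc no[of h k] hk by (simp add: p_def)
      qed
    qed
    then show "i = j \<and> h = k" using e pc hkc by simp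
  qed
  have img: "f ` (carrier ?A \<times> H) \<subseteq> carrier G" using pc HG by (auto simp: f_def)
  have "card (f ` (carrier ?A \<times> H)) = card (carrier G)"
    using card_image[OF inj] ord cA by (simp add: card_cartesian_product order_def)
  then have surj: "f ` (carrier ?A \<times> H) = carrier G" using img fin by (intro card_subset_eq) auto
  have hom: "f \<in> hom (?A \<times>\<times> (G\<lparr>carrier := H\<rparr>)) G"
  proof (rule homI)
    show "f x \<in> carrier G" if "x \<in> carrier (?A \<times>\<times> (G\<lparr>carrier := H\<rparr>))" for x using that img by auto
    fix x y assume "x \<in> carrier (?A \<times>\<times> (G\<lparr>carrier := H\<rparr>))" "y \<in> carrier (?A \<times>\<times> (G\<lparr>carrier := H\<rparr>))"
    moreover obtain i h j k where "x = (i, h)" "y = (j, k)" by (cases x, cases y)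
    ultimately have x: "x = (i, h)" "y = (j, k)" "i \<in> {0,1}" "j \<in> {0,1}" "h \<in> carrier G" "k \<in> carrier G"
      using cA HG by auto
    have "p i \<otimes> p j \<otimes> (h \<otimes> k) = p i \<otimes> ((p j \<otimes> h) \<otimes> k)" using x pc(1) by (simp add: m_assoc)
    also have "\<dots> = p i \<otimes> h \<otimes> (p j \<otimes> k)" using x pc(1) pc(2)[of h j, symmetric] by (simp add: m_assoc)
    finally show "f (x \<otimes>\<^bsub>?A \<times>\<times> (G\<lparr>carrier := H\<rparr>)\<^esub> y) = f x \<otimes> f y"
      using x pm[of i j] by (simp add: f_def)
  qed
  have "?A \<times>\<times> (G\<lparr>carrier := H\<rparr>) \<cong> G"
    unfolding is_iso_def iso_def bij_betw_def using hom inj surj by auto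
  moreover have "group (?A \<times>\<times> (G\<lparr>carrier := H\<rparr>))"
    using subgroup_imp_group[OF H] by (simp add: DirProd_group)
  ultimately show ?thesis by (simp add: group.iso_sym)
qed

lemma generate_eqI:
  assumes "S \<subseteq> carrier G" "T \<subseteq> generate G S" "generate G T = carrier G"
  shows "generate G S = carrier G"
proof
  have sub: "subgroup (generate G S) G" using assms(1) by (rule generate_is_subgroup)
  then show "generate G S \<subseteq> carrier G" by (rule subgroup.subset)
  show "carrier G \<subseteq> generate G S" using generate_subgroup_incl[OF assms(2) sub] assms(3) by simp
qed

lemma generate_mult_eqI:
  assumes x: "x \<in> carrier G" "y \<in> carrier G" "generate G {x, y} = carrier G"
  shows "generate G {x, x \<otimes> y} = carrier G"
proof (rule generate_eqI[OF _ _ x(3)])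
  have sub: "subgroup (generate G {x, x \<otimes> y}) G" using x by (intro generate_is_subgroup) auto
  have i: "x \<in> generate G {x, x \<otimes> y}" "x \<otimes> y \<in> generate G {x, x \<otimes> y}" by (auto intro: generate.incl)
  then have "inv x \<otimes> (x \<otimes> y) \<in> generate G {x, x \<otimes> y}" using sub by (metis subgroup.m_closed subgroup.m_inv_closed)
  then show "{x, y} \<subseteq> generate G {x, x \<otimes> y}" using i x by simp
qed (use x in auto)

text \<open>The commutator y^-1 x^-1 y x is the product of y^-2, a conjugate of x^-2 and (yx)^2,
  hence central. Because x^2 commutes with \<open>y\<close>, the commutator squares to 1.\<close>

lemma central_squares_commutator:
  assumes sq: "\<And>x. x \<in> carrier G \<Longrightarrow> x \<otimes> x \<in> group_center G" and x: "x \<in> carrier G" and y: "y \<in> carrier G"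
  obtains c where "c \<in> group_center G" "c \<otimes> c = \<one>" "y \<otimes> x = (x \<otimes> y) \<otimes> c" "x \<otimes> y = y \<otimes> x \<longleftrightarrow> c = \<one>"
proof -
  define c where "c = inv y \<otimes> inv x \<otimes> (y \<otimes> x)"
  have cc: "c \<in> carrier G" using x y by (simp add: c_def)
  have yx: "y \<otimes> x = (x \<otimes> y) \<otimes> c" unfolding c_def using x y by (simp add: m_assoc)
  have xx: "inv (y \<otimes> y) \<in> group_center G" "inv (x \<otimes> x) \<in> group_center G" "(y \<otimes> x) \<otimes> (y \<otimes> x) \<in> group_center G"
    using sq x y subgroup.m_inv_closed[OF center_subgroup] by auto
  have "c = (inv y \<otimes> inv y) \<otimes> (y \<otimes> (inv x \<otimes> inv x) \<otimes> inv y) \<otimes> ((y \<otimes> x) \<otimes> (y \<otimes> x))"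
    unfolding c_def using x y by (simp add: m_assoc)
  also have "y \<otimes> (inv x \<otimes> inv x) \<otimes> inv y = inv x \<otimes> inv x"
  proof -
    have "inv x \<otimes> inv x \<in> group_center G" using xx(2) x by (simp add: inv_mult_group)
    from center_commute[OF this y] have "y \<otimes> (inv x \<otimes> inv x) = (inv x \<otimes> inv x) \<otimes> y" by simp
    then show ?thesis using x y by (simp add: m_assoc)
  qed
  finally have c: "c \<in> group_center G"
    using xx x y subgroup.m_closed[OF center_subgroup] by (simp add: inv_mult_group)
  have "c \<otimes> c = \<one>"
  proof -
    have "(x \<otimes> x) \<otimes> y = y \<otimes> (x \<otimes> x)" using center_commute[OF sq[OF x] y] .
    also have "\<dots> = (x \<otimes> y \<otimes> c) \<otimes> x" using yx x y by (simp add: m_assoc[symmetric])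
    also have "\<dots> = x \<otimes> (y \<otimes> x) \<otimes> c" using center_commute[OF c x] x y cc by (simp add: m_assoc)
    also have "\<dots> = (x \<otimes> x) \<otimes> y \<otimes> (c \<otimes> c)" unfolding yx using x y cc by (simp add: m_assoc)
    finally have "(x \<otimes> x) \<otimes> y \<otimes> \<one> = (x \<otimes> x) \<otimes> y \<otimes> (c \<otimes> c)" using x y by simp
    then show ?thesis using x y cc by (simp add: m_assoc)
  qed
  moreover have "x \<otimes> y = y \<otimes> x \<longleftrightarrow> c = \<one>" unfolding yx using x y cc by simp
  ultimately show ?thesis using that c yx by blast
qed

lemma square_mult:
  assumes "x \<in> carrier G" "y \<in> carrier G" "c \<in> group_center G" "y \<otimes> x = (x \<otimes> y) \<otimes> c"
  shows "(x \<otimes> y) \<otimes> (x \<otimes> y) = (x \<otimes> x) \<otimes> (y \<otimes> y) \<otimes> c"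
proof -
  have cc: "c \<in> carrier G" using assms(3) center_carrier by blast
  have "(x \<otimes> y) \<otimes> (x \<otimes> y) = x \<otimes> (y \<otimes> x) \<otimes> y" using assms(1,2) by (simp add: m_assoc)
  also have "\<dots> = (x \<otimes> x) \<otimes> (y \<otimes> (c \<otimes> y))" unfolding assms(4) using assms(1,2) cc by (simp add: m_assoc)
  also have "c \<otimes> y = y \<otimes> c" using center_commute[OF assms(3,2)] .
  finally show ?thesis using assms(1,2) cc by (simp add: m_assoc)
qed

lemma square_central_mult:
  assumes "x \<in> carrier G" "z \<in> group_center G"
  shows "(x \<otimes> z) \<otimes> (x \<otimes> z) = (x \<otimes> x) \<otimes> (z \<otimes> z)"
proof -
  have zc: "z \<in> carrier G" using assms(2) center_carrier by blast
  have "z \<otimes> (x \<otimes> z) = x \<otimes> (z \<otimes> z)" using center_commute[OF assms(2,1)] assms(1) zc by (simp add: m_assoc[symmetric])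
  then show ?thesis using assms(1) zc by (simp add: m_assoc)
qed

text \<open>Conjugation by \<open>x\<close> multiplies \<open>y\<close> by the commutator
  \<open>c\<close>, and y c = y^3 is the inverse of \<open>y\<close>.\<close>

lemma commutator_conj_inverse:
  assumes "x \<in> carrier G" "y \<in> carrier G" "c \<in> group_center G" "x \<otimes> y = (y \<otimes> x) \<otimes> c" "y \<otimes> y = c" "c \<otimes> c = \<one>"
  shows "x \<otimes> (y \<otimes> inv x) = inv y"
proof -
  have cc: "c \<in> carrier G" using assms(3) center_carrier by blast
  have "x \<otimes> (y \<otimes> inv x) = (y \<otimes> x) \<otimes> (c \<otimes> inv x)" using assms(1,2,4) cc by (simp add: m_assoc[symmetric])
  also have "c \<otimes> inv x = inv x \<otimes> c" using center_commute[OF assms(3)] assms(1) by simp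
  also have "(y \<otimes> x) \<otimes> (inv x \<otimes> c) = y \<otimes> c" using assms(1,2) cc by (simp add: m_assoc)
  also have "\<dots> = inv y"
  proof (rule inv_equality[symmetric])
    show "y \<otimes> c \<otimes> y = \<one>" using center_commute[OF assms(3,2)] assms(2,5,6) cc by (simp add: m_assoc) (simp add: m_assoc[symmetric])
  qed (use assms(2) cc in auto)
  finally show ?thesis .
qed

text \<open>An involution and an element with square \<open>c\<close> are the reflection and the
  rotation of D_8. Two involutions reduce to this case because their product has square
  \<open>c\<close>. Two squares equal to \<open>c\<close> give Q_8.\<close>

lemma order_8_cases:
  assumes fin: "finite (carrier G)" and ord: "order G = 8" and x: "x \<in> carrier G" and y: "y \<in> carrier G"
    and gen: "generate G {x, y} = carrier G" and c: "c \<in> group_center G" "c \<otimes> c = \<one>" and yx: "y \<otimes> x = (x \<otimes> y) \<otimes> c"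
    and sq: "x \<otimes> x \<in> {\<one>, c}" "y \<otimes> y \<in> {\<one>, c}"
  shows "G \<cong> dihedral_group 4 \<or> G \<cong> dicyclic_group 2"
proof -
  have cc: "c \<in> carrier G" using c(1) center_carrier by blast
  have D: "G \<cong> dihedral_group 4"
    if r: "r \<in> carrier G" "s \<in> carrier G" "generate G {s, r} = carrier G" "s \<otimes> r = (r \<otimes> s) \<otimes> c" "r \<otimes> r = c" "s \<otimes> s = \<one>" for r s
  proof (rule iso_dihedral[OF fin _ _ r(2,1,3)])
    show "s \<otimes> (r \<otimes> inv s) = inv r" using commutator_conj_inverse[OF r(2,1) c(1) r(4,5) c(2)] .
  qed (use r ord c in \<open>auto simp: four_pow numeral_2_eq_2\<close>)
  have xy: "x \<otimes> y = (y \<otimes> x) \<otimes> c" unfolding yx using x y cc c(2) by (simp add: m_assoc)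
  note sm = square_mult[OF x y c(1) yx]
  consider "x \<otimes> x = \<one>" "y \<otimes> y = \<one>" | "x \<otimes> x = \<one>" "y \<otimes> y = c" | "x \<otimes> x = c" "y \<otimes> y = \<one>" | "x \<otimes> x = c" "y \<otimes> y = c"
    using sq by auto
  then show ?thesis
  proof cases
    case 1
    have "x \<otimes> (x \<otimes> y) = (x \<otimes> y \<otimes> x) \<otimes> c"
    proof -
      have "(x \<otimes> y \<otimes> x) \<otimes> c = x \<otimes> ((y \<otimes> x) \<otimes> c)" using x y cc by (simp add: m_assoc)
      then show ?thesis using xy by simp
    qed
    then show ?thesis using D[of "x \<otimes> y" x] sm 1 x y cc generate_mult_eqI[OF x y gen] by simp
  next
    case 2
    then show ?thesis using D[of y x] x y gen xy by simp
  next
    case 3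
    then show ?thesis using D[of x y] x y gen yx by (simp add: insert_commute)
  next
    case 4
    have "G \<cong> dicyclic_group 2"
    proof (rule iso_dicyclic[OF fin _ _ x y gen])
      show "x \<otimes> (y \<otimes> inv x) = inv y" using commutator_conj_inverse[OF x y c(1) xy 4(2) c(2)] .
      show "y [^] (2 * 2 :: nat) = \<one>" using four_pow[OF y] 4 c by simp
    qed (use x y ord 4 in \<open>auto simp: numeral_2_eq_2\<close>)
    then show ?thesis ..
  qed
qed

end

section \<open>Groups of order 16 with center of order 4\<close>

context group
begin

text \<open>The powers of \<open>x\<close> up to its period form a subgroup of \<open>H\<close>, so
  by Lagrange's theorem the period divides the order of \<open>H\<close>.\<close>

lemma subgroup_pow_card:
  assumes "subgroup H G" "finite H" "x \<in> H"
  shows "x [^] card H = \<one>"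
proof -
  have xc: "x \<in> carrier G" using assms subgroup.subset by blast
  have pH: "x [^] (i::nat) \<in> H" for i using subgroup_nat_pow_closed assms by blast
  have "\<not> inj_on (\<lambda>i::nat. x [^] i) {..card H}"
  proof
    assume "inj_on (\<lambda>i::nat. x [^] i) {..card H}"
    then have "card {..card H} \<le> card H" using pH assms(2) by (intro card_inj_on_le) auto
    then show False by simp
  qed
  then obtain i j :: nat where ij: "x [^] i = x [^] j" "i < j" unfolding inj_on_def by (metis nat_neq_iff)
  have "x [^] i \<otimes> x [^] (j - i) = x [^] j" using ij(2) xc by (simp add: nat_pow_mult)
  then have "x [^] i \<otimes> x [^] (j - i) = x [^] i \<otimes> \<one>" using ij(1) xc by simp
  then have "x [^] (j - i) = \<one> \<and> 0 < j - i" using xc ij(2) by simp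
  then have ex: "\<exists>n>0. x [^] (n::nat) = \<one>" by blast
  define n where "n = (LEAST n. 0 < n \<and> x [^] (n::nat) = \<one>)"
  have n: "0 < n" "x [^] n = \<one>" using LeastI_ex[of "\<lambda>n. 0 < n \<and> x [^] (n::nat) = \<one>"] ex unfolding n_def by auto
  have least: "n \<le> m" if "0 < m" "x [^] m = \<one>" for m :: nat unfolding n_def using that by (intro Least_le) auto
  define K where "K = (\<lambda>i. x [^] i) ` {..<n}"
  have mem: "x [^] (i::nat) \<in> K" for i
    unfolding K_def using pow_mod_exponent[OF xc n(2), of i] n(1) by (intro image_eqI[of _ _ "i mod n"]) auto
  have K: "subgroup K (G\<lparr>carrier := H\<rparr>)"
  proof (rule group.subgroupI[OF subgroup_imp_group[OF assms(1)]])
    show "K \<subseteq> carrier (G\<lparr>carrier := H\<rparr>)" "K \<noteq> {}" using pH n(1) unfolding K_def by auto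
    show "a \<otimes>\<^bsub>G\<lparr>carrier := H\<rparr>\<^esub> b \<in> K" if "a \<in> K" "b \<in> K" for a b
    proof -
      obtain i j :: nat where ab: "a = x [^] i" "b = x [^] j" using \<open>a \<in> K\<close> \<open>b \<in> K\<close> unfolding K_def by blast
      show ?thesis using mem[of "i + j"] xc unfolding ab by (simp add: nat_pow_mult)
    qed
    show "inv\<^bsub>G\<lparr>carrier := H\<rparr>\<^esub> a \<in> K" if "a \<in> K" for a
    proof -
      obtain i :: nat where a: "a = x [^] i" "i < n" using \<open>a \<in> K\<close> unfolding K_def by blast
      have "x [^] (n - i) \<otimes> a = x [^] n" using a xc by (simp add: nat_pow_mult)
      then have "inv a = x [^] (n - i)" using a n xc by (intro inv_equality) auto
      moreover have "inv\<^bsub>G\<lparr>carrier := H\<rparr>\<^esub> a = inv a" using a pH by (intro m_inv_consistent[OF assms(1)]) auto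
      ultimately show ?thesis using mem by simp
    qed
  qed
  have "inj_on (\<lambda>i::nat. x [^] i) {..<n}"
  proof (rule linorder_inj_onI)
    fix i j :: nat assume ij: "i < j" "i \<in> {..<n}" "j \<in> {..<n}"
    show "x [^] i \<noteq> x [^] j"
    proof
      assume e: "x [^] i = x [^] j"
      have "x [^] i \<otimes> x [^] (j - i) = x [^] j" using ij(1) xc by (simp add: nat_pow_mult)
      then have "x [^] i \<otimes> x [^] (j - i) = x [^] i \<otimes> \<one>" using e xc by simp
      then have "x [^] (j - i) = \<one>" using xc by simp
      then show False using least[of "j - i"] ij by auto
    qed
  qed auto
  then have "card K = n" unfolding K_def by (simp add: card_image)
  moreover have "card K dvd card H"
    using group.subgroup_card_dvd[OF subgroup_imp_group[OF assms(1)] K] by (simp add: order_def)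
  ultimately obtain q where "card H = n * q" by auto
  then show ?thesis using n xc by (simp add: nat_pow_pow[symmetric])
qed

lemma card_coset_center: "x \<in> carrier G \<Longrightarrow> card ((\<lambda>z. x \<otimes> z) ` group_center G) = card (group_center G)"
  by (intro card_image) (auto simp: inj_on_def center_carrier)

text \<open>The center and its cosets by \<open>x\<close> and \<open>y\<close> are disjoint, which
  gives 12 elements, more than half of the group.\<close>

lemma generate_from_center:
  assumes fin: "finite (carrier G)" and ord: "order G = 16" and Z4: "card (group_center G) = 4"
    and x: "x \<in> carrier G" "y \<in> carrier G" "x \<otimes> y \<noteq> y \<otimes> x"
    and S: "S \<subseteq> carrier G" "group_center G \<subseteq> generate G S" "x \<in> generate G S" "y \<in> generate G S"
  shows "generate G S = carrier G"
proof -
  let ?Z = "group_center G" let ?H = "generate G S"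
  have sub: "subgroup ?H G" using S(1) by (rule generate_is_subgroup)
  have finZ: "finite ?Z" by (rule finite_subset[OF _ fin]) (use center_carrier in blast)
  have nz: "x \<notin> ?Z" "y \<notin> ?Z" using x center_commute by metis+
  have U: "?Z \<union> (\<lambda>z. x \<otimes> z) ` ?Z \<union> (\<lambda>z. y \<otimes> z) ` ?Z \<subseteq> ?H"
    using S sub by (auto intro: subgroup.m_closed)
  have d: "?Z \<inter> (\<lambda>z. u \<otimes> z) ` ?Z = {}" if u: "u \<in> carrier G" "u \<notin> ?Z" for u
  proof -
    have "u \<otimes> z \<notin> ?Z" if z: "z \<in> ?Z" for z
    proof
      assume "u \<otimes> z \<in> ?Z"
      then have "(u \<otimes> z) \<otimes> inv z \<in> ?Z" using z center_subgroup by (simp add: subgroup.m_closed subgroup.m_inv_closed)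
      then show False using u z center_carrier[OF z] by (simp add: m_assoc)
    qed
    then show ?thesis by auto
  qed
  have d2: "(\<lambda>z. x \<otimes> z) ` ?Z \<inter> (\<lambda>z. y \<otimes> z) ` ?Z = {}"
  proof -
    have "x \<otimes> z \<noteq> y \<otimes> w" if z: "z \<in> ?Z" "w \<in> ?Z" for z w
    proof
      assume e: "x \<otimes> z = y \<otimes> w"
      have c: "z \<in> carrier G" "w \<in> carrier G" using z center_carrier by auto
      have "x = y \<otimes> (w \<otimes> inv z)" using e x c by (metis inv_closed m_assoc m_closed r_inv r_one)
      moreover have "w \<otimes> inv z \<in> ?Z" using z center_subgroup by (simp add: subgroup.m_closed subgroup.m_inv_closed)
      ultimately have "x \<otimes> y = y \<otimes> x" using x center_commute[of "w \<otimes> inv z" y] c by (simp add: m_assoc)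
      then show False using x by simp
    qed
    then show ?thesis by auto
  qed
  have "card (?Z \<union> (\<lambda>z. x \<otimes> z) ` ?Z \<union> (\<lambda>z. y \<otimes> z) ` ?Z) = 12"
    using d[OF x(1) nz(1)] d[OF x(2) nz(2)] d2 finZ Z4 card_coset_center x
    by (simp add: card_Un_disjoint Int_Un_distrib2)
  moreover have "finite ?H" using fin sub subgroup.subset finite_subset by metis
  ultimately have "12 \<le> card ?H" using U card_mono by metis
  then show ?thesis using subgroup_eq_carrier[OF fin sub] ord by simp
qed

lemma set4_eq:
  assumes "card Z = 4" "{p, q, r, s} \<subseteq> Z" "distinct [p, q, r, s]"
  shows "Z = {p, q, r, s}"
proof -
  have "card {p, q, r, s} = 4" using assms(3) by simp
  moreover have "finite Z" using assms(1) card.infinite by fastforce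
  ultimately show ?thesis using assms(1,2) by (metis card_subset_eq)
qed

lemma mult_generate: "S \<subseteq> carrier G \<Longrightarrow> g \<in> generate G S \<Longrightarrow> h \<in> generate G S \<Longrightarrow> g \<otimes> h \<in> generate G S"
  by (rule generate.eng)

lemma inv_generate: "S \<subseteq> carrier G \<Longrightarrow> g \<in> generate G S \<Longrightarrow> inv g \<in> generate G S"
  using generate_is_subgroup by (simp add: subgroup.m_inv_closed)

text \<open>The center and the squares of noncentral elements decide. If the center is cyclic,
  generated by \<open>t\<close>, all nontrivial commutators equal t^2. A noncentral element whose
  square generates the center leads to \<open>M_16\<close>; otherwise factors from the center
  produce two noncommuting involutions and \<open>D8_central_Z4\<close>. If the center is a Klein
  four-group, an \<open>x\<close> with a nontrivial commutator \<open>c\<close> and x^2 outside {1,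
  c} leads to \<open>SG_16_3\<close> or \<open>Z4_semidirect_Z4\<close>; otherwise two noncommuting
  elements generate D_8 or Q_8, and a central involution splits off.\<close>

lemma order_16_cases:
  assumes fin: "finite (carrier G)" and ord: "order G = 16" and Z4: "card (group_center G) = 4"
    and sq: "\<And>x. x \<in> carrier G \<Longrightarrow> x \<otimes> x \<in> group_center G"
    and na: "\<exists>x\<in>carrier G. \<exists>y\<in>carrier G. x \<otimes> y \<noteq> y \<otimes> x"
  shows "G \<cong> integer_mod_group 2 \<times>\<times> dihedral_group 4 \<or> G \<cong> integer_mod_group 2 \<times>\<times> dicyclic_group 2 \<or>
    G \<cong> SG_16_3 \<or> G \<cong> Z4_semidirect_Z4 \<or> G \<cong> D8_central_Z4 \<or> G \<cong> M_16"
proof -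
  let ?Z = "group_center G"
  have Zm: "u \<otimes> v \<in> ?Z" if "u \<in> ?Z" "v \<in> ?Z" for u v using that center_subgroup by (simp add: subgroup.m_closed)
  have Z1: "\<one> \<in> ?Z" using center_subgroup by (rule subgroup.one_closed)
  have finZ: "finite ?Z" by (rule finite_subset[OF _ fin]) (use center_carrier in blast)
  note cc = center_carrier
  note genZ = generate_from_center[OF fin ord Z4]
  show ?thesis
  proof (cases "\<exists>t\<in>?Z. t \<otimes> t \<noteq> \<one>")
    case True
    then obtain t where t: "t \<in> ?Z" "t \<otimes> t \<noteq> \<one>" by blast
    have tc: "t \<in> carrier G" using t cc by blast
    have t4: "t [^] (4::nat) = \<one>" using subgroup_pow_card[OF center_subgroup finZ t(1)] Z4 by simp
    then have tt: "(t \<otimes> t) \<otimes> (t \<otimes> t) = \<one>" using four_pow[OF tc] by simp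
    have t1: "t \<noteq> \<one>" using t(2) by auto
    have Z: "?Z = {\<one>, t, t \<otimes> t, t \<otimes> (t \<otimes> t)}"
    proof (rule set4_eq[OF Z4])
      show "{\<one>, t, t \<otimes> t, t \<otimes> (t \<otimes> t)} \<subseteq> ?Z" using Z1 t(1) Zm by auto
      have "t \<otimes> (t \<otimes> t) \<noteq> \<one>"
      proof
        assume "t \<otimes> (t \<otimes> t) = \<one>"
        then have "t \<otimes> (t \<otimes> (t \<otimes> t)) = t" using tc by simp
        then show False using tt t1 tc by (simp add: m_assoc)
      qed
      moreover have "t \<noteq> t \<otimes> t" using t1 tc by simp
      moreover have "t \<noteq> t \<otimes> (t \<otimes> t)" using t(2) tc by simp
      moreover have "t \<otimes> t \<noteq> t \<otimes> (t \<otimes> t)" using t1 tc by simp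
      ultimately show "distinct [\<one>, t, t \<otimes> t, t \<otimes> (t \<otimes> t)]" using t1 t(2) by auto
    qed
    \<comment> \<open>The only involution of the cyclic center is t^2, so every nontrivial
      commutator has this value.\<close>
    have inv2: "c = t \<otimes> t" if "c \<in> ?Z" "c \<otimes> c = \<one>" "c \<noteq> \<one>" for c
    proof -
      have "(t \<otimes> (t \<otimes> t)) \<otimes> (t \<otimes> (t \<otimes> t)) = t \<otimes> t"
      proof -
        have "(t \<otimes> (t \<otimes> t)) \<otimes> (t \<otimes> (t \<otimes> t)) = (t \<otimes> t) \<otimes> (t \<otimes> t) \<otimes> (t \<otimes> t)" using tc by (simp add: m_assoc)
        then show ?thesis using tt tc by simp
      qed
      then have "c \<noteq> t" "c \<noteq> t \<otimes> (t \<otimes> t)" using that t(2) by auto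
      then show ?thesis using that Z by auto
    qed
    have genC: "?Z \<subseteq> generate G S" if "t \<in> generate G S" "S \<subseteq> carrier G" for S
      unfolding Z using that generate.one[of G S] by (auto intro: mult_generate)
    show ?thesis
    proof (cases "\<exists>u\<in>carrier G. u \<notin> ?Z \<and> u \<otimes> u \<notin> {\<one>, t \<otimes> t}")
      case True
      then obtain u where u: "u \<in> carrier G" "u \<notin> ?Z" "u \<otimes> u \<notin> {\<one>, t \<otimes> t}" by blast
      obtain y where y: "y \<in> carrier G" "u \<otimes> y \<noteq> y \<otimes> u" using u by (auto simp: group_center_def)
      obtain c where c: "c \<in> ?Z" "c \<otimes> c = \<one>" "y \<otimes> u = (u \<otimes> y) \<otimes> c" "u \<otimes> y = y \<otimes> u \<longleftrightarrow> c = \<one>"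
        using central_squares_commutator[OF sq u(1) y(1)] .
      have ct: "c = t \<otimes> t" using inv2 c y by blast
      have ccr: "c \<in> carrier G" using c cc by blast
      have uu: "u \<otimes> u = t \<or> u \<otimes> u = t \<otimes> (t \<otimes> t)" using sq[OF u(1)] u(3) Z by auto
      have u4: "(u \<otimes> u) \<otimes> (u \<otimes> u) = c"
      proof -
        have "(t \<otimes> (t \<otimes> t)) \<otimes> (t \<otimes> (t \<otimes> t)) = (t \<otimes> t) \<otimes> (t \<otimes> t) \<otimes> (t \<otimes> t)" using tc by (simp add: m_assoc)
        then show ?thesis using uu tt tc ct by auto
      qed
      \<comment> \<open>Multiplying by \<open>t\<close> multiplies the square by t^2, so a square
        t^2 becomes trivial.\<close>
      have adjust: "\<exists>b\<in>carrier G. b \<otimes> b = \<one> \<and> b \<otimes> u = (u \<otimes> b) \<otimes> c \<and> u \<otimes> b \<noteq> b \<otimes> u"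
        if w: "w \<in> carrier G" "w \<otimes> u = (u \<otimes> w) \<otimes> c" "w \<otimes> w \<in> {\<one>, t \<otimes> t}" for w
      proof (cases "w \<otimes> w = \<one>")
        case True
        have "u \<otimes> w \<noteq> w \<otimes> u" using w u y c ccr by auto
        then show ?thesis using True w by blast
      next
        case False
        then have ww: "w \<otimes> w = t \<otimes> t" using w by simp
        have "(w \<otimes> t) \<otimes> (w \<otimes> t) = \<one>" using square_central_mult[OF w(1) t(1)] ww tt by simp
        moreover have wt: "(w \<otimes> t) \<otimes> u = (u \<otimes> (w \<otimes> t)) \<otimes> c"
        proof -
          have "(w \<otimes> t) \<otimes> u = (w \<otimes> u) \<otimes> t"
            using center_commute[OF t(1) u(1)] w(1) u(1) tc by (simp add: m_assoc)
          also have "\<dots> = u \<otimes> w \<otimes> (c \<otimes> t)" unfolding w(2) using w u tc ccr by (simp add: m_assoc)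
          also have "c \<otimes> t = t \<otimes> c" using center_commute[OF c(1) tc] .
          finally show ?thesis using w u tc ccr by (simp add: m_assoc)
        qed
        moreover have "u \<otimes> (w \<otimes> t) \<noteq> (w \<otimes> t) \<otimes> u" unfolding wt using w u tc ccr y c by auto
        ultimately show ?thesis using w tc by (intro bexI[of _ "w \<otimes> t"]) auto
      qed
      have "\<exists>b\<in>carrier G. b \<otimes> b = \<one> \<and> b \<otimes> u = (u \<otimes> b) \<otimes> c \<and> u \<otimes> b \<noteq> b \<otimes> u"
      proof (cases "y \<otimes> y \<in> {\<one>, t \<otimes> t}")
        case True
        then show ?thesis using adjust[OF y(1) c(3)] by blast
      next
        case False
        then have yy: "y \<otimes> y = t \<or> y \<otimes> y = t \<otimes> (t \<otimes> t)" using sq[OF y(1)] Z by auto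
        \<comment> \<open>If y^2 also generates the center, then u^2 y^2 and hence (uy)^2 lies in
          {1, t^2}, and \<open>u \<otimes> y\<close> takes the place of \<open>y\<close>.\<close>
        have "(u \<otimes> y) \<otimes> (u \<otimes> y) = (u \<otimes> u) \<otimes> (y \<otimes> y) \<otimes> (t \<otimes> t)"
          using square_mult[OF u(1) y(1) c(1,3)] ct by simp
        moreover have "(u \<otimes> u) \<otimes> (y \<otimes> y) \<in> {\<one>, t \<otimes> t}" using uu yy tc tt by (auto simp: m_assoc)
        ultimately have "(u \<otimes> y) \<otimes> (u \<otimes> y) \<in> {\<one>, t \<otimes> t}" using tt tc by auto
        moreover have "(u \<otimes> y) \<otimes> u = (u \<otimes> (u \<otimes> y)) \<otimes> c" using c(3) u y ccr by (simp add: m_assoc)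
        ultimately show ?thesis using adjust[of "u \<otimes> y"] u y by blast
      qed
      then obtain b where b: "b \<in> carrier G" "b \<otimes> b = \<one>" "b \<otimes> u = (u \<otimes> b) \<otimes> c" "u \<otimes> b \<noteq> b \<otimes> u" by blast
      have S: "{u, b} \<subseteq> carrier G" using u b by simp
      have ug: "u \<in> generate G {u, b}" "b \<in> generate G {u, b}" by (auto intro: generate.incl)
      have "t \<in> generate G {u, b}"
      proof (cases "u \<otimes> u = t")
        case True
        then show ?thesis using ug mult_generate[OF S ug(1) ug(1)] by simp
      next
        case False
        then have "u \<otimes> u = t \<otimes> (t \<otimes> t)" using uu by simp
        then have "inv (u \<otimes> u) = t" using tc tt by (intro inv_equality) (auto simp: m_assoc)
        then show ?thesis using inv_generate[OF S mult_generate[OF S ug(1) ug(1)]] by simp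
      qed
      then have gen: "generate G {u, b} = carrier G"
        using genC[OF _ S] ug S u(1) b(1,4) by (intro genZ[of u b]) auto
      have u5: "u [^] (5::nat) = u \<otimes> c" using u4 u(1) by (simp add: numeral_eq_Suc m_assoc)
         (metis (no_types, opaque_lifting) c(1) center_commute m_assoc m_closed u4)
      have "u [^] (8::nat) = (u [^] (4::nat)) \<otimes> (u [^] (4::nat))" using u(1) by (simp add: nat_pow_mult)
      then have u8: "u [^] (8::nat) = \<one>" using four_pow[OF u(1)] u4 c(2) by simp
      have bub: "b \<otimes> (u \<otimes> b) = u \<otimes> c"
      proof -
        have "b \<otimes> (u \<otimes> b) = (b \<otimes> u) \<otimes> b" using u(1) b(1) by (simp add: m_assoc)
        also have "\<dots> = u \<otimes> (b \<otimes> (c \<otimes> b))" unfolding b(3) using u b ccr by (simp add: m_assoc)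
        also have "c \<otimes> b = b \<otimes> c" using center_commute[OF c(1) b(1)] .
        finally show ?thesis using b u ccr by (simp add: m_assoc[symmetric])
      qed
      have "G \<cong> M_16"
        using iso_M_16[OF fin ord u(1) b(1) gen u8 _] u5 bub b by (simp add: numeral_2_eq_2)
      then show ?thesis by blast
    next
      case False
      then have sq2: "u \<otimes> u = \<one> \<or> u \<otimes> u = t \<otimes> t" if "u \<in> carrier G" "u \<notin> ?Z" for u using that by auto
      obtain x y where xy: "x \<in> carrier G" "y \<in> carrier G" "x \<otimes> y \<noteq> y \<otimes> x" using na by blast
      have adjust: "\<exists>w\<in>?Z. (u \<otimes> w) \<otimes> (u \<otimes> w) = \<one>" if u: "u \<in> carrier G" "u \<notin> ?Z" for u
      proof (cases "u \<otimes> u = \<one>")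
        case True
        then show ?thesis using u Z1 by (intro bexI[of _ \<one>]) auto
      next
        case False
        then have "(u \<otimes> t) \<otimes> (u \<otimes> t) = \<one>" using sq2[OF u] square_central_mult[OF u(1) t(1)] tt by simp
        then show ?thesis using t(1) by blast
      qed
      have "x \<notin> ?Z" "y \<notin> ?Z" using xy center_commute by metis+
      then obtain v w where vw: "v \<in> ?Z" "(x \<otimes> v) \<otimes> (x \<otimes> v) = \<one>" "w \<in> ?Z" "(y \<otimes> w) \<otimes> (y \<otimes> w) = \<one>"
        using adjust xy by meson
      define b where "b = x \<otimes> v"
      define c where "c = y \<otimes> w"
      have b: "b \<in> carrier G" "b \<otimes> b = \<one>" and c: "c \<in> carrier G" "c \<otimes> c = \<one>"
        using vw xy cc unfolding b_def c_def by auto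
      have bc: "b \<otimes> c \<noteq> c \<otimes> b"
      proof
        assume e: "b \<otimes> c = c \<otimes> b"
        have v: "v \<in> carrier G" "w \<in> carrier G" using vw cc by auto
        have com: "v \<otimes> g = g \<otimes> v" "w \<otimes> g = g \<otimes> w" if "g \<in> carrier G" for g using vw center_commute that by auto
        have "b \<otimes> c = (x \<otimes> y) \<otimes> (v \<otimes> w)" unfolding b_def c_def using xy v com(1)[of y]
          by (metis m_assoc m_closed)
        moreover have "c \<otimes> b = (y \<otimes> x) \<otimes> (v \<otimes> w)" unfolding b_def c_def using xy v com(2)[of x] com(1)[of w]
          by (metis m_assoc m_closed)
        ultimately show False using e xy v by simp
      qed
      obtain d where d: "d \<in> ?Z" "d \<otimes> d = \<one>" "b \<otimes> c = (c \<otimes> b) \<otimes> d" "c \<otimes> b = b \<otimes> c \<longleftrightarrow> d = \<one>"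
        using central_squares_commutator[OF sq c(1) b(1)] .
      have dt: "d = t \<otimes> t" using inv2 d bc by auto
      have S: "{t, b, c} \<subseteq> carrier G" using tc b c by simp
      have gen: "generate G {t, b, c} = carrier G"
        using genC[OF _ S] S b c bc by (intro genZ[of b c]) (auto intro: generate.incl)
      have "b \<otimes> c = t [^] (2::nat) \<otimes> (c \<otimes> b)"
        using d(3) dt center_commute[OF d(1), of "c \<otimes> b"] b c tc by (simp add: numeral_2_eq_2)
      then have "G \<cong> D8_central_Z4"
        using iso_D8_central_Z4[OF fin ord tc b(1) c(1) gen t4] b c center_commute[OF t(1)] by (simp add: numeral_2_eq_2)
      then show ?thesis by blast
    qed
  next
    case False
    then have Z2: "t \<otimes> t = \<one>" if "t \<in> ?Z" for t using that by blast
    have Z_eq: "?Z = {\<one>, c, d, c \<otimes> d}" if "c \<in> ?Z" "d \<in> ?Z" "c \<noteq> \<one>" "d \<noteq> \<one>" "c \<noteq> d" for c d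
    proof (rule set4_eq[OF Z4])
      have cd: "c \<in> carrier G" "d \<in> carrier G" using that cc by auto
      show "{\<one>, c, d, c \<otimes> d} \<subseteq> ?Z" using that Z1 Zm by auto
      have "\<one> \<noteq> c \<otimes> d"
      proof
        assume "\<one> = c \<otimes> d"
        then have "c \<otimes> c = c \<otimes> d" using Z2 that by simp
        then show False using that cd by simp
      qed
      then show "distinct [\<one>, c, d, c \<otimes> d]" using that cd by auto
    qed
    have Zc: "u \<otimes> v = v \<otimes> u" if "u \<in> ?Z" "v \<in> ?Z" for u v using that center_commute cc by blast
    show ?thesis
    proof (cases "\<exists>x\<in>carrier G. \<exists>y\<in>carrier G. \<exists>c\<in>?Z. y \<otimes> x = (x \<otimes> y) \<otimes> c \<and> c \<noteq> \<one> \<and> x \<otimes> x \<notin> {\<one>, c}")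
      case True
      then obtain x y c where x: "x \<in> carrier G" and y: "y \<in> carrier G" and c: "c \<in> ?Z" and yx: "y \<otimes> x = (x \<otimes> y) \<otimes> c"
        and c1: "c \<noteq> \<one>" and xx: "x \<otimes> x \<notin> {\<one>, c}" by blast
      define d where "d = x \<otimes> x"
      have d: "d \<in> ?Z" "d \<noteq> \<one>" "d \<noteq> c" using sq[OF x] xx unfolding d_def by auto
      have Z: "?Z = {\<one>, c, d, c \<otimes> d}" using Z_eq[OF c d(1) c1 d(2)] d(3) by simp
      have ccr: "c \<in> carrier G" "d \<in> carrier G" using c d cc by auto
      have c2: "c \<otimes> c = \<one>" "d \<otimes> d = \<one>" using Z2 c d by auto
      have cd: "d \<otimes> c = c \<otimes> d" using Zc c d by blast
      have xy: "x \<otimes> y = (y \<otimes> x) \<otimes> c" unfolding yx using x y ccr c2 by (simp add: m_assoc)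
      have ne: "x \<otimes> y \<noteq> y \<otimes> x" unfolding yx using x y ccr c1 by simp
      have sxy: "(x \<otimes> y) \<otimes> (x \<otimes> y) = d \<otimes> (y \<otimes> y) \<otimes> c" using square_mult[OF x y c yx] by (simp add: d_def)
      have gen: "generate G {a, b} = carrier G"
        if ab: "a \<in> carrier G" "b \<in> carrier G" "a \<otimes> b \<noteq> b \<otimes> a" "c \<in> generate G {a, b}" "d \<in> generate G {a, b}" for a b
      proof (rule genZ[OF ab(1-3)])
        have S: "{a, b} \<subseteq> carrier G" using ab by simp
        then show "{a, b} \<subseteq> carrier G" .
        show "?Z \<subseteq> generate G {a, b}" unfolding Z using ab mult_generate[OF S] generate.one[of G "{a,b}"] by auto
      qed (auto intro: generate.incl)
      have genm: "a \<otimes> a \<in> generate G {a, b}" "b \<otimes> b \<in> generate G {a, b}"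
        "(a \<otimes> a) \<otimes> (b \<otimes> b) \<in> generate G {a, b}" if "a \<in> carrier G" "b \<in> carrier G" for a b
      proof -
        have S: "{a, b} \<subseteq> carrier G" using that by simp
        note m = mult_generate[OF S]
        have "a \<in> generate G {a, b}" "b \<in> generate G {a, b}" by (auto intro: generate.incl)
        then show "a \<otimes> a \<in> generate G {a, b}" "b \<otimes> b \<in> generate G {a, b}"
          "(a \<otimes> a) \<otimes> (b \<otimes> b) \<in> generate G {a, b}" using m by blast+
      qed
      have SG: "G \<cong> SG_16_3"
        if b: "b \<in> carrier G" "b \<otimes> x = (x \<otimes> b) \<otimes> c" "b \<otimes> b = c \<otimes> d" for b
      proof (rule iso_SG_16_3[OF fin ord x b(1)])
        have ne': "x \<otimes> b \<noteq> b \<otimes> x" unfolding b(2) using x b ccr c1 by simp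
        have "(b \<otimes> b) \<otimes> (x \<otimes> x) = c" using b(3) ccr c2 by (simp add: d_def[symmetric] m_assoc)
        then have "c \<in> generate G {x, b}" using genm(3)[OF b(1) x] by (simp add: insert_commute)
        moreover have "d \<in> generate G {x, b}" using genm(1)[OF x b(1)] by (simp add: d_def)
        ultimately show "generate G {x, b} = carrier G" using gen[OF x b(1) ne'] by blast
        have cdcd: "(c \<otimes> d) \<otimes> (c \<otimes> d) = \<one>" using Z2 Zm c d by blast
        show "x [^] (4::nat) = \<one>" "b [^] (4::nat) = \<one>"
          using four_pow[OF x] four_pow[OF b(1)] b(3) c2 cdcd by (simp_all add: d_def[symmetric])
        have s: "(x \<otimes> b) \<otimes> (x \<otimes> b) = \<one>"
        proof -
          have "(x \<otimes> b) \<otimes> (x \<otimes> b) = d \<otimes> (c \<otimes> d) \<otimes> c" using square_mult[OF x b(1) c b(2)] b(3) by (simp add: d_def)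
          also have "\<dots> = (d \<otimes> c) \<otimes> (d \<otimes> c)" using ccr by (simp add: m_assoc)
          also have "\<dots> = \<one>" using cd cdcd by simp
          finally show ?thesis .
        qed
        have "inv (x \<otimes> b) = x \<otimes> b" using s x b by (intro inv_equality) auto
        then show "x \<otimes> b = inv b \<otimes> inv x" using x b by (simp add: inv_mult_group)
        have ib: "inv b = b \<otimes> (c \<otimes> d)"
        proof (rule inv_equality)
          have "b \<otimes> (c \<otimes> d) \<otimes> b = (b \<otimes> b) \<otimes> (c \<otimes> d)"
            using center_commute[OF Zm[OF c d(1)] b(1)] b(1) ccr by (simp add: m_assoc)
          then show "b \<otimes> (c \<otimes> d) \<otimes> b = \<one>" using b(3) cdcd by simp
        qed (use b ccr in auto)
        have ix: "inv x = x \<otimes> d"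
        proof (rule inv_equality)
          show "x \<otimes> d \<otimes> x = \<one>" using center_commute[OF d(1) x] x ccr c2 by (simp add: m_assoc) (simp add: m_assoc[symmetric] d_def[symmetric])
        qed (use x ccr in auto)
        show "x \<otimes> inv b = b \<otimes> inv x" unfolding ib ix using b(2) x b(1) ccr by (simp add: m_assoc[symmetric])
      qed
      have ZZ: "G \<cong> Z4_semidirect_Z4"
        if a: "a \<in> carrier G" "x \<otimes> a = (a \<otimes> x) \<otimes> c" "a \<otimes> a = c" for a
      proof (rule iso_Z4_semidirect_Z4[OF fin ord a(1) x])
        have ne': "a \<otimes> x \<noteq> x \<otimes> a" unfolding a(2) using x a ccr c1 by simp
        have "c \<in> generate G {a, x}" "d \<in> generate G {a, x}" using genm(1,2)[OF a(1) x] a(3) by (simp_all add: d_def)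
        then show "generate G {a, x} = carrier G" using gen[OF a(1) x ne'] by blast
        show "x \<otimes> (a \<otimes> inv x) = inv a" using commutator_conj_inverse[OF x a(1) c a(2,3) c2(1)] .
        show "a [^] (4::nat) = \<one>" using four_pow[OF a(1)] a(3) c2 by simp
        show "x [^] (4::nat) = \<one>" using four_pow[OF x] c2 by (simp add: d_def[symmetric])
      qed
      have xyx: "(x \<otimes> y) \<otimes> x = (x \<otimes> (x \<otimes> y)) \<otimes> c" using yx x y ccr by (simp add: m_assoc)
      have xxy: "x \<otimes> (x \<otimes> y) = ((x \<otimes> y) \<otimes> x) \<otimes> c" unfolding xyx using x y ccr c2 by (simp add: m_assoc)
      \<comment> \<open>Replacing \<open>y\<close> by \<open>x \<otimes> y\<close> multiplies the
        square by \<open>c \<otimes> d\<close>. This exchanges 1 with \<open>c \<otimes> d\<close>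
        and \<open>c\<close> with \<open>d\<close>, so that two of the four values remain to be
        treated.\<close>
      have "y \<otimes> y \<in> {\<one>, c, d, c \<otimes> d}" using sq[OF y] Z by simp
      then consider "y \<otimes> y = \<one>" | "y \<otimes> y = c" | "y \<otimes> y = d" | "y \<otimes> y = c \<otimes> d" by auto
      then show ?thesis
      proof cases
        case 1
        then show ?thesis using SG[of "x \<otimes> y"] sxy cd xyx x y ccr by simp
      next
        case 2
        then show ?thesis using ZZ[of y] xy y by simp
      next
        case 3
        then have "(x \<otimes> y) \<otimes> (x \<otimes> y) = c" using sxy c2 ccr by simp
        then show ?thesis using ZZ[of "x \<otimes> y"] xxy x y by simp
      next
        case 4
        then show ?thesis using SG[of y] yx y by simp
      qed
    next
      case False
      then have sq2: "x \<otimes> x \<in> {\<one>, c}"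
        if "x \<in> carrier G" "y \<in> carrier G" "c \<in> ?Z" "y \<otimes> x = (x \<otimes> y) \<otimes> c" "c \<noteq> \<one>" for x y c
        using that by blast
      obtain x y where x: "x \<in> carrier G" and y: "y \<in> carrier G" and ne: "x \<otimes> y \<noteq> y \<otimes> x" using na by blast
      obtain c where c: "c \<in> ?Z" "c \<otimes> c = \<one>" "y \<otimes> x = (x \<otimes> y) \<otimes> c" "x \<otimes> y = y \<otimes> x \<longleftrightarrow> c = \<one>"
        using central_squares_commutator[OF sq x y] .
      have c1: "c \<noteq> \<one>" using ne c(4) by blast
      have ccr: "c \<in> carrier G" using c cc by blast
      have xy: "x \<otimes> y = (y \<otimes> x) \<otimes> c" unfolding c(3) using x y ccr c(2) by (simp add: m_assoc)
      have xx: "x \<otimes> x \<in> {\<one>, c}" "y \<otimes> y \<in> {\<one>, c}" using sq2[OF x y c(1,3) c1] sq2[OF y x c(1) xy c1] by auto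
      have "\<not> ?Z \<subseteq> {\<one>, c}"
      proof
        assume "?Z \<subseteq> {\<one>, c}"
        then have "card ?Z \<le> card {\<one>, c}" by (intro card_mono) auto
        also have "\<dots> \<le> 2" by (simp add: card_insert_if)
        finally show False using Z4 by simp
      qed
      then obtain d where d: "d \<in> ?Z" "d \<noteq> \<one>" "d \<noteq> c" by blast
      have Z: "?Z = {\<one>, c, d, c \<otimes> d}" using Z_eq[OF c(1) d(1) c1 d(2)] d(3) by simp
      define H where "H = generate G {x, y}"
      have S: "{x, y} \<subseteq> carrier G" using x y by simp
      have sub: "subgroup H G" unfolding H_def by (rule generate_is_subgroup[OF S])
      have HG: "H \<subseteq> carrier G" using sub by (rule subgroup.subset)
      have xH: "x \<in> H" "y \<in> H" unfolding H_def by (auto intro: generate.incl)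
      have cH: "c \<in> H"
      proof -
        have "inv (x \<otimes> y) \<otimes> (y \<otimes> x) = c" using c(3) x y ccr by simp
        then show ?thesis using xH sub by (metis subgroup.m_closed subgroup.m_inv_closed)
      qed
      interpret H: group "G\<lparr>carrier := H\<rparr>" using subgroup_imp_group[OF sub] .
      have genH: "generate (G\<lparr>carrier := H\<rparr>) {x, y} = H"
        using generate_consistent[of "{x, y}" H] xH sub by (simp add: H_def)
      have cZH: "c \<in> group_center (G\<lparr>carrier := H\<rparr>)" using cH c(1) HG by (auto simp: group_center_def)
      have "finite H" using HG fin finite_subset by blast
      have "order (G\<lparr>carrier := H\<rparr>) \<le> 4 * card {\<one>, c}"
      proof (rule H.order_le_4_central(2)[of _ "{x, y}" x y c])
        show "{\<one>, c} \<subseteq> group_center (G\<lparr>carrier := H\<rparr>)"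
          using cZH subgroup.one_closed[OF H.center_subgroup] by simp
      qed (use genH xH xx c ccr in auto)
      then have H8: "card H \<le> 8" using c1 by (simp add: order_def)
      \<comment> \<open>If \<open>d\<close> were in \<open>H\<close>, then \<open>H\<close> would
        contain the center and be the whole group, although it has at most 8 elements.\<close>
      have dH: "d \<notin> H"
      proof
        assume "d \<in> H"
        then have "?Z \<subseteq> H" unfolding Z using cH sub by (auto intro: subgroup.m_closed subgroup.one_closed)
        then have "H = carrier G" using genZ[OF x y ne S] xH unfolding H_def by blast
        then show False using H8 ord by (simp add: order_def)
      qed
      \<comment> \<open>Five elements suffice: an order between 5 and 8 that divides 16 is
        8.\<close>
      have "card {\<one>, c, x, y, x \<otimes> y} = 5"
      proof -
        have "x \<noteq> \<one>" "y \<noteq> \<one>" "x \<noteq> y" using ne x y by auto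
        moreover have "x \<noteq> c" "y \<noteq> c" using ne x y center_commute[OF c(1)] by metis+
        moreover have "x \<otimes> y \<noteq> x" "x \<otimes> y \<noteq> y" using \<open>x \<noteq> \<one>\<close> \<open>y \<noteq> \<one>\<close> x y by auto
        moreover have "x \<otimes> y \<notin> {\<one>, c}"
        proof
          assume "x \<otimes> y \<in> {\<one>, c}"
          then have "x \<otimes> y \<in> ?Z" using Z1 c by auto
          then have "(x \<otimes> y) \<otimes> x = x \<otimes> (x \<otimes> y)" using center_commute x by blast
          then show False using ne x y by (simp add: m_assoc)
        qed
        ultimately show ?thesis using c1 by (auto simp: card_insert_if)
      qed
      moreover have "{\<one>, c, x, y, x \<otimes> y} \<subseteq> H" using xH cH sub by (auto intro: subgroup.m_closed subgroup.one_closed)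
      ultimately have "5 \<le> card H" using \<open>finite H\<close> by (metis card_mono)
      moreover have "card H dvd 16" using subgroup_card_dvd[OF sub] ord by simp
      ultimately have "card H = 8"
      proof -
        have "card H \<in> {5, 6, 7, 8}" using \<open>5 \<le> card H\<close> H8 by auto
        then show ?thesis using \<open>card H dvd 16\<close> by auto
      qed
      have "G\<lparr>carrier := H\<rparr> \<cong> dihedral_group 4 \<or> G\<lparr>carrier := H\<rparr> \<cong> dicyclic_group 2"
      proof (rule H.order_8_cases[of x y c])
        show "order (G\<lparr>carrier := H\<rparr>) = 8" using \<open>card H = 8\<close> by (simp add: order_def)
      qed (use genH xH xx c cZH \<open>finite H\<close> in auto)
      moreover have "G \<cong> integer_mod_group 2 \<times>\<times> (G\<lparr>carrier := H\<rparr>)"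
        using iso_Z2_DirProd[OF fin sub _ d(1) Z2[OF d(1)] dH] \<open>card H = 8\<close> ord by simp
      moreover have "G \<cong> integer_mod_group 2 \<times>\<times> K"
        if "G \<cong> integer_mod_group 2 \<times>\<times> (G\<lparr>carrier := H\<rparr>)" "G\<lparr>carrier := H\<rparr> \<cong> K" for K :: "two_gens word set monoid"
        using that iso_trans group.DirProd_iso_trans[OF group_integer_mod_group iso_refl] by blast
      ultimately show ?thesis by blast
    qed
  qed
qed

end

section \<open>Groups whose commuting graph has no clique on five vertices\<close>

text \<open>This isolates the one consequence of planarity on which the classification rests; what
  follows is pure group theory.\<close>

locale small_cliques = group G for G (structure) +
  assumes fin: "finite (carrier G)"
    and nonabelian: "\<exists>x\<in>carrier G. x \<notin> group_center G"
    and clique: "\<And>S. S \<subseteq> carrier G - group_center G \<Longrightarrow> (\<And>x y. x \<in> S \<Longrightarrow> y \<in> S \<Longrightarrow> x \<otimes> y = y \<otimes> x) \<Longrightarrow> card S \<le> 4"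

lemma planar_small_cliques:
  assumes "group G" "finite (carrier G)" "\<not> comm_group G" "planar (commuting_graph G)"
  shows "small_cliques G"
proof -
  interpret group G by fact
  show ?thesis
  proof
    show "finite (carrier G)" by fact
    show "\<exists>x\<in>carrier G. x \<notin> group_center G"
    proof (rule ccontr)
      assume "\<not> ?thesis"
      then have "comm_group G" by (intro group_comm_groupI) (auto simp: group_center_def)
      then show False using assms(3) by simp
    qed
    fix S assume S: "S \<subseteq> carrier G - group_center G" "\<And>x y. x \<in> S \<Longrightarrow> y \<in> S \<Longrightarrow> x \<otimes>\<^bsub>G\<^esub> y = y \<otimes>\<^bsub>G\<^esub> x"
    show "card S \<le> 4"
    proof (rule ccontr)
      assume "\<not> card S \<le> 4"
      then have "5 \<le> card S" by simp
      then obtain K where K: "K \<subseteq> S" "card K = 5" by (rule obtain_subset_with_card_n)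
      define V where "V = carrier G - group_center G"
      define E where "E = {{x, y} | x y. x \<in> V \<and> y \<in> V \<and> x \<noteq> y \<and> x \<otimes>\<^bsub>G\<^esub> y = y \<otimes>\<^bsub>G\<^esub> x}"
      have "planar (V, E)" using assms(4) by (simp add: commuting_graph_def Let_def V_def E_def)
      moreover have "K \<subseteq> V" using K(1) S(1) V_def by blast
      moreover have "{x, y} \<in> E" if "x \<in> K" "y \<in> K" "x \<noteq> y" for x y
        unfolding E_def using that S(2)[of x y] K(1) \<open>K \<subseteq> V\<close> by blast
      ultimately have "card K \<noteq> 5" by (rule planar_no_K5)
      then show False using K by simp
    qed
  qed
qed

context small_cliques
begin

abbreviation Z where "Z \<equiv> group_center G"

lemma finite_Z: "finite Z" by (rule finite_subset[OF _ fin]) (use center_carrier in blast)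

lemma Z_one: "\<one> \<in> Z" using center_subgroup by (rule subgroup.one_closed)
lemma Z_mult: "u \<in> Z \<Longrightarrow> v \<in> Z \<Longrightarrow> u \<otimes> v \<in> Z" using center_subgroup by (rule subgroup.m_closed)
lemma Z_inv: "u \<in> Z \<Longrightarrow> inv u \<in> Z" using center_subgroup by (rule subgroup.m_inv_closed)

lemma Z_mult_iff:
  assumes "z \<in> Z" "x \<in> carrier G"
  shows "z \<otimes> x \<in> Z \<longleftrightarrow> x \<in> Z" "x \<otimes> z \<in> Z \<longleftrightarrow> x \<in> Z"
proof -
  have zc: "z \<in> carrier G" using assms center_carrier by blast
  show 1: "z \<otimes> x \<in> Z \<longleftrightarrow> x \<in> Z"
  proof
    assume "z \<otimes> x \<in> Z"
    then have "inv z \<otimes> (z \<otimes> x) \<in> Z" using Z_mult Z_inv assms by blast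
    then show "x \<in> Z" using zc assms by simp
  qed (use assms Z_mult in auto)
  then show "x \<otimes> z \<in> Z \<longleftrightarrow> x \<in> Z" using center_commute[OF assms] by simp
qed

lemma inv_Z_iff: "x \<in> carrier G \<Longrightarrow> inv x \<in> Z \<longleftrightarrow> x \<in> Z"
  using Z_inv[of x] Z_inv[of "inv x"] by auto

text \<open>The cosets of the center by commuting representatives together form a commuting set of
  noncentral elements, and distinct representatives contribute disjoint cosets.\<close>

lemma clique_cosets:
  assumes Q: "Q \<subseteq> carrier G" "finite Q" and comm: "\<And>p q. p \<in> Q \<Longrightarrow> q \<in> Q \<Longrightarrow> p \<otimes> q = q \<otimes> p"
    and nZ: "\<And>q. q \<in> Q \<Longrightarrow> q \<notin> Z" and diff: "\<And>p q. p \<in> Q \<Longrightarrow> q \<in> Q \<Longrightarrow> p \<noteq> q \<Longrightarrow> inv p \<otimes> q \<notin> Z"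
  shows "card Q * card Z \<le> 4"
proof -
  let ?S = "(\<lambda>(q, z). q \<otimes> z) ` (Q \<times> Z)"
  have c: "z \<in> carrier G" if "z \<in> Z" for z using that by (rule center_carrier)
  have inj: "inj_on (\<lambda>(q, z). q \<otimes> z) (Q \<times> Z)"
  proof (rule inj_onI, clarify)
    fix p z q w assume pq: "p \<in> Q" "q \<in> Q" and zw: "z \<in> Z" "w \<in> Z" and eq: "p \<otimes> z = q \<otimes> w"
    have cc: "p \<in> carrier G" "q \<in> carrier G" "z \<in> carrier G" "w \<in> carrier G" using pq zw Q c by auto
    have "q = p \<otimes> (z \<otimes> inv w)" using eq cc by (metis inv_closed m_assoc m_closed r_inv r_one)
    then have "inv p \<otimes> q = z \<otimes> inv w" using cc by simp
    then have "inv p \<otimes> q \<in> Z" using zw Z_mult Z_inv by simp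
    then have "p = q" using diff pq by blast
    then show "p = q \<and> z = w" using eq cc by simp
  qed
  have "card ?S \<le> 4"
  proof (rule clique)
    show "?S \<subseteq> carrier G - Z"
      using Q nZ Z_mult_iff(2) c by auto
    fix x y assume "x \<in> ?S" "y \<in> ?S"
    then obtain p z q w where x: "x = p \<otimes> z" "y = q \<otimes> w" "p \<in> Q" "q \<in> Q" "z \<in> Z" "w \<in> Z" by auto
    have cc: "p \<in> carrier G" "q \<in> carrier G" "z \<in> carrier G" "w \<in> carrier G" using x Q c by auto
    have "x \<otimes> y = (p \<otimes> q) \<otimes> (z \<otimes> w)" unfolding x(1,2)
      using center_commute[OF x(5) cc(2)] cc by (metis m_assoc m_closed)
    moreover have "y \<otimes> x = (q \<otimes> p) \<otimes> (z \<otimes> w)" unfolding x(1,2)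
      using center_commute[OF x(6) cc(1)] center_commute[OF x(5) cc(4)] cc by (metis m_assoc m_closed)
    ultimately show "x \<otimes> y = y \<otimes> x" using comm x by simp
  qed
  then show ?thesis using card_image[OF inj] by (simp add: card_cartesian_product)
qed

lemma card_Z_le_4: "card Z \<le> 4"
proof -
  obtain x where "x \<in> carrier G" "x \<notin> Z" using nonabelian by blast
  then show ?thesis using clique_cosets[of "{x}"] by simp
qed

text \<open>For |Z| >= 3 a commuting set has room for only one noncentral coset of the center,
  whereas \<open>x\<close> and \<open>y\<close> would contribute two.\<close>

lemma centralizer_coset:
  assumes "card Z \<ge> 3" "x \<in> carrier G" "x \<notin> Z" "y \<in> centralizer G x"
  shows "y \<in> Z \<or> inv x \<otimes> y \<in> Z"
proof (rule ccontr)
  assume n: "\<not> ?thesis"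
  have y: "y \<in> carrier G" "x \<otimes> y = y \<otimes> x" using assms(4) by (auto simp: centralizer_def)
  have "inv y \<otimes> x = inv (inv x \<otimes> y)" using y assms(2) by (simp add: inv_mult_group)
  then have "inv y \<otimes> x \<notin> Z" using n inv_Z_iff[of "inv x \<otimes> y"] y assms(2) by simp
  moreover have "x \<noteq> y" using n y Z_one assms(2) by auto
  ultimately have "card {x, y} * card Z \<le> 4" using assms n y by (intro clique_cosets) auto
  then show False using \<open>x \<noteq> y\<close> assms(1) by simp
qed

text \<open>The square commutes with \<open>x\<close>, and if it lay in the coset of
  \<open>x\<close>, then \<open>x\<close> would be central.\<close>

lemma square_central:
  assumes "card Z \<ge> 3" "x \<in> carrier G" shows "x \<otimes> x \<in> Z"
proof (cases "x \<in> Z")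
  case False
  have "x \<otimes> x \<in> centralizer G x" using assms by (simp add: centralizer_def m_assoc)
  then show ?thesis using centralizer_coset[OF assms False, of "x \<otimes> x"] assms(2) False by auto
qed (use Z_mult in auto)

lemma noncommuting: "\<exists>x\<in>carrier G. \<exists>y\<in>carrier G. x \<otimes> y \<noteq> y \<otimes> x"
  using nonabelian by (auto simp: group_center_def)

lemma centralizer_eq:
  assumes "x \<in> carrier G" "x \<notin> Z" "\<And>y. y \<in> centralizer G x \<Longrightarrow> y \<in> Z \<or> inv x \<otimes> y \<in> Z"
  shows "centralizer G x = Z \<union> (\<lambda>z. x \<otimes> z) ` Z" "card (centralizer G x) = 2 * card Z"
proof -
  show eq: "centralizer G x = Z \<union> (\<lambda>z. x \<otimes> z) ` Z"
  proof
    show "centralizer G x \<subseteq> Z \<union> (\<lambda>z. x \<otimes> z) ` Z"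
    proof
      fix y assume y: "y \<in> centralizer G x"
      then have "y = x \<otimes> (inv x \<otimes> y)" using assms(1) by (simp add: centralizer_def)
      then show "y \<in> Z \<union> (\<lambda>z. x \<otimes> z) ` Z" using assms(3)[OF y] by blast
    qed
    show "Z \<union> (\<lambda>z. x \<otimes> z) ` Z \<subseteq> centralizer G x"
      using center_subset_centralizer[OF assms(1)] subgroup.m_closed[OF centralizer_subgroup[OF assms(1)]] assms(1)
      by (auto simp: centralizer_mem)
  qed
  have "Z \<inter> (\<lambda>z. x \<otimes> z) ` Z = {}" using Z_mult_iff(2)[OF _ assms(1)] assms(2) by auto
  then show "card (centralizer G x) = 2 * card Z"
    unfolding eq using finite_Z card_coset_center[OF assms(1)] by (simp add: card_Un_disjoint)
qed

text \<open>Since squares are central, commutators have order dividing 2; as elements of a center of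
  order 3 they also have order dividing 3.\<close>

lemma card_Z_not_3: "card Z \<noteq> 3"
proof
  assume Z3: "card Z = 3"
  obtain x y where x: "x \<in> carrier G" and y: "y \<in> carrier G" and ne: "x \<otimes> y \<noteq> y \<otimes> x" using noncommuting by blast
  have sq: "u \<otimes> u \<in> Z" if "u \<in> carrier G" for u using square_central that Z3 by simp
  obtain c where c: "c \<in> Z" "c \<otimes> c = \<one>" "y \<otimes> x = (x \<otimes> y) \<otimes> c" "x \<otimes> y = y \<otimes> x \<longleftrightarrow> c = \<one>"
    using central_squares_commutator[OF sq x y] .
  have cc: "c \<in> carrier G" using c(1) by (rule center_carrier)
  have "c [^] (3::nat) = \<one>" using subgroup_pow_card[OF center_subgroup finite_Z c(1)] Z3 by simp
  then have "c \<otimes> (c \<otimes> c) = \<one>" using cc by (simp add: numeral_eq_Suc m_assoc)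
  then show False using c ne cc by simp
qed

lemma noncentral_conj_closed:
  assumes "x \<in> carrier G" "g \<in> carrier G"
  shows "g \<otimes> x \<otimes> inv g \<in> Z \<longleftrightarrow> x \<in> Z"
proof
  assume z: "g \<otimes> x \<otimes> inv g \<in> Z"
  define w where "w = g \<otimes> x \<otimes> inv g"
  have wZ: "w \<in> Z" using z unfolding w_def .
  have w: "w \<in> carrier G" "w \<otimes> g = g \<otimes> w" using assms center_commute[OF z assms(2)] by (simp_all add: w_def)
  have "x = inv g \<otimes> (w \<otimes> g)" unfolding w_def using assms by (simp add: m_assoc)
  also have "\<dots> = w" using w assms by simp
  finally show "x \<in> Z" using wZ by simp
next
  assume z: "x \<in> Z"
  have "g \<otimes> x \<otimes> inv g = x" using center_commute[OF z assms(2)] assms by (simp add: m_assoc flip: center_commute[OF z assms(2)])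
  then show "g \<otimes> x \<otimes> inv g \<in> Z" using z by simp
qed

lemma centralizer_conj_card:
  assumes "x \<in> carrier G" "g \<in> carrier G"
  shows "card (centralizer G (g \<otimes> x \<otimes> inv g)) = card (centralizer G x)"
proof -
  have m: "g \<otimes> x \<otimes> inv g \<in> conj_class G x" using assms(2) by (auto simp: conj_class_def)
  then have c: "g \<otimes> x \<otimes> inv g \<in> carrier G" using assms by simp
  have "card (conj_class G x) * card (centralizer G (g \<otimes> x \<otimes> inv g)) = card (conj_class G x) * card (centralizer G x)"
    using card_conj_class[OF fin assms(1)] card_conj_class[OF fin c] conj_class_eq[OF assms(1) m] by simp
  moreover have "card (conj_class G x) \<noteq> 0"
    using conj_class_self[OF assms(1)] fin by (auto simp: conj_class_def card_eq_0_iff)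
  ultimately show ?thesis by simp
qed

lemma order_pos: "order G > 0" using fin by (simp add: order_gt_0_iff_finite)

lemma class_count:
  assumes "X = {x \<in> carrier G. x \<notin> Z \<and> card (centralizer G x) = d}"
  obtains k where "card X * d = k * order G" "\<And>x. k = 1 \<Longrightarrow> x \<in> X \<Longrightarrow> X = conj_class G x"
proof -
  have "\<exists>k. card X * d = k * order G \<and> (\<forall>x. k = 1 \<longrightarrow> x \<in> X \<longrightarrow> X = conj_class G x)"
  proof (rule card_conj_closed[OF fin])
    fix x g assume xg: "x \<in> X" "g \<in> carrier G"
    then have x: "x \<in> carrier G" "x \<notin> Z" "card (centralizer G x) = d" unfolding assms by auto
    show "g \<otimes> x \<otimes> inv g \<in> X" unfolding assms
      using x xg(2) noncentral_conj_closed[OF x(1) xg(2)] centralizer_conj_card[OF x(1) xg(2)] by simp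
  qed (auto simp: assms)
  then obtain k where "card X * d = k * order G" "\<forall>x. k = 1 \<longrightarrow> x \<in> X \<longrightarrow> X = conj_class G x" by blast
  then show ?thesis by (intro that[of k]) auto
qed

text \<open>All noncentral elements have centralizers of order 8, so with n = |G| the class equation
  reads 8(n - 4) = k n, and n = 8m gives m(8 - k) = 4; hence n is 16 or 32. For n = 32 the
  commutator is an alternating bilinear map from G/Z, of dimension 3 over the field with 2 elements,
  to the 2-dimensional Z. In dimension 3 every element of the exterior square is decomposable, so
  some pair that is independent modulo Z commutes, against the size of the centralizers. The proof
  finds this pair by hand.\<close>

lemma card_Z_4_order:
  assumes Z4: "card Z = 4"
  shows "order G = 16"
proof -
  have C: "centralizer G x = Z \<union> (\<lambda>z. x \<otimes> z) ` Z" "card (centralizer G x) = 8" if "x \<in> carrier G" "x \<notin> Z" for x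
    using centralizer_eq[OF that centralizer_coset[OF _ that]] Z4 by auto
  obtain k where k: "card {x \<in> carrier G. x \<notin> Z \<and> card (centralizer G x) = 8} * 8 = k * order G"
    by (rule class_count[OF HOL.refl, of 8])
  have "{x \<in> carrier G. x \<notin> Z \<and> card (centralizer G x) = 8} = carrier G - Z" using C by auto
  moreover have "Z \<subseteq> carrier G" using center_carrier by blast
  then have "card (carrier G - Z) = order G - 4" using finite_Z Z4 by (simp add: card_Diff_subset order_def)
  ultimately have eq: "(order G - 4) * 8 = k * order G" using k by simp
  obtain x where x: "x \<in> carrier G" "x \<notin> Z" using nonabelian by blast
  obtain m where m: "order G = 8 * m" using subgroup_card_dvd[OF centralizer_subgroup[OF x(1)]] C[OF x] by (auto elim: dvdE)
  have "16 \<le> order G" using proper_subgroup_card[OF fin centralizer_subgroup[OF x(1)]] noncentral_iff[OF x(1)] x(2) C[OF x] by simp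
  then have m2: "m \<ge> 2" using m by simp
  have "8 * m - 4 = k * m" using eq m by simp
  then have mk: "int m * (8 - int k) = 4" using m2 by (simp add: algebra_simps of_nat_diff flip: of_nat_mult)
  then have "m dvd 4" by (metis dvd_triv_left int_dvd_int_iff of_nat_numeral)
  then have "m \<le> 4" using dvd_imp_le by auto
  then have "m = 2 \<or> m = 4" using \<open>m dvd 4\<close> m2 by (cases "m = 3") auto
  moreover have "m \<noteq> 4"
  proof
    assume m4: "m = 4"
    have sq: "u \<otimes> u \<in> Z" if "u \<in> carrier G" for u using square_central that Z4 by simp
    have cc: "z \<in> carrier G" if "z \<in> Z" for z using that by (rule center_carrier)
    \<comment> \<open>The class of \<open>x\<close> has 32/8 = 4 elements and lies in the coset of
      \<open>x\<close>, so it is the whole coset: every central element is a commutator with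
      \<open>x\<close>.\<close>
    have surj: "\<exists>g\<in>carrier G. g \<otimes> x = (x \<otimes> g) \<otimes> w" if x: "x \<in> carrier G" "x \<notin> Z" and w: "w \<in> Z" for x w
    proof -
      have "card (conj_class G x) = 4" using card_conj_class[OF fin x(1)] C[OF x] m m4 by simp
      moreover have "conj_class G x \<subseteq> (\<lambda>z. x \<otimes> z) ` Z"
      proof
        fix y assume "y \<in> conj_class G x"
        then obtain g where g: "g \<in> carrier G" "y = g \<otimes> x \<otimes> inv g" by (auto simp: conj_class_def)
        obtain c where c: "c \<in> Z" "g \<otimes> x = (x \<otimes> g) \<otimes> c" using central_squares_commutator[OF sq x(1) g(1)] by metis
        have "y = x \<otimes> (g \<otimes> (c \<otimes> inv g))" unfolding g(2) c(2) using x g(1) cc[OF c(1)] by (simp add: m_assoc)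
        also have "c \<otimes> inv g = inv g \<otimes> c" using center_commute[OF c(1)] g(1) by simp
        finally show "y \<in> (\<lambda>z. x \<otimes> z) ` Z" using g(1) cc[OF c(1)] c(1) by simp
      qed
      ultimately have "conj_class G x = (\<lambda>z. x \<otimes> z) ` Z"
        using finite_Z Z4 card_coset_center[OF x(1)] by (intro card_subset_eq) auto
      then have "x \<otimes> w \<in> conj_class G x" using w by simp
      then obtain g where g: "g \<in> carrier G" "g \<otimes> x \<otimes> inv g = x \<otimes> w" by (auto simp: conj_class_def)
      then have "g \<otimes> x \<otimes> inv g \<otimes> g = x \<otimes> (w \<otimes> g)" using x cc[OF w] by (simp add: m_assoc)
      then have "g \<otimes> x = x \<otimes> (w \<otimes> g)" using x g(1) by (simp add: m_assoc)
      also have "w \<otimes> g = g \<otimes> w" using center_commute[OF w g(1)] .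
      finally show ?thesis using x g(1) cc[OF w] by (intro bexI[of _ g]) (simp add: m_assoc)
    qed
    \<comment> \<open>Commuting noncentral elements lie in the same coset of the center and hence
      have the same commutator with \<open>x\<close>.\<close>
    have indep: False
      if p: "p \<in> carrier G" "q \<in> carrier G" "p \<otimes> q = q \<otimes> p" and st: "s \<in> Z" "t \<in> Z" "s \<noteq> \<one>" "t \<noteq> \<one>" "s \<noteq> t"
        and pq: "p \<otimes> x = (x \<otimes> p) \<otimes> s" "q \<otimes> x = (x \<otimes> q) \<otimes> t" for p q s t
    proof -
      have "p \<notin> Z"
      proof
        assume "p \<in> Z"
        then have "(x \<otimes> p) \<otimes> s = x \<otimes> p \<otimes> \<one>" using pq(1) center_commute[of p x] x p by simp
        then show False using st(3) x p cc[OF st(1)] by simp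
      qed
      then have "q \<in> Z \<union> (\<lambda>z. p \<otimes> z) ` Z" using C(1)[OF p(1)] p by (auto simp: centralizer_def)
      moreover have "q \<notin> Z"
      proof
        assume "q \<in> Z"
        then have "(x \<otimes> q) \<otimes> t = x \<otimes> q \<otimes> \<one>" using pq(2) center_commute[of q x] x p by simp
        then show False using st(4) x p cc[OF st(2)] by simp
      qed
      ultimately obtain z where z: "z \<in> Z" "q = p \<otimes> z" by blast
      have "q \<otimes> x = (p \<otimes> x) \<otimes> z" unfolding z(2) using center_commute[OF z(1) x(1)] x p cc[OF z(1)] by (simp add: m_assoc)
      also have "\<dots> = (x \<otimes> p) \<otimes> (s \<otimes> z)" unfolding pq(1) using x p cc[OF z(1)] cc[OF st(1)] by (simp add: m_assoc)
      also have "s \<otimes> z = z \<otimes> s" using center_commute[OF st(1) cc[OF z(1)]] .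
      finally have "(x \<otimes> q) \<otimes> t = (x \<otimes> q) \<otimes> s" unfolding pq(2) using x p(1) cc[OF z(1)] cc[OF st(1)] by (simp add: z(2) m_assoc)
      then show False using st(5) x p cc[OF st(1)] cc[OF st(2)] by simp
    qed
    have "\<exists>c d. c \<in> Z \<and> d \<in> Z \<and> c \<noteq> \<one> \<and> d \<noteq> \<one> \<and> c \<noteq> d"
    proof -
      have "card (Z - {\<one>}) = 3" using Z4 finite_Z Z_one by simp
      then obtain p q r where "Z - {\<one>} = {p, q, r}" "p \<noteq> q" by (auto simp: card_Suc_eq numeral_eq_Suc)
      then have "p \<in> Z - {\<one>}" "q \<in> Z - {\<one>}" "p \<noteq> q" by simp_all
      then show ?thesis by blast
    qed
    then obtain c d where cd: "c \<in> Z" "d \<in> Z" "c \<noteq> \<one>" "d \<noteq> \<one>" "c \<noteq> d" by blast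
    obtain y u where y: "y \<in> carrier G" "y \<otimes> x = (x \<otimes> y) \<otimes> c" and u: "u \<in> carrier G" "u \<otimes> x = (x \<otimes> u) \<otimes> d"
      using surj[OF x] cd by meson
    obtain c' where c': "c' \<otimes> c' = \<one>" "c' \<in> Z" "y \<otimes> x = (x \<otimes> y) \<otimes> c'" using central_squares_commutator[OF sq x(1) y(1)] by metis
    have c2: "c \<otimes> c = \<one>" using c' y x cc cd(1) by simp
    obtain d' where d': "d' \<otimes> d' = \<one>" "d' \<in> Z" "u \<otimes> x = (x \<otimes> u) \<otimes> d'" using central_squares_commutator[OF sq x(1) u(1)] by metis
    have d2: "d \<otimes> d = \<one>" using d' u x cc cd(2) by simp
    note cdc = cc[OF cd(1)] cc[OF cd(2)]
    have Zeq: "Z = {\<one>, c, d, c \<otimes> d}"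
    proof (rule set4_eq[OF Z4])
      have "\<one> \<noteq> c \<otimes> d"
      proof
        assume "\<one> = c \<otimes> d"
        then have "c \<otimes> c = c \<otimes> d" using c2 by simp
        then show False using cd cdc by simp
      qed
      then show "distinct [\<one>, c, d, c \<otimes> d]" using cd cdc by auto
    qed (use cd Z_one Z_mult in auto)
    obtain w where w: "w \<in> Z" "u \<otimes> y = (y \<otimes> u) \<otimes> w" using central_squares_commutator[OF sq y(1) u(1)] by metis
    have wc: "w \<in> carrier G" using w cc by blast
    have com: "v \<otimes> g = g \<otimes> v" if "v \<in> Z" "g \<in> carrier G" for v g using center_commute that .
    have px: "(p \<otimes> x) \<otimes> x = (x \<otimes> (p \<otimes> x)) \<otimes> s" if "p \<in> carrier G" "s \<in> Z" "p \<otimes> x = (x \<otimes> p) \<otimes> s" for p s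
    proof -
      have "(p \<otimes> x) \<otimes> x = x \<otimes> p \<otimes> (s \<otimes> x)" unfolding that(3) using that(1) x(1) cc[OF that(2)] by (simp add: m_assoc)
      also have "s \<otimes> x = x \<otimes> s" using com that x by blast
      finally show ?thesis using that(1) x(1) cc[OF that(2)] by (simp add: m_assoc)
    qed
    have uyx: "u \<otimes> (y \<otimes> x) = (y \<otimes> x) \<otimes> u \<otimes> (w \<otimes> d)"
    proof -
      have "u \<otimes> (y \<otimes> x) = (u \<otimes> y) \<otimes> x" using u(1) y(1) x(1) by (simp add: m_assoc)
      also have "\<dots> = y \<otimes> u \<otimes> (w \<otimes> x)" unfolding w(2) using u(1) y(1) x(1) wc by (simp add: m_assoc)
      also have "w \<otimes> x = x \<otimes> w" using com w x by blast
      also have "y \<otimes> u \<otimes> (x \<otimes> w) = y \<otimes> (u \<otimes> x) \<otimes> w" using u(1) y(1) x(1) wc by (simp add: m_assoc)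
      also have "\<dots> = y \<otimes> x \<otimes> u \<otimes> (d \<otimes> w)" unfolding u(2) using u(1) y(1) x(1) wc cdc by (simp add: m_assoc)
      also have "d \<otimes> w = w \<otimes> d" using com cd(2) wc by blast
      finally show ?thesis using u(1) y(1) x(1) wc cdc by (simp add: m_assoc)
    qed
    have uxy: "(u \<otimes> x) \<otimes> y = y \<otimes> (u \<otimes> x) \<otimes> (w \<otimes> c)"
    proof -
      have xy: "x \<otimes> y = (y \<otimes> x) \<otimes> c" unfolding y(2) using x(1) y(1) cdc c2 by (simp add: m_assoc)
      have "(u \<otimes> x) \<otimes> y = (u \<otimes> y) \<otimes> (x \<otimes> c)" using xy u(1) y(1) x(1) cdc by (simp add: m_assoc)
      also have "\<dots> = y \<otimes> u \<otimes> ((w \<otimes> x) \<otimes> c)" unfolding w(2) using u(1) y(1) x(1) wc cdc by (simp add: m_assoc)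
      also have "w \<otimes> x = x \<otimes> w" using com w x by blast
      finally show ?thesis using u(1) y(1) x(1) wc cdc by (simp add: m_assoc)
    qed
    have ux: "u \<otimes> x \<in> carrier G" "y \<otimes> x \<in> carrier G" using u(1) y(1) x(1) by auto
    \<comment> \<open>Replacing \<open>u\<close> by \<open>u \<otimes> x\<close> multiplies the
      commutator \<open>w\<close> by \<open>c\<close>, replacing \<open>y\<close> by
      \<open>y \<otimes> x\<close> multiplies it by \<open>d\<close>, and neither changes the
      commutators with \<open>x\<close>. One of the four combinations makes \<open>w\<close>
      trivial.\<close>
    consider "w = \<one>" | "w = c" | "w = d" | "w = c \<otimes> d" using w(1) Zeq by auto
    then show False
    proof cases
      case 1
      then show False using indep[OF u(1) y(1) _ cd(2,1,4,3) _ u(2) y(2)] w(2) u y cd(5) by simp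
    next
      case 2
      then have "(u \<otimes> x) \<otimes> y = y \<otimes> (u \<otimes> x)" using uxy c2 ux y by simp
      then show False using indep[OF ux(1) y(1) _ cd(2,1,4,3) _ px[OF u(1) cd(2) u(2)] y(2)] cd(5) by simp
    next
      case 3
      then have "u \<otimes> (y \<otimes> x) = (y \<otimes> x) \<otimes> u" using uyx d2 ux u by simp
      then show False using indep[OF u(1) ux(2) _ cd(2,1,4,3) _ u(2) px[OF y(1) cd(1) y(2)]] cd(5) by simp
    next
      case 4
      have cdcd: "(c \<otimes> d) \<otimes> d = c" using cdc d2 by (simp add: m_assoc)
      have "(u \<otimes> x) \<otimes> (y \<otimes> x) = ((u \<otimes> x) \<otimes> y) \<otimes> x" using u(1) y(1) x(1) by (simp add: m_assoc)
      also have "\<dots> = y \<otimes> (u \<otimes> x) \<otimes> ((w \<otimes> c) \<otimes> x)" unfolding uxy using ux y(1) x(1) wc cdc by (simp add: m_assoc)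
      also have "w \<otimes> c = d" unfolding 4 using com[OF cd(1) cdc(2)] cdc c2 by (simp add: m_assoc)
      also have "d \<otimes> x = x \<otimes> d" using com cd x by blast
      also have "y \<otimes> (u \<otimes> x) \<otimes> (x \<otimes> d) = y \<otimes> ((u \<otimes> x) \<otimes> x) \<otimes> d" using ux(1) y(1) x(1) cdc by (simp add: m_assoc)
      also have "\<dots> = (y \<otimes> x) \<otimes> (u \<otimes> x) \<otimes> (d \<otimes> d)" unfolding px[OF u(1) cd(2) u(2)] using ux(1) y(1) x(1) cdc by (simp add: m_assoc)
      finally have "(u \<otimes> x) \<otimes> (y \<otimes> x) = (y \<otimes> x) \<otimes> (u \<otimes> x)" using d2 ux by simp
      then show False
        using indep[OF ux(1,2) _ cd(2,1,4,3) _ px[OF u(1) cd(2) u(2)] px[OF y(1) cd(1) y(2)]] cd(5) by simp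
    qed
  qed
  ultimately show ?thesis using m by auto
qed

lemma card_Z_4_cases:
  assumes "card Z = 4"
  shows "G \<cong> integer_mod_group 2 \<times>\<times> dihedral_group 4 \<or> G \<cong> integer_mod_group 2 \<times>\<times> dicyclic_group 2 \<or>
    G \<cong> SG_16_3 \<or> G \<cong> Z4_semidirect_Z4 \<or> G \<cong> D8_central_Z4 \<or> G \<cong> M_16"
  using order_16_cases[OF fin card_Z_4_order[OF assms] assms square_central noncommuting] assms by simp

end

section \<open>Centers of order 2\<close>

lemma (in group) centralizer_mult_central:
  assumes "h \<in> group_center G" "q \<in> carrier G"
  shows "centralizer G (q \<otimes> h) = centralizer G q"
proof -
  have h: "h \<in> carrier G" using assms center_carrier by blast
  have "(q \<otimes> h) \<otimes> y = y \<otimes> (q \<otimes> h) \<longleftrightarrow> q \<otimes> y = y \<otimes> q" if "y \<in> carrier G" for y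
  proof -
    have "(q \<otimes> h) \<otimes> y = (q \<otimes> y) \<otimes> h" using center_commute[OF assms(1) that] h assms that by (simp add: m_assoc)
    moreover have "y \<otimes> (q \<otimes> h) = (y \<otimes> q) \<otimes> h" using h assms that by (simp add: m_assoc)
    ultimately show ?thesis using h assms that by simp
  qed
  then show ?thesis by (auto simp: centralizer_def)
qed

lemma (in group) centralizer_inv: "x \<in> carrier G \<Longrightarrow> centralizer G (inv x) = centralizer G x"
proof -
  assume x: "x \<in> carrier G"
  have "inv x \<otimes> y = y \<otimes> inv x \<longleftrightarrow> x \<otimes> y = y \<otimes> x" if "y \<in> carrier G" for y
    using commute_inv[of y x] commute_inv[of y "inv x"] x that by auto
  then show ?thesis by (auto simp: centralizer_def)
qed

lemma (in group) conj_eq_imp_commute: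
  assumes "x \<in> carrier G" "g \<in> carrier G" "g \<otimes> x \<otimes> inv g = x" shows "g \<otimes> x = x \<otimes> g"
proof -
  have "g \<otimes> x = (g \<otimes> x \<otimes> inv g) \<otimes> g" using assms(1,2) by (simp add: m_assoc)
  then show ?thesis unfolding assms(3) .
qed

lemma (in group) three_pow: "x \<in> carrier G \<Longrightarrow> x [^] (3::nat) = x \<otimes> (x \<otimes> x)"
  by (simp add: numeral_eq_Suc m_assoc)

lemma (in group) two_pow: "x \<in> carrier G \<Longrightarrow> x [^] (2::nat) = x \<otimes> x"
  by (simp add: numeral_eq_Suc)

lemma (in group) conj_pow:
  assumes "x \<in> carrier G" "g \<in> carrier G"
  shows "(g \<otimes> x \<otimes> inv g) [^] (n::nat) = g \<otimes> x [^] n \<otimes> inv g"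
proof (induction n)
  case (Suc n)
  have "(g \<otimes> x \<otimes> inv g) [^] Suc n = (g \<otimes> x [^] n \<otimes> inv g) \<otimes> (g \<otimes> x \<otimes> inv g)" using Suc by simp
  then show ?case using assms by (simp add: m_assoc)
qed (use assms in simp)

context small_cliques
begin

definition "X4 = {x \<in> carrier G. x \<notin> Z \<and> card (centralizer G x) = 4}"
definition "X6 = {x \<in> carrier G. x \<notin> Z \<and> card (centralizer G x) = 6}"

context
  assumes Z2: "card Z = 2"
begin

lemma Z_two: obtains z where "Z = {\<one>, z}" "z \<noteq> \<one>" "z \<otimes> z = \<one>"
proof -
  have "card (Z - {\<one>}) = 1" using Z2 finite_Z Z_one by simp
  then obtain z where z: "Z - {\<one>} = {z}" by (auto simp: card_1_singleton_iff)
  then have Z: "Z = {\<one>, z}" "z \<noteq> \<one>" "z \<in> Z" using Z_one by auto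
  have "z [^] (2::nat) = \<one>" using subgroup_pow_card[OF center_subgroup finite_Z Z(3)] Z2 by simp
  then show ?thesis using that[OF Z(1,2)] two_pow[of z] center_carrier[OF Z(3)] by simp
qed

text \<open>A commuting set now has room for two noncentral cosets of the center. If
  \<open>y\<close> were in none of the cosets listed, \<open>x\<close>, \<open>y\<close> and
  \<open>x \<otimes> y\<close> would give three.\<close>

lemma centralizer_cases:
  assumes x: "x \<in> carrier G" "x \<notin> Z" and y: "y \<in> centralizer G x"
  shows "y \<in> Z \<or> inv x \<otimes> y \<in> Z \<or> x \<otimes> y \<in> Z"
proof (rule ccontr)
  assume n: "\<not> ?thesis"
  have yc: "y \<in> carrier G" "x \<otimes> y = y \<otimes> x" using y by (auto simp: centralizer_def)
  have 1: "inv y \<otimes> x \<notin> Z"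
  proof -
    have "inv y \<otimes> x = inv (inv x \<otimes> y)" using yc x by (simp add: inv_mult_group)
    then show ?thesis using n inv_Z_iff[of "inv x \<otimes> y"] yc x by simp
  qed
  have 2: "inv x \<otimes> (x \<otimes> y) \<notin> Z" "inv (x \<otimes> y) \<otimes> x \<notin> Z"
  proof -
    show "inv x \<otimes> (x \<otimes> y) \<notin> Z" using n x yc(1) by simp
    have "inv (x \<otimes> y) \<otimes> x = inv y" unfolding yc(2)[symmetric] using yc(1) x by (simp add: inv_mult_group m_assoc)
    then show "inv (x \<otimes> y) \<otimes> x \<notin> Z" using n inv_Z_iff yc by simp
  qed
  have 3: "inv y \<otimes> (x \<otimes> y) \<notin> Z" "inv (x \<otimes> y) \<otimes> y \<notin> Z"
  proof -
    show "inv y \<otimes> (x \<otimes> y) \<notin> Z" unfolding yc(2) using x yc(1) by simp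
    have "inv (x \<otimes> y) \<otimes> y = inv x" unfolding yc(2) using yc(1) x by (simp add: inv_mult_group m_assoc)
    then show "inv (x \<otimes> y) \<otimes> y \<notin> Z" using inv_Z_iff x by simp
  qed
  have ne: "x \<noteq> y" "x \<noteq> x \<otimes> y" "y \<noteq> x \<otimes> y" using 1 2 3 Z_one x yc by auto
  have com: "x \<otimes> (x \<otimes> y) = (x \<otimes> y) \<otimes> x" "y \<otimes> (x \<otimes> y) = (x \<otimes> y) \<otimes> y"
    using yc x by (simp_all add: m_assoc) (simp add: m_assoc[symmetric])
  have "card {x, y, x \<otimes> y} * card Z \<le> 4"
  proof (rule clique_cosets)
    show "p \<otimes> q = q \<otimes> p" if "p \<in> {x, y, x \<otimes> y}" "q \<in> {x, y, x \<otimes> y}" for p q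
      using that yc com by auto
    show "inv p \<otimes> q \<notin> Z" if "p \<in> {x, y, x \<otimes> y}" "q \<in> {x, y, x \<otimes> y}" "p \<noteq> q" for p q
      using that n 1 2 3 by auto
  qed (use x yc n in auto)
  then show False using ne Z2 by simp
qed

text \<open>Modulo the center, the centralizer consists of the classes of 1, \<open>x\<close> and
  the inverse of \<open>x\<close>; the last two coincide exactly if x^2 is central. Otherwise it is
  a group of order 3 modulo the center, so x^3 is central.\<close>

lemma centralizer_card:
  assumes x: "x \<in> carrier G" "x \<notin> Z"
  shows "x \<otimes> x \<in> Z \<Longrightarrow> card (centralizer G x) = 4"
    "x \<otimes> x \<notin> Z \<Longrightarrow> card (centralizer G x) = 6 \<and> x \<otimes> (x \<otimes> x) \<in> Z \<and>
      centralizer G x = Z \<union> (\<lambda>z. x \<otimes> z) ` Z \<union> (\<lambda>z. inv x \<otimes> z) ` Z"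
proof -
  have sub: "subgroup (centralizer G x) G" using centralizer_subgroup x by blast
  have xC: "x \<in> centralizer G x" using x by (simp add: centralizer_def)
  {
    assume xx: "x \<otimes> x \<in> Z"
    have "y \<in> Z \<or> inv x \<otimes> y \<in> Z" if y: "y \<in> centralizer G x" for y
    proof -
      have yc: "y \<in> carrier G" using y by (simp add: centralizer_def)
      have "inv x \<otimes> y = inv (x \<otimes> x) \<otimes> (x \<otimes> y)" using x yc by (simp add: inv_mult_group m_assoc)
      then have "x \<otimes> y \<in> Z \<Longrightarrow> inv x \<otimes> y \<in> Z" using xx Z_mult Z_inv by simp
      then show ?thesis using centralizer_cases[OF x y] by blast
    qed
    then show "card (centralizer G x) = 4" using centralizer_eq[OF x] Z2 by simp
  }
  {
    assume xx: "x \<otimes> x \<notin> Z"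
    have "x \<otimes> x \<in> centralizer G x" using sub xC by (simp add: subgroup.m_closed)
    then have x3: "x \<otimes> (x \<otimes> x) \<in> Z" using centralizer_cases[OF x, of "x \<otimes> x"] x xx by simp
    have C: "centralizer G x = Z \<union> (\<lambda>z. x \<otimes> z) ` Z \<union> (\<lambda>z. inv x \<otimes> z) ` Z"
    proof
      show "centralizer G x \<subseteq> Z \<union> (\<lambda>z. x \<otimes> z) ` Z \<union> (\<lambda>z. inv x \<otimes> z) ` Z"
      proof
        fix y assume y: "y \<in> centralizer G x"
        then have yc: "y \<in> carrier G" by (simp add: centralizer_def)
        have "y = x \<otimes> (inv x \<otimes> y)" "y = inv x \<otimes> (x \<otimes> y)" using yc x by simp_all
        then show "y \<in> Z \<union> (\<lambda>z. x \<otimes> z) ` Z \<union> (\<lambda>z. inv x \<otimes> z) ` Z" using centralizer_cases[OF x y] by blast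
      qed
      have "inv x \<in> centralizer G x" using sub xC by (rule subgroup.m_inv_closed)
      then show "Z \<union> (\<lambda>z. x \<otimes> z) ` Z \<union> (\<lambda>z. inv x \<otimes> z) ` Z \<subseteq> centralizer G x"
        using center_subset_centralizer[OF x(1)] xC subgroup.m_closed[OF sub] by blast
    qed
    have d1: "Z \<inter> (\<lambda>z. x \<otimes> z) ` Z = {}" "Z \<inter> (\<lambda>z. inv x \<otimes> z) ` Z = {}"
      using Z_mult_iff(2)[of _ x] Z_mult_iff(2)[of _ "inv x"] inv_Z_iff x by auto
    have d2: "(\<lambda>z. x \<otimes> z) ` Z \<inter> (\<lambda>z. inv x \<otimes> z) ` Z = {}"
    proof -
      have "x \<otimes> u \<noteq> inv x \<otimes> v" if uv: "u \<in> Z" "v \<in> Z" for u v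
      proof
        assume e: "x \<otimes> u = inv x \<otimes> v"
        have c: "u \<in> carrier G" "v \<in> carrier G" using uv center_carrier by auto
        have "x \<otimes> (x \<otimes> u) = v" using e x c by simp
        then have "(x \<otimes> x) \<otimes> u \<in> Z" using x c uv by (simp add: m_assoc)
        then show False using Z_mult_iff(2)[OF uv(1), of "x \<otimes> x"] x xx by simp
      qed
      then show ?thesis by auto
    qed
    have "card (centralizer G x) = 6"
      unfolding C using d1 d2 finite_Z Z2 card_coset_center x by (simp add: card_Un_disjoint Int_Un_distrib2)
    then show "card (centralizer G x) = 6 \<and> x \<otimes> (x \<otimes> x) \<in> Z \<and>
      centralizer G x = Z \<union> (\<lambda>z. x \<otimes> z) ` Z \<union> (\<lambda>z. inv x \<otimes> z) ` Z" using x3 C by blast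
  }
qed

lemma X4_iff: "x \<in> X4 \<longleftrightarrow> x \<in> carrier G \<and> x \<notin> Z \<and> x \<otimes> x \<in> Z"
  using centralizer_card[of x] unfolding X4_def by (cases "x \<otimes> x \<in> Z") auto

lemma X6_iff: "x \<in> X6 \<longleftrightarrow> x \<in> carrier G \<and> x \<otimes> x \<notin> Z"
proof -
  have "x \<in> Z \<Longrightarrow> x \<otimes> x \<in> Z" using Z_mult by blast
  then show ?thesis using centralizer_card[of x] unfolding X6_def by auto
qed

lemma X_conj: "x \<in> X4 \<Longrightarrow> g \<in> carrier G \<Longrightarrow> g \<otimes> x \<otimes> inv g \<in> X4" "x \<in> X6 \<Longrightarrow> g \<in> carrier G \<Longrightarrow> g \<otimes> x \<otimes> inv g \<in> X6"
  unfolding X4_def X6_def using noncentral_conj_closed centralizer_conj_card by auto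

lemma X_central: "x \<in> X4 \<Longrightarrow> u \<in> Z \<Longrightarrow> x \<otimes> u \<in> X4" "x \<in> X6 \<Longrightarrow> u \<in> Z \<Longrightarrow> x \<otimes> u \<in> X6"
  unfolding X4_def X6_def using centralizer_mult_central Z_mult_iff(2) center_carrier by auto

lemma X6_cube: "x \<in> X6 \<Longrightarrow> x \<otimes> (x \<otimes> x) \<in> Z"
  using centralizer_card(2)[of x] unfolding X6_iff using Z_mult by metis

lemma centralizer_X6: "x \<in> X6 \<Longrightarrow> centralizer G x = Z \<union> (\<lambda>z. x \<otimes> z) ` Z \<union> (\<lambda>z. inv x \<otimes> z) ` Z"
  using centralizer_card(2)[of x] unfolding X6_iff using Z_mult by metis

text \<open>Noncentral elements of the centralizer of \<open>x\<close> are \<open>x\<close> or its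
  inverse times a central factor, so their centralizers have order 6 as well.\<close>

lemma X4_not_commute_X6:
  assumes "x \<in> X6" "y \<in> X4" shows "y \<notin> centralizer G x"
proof
  assume y: "y \<in> centralizer G x"
  have x: "x \<in> carrier G" "card (centralizer G x) = 6" using assms by (auto simp: X6_def)
  have y4: "y \<notin> Z" "card (centralizer G y) = 4" using assms by (auto simp: X4_def)
  obtain u where u: "u \<in> Z" "y = x \<otimes> u \<or> y = inv x \<otimes> u" using y y4 unfolding centralizer_X6[OF assms(1)] by auto
  then have "centralizer G y = centralizer G x"
    using centralizer_mult_central[OF u(1)] centralizer_inv x by auto
  then show False using x y4 by simp
qed

lemma order_eq: "order G = 2 + card X4 + card X6"
proof -
  have "carrier G = Z \<union> (X4 \<union> X6)" using center_carrier X4_iff X6_iff by blast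
  moreover have "Z \<inter> (X4 \<union> X6) = {}" "X4 \<inter> X6 = {}" unfolding X4_def X6_def by auto
  moreover have "finite X4" "finite X6" using fin unfolding X4_def X6_def by auto
  ultimately show ?thesis unfolding order_def using finite_Z Z2 by (simp add: card_Un_disjoint)
qed

text \<open>Centralizers of order 6 cannot occur in a group of order 8, so all squares are central,
  and the center is generated by the commutator of any two noncommuting elements.\<close>

lemma order_8_center_2:
  assumes "order G = 8"
  shows "G \<cong> dihedral_group 4 \<or> G \<cong> dicyclic_group 2"
proof -
  obtain x y where x: "x \<in> carrier G" and y: "y \<in> carrier G" and ne: "x \<otimes> y \<noteq> y \<otimes> x" using noncommuting by blast
  have sq: "u \<otimes> u \<in> Z" if u: "u \<in> carrier G" for u
  proof (rule ccontr)
    assume "u \<otimes> u \<notin> Z"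
    then have "u \<in> X6" using u X6_iff by simp
    then have "6 dvd order G" using subgroup_card_dvd[OF centralizer_subgroup[OF u]] by (simp add: X6_def)
    then show False using assms by simp
  qed
  obtain c where c: "c \<in> Z" "c \<otimes> c = \<one>" "y \<otimes> x = (x \<otimes> y) \<otimes> c" "x \<otimes> y = y \<otimes> x \<longleftrightarrow> c = \<one>"
    using central_squares_commutator[OF sq x y] .
  obtain z where z: "Z = {\<one>, z}" using Z_two by metis
  then have Zc: "Z = {\<one>, c}" using c ne by auto
  have nz: "x \<notin> Z" "y \<notin> Z" using ne x y center_commute by metis+
  have xy: "x \<otimes> y \<notin> Z"
  proof
    assume "x \<otimes> y \<in> Z"
    then have "(x \<otimes> y) \<otimes> x = x \<otimes> (x \<otimes> y)" using center_commute x by blast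
    then show False using ne x y by (simp add: m_assoc)
  qed
  have S: "{x, y} \<subseteq> carrier G" using x y by simp
  have sub: "subgroup (generate G {x, y}) G" using generate_is_subgroup[OF S] .
  have g: "x \<in> generate G {x, y}" "y \<in> generate G {x, y}" by (auto intro: generate.incl)
  have "c = inv (x \<otimes> y) \<otimes> (y \<otimes> x)" using c(3) x y center_carrier[OF c(1)] by simp
  then have "c \<in> generate G {x, y}" using g S by (simp add: mult_generate inv_generate)
  then have "{\<one>, c, x, y, x \<otimes> y} \<subseteq> generate G {x, y}" using g S by (auto intro: mult_generate generate.one)
  moreover have "card {\<one>, c, x, y, x \<otimes> y} = 5"
  proof -
    have "c \<noteq> \<one>" using c(4) ne by blast
    moreover have "{\<one>, c} \<inter> {x, y, x \<otimes> y} = {}" using nz xy Zc by auto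
    moreover have "x \<noteq> y" "x \<noteq> x \<otimes> y" "y \<noteq> x \<otimes> y" using ne x y by auto
    ultimately show ?thesis by auto
  qed
  moreover have "finite (generate G {x, y})" using fin subgroup.subset[OF sub] finite_subset by blast
  ultimately have "5 \<le> card (generate G {x, y})" by (metis card_mono)
  then have "generate G {x, y} = carrier G" using subgroup_eq_carrier[OF fin sub] assms by simp
  then show ?thesis using order_8_cases[OF fin assms x y _ c(1-3)] sq[OF x] sq[OF y] Zc by simp
qed

text \<open>The four elements of \<open>X6\<close> are the noncentral elements of a cyclic group of
  order 6 generated by \<open>r\<close>, which \<open>y\<close> therefore normalizes. Comparing
  cubes leaves \<open>r\<close> and its inverse as possible conjugates, and \<open>y\<close> does
  not commute with \<open>r\<close>. The square of \<open>y\<close>, an element of {1, z},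
  distinguishes the two groups.\<close>

lemma order_12_center_2:
  assumes o12: "order G = 12" and x: "x \<in> X6" and y: "y \<in> X4" and c6: "card X6 = 4"
  shows "G \<cong> dihedral_group 6 \<or> G \<cong> dicyclic_group 3"
proof -
  obtain z where z: "Z = {\<one>, z}" "z \<noteq> \<one>" "z \<otimes> z = \<one>" using Z_two by metis
  have zZ: "z \<in> Z" using z by simp
  have zc: "z \<in> carrier G" using zZ center_carrier by blast
  have xc: "x \<in> carrier G" using x by (simp add: X6_def)
  have yc: "y \<in> carrier G" using y by (simp add: X4_def)
  \<comment> \<open>Multiplication by \<open>z\<close> changes the cube by the factor
    \<open>z\<close>, so one of \<open>x\<close> and \<open>x \<otimes> z\<close> has cube
    \<open>z\<close>.\<close>
  obtain r where r: "r \<in> X6" "r \<otimes> (r \<otimes> r) = z"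
  proof (cases "x \<otimes> (x \<otimes> x) = z")
    case False
    then have x1: "x \<otimes> (x \<otimes> x) = \<one>" using X6_cube[OF x] z by auto
    have "(x \<otimes> z) \<otimes> ((x \<otimes> z) \<otimes> (x \<otimes> z)) = (x \<otimes> z) \<otimes> (x \<otimes> x)"
      using square_central_mult[OF xc zZ] z xc by simp
    also have "\<dots> = z" using x1 center_commute[OF zZ, of "x \<otimes> x"] xc zc by (simp add: m_assoc) (simp add: m_assoc[symmetric])
    finally show ?thesis using that X_central(2)[OF x zZ] by blast
  qed (use that x in blast)
  have rc: "r \<in> carrier G" "r \<notin> Z" using r by (auto simp: X6_def)
  define w where "w = y \<otimes> r \<otimes> inv y"
  have wc: "w \<in> carrier G" using rc yc by (simp add: w_def)
  have w3: "w \<otimes> (w \<otimes> w) = z"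
  proof -
    have "w [^] (3::nat) = y \<otimes> z \<otimes> inv y" unfolding w_def conj_pow[OF rc(1) yc] using three_pow[OF rc(1)] r by simp
    also have "\<dots> = z" using center_commute[OF zZ yc] yc zc by (simp add: m_assoc flip: center_commute[OF zZ yc])
    finally show ?thesis using three_pow[OF wc] by simp
  qed
  have "w \<in> X6" unfolding w_def using X_conj(2)[OF r(1) yc] .
  have C: "centralizer G r = Z \<union> (\<lambda>z. r \<otimes> z) ` Z \<union> (\<lambda>z. inv r \<otimes> z) ` Z" by (rule centralizer_X6[OF r(1)])
  have "X6 = centralizer G r - Z"
  proof -
    have "centralizer G r - Z \<subseteq> X6"
      unfolding C using X_central(2)[OF r(1)] X_central(2)[of "inv r"] r(1) centralizer_inv[OF rc(1)] rc inv_Z_iff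
      by (auto simp: X6_def)
    moreover have "card (centralizer G r - Z) = 4"
      using center_subset_centralizer[OF rc(1)] finite_Z Z2 r(1) by (simp add: card_Diff_subset X6_def)
    moreover have "finite X6" using fin by (simp add: X6_def)
    ultimately show ?thesis using c6 by (metis card_subset_eq)
  qed
  then have "w \<in> {r, r \<otimes> z, inv r, inv r \<otimes> z}" using \<open>w \<in> X6\<close> unfolding C z(1) using rc by auto
  moreover have "w \<noteq> r"
  proof
    assume "w = r"
    then have "y \<otimes> r = r \<otimes> y" using conj_eq_imp_commute[OF rc(1) yc] by (simp add: w_def)
    then have "y \<in> centralizer G r" using yc by (simp add: centralizer_def)
    then show False using X4_not_commute_X6[OF r(1) y] by blast
  qed
  moreover have cube: "(u \<otimes> z) \<otimes> ((u \<otimes> z) \<otimes> (u \<otimes> z)) = (u \<otimes> (u \<otimes> u)) \<otimes> z" if "u \<in> carrier G" for u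
  proof -
    have "(u \<otimes> z) \<otimes> ((u \<otimes> z) \<otimes> (u \<otimes> z)) = (u \<otimes> z) \<otimes> (u \<otimes> u)"
      using square_central_mult[OF that zZ] z that by simp
    also have "\<dots> = u \<otimes> (z \<otimes> (u \<otimes> u))" using that zc by (simp add: m_assoc)
    also have "z \<otimes> (u \<otimes> u) = (u \<otimes> u) \<otimes> z" using center_commute[OF zZ, of "u \<otimes> u"] that by simp
    finally show ?thesis using that zc by (simp add: m_assoc)
  qed
  have "w \<noteq> r \<otimes> z" using cube[OF rc(1)] r w3 z by auto
  moreover have "w \<noteq> inv r \<otimes> z"
  proof
    assume e: "w = inv r \<otimes> z"
    have "inv r \<otimes> (inv r \<otimes> inv r) = inv (r \<otimes> (r \<otimes> r))" using rc by (simp add: inv_mult_group m_assoc)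
    also have "\<dots> = z" unfolding r(2) using z zc by (intro inv_equality) auto
    finally have "w \<otimes> (w \<otimes> w) = \<one>" unfolding e using cube[of "inv r"] rc z by simp
    then show False using w3 z by simp
  qed
  ultimately have yr: "y \<otimes> (r \<otimes> inv y) = inv r" using yc rc by (auto simp: w_def m_assoc)
  have S: "{y, r} \<subseteq> carrier G" using yc rc by simp
  have sub: "subgroup (generate G {y, r}) G" using generate_is_subgroup[OF S] .
  have g: "r \<in> generate G {y, r}" "y \<in> generate G {y, r}" by (auto intro: generate.incl)
  have zg: "z \<in> generate G {y, r}" using mult_generate[OF S g(1) mult_generate[OF S g(1,1)]] r(2) by simp
  have "insert y (centralizer G r) \<subseteq> generate G {y, r}"
    unfolding C z(1) using g zg S by (auto intro: mult_generate inv_generate generate.one)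
  moreover have finC: "finite (centralizer G r)" using fin by (simp add: centralizer_def)
  then have "card (insert y (centralizer G r)) = 7" using X4_not_commute_X6[OF r(1) y] r(1) by (simp add: X6_def)
  moreover have "finite (generate G {y, r})" using fin subgroup.subset[OF sub] finite_subset by blast
  ultimately have "7 \<le> card (generate G {y, r})" by (metis card_mono)
  then have gen: "generate G {y, r} = carrier G" using subgroup_eq_carrier[OF fin sub] o12 by simp
  have r3: "r [^] (3::nat) = z" using three_pow[OF rc(1)] r(2) by simp
  have "r [^] (6::nat) = r [^] (3::nat) \<otimes> r [^] (3::nat)" using rc by (simp add: nat_pow_mult)
  then have r6: "r [^] (6::nat) = \<one>" using r3 z by simp
  have "y \<otimes> y \<in> {\<one>, z}" using y X4_iff z by simp
  then show ?thesis
  proof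
    assume "y \<otimes> y = \<one>"
    then have "G \<cong> dihedral_group 6"
      using two_pow[OF yc] r6 yr by (intro iso_dihedral[OF fin _ _ yc rc(1) gen]) (auto simp: o12)
    then show ?thesis ..
  next
    assume "y \<otimes> y \<in> {z}"
    then have "G \<cong> dicyclic_group 3"
      using two_pow[OF yc] r6 r3 yr by (intro iso_dicyclic[OF fin _ _ yc rc(1) gen]) (auto simp: o12)
    then show ?thesis ..
  qed
qed

text \<open>The Sylow 2-subgroup is the union of the center and \<open>X4\<close>, a quaternion
  group, and an element \<open>s\<close> of order 3 permutes \<open>X4\<close> by conjugation. A
  suitable \<open>c\<close> in \<open>X4\<close> and its images under this conjugation behave like
  i, j, k. The generators of the presentation are \<open>c\<close>, a = s z, which has cube
  \<open>z\<close>, and b = a^-1 c.\<close>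

lemma order_24_center_2:
  assumes o24: "order G = 24" and X4c: "card X4 = 6" "\<And>x. x \<in> X4 \<Longrightarrow> X4 = conj_class G x" and x: "x \<in> X6"
  shows "G \<cong> SL_2_3"
proof -
  obtain z where z: "Z = {\<one>, z}" "z \<noteq> \<one>" "z \<otimes> z = \<one>" using Z_two by metis
  have zZ: "z \<in> Z" using z by simp
  have zc: "z \<in> carrier G" using zZ center_carrier by blast
  have zcom: "z \<otimes> g = g \<otimes> z" if "g \<in> carrier G" for g using center_commute[OF zZ that] .
  have finX: "finite X4" using fin by (simp add: X4_def)
  have xc: "x \<in> carrier G" using x by (simp add: X6_def)
  have X4m: "u \<in> carrier G" "u \<notin> Z" "u \<otimes> u \<in> Z" if "u \<in> X4" for u using that X4_iff by blast+
  obtain P where P: "subgroup P G" "card P = 8"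
  proof -
    have "prime (2::nat)" "order G = 2 ^ 3 * 3" using o24 by simp_all
    from sylow_thm[OF this(1) is_group this(2) fin] show ?thesis using that by auto
  qed
  have Pc: "P \<subseteq> carrier G" using P(1) by (rule subgroup.subset)
  have finP: "finite P" using P(2) card.infinite by fastforce
  \<comment> \<open>An element with noncentral square has a central cube, so y^6 = 1; together with
    y^8 = 1 this makes y^2 trivial, a contradiction.\<close>
  have PX: "P - Z \<subseteq> X4"
  proof
    fix y assume y: "y \<in> P - Z"
    have yc: "y \<in> carrier G" using y Pc by auto
    have "y \<otimes> y \<in> Z"
    proof (rule ccontr)
      assume "y \<otimes> y \<notin> Z"
      then have "y \<in> X6" using X6_iff yc by simp
      then have y3: "y \<otimes> (y \<otimes> y) \<in> Z" by (rule X6_cube)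
      have y8: "y [^] (8::nat) = \<one>" using subgroup_pow_card[OF P(1) finP, of y] P(2) y by simp
      have "(y \<otimes> (y \<otimes> y)) \<otimes> (y \<otimes> (y \<otimes> y)) = \<one>" using y3 z by auto
      moreover have "(y \<otimes> (y \<otimes> y)) \<otimes> (y \<otimes> (y \<otimes> y)) \<otimes> (y \<otimes> y) = y [^] (8::nat)"
        using yc by (simp add: numeral_eq_Suc m_assoc)
      ultimately have "y \<otimes> y = \<one>" using y8 yc by simp
      then show False using \<open>y \<otimes> y \<notin> Z\<close> Z_one by simp
    qed
    then show "y \<in> X4" using X4_iff yc y by simp
  qed
  have PZ: "P = Z \<union> X4"
  proof -
    have "card (P - Z) \<le> 6" using PX X4c(1) finX by (metis card_mono)
    moreover have "card P = card (P \<inter> Z) + card (P - Z)" using finP by (metis card_Int_Diff)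
    moreover have "card (P \<inter> Z) \<le> card Z" using finite_Z by (intro card_mono) auto
    ultimately have c: "card (P \<inter> Z) = 2" "card (P - Z) = 6" using P(2) Z2 by linarith+
    have "P \<inter> Z = Z" by (rule card_subset_eq[OF finite_Z]) (use c Z2 in auto)
    moreover have "P - Z = X4" by (rule card_subset_eq[OF finX PX]) (use c X4c(1) in auto)
    ultimately show ?thesis by blast
  qed
  have Pm: "u \<otimes> v \<in> P" if "u \<in> P" "v \<in> P" for u v using that P(1) by (simp add: subgroup.m_closed)
  obtain c0 where c0: "c0 \<in> X4" using X4c(1) by fastforce
  \<comment> \<open>Since \<open>X4\<close> is a single class, all squares of its elements are
    conjugate, and being central they are equal.\<close>
  have same: "u \<otimes> u = c0 \<otimes> c0" if u: "u \<in> X4" for u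
  proof -
    have "u \<in> conj_class G c0" using u X4c(2)[OF c0] by simp
    then obtain g where g: "g \<in> carrier G" "u = g \<otimes> c0 \<otimes> inv g" by (auto simp: conj_class_def)
    have "u [^] (2::nat) = g \<otimes> c0 [^] (2::nat) \<otimes> inv g" using conj_pow[OF X4m(1)[OF c0] g(1)] g(2) by simp
    then have "u \<otimes> u = g \<otimes> (c0 \<otimes> c0) \<otimes> inv g" using X4m(1)[OF c0] X4m(1)[OF u] by (simp add: two_pow)
    also have "g \<otimes> (c0 \<otimes> c0) = (c0 \<otimes> c0) \<otimes> g" using center_commute[OF X4m(3)[OF c0] g(1)] by simp
    finally show ?thesis using g(1) X4m(1)[OF c0] by (simp add: m_assoc)
  qed
  \<comment> \<open>If the common square were trivial, \<open>P\<close> would be elementary abelian,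
    and an element of \<open>X4\<close> would have at least 8 elements in its centralizer instead of
    4.\<close>
  have sqz: "u \<otimes> u = z" if u: "u \<in> X4" for u
  proof (rule ccontr)
    assume "u \<otimes> u \<noteq> z"
    then have "u \<otimes> u = \<one>" using X4m(3)[OF u] z by auto
    then have "v \<otimes> v = \<one>" if "v \<in> P" for v using that PZ same[OF u] same z by auto
    then have ivP: "inv v = v" if "v \<in> P" for v using that Pc by (intro inv_equality) auto
    have "v \<otimes> w = w \<otimes> v" if vw: "v \<in> P" "w \<in> P" for v w
    proof -
      have "v \<otimes> w = inv (v \<otimes> w)" using ivP[OF Pm[OF vw]] by simp
      also have "\<dots> = w \<otimes> v" using vw Pc ivP by (auto simp: inv_mult_group subset_iff)
      finally show ?thesis .
    qed
    then have "P \<subseteq> centralizer G u" using u PZ Pc by (auto simp: centralizer_def)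
    then have "card P \<le> card (centralizer G u)" using fin by (intro card_mono) (auto simp: centralizer_def)
    then show False using u P(2) by (simp add: X4_def)
  qed
  obtain s where s: "s \<in> X6" "s \<otimes> (s \<otimes> s) = \<one>"
  proof (cases "x \<otimes> (x \<otimes> x) = \<one>")
    case False
    then have x1: "x \<otimes> (x \<otimes> x) = z" using X6_cube[OF x] z by auto
    have "(x \<otimes> z) \<otimes> ((x \<otimes> z) \<otimes> (x \<otimes> z)) = (x \<otimes> z) \<otimes> (x \<otimes> x)"
      using square_central_mult[OF xc zZ] z xc by simp
    also have "\<dots> = (x \<otimes> (x \<otimes> x)) \<otimes> z" using zcom[of "x \<otimes> x"] xc zc by (simp add: m_assoc)
    also have "\<dots> = \<one>" using x1 z by simp
    finally show ?thesis using that X_central(2)[OF x zZ] by blast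
  qed (use that x in blast)
  have sc: "s \<in> carrier G" "s \<otimes> s \<notin> Z" using s X6_iff by auto
  have sP: "s \<notin> P" using PZ s(1) X4_iff X6_iff by (auto simp: X6_def)
  define K where "K u = s \<otimes> u \<otimes> inv s" for u
  have KX: "K u \<in> X4" if "u \<in> X4" for u unfolding K_def using X_conj(1)[OF that sc(1)] .
  have Ks: "s \<otimes> u = K u \<otimes> s" if "u \<in> carrier G" for u unfolding K_def using that sc(1) by (simp add: m_assoc)
  have K3: "K (K (K u)) = u" if "u \<in> carrier G" for u
  proof -
    have "K (K (K u)) = (s \<otimes> (s \<otimes> s)) \<otimes> u \<otimes> inv (s \<otimes> (s \<otimes> s))"
      unfolding K_def using that sc(1) by (simp add: m_assoc inv_mult_group)
    then show ?thesis using s(2) that by simp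
  qed
  have Kz: "K (u \<otimes> z) = K u \<otimes> z" if "u \<in> carrier G" for u
    unfolding K_def using that sc(1) zc zcom[of "inv s"] by (simp add: m_assoc)
  have Kinj: "K u = K v \<Longrightarrow> u = v" if "u \<in> carrier G" "v \<in> carrier G" for u v
    using K3[OF that(1)] K3[OF that(2)] by metis
  have Kne: "K u \<noteq> u" "K u \<noteq> u \<otimes> z" if u: "u \<in> X4" for u
  proof -
    have uc: "u \<in> carrier G" using X4m u by blast
    show 1: "K u \<noteq> u"
    proof
      assume "K u = u"
      then have "s \<otimes> u = u \<otimes> s" using conj_eq_imp_commute[OF uc sc(1)] by (simp add: K_def)
      then show False using X4_not_commute_X6[OF s(1) u] uc by (simp add: centralizer_def)
    qed
    show "K u \<noteq> u \<otimes> z"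
    proof
      assume e: "K u = u \<otimes> z"
      then have "K (K u) = (u \<otimes> z) \<otimes> z" using Kz[OF uc] by simp
      then have "K (K u) = u" using uc zc z by (simp add: m_assoc)
      then have "K u = u" using K3[OF uc] by simp
      then show False using 1 by simp
    qed
  qed
  \<comment> \<open>The hypothesis \<open>e\<close> is the quaternion relation ij = k. It makes the
    product of \<open>K d\<close>, \<open>d\<close> and \<open>c\<close> trivial, and the
    telescoping used for the presentation evaluates the same product to z b^3; hence b^3 =
    z.\<close>
  have main: "G \<cong> SL_2_3" if c: "c \<in> X4" and e: "K (K c) = c \<otimes> K c" for c
  proof -
    have cc: "c \<in> carrier G" using X4m c by blast
    define d where "d = K c"
    have d: "d \<in> X4" "d \<in> carrier G" using KX[OF c] X4m unfolding d_def by blast+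
    have dne: "d \<noteq> c" "d \<noteq> c \<otimes> z" using Kne[OF c] by (auto simp: d_def)
    define a where "a = s \<otimes> z"
    define b where "b = inv a \<otimes> c"
    have ac: "a \<in> carrier G" "b \<in> carrier G" using sc zc cc by (auto simp: a_def b_def)
    have a3: "a \<otimes> (a \<otimes> a) = z"
    proof -
      have "a \<otimes> (a \<otimes> a) = (s \<otimes> z) \<otimes> (s \<otimes> s)" unfolding a_def using square_central_mult[OF sc(1) zZ] z sc by simp
      also have "\<dots> = (s \<otimes> (s \<otimes> s)) \<otimes> z" using zcom[of "s \<otimes> s"] sc zc by (simp add: m_assoc)
      finally show ?thesis using s(2) zc by simp
    qed
    have cab: "c = a \<otimes> b" unfolding b_def using ac cc by simp
    have aK: "a \<otimes> u = K u \<otimes> a" if "u \<in> carrier G" for u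
    proof -
      have "a \<otimes> u = (s \<otimes> u) \<otimes> z" unfolding a_def using zcom[OF that] that sc zc by (simp add: m_assoc)
      then show ?thesis unfolding Ks[OF that] a_def using that sc zc by (simp add: m_assoc K_def)
    qed
    have da: "d \<otimes> a = a \<otimes> (a \<otimes> b)" using aK[OF cc] cab by (simp add: d_def)
    have ea: "K d \<otimes> a = a \<otimes> d" using aK[OF d(2)] by simp
    have ec: "K d \<in> carrier G" using KX[OF d(1)] X4m by blast
    have "K d \<otimes> (d \<otimes> c) = K d \<otimes> (d \<otimes> a) \<otimes> b" using cab ac d ec by (simp add: m_assoc)
    also have "\<dots> = (K d \<otimes> a) \<otimes> (a \<otimes> b) \<otimes> b" unfolding da using ac d ec by (simp add: m_assoc)
    also have "\<dots> = a \<otimes> (d \<otimes> a) \<otimes> b \<otimes> b" unfolding ea using ac d by (simp add: m_assoc)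
    also have "\<dots> = (a \<otimes> (a \<otimes> a)) \<otimes> (b \<otimes> (b \<otimes> b))" unfolding da using ac by (simp add: m_assoc)
    finally have edc: "K d \<otimes> (d \<otimes> c) = z \<otimes> (b \<otimes> (b \<otimes> b))" unfolding a3 .
    have "K d \<otimes> (d \<otimes> c) = c \<otimes> (d \<otimes> d) \<otimes> c" using e cc d by (simp add: d_def[symmetric] m_assoc)
    also have "\<dots> = (c \<otimes> c) \<otimes> z" using sqz[OF d(1)] zcom[OF cc] cc zc by (simp add: m_assoc)
    also have "\<dots> = \<one>" using sqz[OF c] z by simp
    finally have "z \<otimes> (b \<otimes> (b \<otimes> b)) = z \<otimes> z" using edc z by simp
    then have b3: "b \<otimes> (b \<otimes> b) = z" using ac zc by simp
    have S: "{a, b, c} \<subseteq> carrier G" using ac cc by simp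
    have sub: "subgroup (generate G {a, b, c}) G" using generate_is_subgroup[OF S] .
    have g: "a \<in> generate G {a, b, c}" "c \<in> generate G {a, b, c}" by (auto intro: generate.incl)
    note mg = mult_generate[OF S]
    have zg: "z \<in> generate G {a, b, c}" using mg[OF g(1) mg[OF g(1,1)]] a3 by simp
    have "d = a \<otimes> c \<otimes> inv a" using aK[OF cc] ac cc d by (simp add: d_def[symmetric] m_assoc)
    then have dg: "d \<in> generate G {a, b, c}" using mg[OF mg[OF g] inv_generate[OF S g(1)]] by simp
    have "s = a \<otimes> z" unfolding a_def using sc zc z by (simp add: m_assoc)
    then have sg: "s \<in> generate G {a, b, c}" using mg[OF g(1) zg] by simp
    have cd: "c \<otimes> d = K d" using e by (simp add: d_def)
    have X4eq: "X4 = {c, c \<otimes> z, d, d \<otimes> z, K d, K d \<otimes> z}"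
    proof (rule card_subset_eq[OF finX, symmetric])
      show "{c, c \<otimes> z, d, d \<otimes> z, K d, K d \<otimes> z} \<subseteq> X4"
        using c d KX[OF d(1)] X_central(1) zZ by simp
      have n1: "u \<noteq> u \<otimes> z" if "u \<in> carrier G" for u using that z zc by simp
      have zz: "u \<otimes> z = v \<longleftrightarrow> u = v \<otimes> z" if "u \<in> carrier G" "v \<in> carrier G" for u v
        using that z zc by (metis m_assoc r_one)
      have c1: "d \<noteq> c" "d \<noteq> c \<otimes> z" by (rule dne)+
      have c2: "K d \<noteq> d" "K d \<noteq> d \<otimes> z" using Kne[OF d(1)] by auto
      have c3: "K d \<noteq> c" "K d \<noteq> c \<otimes> z"
      proof -
        show "K d \<noteq> c"
        proof
          assume "K d = c"
          then have "K c = c" using K3[OF cc] by (simp add: d_def)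
          then show False using Kne[OF c] by simp
        qed
        show "K d \<noteq> c \<otimes> z"
        proof
          assume "K d = c \<otimes> z"
          then have "c = K c \<otimes> z" using K3[OF cc] Kz[OF cc] by (simp add: d_def)
          then have "K c = c \<otimes> z" using zz[of d c] d cc by (simp add: d_def)
          then show False using Kne[OF c] by simp
        qed
      qed
      have c4: "c \<noteq> d \<otimes> z" "c \<noteq> K d \<otimes> z" "d \<noteq> K d \<otimes> z"
        using c1(2) c2(2) c3(2) zz[OF d(2) cc] zz[OF ec cc] zz[OF ec d(2)] by auto
      have c5: "c \<otimes> z \<noteq> d \<otimes> z" "c \<otimes> z \<noteq> K d \<otimes> z" "d \<otimes> z \<noteq> K d \<otimes> z"
        using c1(1) c2(1) c3(1) cc d(2) ec zc right_cancel by metis+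
      show "card {c, c \<otimes> z, d, d \<otimes> z, K d, K d \<otimes> z} = card X4"
        unfolding X4c(1) using n1[OF cc] n1[OF d(2)] n1[OF ec] c1 c2 c3 c4 c5
        by (simp add: card_insert_if)
    qed
    have Pg: "P \<subseteq> generate G {a, b, c}"
      unfolding PZ X4eq z(1) using g zg dg cd[symmetric] mg by (auto intro: generate.one)
    have "P \<union> (\<lambda>p. s \<otimes> p) ` P \<subseteq> generate G {a, b, c}" using Pg sg mg by auto
    moreover have "card (P \<union> (\<lambda>p. s \<otimes> p) ` P) = 16"
    proof -
      have "s \<otimes> p \<notin> P" if "p \<in> P" for p
      proof
        assume "s \<otimes> p \<in> P"
        then have "(s \<otimes> p) \<otimes> inv p \<in> P" using that P(1) by (simp add: subgroup.m_closed subgroup.m_inv_closed)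
        then show False using sP sc that Pc by (auto simp: m_assoc)
      qed
      then have "P \<inter> (\<lambda>p. s \<otimes> p) ` P = {}" by auto
      moreover have "card ((\<lambda>p. s \<otimes> p) ` P) = 8" using sc Pc P(2) by (subst card_image) (auto simp: inj_on_def subset_iff)
      ultimately show ?thesis using finP P(2) by (simp add: card_Un_disjoint)
    qed
    moreover have "finite (generate G {a, b, c})" using fin subgroup.subset[OF sub] finite_subset by blast
    ultimately have "16 \<le> card (generate G {a, b, c})" by (metis card_mono)
    then have gen: "generate G {a, b, c} = carrier G" using subgroup_eq_carrier[OF fin sub] o24 by simp
    show ?thesis
    proof (rule iso_SL_2_3[OF fin o24 ac cc gen])
      show "c [^] (2::nat) = a \<otimes> (b \<otimes> c)"
        using two_pow[OF cc] cab ac cc by (simp add: m_assoc[symmetric])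
    qed (use a3 b3 sqz[OF c] ac cc in \<open>simp_all add: three_pow two_pow\<close>)
  qed
  have c0c: "c0 \<in> carrier G" using X4m c0 by blast
  \<comment> \<open>Apart from \<open>c0\<close>, \<open>K c0\<close> and their products with
    \<open>z\<close>, the set \<open>X4\<close> contains only \<open>c0 \<otimes> K c0\<close> and
    its product with \<open>z\<close>. The wrong sign is removed afterwards by replacing
    \<open>c0\<close> with \<open>c0 \<otimes> z\<close>.\<close>
  have "K (K c0) = c0 \<otimes> K c0 \<or> K (K c0) = (c0 \<otimes> K c0) \<otimes> z"
  proof -
    define d where "d = K c0"
    have d: "d \<in> X4" "d \<in> carrier G" using KX[OF c0] X4m unfolding d_def by blast+
    have dne: "d \<noteq> c0" "d \<noteq> c0 \<otimes> z" using Kne[OF c0] by (auto simp: d_def)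
    have cdP: "c0 \<otimes> d \<in> P" using c0 d PZ Pm by auto
    have zz: "u \<otimes> z = v \<longleftrightarrow> u = v \<otimes> z" if "u \<in> carrier G" "v \<in> carrier G" for u v
      using that z zc by (metis m_assoc r_one)
    have n1: "u \<noteq> u \<otimes> z" if "u \<in> carrier G" for u using that z zc by simp
    have cdZ: "c0 \<otimes> d \<notin> Z"
    proof
      assume "c0 \<otimes> d \<in> Z"
      then have "c0 \<otimes> (c0 \<otimes> d) = c0 \<or> c0 \<otimes> (c0 \<otimes> d) = c0 \<otimes> z" using z c0c by auto
      then have "d \<otimes> z = c0 \<or> d \<otimes> z = c0 \<otimes> z" using sqz[OF c0] zcom[OF d(2)] c0c d by (simp add: m_assoc[symmetric])
      then show False using dne zz[OF d(2) c0c] d c0c zc by auto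
    qed
    then have cdX: "c0 \<otimes> d \<in> X4" using cdP PZ by blast
    have cd1: "c0 \<otimes> d \<noteq> c0" "c0 \<otimes> d \<noteq> d" "c0 \<otimes> d \<noteq> c0 \<otimes> z" "c0 \<otimes> d \<noteq> d \<otimes> z"
    proof -
      have "d \<noteq> \<one>" "d \<noteq> z" "c0 \<noteq> \<one>" "c0 \<noteq> z" using X4m(2)[OF d(1)] X4m(2)[OF c0] z by auto
      then show "c0 \<otimes> d \<noteq> c0" "c0 \<otimes> d \<noteq> d" "c0 \<otimes> d \<noteq> c0 \<otimes> z" "c0 \<otimes> d \<noteq> d \<otimes> z"
        using c0c d zc zcom[OF d(2), symmetric] by auto
    qed
    have "X4 = {c0, c0 \<otimes> z, d, d \<otimes> z, c0 \<otimes> d, (c0 \<otimes> d) \<otimes> z}"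
    proof (rule card_subset_eq[OF finX, symmetric])
      show "{c0, c0 \<otimes> z, d, d \<otimes> z, c0 \<otimes> d, (c0 \<otimes> d) \<otimes> z} \<subseteq> X4" using c0 d cdX X_central(1) zZ by simp
      have m: "c0 \<otimes> d \<in> carrier G" using c0c d by simp
      have "c0 \<noteq> d \<otimes> z" "c0 \<noteq> (c0 \<otimes> d) \<otimes> z" "d \<noteq> (c0 \<otimes> d) \<otimes> z"
        using dne(2) cd1 zz[OF d(2) c0c] zz[OF m c0c] zz[OF m d(2)] by auto
      moreover have "c0 \<otimes> z \<noteq> d \<otimes> z" "c0 \<otimes> z \<noteq> (c0 \<otimes> d) \<otimes> z" "d \<otimes> z \<noteq> (c0 \<otimes> d) \<otimes> z"
        using dne cd1 c0c d m zc right_cancel by metis+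
      ultimately show "card {c0, c0 \<otimes> z, d, d \<otimes> z, c0 \<otimes> d, (c0 \<otimes> d) \<otimes> z} = card X4"
        unfolding X4c(1) using dne cd1 n1[OF c0c] n1[OF d(2)] n1[OF m]
        by (simp add: card_insert_if)
    qed
    moreover have "K d \<in> X4" by (rule KX[OF d(1)])
    moreover have "K d \<noteq> c0"
    proof
      assume "K d = c0"
      then have "K c0 = c0" using K3[OF c0c] by (simp add: d_def)
      then show False using Kne[OF c0] by simp
    qed
    moreover have "K d \<noteq> c0 \<otimes> z"
    proof
      assume "K d = c0 \<otimes> z"
      then have "c0 = K c0 \<otimes> z" using K3[OF c0c] Kz[OF c0c] by (simp add: d_def)
      then have "K c0 = c0 \<otimes> z" using zz[of d c0] d c0c by (simp add: d_def)
      then show False using Kne[OF c0] by simp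
    qed
    moreover have "K d \<noteq> d" "K d \<noteq> d \<otimes> z" using Kne[OF d(1)] by auto
    ultimately show ?thesis unfolding d_def by blast
  qed
  then show ?thesis
  proof
    assume "K (K c0) = (c0 \<otimes> K c0) \<otimes> z"
    moreover have Kc: "K c0 \<in> carrier G" "K (K c0) \<in> carrier G" using KX[OF c0] KX[OF KX[OF c0]] X4m by blast+
    ultimately have "K (K (c0 \<otimes> z)) = (c0 \<otimes> K c0) \<otimes> (z \<otimes> z)"
      using Kz[OF c0c] Kz[OF Kc(1)] c0c zc by (simp add: m_assoc)
    also have "\<dots> = (c0 \<otimes> z) \<otimes> K (c0 \<otimes> z)"
    proof -
      have "(c0 \<otimes> z) \<otimes> K (c0 \<otimes> z) = c0 \<otimes> (z \<otimes> K c0) \<otimes> z" using Kz[OF c0c] Kc c0c zc by (simp add: m_assoc)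
      also have "z \<otimes> K c0 = K c0 \<otimes> z" using zcom[OF Kc(1)] .
      finally show ?thesis using Kc c0c zc by (simp add: m_assoc)
    qed
    finally show ?thesis using main[OF X_central(1)[OF c0 zZ]] by simp
  qed (rule main[OF c0])
qed

text \<open>With n for the order, n = 2 + k n/4 + l n/6 becomes n(12 - 3k - 2l) = 24. A noncentral
  centralizer is proper with at least 4 elements, so n >= 8, which leaves 8, 12 and 24.\<close>

lemma card_Z_2_cases:
  "G \<cong> dihedral_group 4 \<or> G \<cong> dicyclic_group 2 \<or> G \<cong> dihedral_group 6 \<or> G \<cong> dicyclic_group 3 \<or> G \<cong> SL_2_3"
proof -
  obtain z where z: "Z = {\<one>, z}" "z \<noteq> \<one>" "z \<otimes> z = \<one>" using Z_two by metis
  have zZ: "z \<in> Z" using z by simp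
  have zc: "z \<in> carrier G" using zZ center_carrier by blast
  obtain k where k: "card X4 * 4 = k * order G" "\<And>x. k = 1 \<Longrightarrow> x \<in> X4 \<Longrightarrow> X4 = conj_class G x"
    using class_count[OF X4_def] by metis
  obtain l where l: "card X6 * 6 = l * order G" "\<And>x. l = 1 \<Longrightarrow> x \<in> X6 \<Longrightarrow> X6 = conj_class G x"
    using class_count[OF X6_def] by metis
  define n where "n = order G"
  have eq: "12 * n = 24 + 3 * (k * n) + 2 * (l * n)" using order_eq k(1) l(1) unfolding n_def by linarith
  have "12 * int n = 24 + 3 * (int k * int n) + 2 * (int l * int n)" using arg_cong[OF eq, of int] by simp
  then have eqi: "int n * (12 - 3 * int k - 2 * int l) = 24" by (simp add: algebra_simps)
  then have "int n dvd 24" by (metis dvd_triv_left)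
  then have ndvd: "n dvd 24" by (metis int_dvd_int_iff of_nat_numeral)
  obtain x where x: "x \<in> carrier G" "x \<notin> Z" using nonabelian by blast
  have "4 \<le> card (centralizer G x)" using centralizer_card[OF x] by (cases "x \<otimes> x \<in> Z") auto
  then have n8: "8 \<le> n" using proper_subgroup_card[OF fin centralizer_subgroup[OF x(1)]] noncentral_iff[OF x(1)] x(2)
    unfolding n_def by simp
  have "n \<in> {8, 12, 24}"
  proof -
    obtain q where q: "24 = n * q" using ndvd by (rule dvdE)
    have "q \<noteq> 0" using q by (intro notI) simp
    moreover have "8 * q \<le> 24" using mult_le_mono1[OF n8, of q] unfolding q[symmetric] .
    ultimately have "q = 1 \<or> q = 2 \<or> q = 3" by auto
    then show ?thesis using q by auto
  qed
  then consider "n = 8" | "n = 12" | "n = 24" by auto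
  then show ?thesis
  proof cases
    case 1
    then show ?thesis using order_8_center_2 unfolding n_def by auto
  next
    case 2
    have kl: "3 * k + 2 * l = 10" using eq 2 by simp
    \<comment> \<open>A Sylow subgroup of order 4 exceeds the center and yields an element of
      \<open>X4\<close>, so k > 0. Then 3k + 2l = 10 has the only solution k = l = 2.\<close>
    obtain P where P: "subgroup P G" "card P = 4"
    proof -
      have "prime (2::nat)" "order G = 2 ^ 2 * 3" using 2 n_def by simp_all
      from sylow_thm[OF this(1) is_group this(2) fin] show ?thesis using that by auto
    qed
    have finP: "finite P" using P(2) card.infinite by fastforce
    have "\<not> P \<subseteq> Z"
    proof
      assume "P \<subseteq> Z"
      then have "card P \<le> card Z" using finite_Z by (rule card_mono[rotated])
      then show False using P(2) Z2 by simp
    qed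
    then obtain y where y: "y \<in> P" "y \<notin> Z" by blast
    have yc: "y \<in> carrier G" using y P subgroup.subset by blast
    have "y \<in> X4"
    proof (rule ccontr)
      assume "y \<notin> X4"
      then have "y \<in> X6" using X4_iff X6_iff yc y by blast
      then have y3: "y \<otimes> (y \<otimes> y) \<in> Z" by (rule X6_cube)
      have "y [^] (4::nat) = \<one>" using subgroup_pow_card[OF P(1) finP y(1)] P(2) by simp
      then have "y \<otimes> (y \<otimes> (y \<otimes> y)) = \<one>" using four_pow[OF yc] yc by (simp add: m_assoc)
      then have "inv (y \<otimes> (y \<otimes> y)) = y" using yc by (intro inv_equality) auto
      then show False using Z_inv[OF y3] y(2) by simp
    qed
    have "finite X4" using fin by (simp add: X4_def)
    then have "card X4 \<noteq> 0" using \<open>y \<in> X4\<close> by auto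
    then have "k \<noteq> 0" using k(1) by (intro notI) simp
    then have "k = 2" "l = 2" using kl by presburger+
    then have c6: "card X6 = 4" using l(1) 2 n_def by simp
    then obtain r where "r \<in> X6" by fastforce
    then show ?thesis using order_12_center_2[OF _ _ \<open>y \<in> X4\<close> c6] 2 unfolding n_def by auto
  next
    case 3
    have kl: "3 * k + 2 * l = 11" using eq 3 by simp
    \<comment> \<open>If \<open>X6\<close> were a single class, \<open>r\<close> and
      \<open>r \<otimes> z\<close> would be conjugate, but their cubes are central and differ by
      \<open>z\<close>. The remaining solution of 3k + 2l = 11 is k = 1, l = 4.\<close>
    have "l \<noteq> 1"
    proof
      assume l1: "l = 1"
      then have "card X6 = 4" using l(1) 3 n_def by simp
      then obtain r where r: "r \<in> X6" by fastforce
      have rc: "r \<in> carrier G" using r by (simp add: X6_def)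
      have r3: "r [^] (3::nat) \<in> Z" using X6_cube[OF r] three_pow[OF rc] by simp
      have "r \<otimes> z \<in> conj_class G r" using l(2)[OF l1 r] X_central(2)[OF r zZ] by simp
      then obtain g where g: "g \<in> carrier G" "r \<otimes> z = g \<otimes> r \<otimes> inv g" by (auto simp: conj_class_def)
      have "(r \<otimes> z) [^] (3::nat) = g \<otimes> r [^] (3::nat) \<otimes> inv g" unfolding g(2) by (rule conj_pow[OF rc g(1)])
      also have "g \<otimes> r [^] (3::nat) = r [^] (3::nat) \<otimes> g" using center_commute[OF r3 g(1)] by simp
      also have "r [^] (3::nat) \<otimes> g \<otimes> inv g = r [^] (3::nat)" using rc g by (simp add: m_assoc)
      finally have "(r \<otimes> z) [^] (3::nat) = r [^] (3::nat)" .
      moreover have "(r \<otimes> z) [^] (3::nat) = r [^] (3::nat) \<otimes> z"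
      proof -
        have "(r \<otimes> z) [^] (3::nat) = (r \<otimes> z) \<otimes> (r \<otimes> r)"
          using three_pow[of "r \<otimes> z"] square_central_mult[OF rc zZ] z rc zc by simp
        also have "\<dots> = r \<otimes> (z \<otimes> (r \<otimes> r))" using rc zc by (simp add: m_assoc)
        also have "z \<otimes> (r \<otimes> r) = (r \<otimes> r) \<otimes> z" using center_commute[OF zZ, of "r \<otimes> r"] rc by simp
        finally show ?thesis using three_pow[OF rc] rc zc by (simp add: m_assoc)
      qed
      ultimately show False using rc zc z by simp
    qed
    moreover have "l \<le> 5" using kl by linarith
    then have "l \<in> {0,1,2,3,4,5}" by auto
    ultimately have kl1: "k = 1" "l = 4" using kl by auto presburger+
    have "card X4 = 6" "card X6 = 16" using k(1) l(1) kl1 3 n_def by simp_all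
    moreover from this obtain r where "r \<in> X6" by fastforce
    ultimately have "G \<cong> SL_2_3" using order_24_center_2[OF _ _ k(2)[OF kl1(1)]] 3 unfolding n_def by simp
    then show ?thesis by blast
  qed
qed

end

end

section \<open>Actions by conjugation\<close>

text \<open>The members of \<open>F\<close> are numbered from 1 to \<open>m\<close> because
  \<open>sym_group m\<close> consists of permutations of \<open>{1..m}\<close>; a trivial kernel
  then means injectivity.\<close>

lemma (in group) conj_action_sym_group:
  assumes F: "finite F" "card F = m" "\<And>A. A \<in> F \<Longrightarrow> A \<subseteq> carrier G"
    and closed: "\<And>g A. g \<in> carrier G \<Longrightarrow> A \<in> F \<Longrightarrow> (\<lambda>x. g \<otimes> x \<otimes> inv g) ` A \<in> F"
    and faithful: "\<And>g. g \<in> carrier G \<Longrightarrow> (\<And>A. A \<in> F \<Longrightarrow> (\<lambda>x. g \<otimes> x \<otimes> inv g) ` A = A) \<Longrightarrow> g = \<one>"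
  obtains \<phi> where "\<phi> \<in> hom G (sym_group m)" "inj_on \<phi> (carrier G)"
proof -
  define c where "c g A = (\<lambda>x. g \<otimes> x \<otimes> inv g) ` A" for g A
  have cF: "c g A \<in> F" if "g \<in> carrier G" "A \<in> F" for g A using closed[OF that] by (simp add: c_def)
  have cc: "c g (c h A) = c (g \<otimes> h) A" if "g \<in> carrier G" "h \<in> carrier G" "A \<in> F" for g h A
    unfolding c_def image_image using F(3)[OF that(3)] that conj_conj by (intro image_cong) auto
  have c1: "c \<one> A = A" if "A \<in> F" for A
    unfolding c_def using F(3)[OF that] by (auto simp: image_iff subset_iff)
  obtain \<beta> where \<beta>: "bij_betw \<beta> {1..m} F" using ex_bij_betw_nat_finite_1[OF F(1)] F(2) by blast
  define \<alpha> where "\<alpha> = the_inv_into {1..m} \<beta>"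
  have \<alpha>: "\<alpha> A \<in> {1..m}" "\<beta> (\<alpha> A) = A" if "A \<in> F" for A
    using \<beta> that f_the_inv_into_f_bij_betw[OF \<beta>] the_inv_into_into[of \<beta> "{1..m}" A "{1..m}"]
    by (auto simp: \<alpha>_def bij_betw_def)
  have \<beta>F: "\<beta> i \<in> F" if "i \<in> {1..m}" for i using \<beta> that by (auto simp: bij_betw_def)
  have \<alpha>\<beta>: "\<alpha> (\<beta> i) = i" if "i \<in> {1..m}" for i
    using \<beta> that by (simp add: \<alpha>_def bij_betw_def the_inv_into_f_f)
  define \<phi> where "\<phi> g i = (if i \<in> {1..m} then \<alpha> (c g (\<beta> i)) else i)" for g i
  have comp: "\<phi> g (\<phi> h i) = \<phi> (g \<otimes> h) i" if "g \<in> carrier G" "h \<in> carrier G" for g h i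
    using that \<alpha> \<beta>F cF cc by (auto simp: \<phi>_def)
  have id: "\<phi> \<one> = id" using c1 \<beta>F \<alpha>\<beta> by (auto simp: \<phi>_def)
  have perm: "\<phi> g permutes {1..m}" if g: "g \<in> carrier G" for g
  proof (rule bij_imp_permutes)
    show "bij_betw (\<phi> g) {1..m} {1..m}"
    proof (rule bij_betwI[where g = "\<phi> (inv g)"])
      show "\<phi> g \<in> {1..m} \<rightarrow> {1..m}" "\<phi> (inv g) \<in> {1..m} \<rightarrow> {1..m}"
        using \<alpha>(1) cF \<beta>F g by (auto simp: \<phi>_def Pi_def)
    qed (use comp[of "inv g" g] comp[of g "inv g"] g id in auto)
  qed (auto simp: \<phi>_def)
  have "\<phi> \<in> hom G (sym_group m)"
    using perm comp by (auto simp: hom_def sym_group_def fun_eq_iff)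
  moreover have "inj_on \<phi> (carrier G)"
  proof (rule inj_onI)
    fix g h assume gh: "g \<in> carrier G" "h \<in> carrier G" and eq: "\<phi> g = \<phi> h"
    have "inv g \<otimes> h = \<one>"
    proof (rule faithful)
      fix A assume A: "A \<in> F"
      have "\<phi> (inv g \<otimes> h) = \<phi> (inv g \<otimes> g)"
        using comp[of "inv g" h, symmetric] comp[of "inv g" g, symmetric] eq gh by (auto simp: fun_eq_iff)
      then have "\<phi> (inv g \<otimes> h) (\<alpha> A) = \<alpha> A" using id gh by simp
      then have "\<alpha> (c (inv g \<otimes> h) A) = \<alpha> A" using \<alpha>[OF A] by (simp add: \<phi>_def)
      then have "c (inv g \<otimes> h) A = A" using \<alpha>(2)[OF A] \<alpha>(2)[OF cF[of "inv g \<otimes> h" A]] A gh by simp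
      then show "(\<lambda>x. (inv g \<otimes> h) \<otimes> x \<otimes> inv (inv g \<otimes> h)) ` A = A" by (simp add: c_def)
    qed (use gh in simp)
    then have "g \<otimes> (inv g \<otimes> h) = g" using gh by simp
    then show "g = h" using gh by simp
  qed
  ultimately show ?thesis by (rule that)
qed

lemma (in group) iso_sym_groupI:
  assumes "\<phi> \<in> hom G (sym_group m)" "inj_on \<phi> (carrier G)" "order G = fact m"
  shows "G \<cong> sym_group m"
proof -
  have fin: "finite (carrier (sym_group m))"
    using sym_group_card_carrier[of m] card.infinite by fastforce
  have sub: "\<phi> ` carrier G \<subseteq> carrier (sym_group m)" using assms(1) by (auto simp: hom_def)
  have "\<phi> ` carrier G = carrier (sym_group m)"
    using card_image[OF assms(2)] assms(3) sym_group_card_carrier[of m]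
    by (intro card_subset_eq[OF fin sub]) (simp add: order_def)
  then show ?thesis using assms unfolding is_iso_def iso_def bij_betw_def by blast
qed

text \<open>An element with an odd power equal to 1 maps to an even permutation. As more than half
  of the elements are of this kind, the subgroup of elements with even image is everything, and
  counting identifies the image with the alternating group.\<close>

lemma (in group) iso_alt_groupI:
  assumes \<phi>: "\<phi> \<in> hom G (sym_group m)" "inj_on \<phi> (carrier G)" and m: "2 * order G = fact m" "m \<ge> 2"
    and O: "Od \<subseteq> carrier G" "order G < 2 * card Od" "\<And>x. x \<in> Od \<Longrightarrow> \<exists>k. odd k \<and> x [^] (k::nat) = \<one>"
  shows "G \<cong> alt_group m"
proof -
  interpret S: group "sym_group m" by (rule sym_group_is_group)
  interpret \<phi>: group_hom G "sym_group m" \<phi> by unfold_locales (rule \<phi>(1))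
  have fin: "finite (carrier G)" using m fact_nonzero[of m] order_gt_0_iff_finite by (metis mult_0_right neq0_conv)
  have perm: "permutation (\<phi> x)" if "x \<in> carrier G" for x
    using \<phi>.hom_closed[OF that] sym_group_carrier' by blast
  define K where "K = {x \<in> carrier G. evenperm (\<phi> x)}"
  have even_iff: "evenperm (\<phi> (x \<otimes> y)) \<longleftrightarrow> evenperm (\<phi> x) = evenperm (\<phi> y)" if "x \<in> carrier G" "y \<in> carrier G" for x y
    using that by (simp add: sym_group_mult evenperm_comp perm)
  have e1: "evenperm (\<phi> \<one>)" using \<phi>.hom_one by (simp add: sym_group_one evenperm_id)
  have K: "subgroup K G"
  proof (rule subgroupI)
    show "inv x \<in> K" if x: "x \<in> K" for x
    proof -
      have xc: "x \<in> carrier G" "evenperm (\<phi> x)" using x by (auto simp: K_def)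
      have "evenperm (\<phi> (inv x \<otimes> x))" using e1 xc by simp
      then show ?thesis using even_iff[of "inv x" x] xc by (simp add: K_def)
    qed
    show "x \<otimes> y \<in> K" if "x \<in> K" "y \<in> K" for x y using that even_iff by (auto simp: K_def)
    show "K \<noteq> {}" using e1 by (auto simp: K_def)
  qed (auto simp: K_def)
  have epow: "evenperm (\<phi> (x [^] (k::nat))) \<longleftrightarrow> evenperm (\<phi> x) \<or> even k" if "x \<in> carrier G" for x k
    by (induction k) (use that e1 even_iff in auto)
  have "Od \<subseteq> K"
  proof
    fix x assume x: "x \<in> Od"
    then obtain k :: nat where "odd k" "x [^] k = \<one>" using O(3) by blast
    then show "x \<in> K" using O(1) x epow[of x k] e1 unfolding K_def by auto
  qed
  then have "card Od \<le> card K" using fin by (intro card_mono) (auto simp: K_def)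
  then have "K = carrier G" using subgroup_eq_carrier[OF fin K] O(2) by simp
  then have sub: "\<phi> ` carrier G \<subseteq> carrier (alt_group m)"
    using \<phi>.hom_closed unfolding K_def by (auto simp: alt_group_carrier sym_group_carrier)
  have finA: "finite (carrier (alt_group m))"
    using sym_group_card_carrier[of m] card.infinite[of "carrier (sym_group m)"]
    by (intro finite_subset[OF subgroup.subset[OF alt_group_is_subgroup]]) fastforce
  have "\<phi> ` carrier G = carrier (alt_group m)"
    using card_image[OF \<phi>(2)] m alt_group_card_carrier[OF m(2)]
    by (intro card_subset_eq[OF finA sub]) (simp add: order_def)
  moreover have "\<phi> \<in> hom G (alt_group m)"
    using sub \<phi>(1) by (auto simp: hom_def alt_group_mult sym_group_mult image_subset_iff)
  ultimately have "\<phi> \<in> iso G (alt_group m)" using \<phi>(2) by (auto simp: iso_def bij_betw_def)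
  then show ?thesis unfolding is_iso_def by blast
qed

section \<open>Centerless groups\<close>

text \<open>The class equation, multiplied by 120; \<open>k\<^sub>d\<close> is the number of classes of elements with
  centralizers of order \<open>d\<close> and \<open>n\<close> the order of the group. The divisibility by 6 and 20 reflects that
  the elements with centralizers of order 3 and 5 come in blocks of 2 and 4.\<close>

lemma class_equation_check:
  "\<forall>k2\<in>set [0..<2]. \<forall>k3\<in>set [0..<3]. \<forall>k4\<in>set [0..<4]. \<forall>k5\<in>set [0..<5].
     (if 60 * k2 + 40 * k3 + 30 * k4 + 24 * k5 \<ge> 120 then True else \<forall>k8\<in>set [0..<8].
    (let s = 60 * k2 + 40 * k3 + 30 * k4 + 24 * k5 + 15 * k8; n = 120 div (120 - s)
     in if s \<ge> 120 then True else if 120 mod (120 - s) \<noteq> 0 then True else ((k8 = 0 \<or> k4 \<noteq> 0) \<longrightarrow> n \<noteq> 1 \<longrightarrow>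
      (k3 * n) mod 6 = 0 \<longrightarrow> (k5 * n) mod 20 = 0 \<longrightarrow>
      (k2 = 0 \<or> n mod 2 = 0 \<and> n \<noteq> 2) \<longrightarrow> (k3 = 0 \<or> n mod 3 = 0 \<and> n \<noteq> 3) \<longrightarrow> (k4 = 0 \<or> n mod 4 = 0 \<and> n \<noteq> 4) \<longrightarrow>
      (k5 = 0 \<or> n mod 5 = 0 \<and> n \<noteq> 5) \<longrightarrow> (k8 = 0 \<or> n mod 8 = 0 \<and> n \<noteq> 8) \<longrightarrow>
      List.member [(6, 1, 1, 0, 0, 0), (10, 1, 0, 0, 2, 0), (12, 0, 2, 1, 0, 0), (20, 0, 0, 3, 1, 0),
     (20, 1, 0, 1, 1, 0), (24, 0, 1, 1, 0, 3), (24, 0, 1, 2, 0, 1), (40, 0, 0, 1, 3, 1), (60, 0, 1, 1, 2, 0)] (n, k2, k3, k4, k5, k8 :: nat))))"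
  by code_simp

text \<open>The equation says (120 - s) n = 120, so the numbers of classes determine n, and s < 120
  bounds each of them by 120 divided by its coefficient. What remains is a finite check.\<close>

lemma class_equation_solutions:
  fixes n k2 k3 k4 k5 k8 :: nat
  assumes eq: "120 * n = 120 + (60 * k2 + 40 * k3 + 30 * k4 + 24 * k5 + 15 * k8) * n" and "n > 1"
    and "k8 = 0 \<or> k4 \<noteq> 0" "6 dvd k3 * n" "20 dvd k5 * n"
    and "k2 = 0 \<or> 2 dvd n \<and> n \<noteq> 2" "k3 = 0 \<or> 3 dvd n \<and> n \<noteq> 3" "k4 = 0 \<or> 4 dvd n \<and> n \<noteq> 4"
    and "k5 = 0 \<or> 5 dvd n \<and> n \<noteq> 5" "k8 = 0 \<or> 8 dvd n \<and> n \<noteq> 8"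
  shows "(n, k2, k3, k4, k5, k8) \<in> {(6, 1, 1, 0, 0, 0), (10, 1, 0, 0, 2, 0), (12, 0, 2, 1, 0, 0), (20, 0, 0, 3, 1, 0),
     (20, 1, 0, 1, 1, 0), (24, 0, 1, 1, 0, 3), (24, 0, 1, 2, 0, 1), (40, 0, 0, 1, 3, 1), (60, 0, 1, 1, 2, 0)}"
proof -
  define s where "s = 60 * k2 + 40 * k3 + 30 * k4 + 24 * k5 + 15 * k8"
  have s: "s < 120"
  proof (rule ccontr)
    assume "\<not> s < 120"
    then have "120 * n \<le> s * n" by simp
    then show False using eq by (simp add: s_def[symmetric])
  qed
  have "(120 - s) * n = 120" using eq s by (simp add: s_def[symmetric] diff_mult_distrib)
  then have N: "120 div (120 - s) = n" "120 mod (120 - s) = 0" using s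
    by (metis less_numeral_extra(3) nonzero_mult_div_cancel_left zero_less_diff, metis mod_mult_self1_is_0)
  have b: "k2 < 2" "k3 < 3" "k4 < 4" "k5 < 5" "k8 < 8" using s unfolding s_def by linarith+
  then have m: "k2 \<in> set [0..<2]" "k3 \<in> set [0..<3]" "k4 \<in> set [0..<4]" "k5 \<in> set [0..<5]" "k8 \<in> set [0..<8]" by simp_all
  have A: "\<not> 60 * k2 + 40 * k3 + 30 * k4 + 24 * k5 \<ge> 120" and S: "\<not> 120 \<le> s" and M: "\<not> 120 mod (120 - s) \<noteq> 0"
    using s N(2) unfolding s_def by linarith+
  note c = class_equation_check[THEN bspec, OF m(1), THEN bspec, OF m(2), THEN bspec, OF m(3), THEN bspec, OF m(4),
      unfolded if_not_P[OF A], THEN bspec, OF m(5), unfolded Let_def, folded s_def, unfolded if_not_P[OF S] if_not_P[OF M] N(1)]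
  have "n \<noteq> 1" using assms(2) by simp
  have "List.member [(6, 1, 1, 0, 0, 0), (10, 1, 0, 0, 2, 0), (12, 0, 2, 1, 0, 0), (20, 0, 0, 3, 1, 0),
     (20, 1, 0, 1, 1, 0), (24, 0, 1, 1, 0, 3), (24, 0, 1, 2, 0, 1), (40, 0, 0, 1, 3, 1), (60, 0, 1, 1, 2, 0)] (n, k2, k3, k4, k5, k8)"
    using c assms(3-10) \<open>n \<noteq> 1\<close> unfolding dvd_eq_mod_eq_0 by blast
  then show ?thesis by simp
qed

context small_cliques
begin

definition "Cd d = {x \<in> carrier G. x \<notin> Z \<and> card (centralizer G x) = d}"

end

locale centerless_cliques = small_cliques +
  assumes Z1: "card (group_center G) = 1"
begin

lemma Z_trivial: "Z = {\<one>}"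
  using Z1 Z_one by (metis card_1_singletonE singletonD)

section \<open>Orders and centralizers of elements when the center is trivial\<close>

lemma commuting_card_le_4:
  assumes "S \<subseteq> carrier G" "\<one> \<notin> S" "\<And>x y. x \<in> S \<Longrightarrow> y \<in> S \<Longrightarrow> x \<otimes> y = y \<otimes> x"
  shows "card S \<le> 4"
proof (rule clique)
  show "S \<subseteq> carrier G - Z" using assms(1,2) Z_trivial by auto
qed (rule assms(3))

lemma pow_commute: "x \<in> carrier G \<Longrightarrow> x [^] (i::nat) \<otimes> x [^] (j::nat) = x [^] j \<otimes> x [^] i"
  by (simp add: nat_pow_mult add.commute)

text \<open>Otherwise the first five powers of \<open>x\<close> would be distinct nontrivial
  commuting elements.\<close>

lemma element_order:
  assumes x: "x \<in> carrier G" "x \<noteq> \<one>"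
  obtains n where "n \<in> {2, 3, 4, 5::nat}" "x [^] n = \<one>" "inj_on (\<lambda>i::nat. x [^] i) {..<n}"
proof -
  have pw: "x [^] (j - i) = \<one>" if "i < j" "x [^] i = x [^] j" for i j :: nat
  proof -
    have "x [^] i \<otimes> x [^] (j - i) = x [^] j" using that(1) x by (simp add: nat_pow_mult)
    then have "x [^] i \<otimes> x [^] (j - i) = x [^] i \<otimes> \<one>" using that(2) x by simp
    then show ?thesis using x by simp
  qed
  have ex: "\<exists>n\<in>{1..5}. x [^] (n::nat) = \<one>"
  proof (rule ccontr)
    assume n: "\<not> ?thesis"
    let ?S = "(\<lambda>i::nat. x [^] i) ` {1..5}"
    have "inj_on (\<lambda>i::nat. x [^] i) {1..5}"
    proof (rule linorder_inj_onI)
      show "x [^] i \<noteq> x [^] j" if "i < j" "i \<in> {1..5}" "j \<in> {1..5}" for i j :: nat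
        using pw[OF that(1)] n that by fastforce
    qed auto
    then have "card ?S = 5" by (simp add: card_image)
    moreover have "card ?S \<le> 4"
      using x n pow_commute[OF x(1)] by (intro commuting_card_le_4) auto
    ultimately show False by simp
  qed
  define n where "n = (LEAST n. 0 < n \<and> x [^] (n::nat) = \<one>)"
  obtain m where m: "m \<in> {1..5}" "x [^] (m::nat) = \<one>" using ex by blast
  have n: "0 < n \<and> x [^] n = \<one>" unfolding n_def by (rule LeastI[of _ m]) (use m in auto)
  have least: "n \<le> k" if "0 < k" "x [^] k = \<one>" for k :: nat unfolding n_def using that by (intro Least_le) auto
  have "n \<noteq> 1" using n x by auto
  then have "n \<in> {2, 3, 4, 5}" using least[of m] m n by auto
  moreover have "inj_on (\<lambda>i::nat. x [^] i) {..<n}"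
  proof (rule linorder_inj_onI)
    show "x [^] i \<noteq> x [^] j" if "i < j" "i \<in> {..<n}" "j \<in> {..<n}" for i j :: nat
      using pw[OF that(1)] least[of "j - i"] that by fastforce
  qed auto
  ultimately show ?thesis using n that by blast
qed

text \<open>A further element of the centralizer would add a second coset of the powers of
  \<open>x\<close>, and 2n - 1 >= 5 nontrivial elements would commute pairwise.\<close>

lemma centralizer_cyclic:
  assumes x: "x \<in> carrier G" "x \<noteq> \<one>" and n: "n \<ge> 3" "x [^] (n::nat) = \<one>" and inj: "inj_on (\<lambda>i::nat. x [^] i) {..<n}"
  shows "centralizer G x = (\<lambda>i. x [^] i) ` {..<n}" "card (centralizer G x) = n"
proof -
  let ?P = "(\<lambda>i::nat. x [^] i) ` {..<n}"
  have mem: "x [^] (i::nat) \<in> ?P" for i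
    using pow_mod_exponent[OF x(1) n(2), of i] n(1) by (intro image_eqI[of _ _ "i mod n"]) auto
  have cardP: "card ?P = n" using inj by (simp add: card_image)
  have "y \<in> ?P" if y: "y \<in> centralizer G x" for y
  proof (rule ccontr)
    assume yP: "y \<notin> ?P"
    have yc: "y \<in> carrier G" "y \<otimes> x = x \<otimes> y" using y by (auto simp: centralizer_def)
    have yx: "y \<otimes> x [^] i = x [^] i \<otimes> y" for i :: nat
      using twisted_pow[OF x(1) yc(1), of 1 i] yc x by simp
    let ?Q = "(\<lambda>p. p \<otimes> y) ` ?P"
    have Pc: "?P \<subseteq> carrier G" using x by auto
    have disj: "?P \<inter> ?Q = {}"
    proof -
      have "x [^] j \<otimes> y \<notin> ?P" if "j < n" for j
      proof
        assume "x [^] j \<otimes> y \<in> ?P"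
        then obtain i :: nat where i: "x [^] j \<otimes> y = x [^] i" by auto
        have "x [^] (n - j) \<otimes> (x [^] j \<otimes> y) = (x [^] (n - j) \<otimes> x [^] j) \<otimes> y" using x yc by (simp add: m_assoc)
        also have "x [^] (n - j) \<otimes> x [^] j = \<one>" using that n x by (simp add: nat_pow_mult)
        finally have "y = x [^] (n - j) \<otimes> x [^] i" using i yc by simp
        then show False using yP mem[of "n - j + i"] x by (simp add: nat_pow_mult)
      qed
      note nP = this
      show ?thesis
      proof (rule equals0I)
        fix w assume w: "w \<in> ?P \<inter> ?Q"
        then obtain j :: nat where "j < n" "w = x [^] j \<otimes> y" by auto
        then show False using nP[of j] w by simp
      qed
    qed
    have cQ: "card ?Q = n" using cardP Pc yc by (subst card_image) (auto simp: inj_on_def subset_iff)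
    have one: "\<one> \<in> ?P" using mem[of 0] by simp
    have "card (?P \<union> ?Q - {\<one>}) = 2 * n - 1"
      using disj cQ cardP one by (simp add: card_Un_disjoint)
    moreover have "card (?P \<union> ?Q - {\<one>}) \<le> 4"
    proof (rule commuting_card_le_4)
      fix u v assume "u \<in> ?P \<union> ?Q - {\<one>}" "v \<in> ?P \<union> ?Q - {\<one>}"
      then have uv: "(\<exists>i::nat. u = x [^] i \<or> u = x [^] i \<otimes> y)" "(\<exists>i::nat. v = x [^] i \<or> v = x [^] i \<otimes> y)" by auto
      have xx: "x [^] i \<otimes> x [^] j = x [^] j \<otimes> x [^] i" for i j :: nat using pow_commute[OF x(1)] .
      have 1: "x [^] i \<otimes> (x [^] j \<otimes> y) = (x [^] j \<otimes> y) \<otimes> x [^] i" for i j :: nat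
      proof -
        have "x [^] i \<otimes> (x [^] j \<otimes> y) = (x [^] j \<otimes> x [^] i) \<otimes> y" using x yc xx[of i j] by (simp add: m_assoc[symmetric])
        also have "\<dots> = x [^] j \<otimes> (y \<otimes> x [^] i)" unfolding yx using x yc by (simp add: m_assoc)
        finally show ?thesis using x yc by (simp add: m_assoc)
      qed
      have 2: "(x [^] i \<otimes> y) \<otimes> (x [^] j \<otimes> y) = (x [^] j \<otimes> y) \<otimes> (x [^] i \<otimes> y)" for i j :: nat
      proof -
        have "(x [^] i \<otimes> y) \<otimes> (x [^] j \<otimes> y) = (x [^] i \<otimes> x [^] j) \<otimes> (y \<otimes> y)" for i j :: nat
        proof -
          have "(x [^] i \<otimes> y) \<otimes> (x [^] j \<otimes> y) = x [^] i \<otimes> (y \<otimes> x [^] j) \<otimes> y" using x yc by (simp add: m_assoc)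
          then show ?thesis unfolding yx using x yc by (simp add: m_assoc)
        qed
        then show ?thesis using xx[of i j] by simp
      qed
      show "u \<otimes> v = v \<otimes> u" using uv xx 1 2 by metis
    qed (use x yc in auto)
    ultimately show False using n(1) by simp
  qed
  moreover have "?P \<subseteq> centralizer G x" using x nat_pow_Suc2[OF x(1)] by (auto simp: centralizer_def)
  ultimately show eq: "centralizer G x = ?P" by blast
  show "card (centralizer G x) = n" unfolding eq by (rule cardP)
qed

text \<open>A further element \<open>w\<close> commuting with both would make \<open>x\<close>,
  \<open>y\<close>, \<open>xy\<close>, \<open>w\<close>, \<open>xw\<close> five nontrivial commuting
  elements.\<close>

lemma centralizer_involution_inter:
  assumes x: "x \<in> carrier G" "x \<noteq> \<one>" "x \<otimes> x = \<one>" and y: "y \<in> centralizer G x" "y \<noteq> \<one>" "y \<noteq> x"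
  shows "centralizer G x \<inter> centralizer G y = {\<one>, x, y, x \<otimes> y}" "card {\<one>, x, y, x \<otimes> y} = 4"
proof -
  have yc: "y \<in> carrier G" "x \<otimes> y = y \<otimes> x" using y by (auto simp: centralizer_def)
  have xy1: "x \<otimes> y \<noteq> \<one>"
  proof
    assume "x \<otimes> y = \<one>"
    then have "x \<otimes> (x \<otimes> y) = x" using x by simp
    then show False using x y(3) yc(1) by (simp add: m_assoc[symmetric])
  qed
  have ne: "x \<otimes> y \<noteq> x" "x \<otimes> y \<noteq> y" using x(1,2) y(2) yc(1) by auto
  show c4: "card {\<one>, x, y, x \<otimes> y} = 4" using x(2) y(2,3) xy1 ne by (auto simp: card_insert_if)
  have xxy: "x \<otimes> (x \<otimes> y) = y" using x yc(1) by (simp add: m_assoc[symmetric])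
  have yxy: "y \<otimes> (x \<otimes> y) = (x \<otimes> y) \<otimes> y"
    by (rule commute_mult[OF yc(1) x(1) yc(1) yc(2)[symmetric] HOL.refl])
  have xyx: "(x \<otimes> y) \<otimes> x = y"
  proof -
    have "(x \<otimes> y) \<otimes> x = x \<otimes> (y \<otimes> x)" using x(1) yc(1) by (simp add: m_assoc)
    then show ?thesis using xxy yc(2) by simp
  qed
  have "w \<in> {\<one>, x, y, x \<otimes> y}" if w: "w \<in> centralizer G x" "w \<in> centralizer G y" for w
  proof (rule ccontr)
    assume n: "w \<notin> {\<one>, x, y, x \<otimes> y}"
    have wc: "w \<in> carrier G" "x \<otimes> w = w \<otimes> x" "y \<otimes> w = w \<otimes> y" using w by (auto simp: centralizer_def)
    have wxy: "w \<otimes> (x \<otimes> y) = (x \<otimes> y) \<otimes> w" using commute_mult[OF wc(1) x(1) yc(1)] wc by simp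
    have wx1: "x \<otimes> w \<noteq> \<one>"
    proof
      assume "x \<otimes> w = \<one>"
      then have "x \<otimes> w = x \<otimes> x" using x by simp
      then have "w = x" using x(1) wc(1) by simp
      then show False using n by simp
    qed
    have xwx: "x \<otimes> w \<noteq> x" "x \<otimes> w \<noteq> w" "x \<otimes> w \<noteq> x \<otimes> y" using x(1,2) n wc(1) yc(1) by auto
    have xwy: "x \<otimes> w \<noteq> y"
    proof
      assume "x \<otimes> w = y"
      then have "x \<otimes> (x \<otimes> w) = x \<otimes> y" by simp
      then have "w = x \<otimes> y" using x(1,3) wc(1) by (simp add: m_assoc[symmetric])
      then show False using n by simp
    qed
    have xw: "x \<otimes> (x \<otimes> w) = (x \<otimes> w) \<otimes> x" "y \<otimes> (x \<otimes> w) = (x \<otimes> w) \<otimes> y" "w \<otimes> (x \<otimes> w) = (x \<otimes> w) \<otimes> w"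
    proof -
      show "x \<otimes> (x \<otimes> w) = (x \<otimes> w) \<otimes> x" by (rule commute_mult[OF x(1) x(1) wc(1) HOL.refl wc(2)])
      show "y \<otimes> (x \<otimes> w) = (x \<otimes> w) \<otimes> y" by (rule commute_mult[OF yc(1) x(1) wc(1) yc(2)[symmetric] wc(3)])
      show "w \<otimes> (x \<otimes> w) = (x \<otimes> w) \<otimes> w" by (rule commute_mult[OF wc(1) x(1) wc(1) wc(2)[symmetric] HOL.refl])
    qed
    have "card {x, y, x \<otimes> y, w, x \<otimes> w} = 5"
      using y(3) ne n xwx xwy by (auto simp: card_insert_if)
    moreover have "card {x, y, x \<otimes> y, w, x \<otimes> w} \<le> 4"
    proof (rule commuting_card_le_4)
      show "{x, y, x \<otimes> y, w, x \<otimes> w} \<subseteq> carrier G" using x yc wc by simp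
      show "\<one> \<notin> {x, y, x \<otimes> y, w, x \<otimes> w}" using x(2) y(2) xy1 n wx1 by auto
      have "(x \<otimes> y) \<otimes> (x \<otimes> w) = (x \<otimes> w) \<otimes> (x \<otimes> y)"
        using x(1) yc(1) wc(1) commute_mult[of "x \<otimes> w" x y] xw by simp
      then show "p \<otimes> q = q \<otimes> p" if "p \<in> {x, y, x \<otimes> y, w, x \<otimes> w}" "q \<in> {x, y, x \<otimes> y, w, x \<otimes> w}" for p q
        using that yc(2) wc(2,3) wxy xw xxy xyx yxy by (elim insertE emptyE) (simp_all only:)
    qed
    ultimately show False by simp
  qed
  moreover have "{\<one>, x, y, x \<otimes> y} \<subseteq> centralizer G x \<inter> centralizer G y"
    using x(1) yc xxy xyx yxy by (auto simp: centralizer_def)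
  ultimately show "centralizer G x \<inter> centralizer G y = {\<one>, x, y, x \<otimes> y}" by blast
qed

text \<open>This is the class equation of C(x) itself. Every element of C(x) other than 1 and
  \<open>x\<close> has a centralizer of order 4 inside C(x), so with m = |C(x)| the equation is 4(m
  - 2) = k m, whence m divides 8.\<close>

lemma centralizer_involution_card:
  assumes x: "x \<in> carrier G" "x \<noteq> \<one>" "x \<otimes> x = \<one>"
  shows "card (centralizer G x) \<in> {2, 4, 8}"
proof -
  define C where "C = centralizer G x"
  have sub: "subgroup C G" unfolding C_def by (rule centralizer_subgroup[OF x(1)])
  have finC: "finite C" using fin by (simp add: C_def centralizer_def)
  interpret H: group "G\<lparr>carrier := C\<rparr>" using subgroup_imp_group[OF sub] .
  have xC: "x \<in> C" "\<one> \<in> C" using x by (auto simp: C_def centralizer_def)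
  have cent: "centralizer (G\<lparr>carrier := C\<rparr>) y = C \<inter> centralizer G y" if "y \<in> C" for y
    using subgroup.subset[OF sub] by (auto simp: centralizer_def)
  have inv: "inv\<^bsub>G\<lparr>carrier := C\<rparr>\<^esub> g = inv g" if "g \<in> C" for g using m_inv_consistent[OF sub that] .
  have gC: "g \<in> carrier G" "x \<otimes> g = g \<otimes> x" if "g \<in> C" for g using that by (auto simp: C_def centralizer_def)
  have "\<exists>k. card (C - {\<one>, x}) * 4 = k * order (G\<lparr>carrier := C\<rparr>) \<and>
      (\<forall>y. k = 1 \<longrightarrow> y \<in> C - {\<one>, x} \<longrightarrow> C - {\<one>, x} = conj_class (G\<lparr>carrier := C\<rparr>) y)"
  proof (rule H.card_conj_closed)
    show "card (centralizer (G\<lparr>carrier := C\<rparr>) y) = 4" if "y \<in> C - {\<one>, x}" for y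
      using cent[of y] centralizer_involution_inter[OF x, of y] that by (simp add: C_def)
    fix y g assume y: "y \<in> C - {\<one>, x}" and "g \<in> carrier (G\<lparr>carrier := C\<rparr>)"
    then have g: "g \<in> C" by simp
    have ygC: "g \<otimes> y \<otimes> inv g \<in> C" using y g sub by (simp add: subgroup.m_closed subgroup.m_inv_closed)
    have y_conj: "y = inv g \<otimes> (g \<otimes> y \<otimes> inv g) \<otimes> g" using gC[OF g] gC[of y] y by (simp add: m_assoc)
    have "g \<otimes> y \<otimes> inv g \<noteq> \<one>"
    proof
      assume "g \<otimes> y \<otimes> inv g = \<one>"
      then have "y = \<one>" using y_conj gC[OF g] by simp
      then show False using y by simp
    qed
    moreover have "g \<otimes> y \<otimes> inv g \<noteq> x"
    proof
      assume "g \<otimes> y \<otimes> inv g = x"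
      then have "y = inv g \<otimes> (x \<otimes> g)" using y_conj gC[OF g] x by (simp add: m_assoc)
      then have "y = x" using gC[OF g] x by simp
      then show False using y by simp
    qed
    ultimately show "g \<otimes>\<^bsub>G\<lparr>carrier := C\<rparr>\<^esub> y \<otimes>\<^bsub>G\<lparr>carrier := C\<rparr>\<^esub> inv\<^bsub>G\<lparr>carrier := C\<rparr>\<^esub> g \<in> C - {\<one>, x}"
      using ygC inv[OF g] by simp
  qed (use finC in auto)
  then obtain k where k: "card (C - {\<one>, x}) * 4 = k * card C" by (auto simp: order_def)
  have "card (C - {\<one>, x}) + 2 = card C"
  proof -
    have "card {\<one>, x} \<le> card C" using xC finC by (intro card_mono) auto
    then show ?thesis using xC x(2) finC by (simp add: card_Diff_subset)
  qed
  then have "4 * card C = k * card C + 8" using k by simp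
  then have "4 * int (card C) = int k * int (card C) + 8" by (metis of_nat_add of_nat_mult of_nat_numeral)
  then have "int (card C) * (4 - int k) = 8" by (simp add: algebra_simps)
  then have "int (card C) dvd 8" by (metis dvd_triv_left)
  then have d: "card C dvd 8" by (metis int_dvd_int_iff of_nat_numeral)
  then obtain q where q: "8 = card C * q" by (rule dvdE)
  have "card C \<le> 8" using d by (simp add: dvd_imp_le)
  moreover have "card C \<noteq> 0" "card C \<noteq> 1" using \<open>card (C - {\<one>, x}) + 2 = card C\<close> by auto
  moreover have "\<not> 3 dvd (8::nat)" "\<not> 5 dvd (8::nat)" "\<not> 6 dvd (8::nat)" "\<not> 7 dvd (8::nat)" by simp_all
  ultimately have "card C \<in> {2, 4, 8}"
  proof -
    assume a: "card C \<le> 8" "card C \<noteq> 0" "card C \<noteq> 1" and nd: "\<not> 3 dvd (8::nat)" "\<not> 5 dvd (8::nat)" "\<not> 6 dvd (8::nat)" "\<not> 7 dvd (8::nat)"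
    have "card C \<noteq> 3" "card C \<noteq> 5" "card C \<noteq> 6" "card C \<noteq> 7" using d nd by metis+
    then have "card C = 2 \<or> card C = 4 \<or> card C = 8" using a by linarith
    then show ?thesis by simp
  qed
  then show ?thesis by (simp add: C_def)
qed

lemma noncentral_ne_one: "x \<notin> Z \<longleftrightarrow> x \<noteq> \<one>" using Z_trivial by simp

lemma element_types:
  assumes "x \<in> carrier G" "x \<noteq> \<one>"
  shows "(x \<otimes> x = \<one> \<and> card (centralizer G x) \<in> {2, 4, 8}) \<or>
    (\<exists>n\<in>{3, 4, 5::nat}. x [^] n = \<one> \<and> x \<otimes> x \<noteq> \<one> \<and> card (centralizer G x) = n \<and> centralizer G x = (\<lambda>i. x [^] i) ` {..<n})"
proof -
  obtain n where n: "n \<in> {2, 3, 4, 5::nat}" "x [^] n = \<one>" "inj_on (\<lambda>i::nat. x [^] i) {..<n}" using element_order[OF assms] .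
  show ?thesis
  proof (cases "n = 2")
    case True
    then have "x \<otimes> x = \<one>" using n(2) two_pow[OF assms(1)] by simp
    then show ?thesis using centralizer_involution_card[OF assms] by blast
  next
    case False
    then have "n \<ge> 3" using n(1) by auto
    moreover have "x \<otimes> x \<noteq> \<one>"
    proof
      assume "x \<otimes> x = \<one>"
      then have "x [^] (2::nat) = x [^] (0::nat)" using two_pow[OF assms(1)] by simp
      then have "(2::nat) = 0" using inj_onD[OF n(3), of 2 0] \<open>n \<ge> 3\<close> by auto
      then show False by simp
    qed
    ultimately show ?thesis using centralizer_cyclic[OF assms _ n(2,3)] n(1,2) False by auto
  qed
qed

lemma Cd_mem: "x \<in> Cd d \<longleftrightarrow> x \<in> carrier G \<and> x \<noteq> \<one> \<and> card (centralizer G x) = d"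
  by (auto simp: Cd_def noncentral_ne_one)

lemma finite_Cd: "finite (Cd d)" using fin by (simp add: Cd_def)

lemma carrier_Cd: "carrier G = {\<one>} \<union> (Cd 2 \<union> (Cd 3 \<union> (Cd 4 \<union> (Cd 5 \<union> Cd 8))))"
  using element_types by (fastforce simp: Cd_mem)

lemma order_Cd: "order G = 1 + card (Cd 2) + card (Cd 3) + card (Cd 4) + card (Cd 5) + card (Cd 8)"
proof -
  have "Cd 2 \<inter> (Cd 3 \<union> (Cd 4 \<union> (Cd 5 \<union> Cd 8))) = {}" "Cd 3 \<inter> (Cd 4 \<union> (Cd 5 \<union> Cd 8)) = {}"
     "Cd 4 \<inter> (Cd 5 \<union> Cd 8) = {}" "Cd 5 \<inter> Cd 8 = {}" "{\<one>} \<inter> (Cd 2 \<union> (Cd 3 \<union> (Cd 4 \<union> (Cd 5 \<union> Cd 8)))) = {}"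
    by (auto simp: Cd_mem)
  then show ?thesis unfolding order_def by (subst carrier_Cd) (simp add: card_Un_disjoint finite_Cd)
qed

lemma Cd_odd:
  assumes "d \<in> {3, 5}" "x \<in> Cd d"
  shows "x [^] d = \<one>" "centralizer G x = (\<lambda>i. x [^] i) ` {..<d}" "x \<otimes> x \<noteq> \<one>"
  using element_types[of x] assms by (auto simp: Cd_mem)

lemma Cd_4: "x \<in> Cd 4 \<Longrightarrow> x [^] (4::nat) = \<one>"
  using element_types[of x] four_pow[of x] by (auto simp: Cd_mem)

lemma Cd_even: "x \<in> Cd 2 \<or> x \<in> Cd 8 \<Longrightarrow> x \<otimes> x = \<one>"
  using element_types[of x] by (auto simp: Cd_mem)

lemma Cd_conj: "x \<in> Cd d \<Longrightarrow> g \<in> carrier G \<Longrightarrow> g \<otimes> x \<otimes> inv g \<in> Cd d"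
  unfolding Cd_def using noncentral_conj_closed centralizer_conj_card by auto

text \<open>As \<open>d\<close> is odd, a nontrivial \<open>y\<close> in C(x) is not an involution,
  so C(y) has order 3, 4 or 5. This order is a multiple of \<open>d\<close>, since C(y) contains the
  cyclic group C(x), and therefore equals \<open>d\<close>.\<close>

lemma Cd_blocks:
  assumes d: "d \<in> {3, 5}" and x: "x \<in> Cd d" and y: "y \<in> centralizer G x" "y \<noteq> \<one>"
  shows "y \<in> Cd d" "centralizer G y = centralizer G x"
proof -
  have xc: "x \<in> carrier G" "card (centralizer G x) = d" using x by (auto simp: Cd_mem)
  have yc: "y \<in> carrier G" using y by (simp add: centralizer_def)
  obtain i :: nat where i: "y = x [^] i" using y(1) unfolding Cd_odd(2)[OF d x] by auto
  have sub: "centralizer G x \<subseteq> centralizer G y"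
    unfolding Cd_odd(2)[OF d x] i using xc pow_commute by (auto simp: centralizer_def)
  have finy: "finite (centralizer G y)" using fin by (simp add: centralizer_def)
  have d3: "d \<le> card (centralizer G y)" using card_mono[OF finy sub] xc by simp
  have yd: "y [^] d = \<one>"
  proof -
    have "(x [^] i) [^] d = (x [^] d) [^] i" using xc by (simp add: nat_pow_pow mult.commute)
    then show ?thesis using Cd_odd(1)[OF d x] i by simp
  qed
  have yy: "y \<otimes> y \<noteq> \<one>"
  proof
    assume e: "y \<otimes> y = \<one>"
    obtain q where "d = Suc (2 * q)" using d by auto
    then have "y [^] d = (y \<otimes> y) [^] q \<otimes> y" using yc two_pow[OF yc] by (simp add: nat_pow_pow[symmetric])
    then show False using e yd yc y(2) by simp
  qed
  then obtain n where n: "n \<in> {3, 4, 5::nat}" "y [^] n = \<one>" "card (centralizer G y) = n"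
    using element_types[OF yc y(2)] by blast
  have "d dvd n"
  proof -
    have "subgroup (centralizer G x) (G\<lparr>carrier := centralizer G y\<rparr>)"
      using centralizer_subgroup[OF xc(1)] centralizer_subgroup[OF yc] sub
      by (simp add: subgroup_incl)
    from group.subgroup_card_dvd[OF subgroup_imp_group[OF centralizer_subgroup[OF yc]] this]
    show ?thesis using xc n by (simp add: order_def)
  qed
  then have "n = d" using n d by auto
  then show "y \<in> Cd d" using n yc y by (simp add: Cd_mem)
  show "centralizer G y = centralizer G x"
    using card_subset_eq[OF finy sub] xc n \<open>n = d\<close> by simp
qed

text \<open>The nontrivial parts of the centralizers are disjoint blocks of \<open>d - 1\<close>
  elements. This yields the divisibility conditions for the class equation and, for order 3, the
  number of subgroups on which the group acts.\<close>

lemma Cd_partition: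
  assumes d: "d \<in> {3, 5}"
  shows "(d - 1) * card (centralizer G ` Cd d) = card (Cd d)"
proof -
  let ?B = "(\<lambda>A. A - {\<one>}) ` centralizer G ` Cd d"
  have one: "\<one> \<in> centralizer G x" if "x \<in> carrier G" for x using that by (simp add: centralizer_def)
  have inj: "inj_on (\<lambda>A. A - {\<one>}) (centralizer G ` Cd d)"
    using one by (auto simp: inj_on_def Cd_mem)
  have U: "\<Union> ?B = Cd d"
  proof
    show "\<Union> ?B \<subseteq> Cd d" using Cd_blocks(1)[OF d] by auto
    show "Cd d \<subseteq> \<Union> ?B" by (auto simp: Cd_mem centralizer_def)
  qed
  have "(d - 1) * card ?B = card (\<Union> ?B)"
  proof (rule card_partition)
    show "finite ?B" using finite_Cd by simp
    show "finite (\<Union> ?B)" unfolding U by (rule finite_Cd)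
    show "card c = d - 1" if c: "c \<in> ?B" for c
    proof -
      obtain x where x: "x \<in> Cd d" "c = centralizer G x - {\<one>}" using c by auto
      have "finite (centralizer G x)" using fin by (simp add: centralizer_def)
      then show ?thesis using x one[of x] by (simp add: Cd_mem)
    qed
    show "c1 \<inter> c2 = {}" if c: "c1 \<in> ?B" "c2 \<in> ?B" "c1 \<noteq> c2" for c1 c2
    proof -
      obtain x y where x: "x \<in> Cd d" "c1 = centralizer G x - {\<one>}" and y: "y \<in> Cd d" "c2 = centralizer G y - {\<one>}"
        using c by auto
      have "w \<notin> c2" if "w \<in> c1" for w
        using Cd_blocks(2)[OF d x(1), of w] Cd_blocks(2)[OF d y(1), of w] x(2) y(2) c(3) that by auto
      then show ?thesis by blast
    qed
  qed
  then show ?thesis unfolding U using card_image[OF inj] by simp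
qed

end

lemma (in group) conj_centralizer:
  assumes "x \<in> carrier G" "g \<in> carrier G"
  shows "(\<lambda>w. g \<otimes> w \<otimes> inv g) ` centralizer G x = centralizer G (g \<otimes> x \<otimes> inv g)"
proof -
  have sub: "(\<lambda>w. h \<otimes> w \<otimes> inv h) ` centralizer G y \<subseteq> centralizer G (h \<otimes> y \<otimes> inv h)"
    if "y \<in> carrier G" "h \<in> carrier G" for y h
  proof
    fix v assume "v \<in> (\<lambda>w. h \<otimes> w \<otimes> inv h) ` centralizer G y"
    then obtain w where w: "v = h \<otimes> w \<otimes> inv h" "w \<in> carrier G" "y \<otimes> w = w \<otimes> y" by (auto simp: centralizer_def)
    have "(h \<otimes> y \<otimes> inv h) \<otimes> (h \<otimes> w \<otimes> inv h) = h \<otimes> (y \<otimes> w) \<otimes> inv h" using that w(2) by (simp add: m_assoc)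
    also have "\<dots> = (h \<otimes> w \<otimes> inv h) \<otimes> (h \<otimes> y \<otimes> inv h)" unfolding w(3) using that w(2) by (simp add: m_assoc)
    finally show "v \<in> centralizer G (h \<otimes> y \<otimes> inv h)" using w that by (simp add: centralizer_def)
  qed
  show ?thesis
  proof
    show "(\<lambda>w. g \<otimes> w \<otimes> inv g) ` centralizer G x \<subseteq> centralizer G (g \<otimes> x \<otimes> inv g)" using sub assms .
    show "centralizer G (g \<otimes> x \<otimes> inv g) \<subseteq> (\<lambda>w. g \<otimes> w \<otimes> inv g) ` centralizer G x"
    proof
      fix v assume v: "v \<in> centralizer G (g \<otimes> x \<otimes> inv g)"
      then have vc: "v \<in> carrier G" by (simp add: centralizer_def)
      have "inv g \<otimes> v \<otimes> g \<in> centralizer G (inv g \<otimes> (g \<otimes> x \<otimes> inv g) \<otimes> g)"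
        using sub[of "g \<otimes> x \<otimes> inv g" "inv g"] v assms by auto
      also have "inv g \<otimes> (g \<otimes> x \<otimes> inv g) \<otimes> g = x" using assms by (simp add: m_assoc)
      finally show "v \<in> (\<lambda>w. g \<otimes> w \<otimes> inv g) ` centralizer G x"
        using assms vc by (intro image_eqI[of _ _ "inv g \<otimes> v \<otimes> g"]) (simp_all add: m_assoc)
    qed
  qed
qed

context centerless_cliques
begin

lemma centralizer_one: "\<one> \<in> centralizer G x" if "x \<in> carrier G"
  using that by (simp add: centralizer_def)

lemma centralizer_self: "x \<in> carrier G \<Longrightarrow> x \<in> centralizer G x"
  by (simp add: centralizer_def)

lemma finite_centralizer: "finite (centralizer G x)"
  using fin by (simp add: centralizer_def)

lemma Cd_3_centralizer: "x \<in> Cd 3 \<Longrightarrow> centralizer G x = {\<one>, x, x \<otimes> x}"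
proof -
  assume x: "x \<in> Cd 3"
  then have xc: "x \<in> carrier G" by (simp add: Cd_mem)
  have "{..<3::nat} = {0, 1, 2}" by auto
  then show ?thesis using Cd_odd(2)[OF _ x] two_pow[OF xc] xc by simp
qed

lemma Cd_2_centralizer: "x \<in> Cd 2 \<Longrightarrow> centralizer G x = {\<one>, x}"
proof -
  assume x: "x \<in> Cd 2"
  then have xc: "x \<in> carrier G" "x \<noteq> \<one>" "card (centralizer G x) = 2" by (auto simp: Cd_mem)
  have "{\<one>, x} \<subseteq> centralizer G x" using centralizer_one centralizer_self xc by simp
  from card_subset_eq[OF finite_centralizer this] show ?thesis using xc by simp
qed

lemma Cd_dvd:
  assumes "x \<in> Cd d" shows "d dvd order G" "order G \<noteq> d"
proof -
  have x: "x \<in> carrier G" "x \<notin> Z" "card (centralizer G x) = d" using assms by (auto simp: Cd_def)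
  show "d dvd order G" using subgroup_card_dvd[OF centralizer_subgroup[OF x(1)]] x by simp
  have "2 * d \<le> order G" using proper_subgroup_card[OF fin centralizer_subgroup[OF x(1)]] noncentral_iff[OF x(1)] x by simp
  then show "order G \<noteq> d" using order_pos by auto
qed

text \<open>In a centralizer of order 8 all elements satisfy y^8 = 1, which excludes
  \<open>Cd 3\<close> and \<open>Cd 5\<close>. If all its squares were trivial, it would be abelian
  with 7 nontrivial elements; an element with nontrivial square belongs to \<open>Cd 4\<close>. So
  \<open>k 8\<close> can be nonzero only together with \<open>k 4\<close>.\<close>

lemma Cd_8_centralizer:
  assumes x: "x \<in> Cd 8"
  shows "\<exists>y\<in>centralizer G x. y \<in> Cd 4 \<and> y \<otimes> y \<noteq> \<one>" "centralizer G x \<inter> Cd 3 = {}" "centralizer G x \<inter> Cd 5 = {}"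
proof -
  let ?C = "centralizer G x"
  have xc: "x \<in> carrier G" "card ?C = 8" using x by (auto simp: Cd_mem)
  have C: "subgroup ?C G" using centralizer_subgroup xc by blast
  have y8: "y [^] (8::nat) = \<one>" if "y \<in> ?C" for y
    using subgroup_pow_card[OF C finite_centralizer that] xc by simp
  have odd: "False" if y: "y \<in> ?C" "y \<in> Cd d" "d \<in> {3, 5}" for y d
  proof -
    have yc: "y \<in> carrier G" using y by (simp add: Cd_mem)
    have yd: "y [^] d = \<one>" "y \<otimes> y \<noteq> \<one>" using Cd_odd[OF y(3,2)] by auto
    have "y [^] (8::nat) = y [^] (8 mod d)" using pow_mod_exponent[OF yc yd(1)] .
    then have "y [^] (2::nat) = \<one> \<or> y [^] (3::nat) = \<one>" using y8[OF y(1)] y(3) by auto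
    moreover have "y [^] (3::nat) = \<one> \<Longrightarrow> y [^] (2::nat) = \<one>"
    proof -
      assume y3: "y [^] (3::nat) = \<one>"
      have "y [^] (8::nat) = y [^] (8 mod 3 :: nat)" using pow_mod_exponent[OF yc y3] .
      then show ?thesis using y8[OF y(1)] by simp
    qed
    ultimately show False using yd(2) two_pow[OF yc] by auto
  qed
  show "?C \<inter> Cd 3 = {}" "?C \<inter> Cd 5 = {}" using odd[of _ 3] odd[of _ 5] by auto
  have "\<exists>y\<in>?C. y \<otimes> y \<noteq> \<one>"
  proof (rule ccontr)
    assume n: "\<not> ?thesis"
    have Cc: "?C \<subseteq> carrier G" by (auto simp: centralizer_def)
    have iv: "inv v = v" if "v \<in> ?C" for v using n that Cc by (intro inv_equality) auto
    have "v \<otimes> w = w \<otimes> v" if vw: "v \<in> ?C" "w \<in> ?C" for v w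
    proof -
      have "v \<otimes> w = inv (v \<otimes> w)" using iv[OF subgroup.m_closed[OF C vw]] by simp
      also have "\<dots> = w \<otimes> v" using vw Cc iv by (auto simp: inv_mult_group subset_iff)
      finally show ?thesis .
    qed
    then have "card (?C - {\<one>}) \<le> 4" using Cc by (intro commuting_card_le_4) auto
    then show False using centralizer_one[OF xc(1)] xc by (simp add: card_Diff_singleton)
  qed
  then obtain y where y: "y \<in> ?C" "y \<otimes> y \<noteq> \<one>" by blast
  have yc: "y \<in> carrier G" "y \<noteq> \<one>" using y by (auto simp: centralizer_def)
  have "y \<in> Cd 4" using element_types[OF yc] y odd[OF y(1), of 3] odd[OF y(1), of 5] yc by (auto simp: Cd_mem)
  then show "\<exists>y\<in>?C. y \<in> Cd 4 \<and> y \<otimes> y \<noteq> \<one>" using y by blast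
qed

text \<open>The number of conjugacy classes in \<open>Cd d\<close>; by \<open>k_eq\<close> the
  division is exact.\<close>

definition "k d = card (Cd d) * d div order G"

lemma k_eq: "card (Cd d) * d = k d * order G"
  and k_one: "k d = 1 \<Longrightarrow> x \<in> Cd d \<Longrightarrow> Cd d = conj_class G x"
proof -
  obtain l where l: "card (Cd d) * d = l * order G" "\<And>x. l = 1 \<Longrightarrow> x \<in> Cd d \<Longrightarrow> Cd d = conj_class G x"
    using class_count[OF Cd_def] by blast
  have "k d = l" using l(1) order_pos by (simp add: k_def)
  then show "card (Cd d) * d = k d * order G" "k d = 1 \<Longrightarrow> x \<in> Cd d \<Longrightarrow> Cd d = conj_class G x" using l by auto
qed

lemma k_zero: "d > 0 \<Longrightarrow> k d = 0 \<longleftrightarrow> Cd d = {}"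
  using k_eq[of d] order_pos finite_Cd[of d] by (metis card_0_eq mult_eq_0_iff neq0_conv)

lemma order_cases: "(order G, k 2, k 3, k 4, k 5, k 8) \<in> {(6, 1, 1, 0, 0, 0), (10, 1, 0, 0, 2, 0), (12, 0, 2, 1, 0, 0), (20, 0, 0, 3, 1, 0),
     (20, 1, 0, 1, 1, 0), (24, 0, 1, 1, 0, 3), (24, 0, 1, 2, 0, 1), (40, 0, 0, 1, 3, 1), (60, 0, 1, 1, 2, 0)}"
proof (rule class_equation_solutions)
  have "(60 * k 2 + 40 * k 3 + 30 * k 4 + 24 * k 5 + 15 * k 8) * order G =
      60 * (k 2 * order G) + 40 * (k 3 * order G) + 30 * (k 4 * order G) + 24 * (k 5 * order G) + 15 * (k 8 * order G)"
    by (simp add: algebra_simps)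
  then show "120 * order G = 120 + (60 * k 2 + 40 * k 3 + 30 * k 4 + 24 * k 5 + 15 * k 8) * order G"
    unfolding k_eq[symmetric] using order_Cd by simp
  obtain x where x: "x \<in> carrier G" "x \<notin> Z" using nonabelian by blast
  have "card {\<one>, x} \<le> order G" unfolding order_def using fin x by (intro card_mono) auto
  then show "order G > 1" using x noncentral_ne_one by simp
  show "k 8 = 0 \<or> k 4 \<noteq> 0" using Cd_8_centralizer(1) k_zero[of 8] k_zero[of 4] by auto
  show "6 dvd k 3 * order G" unfolding k_eq[symmetric] Cd_partition[of 3, symmetric, simplified] by simp
  show "20 dvd k 5 * order G" unfolding k_eq[symmetric] Cd_partition[of 5, symmetric, simplified] by simp
  show "k 2 = 0 \<or> 2 dvd order G \<and> order G \<noteq> 2" using k_zero[of 2] Cd_dvd[of _ 2] by auto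
  show "k 3 = 0 \<or> 3 dvd order G \<and> order G \<noteq> 3" using k_zero[of 3] Cd_dvd[of _ 3] by auto
  show "k 4 = 0 \<or> 4 dvd order G \<and> order G \<noteq> 4" using k_zero[of 4] Cd_dvd[of _ 4] by auto
  show "k 5 = 0 \<or> 5 dvd order G \<and> order G \<noteq> 5" using k_zero[of 5] Cd_dvd[of _ 5] by auto
  show "k 8 = 0 \<or> 8 dvd order G \<and> order G \<noteq> 8" using k_zero[of 8] Cd_dvd[of _ 8] by auto
qed

text \<open>An element normalizing all subgroups of order 3 and centralizing none of them inverts all elements
  of order 3. Such an element is determined by this property, hence central.\<close>

lemma Cd_3_faithful:
  assumes two: "card (centralizer G ` Cd 3) \<ge> 2" and g: "g \<in> carrier G"
    and fixed: "\<And>A. A \<in> centralizer G ` Cd 3 \<Longrightarrow> (\<lambda>x. g \<otimes> x \<otimes> inv g) ` A = A"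
  shows "g = \<one>"
proof (rule ccontr)
  assume g1: "g \<noteq> \<one>"
  have other: "\<exists>y\<in>Cd 3. centralizer G y \<noteq> centralizer G x" for x
  proof (rule ccontr)
    assume "\<not> ?thesis"
    then have "centralizer G ` Cd 3 \<subseteq> {centralizer G x}" by auto
    then have "card (centralizer G ` Cd 3) \<le> card {centralizer G x}" by (intro card_mono) auto
    then show False using two by simp
  qed
  have x3: "x \<otimes> x \<otimes> x = \<one>" if "x \<in> Cd 3" for x
    using Cd_odd(1)[of 3 x] three_pow[of x] that by (simp add: Cd_mem m_assoc)
  have gx: "g \<otimes> x \<otimes> inv g = x \<or> g \<otimes> x \<otimes> inv g = x \<otimes> x" if x: "x \<in> Cd 3" for x
  proof -
    have "g \<otimes> x \<otimes> inv g \<in> centralizer G x" using fixed[of "centralizer G x"] centralizer_self x by (auto simp: Cd_mem)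
    moreover have "g \<otimes> x \<otimes> inv g \<noteq> \<one>" using Cd_conj[OF x g] by (simp add: Cd_mem)
    ultimately show ?thesis using Cd_3_centralizer[OF x] by auto
  qed
  \<comment> \<open>If \<open>g\<close> centralized some \<open>x\<close> in \<open>Cd 3\<close>, it
    would itself be in C(x) and have order 3. It would invert the elements of another such subgroup,
    so \<open>g \<otimes> g\<close> would centralize them, and so would g^4 = g, a
    contradiction.\<close>
  have inverts: "g \<otimes> x \<otimes> inv g = x \<otimes> x" if x: "x \<in> Cd 3" for x
  proof (rule ccontr)
    assume "g \<otimes> x \<otimes> inv g \<noteq> x \<otimes> x"
    then have "g \<otimes> x \<otimes> inv g = x" using gx x by blast
    then have "g \<in> centralizer G x" using conj_eq_imp_commute[of x g] x g by (simp add: Cd_mem centralizer_def)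
    then have gC: "g \<in> Cd 3" "centralizer G g = centralizer G x" using Cd_blocks[OF _ x _ g1] by auto
    obtain y where y: "y \<in> Cd 3" "centralizer G y \<noteq> centralizer G x" using other by blast
    have yc: "y \<in> carrier G" "y \<noteq> \<one>" using y by (auto simp: Cd_mem)
    have nc: "g \<notin> centralizer G y" using Cd_blocks(2)[OF _ y(1) _ g1] y gC by auto
    then have "g \<otimes> y \<otimes> inv g \<noteq> y" using conj_eq_imp_commute[OF yc(1) g] g by (auto simp: centralizer_def)
    then have gy: "g \<otimes> y \<otimes> inv g = y \<otimes> y" using gx y by blast
    have "(g \<otimes> g) \<otimes> y \<otimes> inv (g \<otimes> g) = g \<otimes> (y \<otimes> y) \<otimes> inv g" using conj_conj[OF yc(1) g g] gy by simp
    also have "\<dots> = (g \<otimes> y \<otimes> inv g) \<otimes> (g \<otimes> y \<otimes> inv g)" using g yc(1) by (simp add: m_assoc inv_mult_cancel)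
    also have "\<dots> = (y \<otimes> y \<otimes> y) \<otimes> y" unfolding gy using yc by (simp add: m_assoc)
    also have "\<dots> = y" using x3[OF y(1)] yc by simp
    finally have "g \<otimes> g \<in> centralizer G y" using conj_eq_imp_commute[of y "g \<otimes> g"] yc g by (simp add: centralizer_def)
    then have "(g \<otimes> g) \<otimes> (g \<otimes> g) \<in> centralizer G y" using centralizer_subgroup[OF yc(1)] by (simp add: subgroup.m_closed)
    moreover have "(g \<otimes> g) \<otimes> (g \<otimes> g) = g" using x3[OF gC(1)] g by (simp add: m_assoc[symmetric])
    ultimately show False using nc by simp
  qed
  have "g \<in> Z"
  proof -
    \<comment> \<open>Every conjugate \<open>h\<close> of \<open>g\<close> inverts the elements of
      \<open>Cd 3\<close> as well, so g^-1 h centralizes all of them and lies in two subgroups of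
      order 3 that share only the identity.\<close>
    have "g \<otimes> y = y \<otimes> g" if y: "y \<in> carrier G" for y
    proof -
      define h where "h = y \<otimes> g \<otimes> inv y"
      have hc: "h \<in> carrier G" using y g by (simp add: h_def)
      have "inv g \<otimes> h \<in> centralizer G x" if x: "x \<in> Cd 3" for x
      proof -
        have xc: "x \<in> carrier G" using x by (simp add: Cd_mem)
        define w where "w = inv y \<otimes> x \<otimes> y"
        have wc: "w \<in> carrier G" using xc y by (simp add: w_def)
        have w: "w \<in> Cd 3" unfolding w_def using Cd_conj[OF x, of "inv y"] y by simp
        have xw: "x = y \<otimes> w \<otimes> inv y" unfolding w_def using xc y by (simp add: m_assoc)
        have "h \<otimes> x \<otimes> inv h = y \<otimes> (g \<otimes> w \<otimes> inv g) \<otimes> inv y"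
          unfolding h_def xw using y g wc by (simp add: m_assoc inv_mult_group)
        also have "\<dots> = (y \<otimes> w \<otimes> inv y) \<otimes> (y \<otimes> w \<otimes> inv y)" unfolding inverts[OF w] using y wc by (simp add: m_assoc)
        also have "\<dots> = g \<otimes> x \<otimes> inv g" unfolding xw[symmetric] inverts[OF x] ..
        finally show ?thesis using conj_eq_iff[OF xc g hc] by simp
      qed
      note inC = this
      obtain x where x: "x \<in> Cd 3" using other by blast
      obtain x' where x': "x' \<in> Cd 3" "centralizer G x' \<noteq> centralizer G x" using other by blast
      have "inv g \<otimes> h = \<one>"
      proof (rule ccontr)
        assume "inv g \<otimes> h \<noteq> \<one>"
        then have "centralizer G x' = centralizer G x"
          using Cd_blocks(2)[OF _ x inC[OF x]] Cd_blocks(2)[OF _ x'(1) inC[OF x'(1)]] by auto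
        then show False using x' by simp
      qed
      then have "g \<otimes> (inv g \<otimes> h) = g" using g by simp
      then have "y \<otimes> g \<otimes> inv y = g" using g hc by (simp add: h_def)
      then show ?thesis using conj_eq_imp_commute[OF g y] by simp
    qed
    then show ?thesis using g by (simp add: group_center_def)
  qed
  then show False using g1 Z_trivial by simp
qed

lemma Cd_3_action:
  assumes "card (Cd 3) = 8"
  obtains \<phi> where "\<phi> \<in> hom G (sym_group 4)" "inj_on \<phi> (carrier G)"
proof (rule conj_action_sym_group)
  show F: "card (centralizer G ` Cd 3) = 4" using Cd_partition[of 3] assms by simp
  show "finite (centralizer G ` Cd 3)" using finite_Cd by simp
  show "A \<subseteq> carrier G" if "A \<in> centralizer G ` Cd 3" for A using that by (auto simp: centralizer_def)
  show "(\<lambda>x. g \<otimes> x \<otimes> inv g) ` A \<in> centralizer G ` Cd 3" if "g \<in> carrier G" "A \<in> centralizer G ` Cd 3" for g A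
    using that conj_centralizer Cd_conj by (auto simp: Cd_mem)
  show "g = \<one>" if "g \<in> carrier G" "\<And>A. A \<in> centralizer G ` Cd 3 \<Longrightarrow> (\<lambda>x. g \<otimes> x \<otimes> inv g) ` A = A" for g
    using Cd_3_faithful[OF _ that] F by simp
qed (rule that)

section \<open>The solutions of the class equation and their groups\<close>

lemma order_24: assumes "order G = 24" "k 3 = 1" shows "G \<cong> sym_group 4"
proof -
  have "card (Cd 3) = 8" using k_eq[of 3] assms by simp
  then obtain \<phi> where "\<phi> \<in> hom G (sym_group 4)" "inj_on \<phi> (carrier G)" using Cd_3_action by blast
  then show ?thesis using assms by (intro iso_sym_groupI) (auto simp: fact_numeral)
qed

lemma order_12: assumes "order G = 12" "k 3 = 2" shows "G \<cong> alt_group 4"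
proof -
  have c: "card (Cd 3) = 8" using k_eq[of 3] assms by simp
  then obtain \<phi> where \<phi>: "\<phi> \<in> hom G (sym_group 4)" "inj_on \<phi> (carrier G)" using Cd_3_action by blast
  show ?thesis
  proof (rule iso_alt_groupI[OF \<phi>, of "Cd 3"])
    show "2 * order G = fact 4" using assms by (simp add: fact_numeral)
    show "order G < 2 * card (Cd 3)" using assms c by simp
    show "\<exists>k. odd k \<and> x [^] (k::nat) = \<one>" if "x \<in> Cd 3" for x using Cd_odd(1)[OF _ that] by (intro exI[of _ 3]) auto
  qed (auto simp: Cd_mem)
qed

text \<open>The group permutes its three involutions in \<open>Cd 2\<close> faithfully, since each
  of them is centralized only by itself and the identity.\<close>

lemma order_6: assumes "order G = 6" "k 2 = 1" shows "G \<cong> sym_group 3"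
proof -
  have c: "card (Cd 2) = 3" using k_eq[of 2] assms by simp
  obtain \<phi> where \<phi>: "\<phi> \<in> hom G (sym_group 3)" "inj_on \<phi> (carrier G)"
  proof (rule conj_action_sym_group)
    let ?F = "(\<lambda>t. {t}) ` Cd 2"
    show "finite ?F" using finite_Cd by simp
    show "card ?F = 3" using c by (subst card_image) auto
    show "A \<subseteq> carrier G" if "A \<in> ?F" for A using that by (auto simp: Cd_mem)
    show "(\<lambda>x. g \<otimes> x \<otimes> inv g) ` A \<in> ?F" if "g \<in> carrier G" "A \<in> ?F" for g A using that Cd_conj by auto
    fix g assume g: "g \<in> carrier G" and fixed: "\<And>A. A \<in> ?F \<Longrightarrow> (\<lambda>x. g \<otimes> x \<otimes> inv g) ` A = A"
    have gt: "g \<in> {\<one>, t}" if t: "t \<in> Cd 2" for t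
    proof -
      have "g \<otimes> t \<otimes> inv g = t" using fixed[of "{t}"] t by auto
      then have "g \<in> centralizer G t" using conj_eq_imp_commute[of t g] t g by (simp add: Cd_mem centralizer_def)
      then show ?thesis using Cd_2_centralizer[OF t] by simp
    qed
    obtain t where t: "t \<in> Cd 2" using c by fastforce
    have "Cd 2 \<noteq> {t}" using c by auto
    then obtain s where "s \<in> Cd 2" "s \<noteq> t" using t by blast
    then show "g = \<one>" using gt t by blast
  qed (rule that)
  then show ?thesis using assms by (intro iso_sym_groupI) (auto simp: fact_numeral)
qed

lemma Cd_5_powers:
  assumes "a \<in> Cd 5"
  shows "a \<in> carrier G" "a [^] (5::nat) = \<one>" "centralizer G a = {\<one>, a, a [^] (2::nat), a [^] (3::nat), a [^] (4::nat)}"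
    "card (centralizer G a) = 5" "a [^] (2::nat) \<noteq> \<one>" "a \<noteq> \<one>" "a [^] (4::nat) \<noteq> a" "a [^] (4::nat) = inv a"
proof -
  show a: "a \<in> carrier G" "card (centralizer G a) = 5" "a \<noteq> \<one>" using assms by (auto simp: Cd_mem)
  show a5: "a [^] (5::nat) = \<one>" using Cd_odd(1)[OF _ assms] by simp
  have "{..<5::nat} = {0, 1, 2, 3, 4}" by auto
  then show C: "centralizer G a = {\<one>, a, a [^] (2::nat), a [^] (3::nat), a [^] (4::nat)}"
    using Cd_odd(2)[OF _ assms] a by simp
  show a2: "a [^] (2::nat) \<noteq> \<one>" using Cd_odd(3)[OF _ assms] two_pow[OF a(1)] by simp
  show "a [^] (4::nat) = inv a" using inv_eq_pow[OF a(1) a5] by simp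
  show "a [^] (4::nat) \<noteq> a"
  proof
    assume "a [^] (4::nat) = a"
    then have "card (centralizer G a) \<le> card {\<one>, a, a [^] (2::nat), a [^] (3::nat)}"
      unfolding C by (intro card_mono) auto
    also have "\<dots> \<le> 4" by (simp add: card_insert_if)
    finally show False using a by simp
  qed
qed

lemma order_10: assumes o: "order G = 10" and k: "k 2 = 1" "k 5 = 2" shows "G \<cong> dihedral_group 5"
proof -
  have c: "card (Cd 2) = 5" "card (Cd 5) = 4" using k_eq[of 2] k_eq[of 5] o k by simp_all
  obtain a where a: "a \<in> Cd 5" using c by fastforce
  obtain t where t: "t \<in> Cd 2" using c by fastforce
  note p = Cd_5_powers[OF a]
  have tc: "t \<in> carrier G" "t \<otimes> t = \<one>" "t \<noteq> \<one>" using t Cd_even by (auto simp: Cd_mem)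
  have "Cd 5 = centralizer G a - {\<one>}"
  proof -
    have "centralizer G a - {\<one>} \<subseteq> Cd 5" using Cd_blocks(1)[OF _ a] by auto
    moreover have "card (centralizer G a - {\<one>}) = 4" using p(4) centralizer_one[OF p(1)] finite_centralizer by simp
    ultimately show ?thesis using c card_subset_eq[OF finite_Cd] by metis
  qed
  then have tat: "t \<otimes> a \<otimes> inv t \<in> {a, a [^] (2::nat), a [^] (3::nat), a [^] (4::nat)}"
    using Cd_conj[OF a tc(1)] p(3) by auto
  have tCa: "t \<notin> centralizer G a"
  proof
    assume "t \<in> centralizer G a"
    then have "t \<in> Cd 5" using Cd_blocks(1)[OF _ a _ tc(3)] by simp
    then show False using t by (simp add: Cd_mem)
  qed
  \<comment> \<open>As \<open>t\<close> is an involution, conjugating twice gives i^2 = 1 modulo 5,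
    which leaves i = 1 and i = 4.\<close>
  have sq: "a = a [^] (i * i)" if "t \<otimes> a \<otimes> inv t = a [^] (i::nat)" for i
  proof -
    have "t \<otimes> (t \<otimes> a \<otimes> inv t) \<otimes> inv t = a [^] (i * i)"
      unfolding that using conj_pow[OF p(1) tc(1), of i] that p(1) by (simp add: nat_pow_pow)
    moreover have "t \<otimes> (t \<otimes> a \<otimes> inv t) \<otimes> inv t = a" using conj_conj[OF p(1) tc(1) tc(1)] tc p(1) by simp
    ultimately show ?thesis by simp
  qed
  have "t \<otimes> a \<otimes> inv t \<noteq> a" using conj_eq_imp_commute[OF p(1) tc(1)] tCa tc by (auto simp: centralizer_def)
  moreover have "t \<otimes> a \<otimes> inv t \<noteq> a [^] (2::nat)" using sq[of 2] p(7) by auto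
  moreover have "t \<otimes> a \<otimes> inv t \<noteq> a [^] (3::nat)"
    using sq[of 3] p(7) pow_mod_exponent[OF p(1,2), of 9] by auto
  ultimately have inv: "t \<otimes> (a \<otimes> inv t) = inv a" using tat p(1,8) tc by (auto simp: m_assoc)
  have S: "{t, a} \<subseteq> carrier G" using tc p by simp
  have sub: "subgroup (generate G {t, a}) G" using generate_is_subgroup[OF S] .
  have g: "a \<in> generate G {t, a}" "t \<in> generate G {t, a}" by (auto intro: generate.incl)
  have "insert t (centralizer G a) \<subseteq> generate G {t, a}"
    unfolding p(3) using g subgroup_nat_pow_closed[OF sub g(1)] subgroup.one_closed[OF sub] by auto
  moreover have "card (insert t (centralizer G a)) = 6" using tCa p(4) finite_centralizer by simp
  moreover have "finite (generate G {t, a})" using fin subgroup.subset[OF sub] finite_subset by blast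
  ultimately have "6 \<le> card (generate G {t, a})" by (metis card_mono)
  then have gen: "generate G {t, a} = carrier G" using subgroup_eq_carrier[OF fin sub] o by simp
  show ?thesis
    using two_pow[OF tc(1)] tc p inv by (intro iso_dihedral[OF fin _ _ tc(1) p(1) gen]) (auto simp: o)
qed

text \<open>The two solutions of order 20 share a construction: \<open>Cd 5\<close> is one class, so
  some \<open>b\<close> conjugates \<open>a\<close> to a^2, and it has order 4. For
  \<open>k 2 \<noteq> 0\<close> the set \<open>Cd 4\<close> is a single class; it would contain both
  \<open>b\<close> and its square, which cannot be conjugate.\<close>

lemma order_20:
  assumes o: "order G = 20" and k5: "k 5 = 1" and k38: "k 3 = 0" "k 8 = 0" and k4: "k 2 = 0 \<or> k 4 = 1"
  shows "G \<cong> Sz_2 \<and> k 2 = 0"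
proof -
  have c: "card (Cd 5) = 4" using k_eq[of 5] o k5 by simp
  obtain a where a: "a \<in> Cd 5" using c by fastforce
  note p = Cd_5_powers[OF a]
  have E: "Cd 3 = {}" "Cd 8 = {}" using k_zero k38 by auto
  have "a [^] (2::nat) \<in> Cd 5" using Cd_blocks(1)[OF _ a, of "a [^] (2::nat)"] p by simp
  then obtain b where b: "b \<in> carrier G" "b \<otimes> a \<otimes> inv b = a [^] (2::nat)"
    using k_one[OF k5 a] by (auto simp: conj_class_def)
  have b2a: "(b \<otimes> b) \<otimes> a \<otimes> inv (b \<otimes> b) = a [^] (4::nat)"
  proof -
    have "(b \<otimes> b) \<otimes> a \<otimes> inv (b \<otimes> b) = b \<otimes> a [^] (2::nat) \<otimes> inv b" using conj_conj[OF p(1) b(1) b(1)] b(2) by simp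
    also have "\<dots> = (a [^] (2::nat)) [^] (2::nat)" using conj_pow[OF p(1) b(1), of 2] b(2) by simp
    finally show ?thesis using p(1) by (simp add: nat_pow_pow)
  qed
  have bbC: "b \<otimes> b \<notin> centralizer G a"
  proof
    assume "b \<otimes> b \<in> centralizer G a"
    then have "(b \<otimes> b) \<otimes> a = a \<otimes> (b \<otimes> b)" by (simp add: centralizer_def)
    then have "(b \<otimes> b) \<otimes> a \<otimes> inv (b \<otimes> b) = a" using p(1) b(1) by (simp add: m_assoc inv_mult_group)
    then show False using b2a p(7) by simp
  qed
  then have bb1: "b \<otimes> b \<noteq> \<one>" using centralizer_one[OF p(1)] by auto
  have bC: "b \<notin> centralizer G a" using bbC subgroup.m_closed[OF centralizer_subgroup[OF p(1)]] by blast
  have b1: "b \<noteq> \<one>" using bb1 b by auto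
  have "b \<notin> Cd 5"
  proof
    assume "b \<in> Cd 5"
    moreover have "Cd 5 = centralizer G a - {\<one>}"
    proof -
      have "centralizer G a - {\<one>} \<subseteq> Cd 5" using Cd_blocks(1)[OF _ a] by auto
      moreover have "card (centralizer G a - {\<one>}) = 4" using p(4) centralizer_one[OF p(1)] finite_centralizer by simp
      ultimately show ?thesis using c card_subset_eq[OF finite_Cd] by metis
    qed
    ultimately show False using bC by blast
  qed
  moreover have "b \<notin> Cd 2" using Cd_even bb1 by blast
  ultimately have b4: "b \<in> Cd 4" using carrier_Cd b b1 E by auto
  have bp4: "b [^] (4::nat) = \<one>" by (rule Cd_4[OF b4])
  have "k 2 = 0"
  proof (rule ccontr)
    assume "k 2 \<noteq> 0"
    then have k41: "k 4 = 1" using k4 by simp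
    have bbbb: "(b \<otimes> b) \<otimes> (b \<otimes> b) = \<one>" using bp4 four_pow[OF b(1)] by simp
    have bbc: "b \<otimes> b \<in> carrier G" using b by simp
    have "{\<one>, b, b \<otimes> b} \<subseteq> centralizer G (b \<otimes> b)" using b(1) by (auto simp: centralizer_def m_assoc)
    then have "card {\<one>, b, b \<otimes> b} \<le> card (centralizer G (b \<otimes> b))" using finite_centralizer by (intro card_mono)
    moreover have "card {\<one>, b, b \<otimes> b} = 3" using b1 bb1 b(1) by (auto simp: card_insert_if)
    ultimately have "b \<otimes> b \<notin> Cd 2" by (auto simp: Cd_mem)
    moreover have "b \<otimes> b \<notin> Cd 5" using Cd_odd(3)[of 5 "b \<otimes> b"] bbbb by auto
    ultimately have "b \<otimes> b \<in> Cd 4" using carrier_Cd bbc bb1 E by auto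
    then obtain g where g: "g \<in> carrier G" "b \<otimes> b = g \<otimes> b \<otimes> inv g"
      using k_one[OF k41 b4] by (auto simp: conj_class_def)
    have "(g \<otimes> b \<otimes> inv g) \<otimes> (g \<otimes> b \<otimes> inv g) = g \<otimes> (b \<otimes> b) \<otimes> inv g"
      using g(1) b(1) by (simp add: m_assoc inv_mult_cancel)
    then have "(b \<otimes> b) \<otimes> (b \<otimes> b) = g \<otimes> (b \<otimes> b) \<otimes> inv g" by (simp only: g(2)[symmetric])
    then have "b \<otimes> b = inv g \<otimes> (\<one> \<otimes> g)" unfolding bbbb using g(1) bbc
      by (metis inv_closed inv_mult_cancel(1) inv_solve_right' l_one m_assoc m_closed)
    then show False using bb1 g by simp
  qed
  moreover have "G \<cong> Sz_2"
  proof -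
    let ?H = "generate G {a, b}" let ?C = "centralizer G a"
    have S: "{a, b} \<subseteq> carrier G" using b p by simp
    have sub: "subgroup ?H G" using generate_is_subgroup[OF S] .
    have g: "a \<in> ?H" "b \<in> ?H" by (auto intro: generate.incl)
    note m = mult_generate[OF S]
    have C: "subgroup ?C G" by (rule centralizer_subgroup[OF p(1)])
    have Cc: "?C \<subseteq> carrier G" by (auto simp: centralizer_def)
    have CH: "?C \<subseteq> ?H"
      unfolding p(3) using g subgroup_nat_pow_closed[OF sub g(1)] subgroup.one_closed[OF sub] by auto
    have "?C \<union> ((\<lambda>w. b \<otimes> w) ` ?C \<union> (\<lambda>w. (b \<otimes> b) \<otimes> w) ` ?C) \<subseteq> ?H" using CH g m by auto
    \<comment> \<open>Three cosets of C(a) already exceed half of the group.\<close>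
    moreover have "card (?C \<union> ((\<lambda>w. b \<otimes> w) ` ?C \<union> (\<lambda>w. (b \<otimes> b) \<otimes> w) ` ?C)) = 15"
    proof -
      have d: "u \<otimes> w \<notin> ?C" if "u \<in> carrier G" "u \<notin> ?C" "w \<in> ?C" for u w
      proof
        assume "u \<otimes> w \<in> ?C"
        then have "(u \<otimes> w) \<otimes> inv w \<in> ?C" using that C by (simp add: subgroup.m_closed subgroup.m_inv_closed)
        then show False using that Cc by (auto simp: m_assoc)
      qed
      have "b \<otimes> v \<noteq> (b \<otimes> b) \<otimes> w" if "v \<in> ?C" "w \<in> ?C" for v w
      proof
        assume e: "b \<otimes> v = (b \<otimes> b) \<otimes> w"
        have "v \<in> carrier G" "w \<in> carrier G" using that Cc by auto
        then have "v = b \<otimes> w" using e b(1) by (simp add: m_assoc)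
        then show False using d[OF b(1) bC that(2)] that by simp
      qed
      then have "(\<lambda>w. b \<otimes> w) ` ?C \<inter> (\<lambda>w. (b \<otimes> b) \<otimes> w) ` ?C = {}" by blast
      moreover have "?C \<inter> ((\<lambda>w. b \<otimes> w) ` ?C \<union> (\<lambda>w. (b \<otimes> b) \<otimes> w) ` ?C) = {}"
        using d[OF b(1) bC] d[OF _ bbC] b(1) by blast
      moreover have "card ((\<lambda>w. u \<otimes> w) ` ?C) = 5" if "u \<in> carrier G" for u
        using that Cc p(4) by (subst card_image) (auto simp: inj_on_def subset_iff)
      ultimately show ?thesis using b(1) p(4) finite_centralizer by (simp add: card_Un_disjoint)
    qed
    moreover have "finite ?H" using fin subgroup.subset[OF sub] finite_subset by blast
    ultimately have "15 \<le> card ?H" by (metis card_mono)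
    then have gen: "?H = carrier G" using subgroup_eq_carrier[OF fin sub] o by simp
    show ?thesis
      using b p bp4 by (intro iso_Sz_2[OF fin o p(1) b(1) gen]) (auto simp: m_assoc)
  qed
  ultimately show ?thesis by simp
qed

text \<open>Square roots are counted. Besides 1, the centralizer of \<open>t\<close> in
  \<open>Cd 8\<close> consists of the square roots of \<open>t\<close> in \<open>Cd 4\<close> and of
  the members of \<open>Cd 8\<close> commuting with \<open>t\<close>, including \<open>t\<close>; so
  r roots and q such members satisfy r + q = 7. Always q <= 5, and q <= 4 for some \<open>t\<close>
  because the five elements of \<open>Cd 8\<close> cannot all commute. This requires at least 3 + 4
  * 2 = 11 roots, but \<open>Cd 4\<close> has 10 elements.\<close>

lemma order_40: assumes o: "order G = 40" and k: "k 4 = 1" "k 8 = 1" "k 2 = 0" "k 3 = 0" shows False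
proof -
  have c: "card (Cd 4) = 10" "card (Cd 8) = 5" using k_eq[of 4] k_eq[of 8] o k by simp_all
  have E: "Cd 2 = {}" "Cd 3 = {}" using k_zero k by auto
  have sq8: "t \<otimes> t = \<one>" if "t \<in> Cd 8" for t using Cd_even that by blast
  \<comment> \<open>\<open>Cd 4\<close> is a single class and contains an element with nontrivial
    square, so none of its elements is an involution.\<close>
  have sq4: "y \<otimes> y \<noteq> \<one>" if y: "y \<in> Cd 4" for y
  proof
    assume e: "y \<otimes> y = \<one>"
    obtain t where t: "t \<in> Cd 8" using c by fastforce
    obtain w where w: "w \<in> Cd 4" "w \<otimes> w \<noteq> \<one>" using Cd_8_centralizer(1)[OF t] by blast
    have yc: "y \<in> carrier G" using y by (simp add: Cd_mem)
    obtain g where g: "g \<in> carrier G" "w = g \<otimes> y \<otimes> inv g" using k_one[OF k(1) y] w by (auto simp: conj_class_def)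
    have "w \<otimes> w = g \<otimes> (y \<otimes> y) \<otimes> inv g" unfolding g(2) using g(1) yc by (simp add: m_assoc)
    then show False using e g w by simp
  qed
  define R where "R t = {y \<in> Cd 4. y \<otimes> y = t}" for t
  have R: "centralizer G t = {\<one>, t} \<union> (R t \<union> (Cd 8 \<inter> centralizer G t - {t}))" if t: "t \<in> Cd 8" for t
  proof
    have tc: "t \<in> carrier G" "t \<noteq> \<one>" using t by (auto simp: Cd_mem)
    show "{\<one>, t} \<union> (R t \<union> (Cd 8 \<inter> centralizer G t - {t})) \<subseteq> centralizer G t"
      using centralizer_one[OF tc(1)] centralizer_self[OF tc(1)] by (auto simp: R_def centralizer_def Cd_mem m_assoc)
    show "centralizer G t \<subseteq> {\<one>, t} \<union> (R t \<union> (Cd 8 \<inter> centralizer G t - {t}))"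
    proof
      fix y assume y: "y \<in> centralizer G t"
      have "y \<in> carrier G" using y by (simp add: centralizer_def)
      then consider "y = \<one>" | "y \<in> Cd 8" | "y \<in> Cd 4"
        using carrier_Cd E Cd_8_centralizer(2,3)[OF t] y by auto
      then show "y \<in> {\<one>, t} \<union> (R t \<union> (Cd 8 \<inter> centralizer G t - {t}))"
      proof cases
        case 3
        then have "centralizer G y = (\<lambda>i::nat. y [^] i) ` {..<4}"
          using element_types[of y] sq4[OF 3] by (auto simp: Cd_mem)
        moreover have "t \<in> centralizer G y" using y tc by (simp add: centralizer_def)
        ultimately obtain i :: nat where i: "t = y [^] i" "i < 4" by auto
        have yc: "y \<in> carrier G" using 3 by (simp add: Cd_mem)
        have "y \<otimes> y = t"
        proof -
          have "i = 0 \<or> i = 1 \<or> i = 2 \<or> i = 3" using i(2) by auto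
          moreover have "i \<noteq> 0"
          proof
            assume "i = 0"
            then show False using i(1) tc(2) by simp
          qed
          moreover have "i \<noteq> 1" using i 3 t yc by (auto simp: Cd_mem)
          moreover have "i \<noteq> 3"
          proof
            assume "i = 3"
            then have "t \<otimes> t = y [^] (6::nat)" using i yc by (simp add: nat_pow_mult)
            then have "y [^] (2::nat) = \<one>" using sq8[OF t] pow_mod_exponent[OF yc Cd_4[OF 3], of 6] by simp
            then show False using sq4[OF 3] two_pow[OF yc] by simp
          qed
          ultimately have "i = 2" by simp
          then show ?thesis using i two_pow[OF yc] by simp
        qed
        then show ?thesis using 3 by (simp add: R_def)
      qed (use y in auto)
    qed
  qed
  have finR: "finite (R t)" for t using finite_Cd by (simp add: R_def)
  have cR: "card (R t) + card (Cd 8 \<inter> centralizer G t) = 7" if t: "t \<in> Cd 8" for t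
  proof -
    have tc: "t \<in> carrier G" "t \<noteq> \<one>" "card (centralizer G t) = 8" using t by (auto simp: Cd_mem)
    have d: "{\<one>, t} \<inter> (R t \<union> (Cd 8 \<inter> centralizer G t - {t})) = {}" "R t \<inter> (Cd 8 \<inter> centralizer G t - {t}) = {}"
      using t by (auto simp: R_def Cd_mem)
    have "card (centralizer G t) = card ({\<one>, t} \<union> (R t \<union> (Cd 8 \<inter> centralizer G t - {t})))"
      using R[OF t] by simp
    also have "\<dots> = card {\<one>, t} + (card (R t) + card (Cd 8 \<inter> centralizer G t - {t}))"
      using d finR finite_Cd by (subst card_Un_disjoint) (auto simp: card_Un_disjoint)
    finally have "8 = 2 + (card (R t) + card (Cd 8 \<inter> centralizer G t - {t}))" using tc by simp
    moreover have "t \<in> Cd 8 \<inter> centralizer G t" using t centralizer_self[OF tc(1)] by simp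
    then have "card (Cd 8 \<inter> centralizer G t) = Suc (card (Cd 8 \<inter> centralizer G t - {t}))"
      using finite_Cd by (simp add: card_Suc_Diff1 del: card_Diff_singleton_if card_Diff_insert)
    ultimately show ?thesis by simp
  qed
  have le5: "card (Cd 8 \<inter> centralizer G t) \<le> 5" for t
    using card_mono[OF finite_Cd, of "Cd 8 \<inter> centralizer G t" 8] c by simp
  have "\<exists>t\<in>Cd 8. \<exists>u\<in>Cd 8. t \<otimes> u \<noteq> u \<otimes> t"
  proof (rule ccontr)
    assume "\<not> ?thesis"
    then have "card (Cd 8) \<le> 4" by (intro commuting_card_le_4) (auto simp: Cd_mem)
    then show False using c by simp
  qed
  then obtain t u where tu: "t \<in> Cd 8" "u \<in> Cd 8" "t \<otimes> u \<noteq> u \<otimes> t" by blast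
  have "Cd 8 \<inter> centralizer G t \<subseteq> Cd 8 - {u}" using tu by (auto simp: centralizer_def)
  then have "card (Cd 8 \<inter> centralizer G t) \<le> card (Cd 8 - {u})" using finite_Cd by (intro card_mono) auto
  then have "card (Cd 8 \<inter> centralizer G t) \<le> 4" using c tu finite_Cd by simp
  then have R3: "card (R t) \<ge> 3" using cR[OF tu(1)] by simp
  have R2: "card (R s) \<ge> 2" if "s \<in> Cd 8" for s using cR[OF that] le5[of s] by simp
  have "card (Cd 8 - {t}) * 2 \<le> (\<Sum>s\<in>Cd 8 - {t}. card (R s))"
    using sum_bounded_below[of "Cd 8 - {t}" 2 "\<lambda>s. card (R s)"] R2 by simp
  then have "11 \<le> (\<Sum>s\<in>Cd 8. card (R s))"
    using sum.remove[OF finite_Cd tu(1), of "\<lambda>s. card (R s)"] R3 c tu finite_Cd by simp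
  also have "\<dots> = card (\<Union> (R ` Cd 8))"
    using finite_Cd finR by (subst card_UN_disjoint) (auto simp: R_def)
  also have "\<dots> \<le> card (Cd 4)" using finite_Cd by (intro card_mono) (auto simp: R_def)
  finally show False using c by simp
qed

text \<open>The 15 elements of \<open>Cd 4\<close> are involutions, and their centralizers are Klein
  four-groups meeting trivially; there are 15/3 = 5 of them, on which the group acts. A nontrivial
  \<open>g\<close> in the kernel would have at least 60/5 = 12 conjugates there, too many for a
  kernel of at most 12 elements including the identity. The 44 elements of order 3 or 5 single out
  the alternating group.\<close>

lemma order_60: assumes o: "order G = 60" and k: "k 2 = 0" "k 3 = 1" "k 4 = 1" "k 5 = 2" "k 8 = 0" shows "G \<cong> alt_group 5"
proof -
  have c: "card (Cd 3) = 20" "card (Cd 4) = 15" "card (Cd 5) = 24"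
    using k_eq[of 3] k_eq[of 4] k_eq[of 5] o k by simp_all
  have E: "Cd 2 = {}" "Cd 8 = {}" using k_zero k by auto
  \<comment> \<open>Otherwise \<open>t\<close> would be conjugate to its square, and squaring this
    relation makes t^2 conjugate to t^4 = 1.\<close>
  have sq4: "t \<otimes> t = \<one>" if t: "t \<in> Cd 4" for t
  proof (rule ccontr)
    assume n: "t \<otimes> t \<noteq> \<one>"
    have tc: "t \<in> carrier G" using t by (simp add: Cd_mem)
    have tttt: "(t \<otimes> t) \<otimes> (t \<otimes> t) = \<one>" using Cd_4[OF t] four_pow[OF tc] by simp
    have "t \<otimes> t \<notin> Cd 5" "t \<otimes> t \<notin> Cd 3" using Cd_odd(3)[of 5 "t \<otimes> t"] Cd_odd(3)[of 3 "t \<otimes> t"] tttt by auto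
    then have "t \<otimes> t \<in> Cd 4" using carrier_Cd E n m_closed[OF tc tc] by auto
    then obtain g where g: "g \<in> carrier G" "t = g \<otimes> (t \<otimes> t) \<otimes> inv g"
      using k_one[OF k(3) \<open>t \<otimes> t \<in> Cd 4\<close>] t by (auto simp: conj_class_def)
    have "t [^] (2::nat) = g \<otimes> (t \<otimes> t) [^] (2::nat) \<otimes> inv g"
      using conj_pow[of "t \<otimes> t" g 2] g tc by simp
    then have "t \<otimes> t = \<one>" using tttt g tc by (simp add: two_pow)
    then show False using n by simp
  qed
  have block: "y \<in> Cd 4 \<and> centralizer G y = centralizer G t" if t: "t \<in> Cd 4" and y: "y \<in> centralizer G t" "y \<noteq> \<one>" for t y
  proof -
    have tc: "t \<in> carrier G" "t \<noteq> \<one>" "card (centralizer G t) = 4" using t by (auto simp: Cd_mem)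
    have yc: "y \<in> carrier G" using y by (simp add: centralizer_def)
    have "y [^] (4::nat) = \<one>" using subgroup_pow_card[OF centralizer_subgroup[OF tc(1)] finite_centralizer y(1)] tc by simp
    have "y \<notin> Cd d" if d: "d \<in> {3, 5}" for d
    proof
      assume yd: "y \<in> Cd d"
      have yd1: "y [^] d = \<one>" using Cd_odd(1)[OF d yd] .
      consider "d = 3" | "d = 5" using d by auto
      then show False
      proof cases
        case 1
        have "y [^] (4::nat) = y [^] d \<otimes> y" unfolding 1 by (simp add: eval_nat_numeral)
        then show False using yd1 \<open>y [^] (4::nat) = \<one>\<close> yc y(2) by simp
      next
        case 2
        have "y [^] d = y [^] (4::nat) \<otimes> y" unfolding 2 by (simp add: eval_nat_numeral)
        then show False using yd1 \<open>y [^] (4::nat) = \<one>\<close> yc y(2) by simp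
      qed
    qed
    then have y4: "y \<in> Cd 4" using carrier_Cd E yc y by auto
    have "centralizer G y = centralizer G t"
    proof (cases "y = t")
      case False
      have i: "centralizer G t \<inter> centralizer G y = {\<one>, t, y, t \<otimes> y}" "card {\<one>, t, y, t \<otimes> y} = 4"
        using centralizer_involution_inter[OF tc(1,2) sq4[OF t] y False] by auto
      have "card (centralizer G y) = 4" using y4 by (simp add: Cd_mem)
      then have "centralizer G t \<inter> centralizer G y = centralizer G t" "centralizer G t \<inter> centralizer G y = centralizer G y"
        using card_subset_eq[OF finite_centralizer[of t] Int_lower1[of "centralizer G t" "centralizer G y"]]
          card_subset_eq[OF finite_centralizer[of y] Int_lower2[of "centralizer G t" "centralizer G y"]] i tc by simp_all
      then show ?thesis by simp
    qed simp
    then show ?thesis using y4 by blast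
  qed
  let ?F = "centralizer G ` Cd 4"
  have cF: "card ?F = 5"
  proof -
    let ?B = "(\<lambda>A. A - {\<one>}) ` ?F"
    have one: "\<one> \<in> centralizer G x" if "x \<in> carrier G" for x using that by (simp add: centralizer_def)
    have inj: "inj_on (\<lambda>A. A - {\<one>}) ?F" using one by (auto simp: inj_on_def Cd_mem)
    have U: "\<Union> ?B = Cd 4"
    proof
      show "\<Union> ?B \<subseteq> Cd 4"
      proof
        fix w assume "w \<in> \<Union> ?B"
        then obtain t where "t \<in> Cd 4" "w \<in> centralizer G t" "w \<noteq> \<one>" by auto
        then show "w \<in> Cd 4" using block by blast
      qed
      show "Cd 4 \<subseteq> \<Union> ?B" by (auto simp: Cd_mem centralizer_def)
    qed
    have "3 * card ?B = card (\<Union> ?B)"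
    proof (rule card_partition)
      show "finite ?B" using finite_Cd by simp
      show "finite (\<Union> ?B)" unfolding U by (rule finite_Cd)
      show "card c = 3" if c: "c \<in> ?B" for c
        using c one finite_centralizer by (auto simp: Cd_mem)
      show "c1 \<inter> c2 = {}" if c: "c1 \<in> ?B" "c2 \<in> ?B" "c1 \<noteq> c2" for c1 c2
      proof -
        obtain x y where x: "x \<in> Cd 4" "c1 = centralizer G x - {\<one>}" and y: "y \<in> Cd 4" "c2 = centralizer G y - {\<one>}"
          using c by auto
        have "w \<notin> c2" if "w \<in> c1" for w
          using block[OF x(1), of w] block[OF y(1), of w] x(2) y(2) c(3) that by auto
        then show ?thesis by blast
      qed
    qed
    then show ?thesis unfolding U using card_image[OF inj] c by simp
  qed
  obtain \<phi> where \<phi>: "\<phi> \<in> hom G (sym_group 5)" "inj_on \<phi> (carrier G)"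
  proof (rule conj_action_sym_group)
    show "finite ?F" using finite_Cd by simp
    show "card ?F = 5" by (rule cF)
    show "A \<subseteq> carrier G" if "A \<in> ?F" for A using that by (auto simp: centralizer_def)
    show "(\<lambda>x. g \<otimes> x \<otimes> inv g) ` A \<in> ?F" if "g \<in> carrier G" "A \<in> ?F" for g A
      using that conj_centralizer Cd_conj by (auto simp: Cd_mem)
    fix g assume g: "g \<in> carrier G" and fixed: "\<And>A. A \<in> ?F \<Longrightarrow> (\<lambda>x. g \<otimes> x \<otimes> inv g) ` A = A"
    show "g = \<one>"
    proof (rule ccontr)
      assume g1: "g \<noteq> \<one>"
      define K where "K = {h \<in> carrier G. \<forall>A\<in>?F. (\<lambda>x. h \<otimes> x \<otimes> inv h) ` A = A}"
      obtain t where t: "t \<in> Cd 4" using c by fastforce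
      have tc: "t \<in> carrier G" "card (centralizer G t) = 4" using t by (auto simp: Cd_mem)
      \<comment> \<open>the conjugates of \<open>t\<close> under \<open>K\<close> lie in a group of order 4 and each of them arises from at most 4 elements\<close>
      have "K \<subseteq> (\<Union>v\<in>centralizer G t - {\<one>}. {h \<in> carrier G. h \<otimes> t \<otimes> inv h = v})"
      proof
        fix h assume h: "h \<in> K"
        then have "h \<otimes> t \<otimes> inv h \<in> centralizer G t" using t centralizer_self[OF tc(1)] unfolding K_def by blast
        moreover have "h \<otimes> t \<otimes> inv h \<noteq> \<one>" using Cd_conj[OF t, of h] h by (auto simp: K_def Cd_mem)
        ultimately show "h \<in> (\<Union>v\<in>centralizer G t - {\<one>}. {h \<in> carrier G. h \<otimes> t \<otimes> inv h = v})" using h by (auto simp: K_def)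
      qed
      then have "card K \<le> card (\<Union>v\<in>centralizer G t - {\<one>}. {h \<in> carrier G. h \<otimes> t \<otimes> inv h = v})"
        using fin finite_centralizer by (intro card_mono) auto
      also have "\<dots> \<le> (\<Sum>v\<in>centralizer G t - {\<one>}. card {h \<in> carrier G. h \<otimes> t \<otimes> inv h = v})"
        using finite_centralizer by (intro card_UN_le) simp
      also have "\<dots> \<le> (\<Sum>v\<in>centralizer G t - {\<one>}. 4)"
      proof (rule sum_mono)
        fix v
        show "card {h \<in> carrier G. h \<otimes> t \<otimes> inv h = v} \<le> 4"
        proof (cases "{h \<in> carrier G. h \<otimes> t \<otimes> inv h = v} = {}")
          case False
          then obtain h where h: "h \<in> carrier G" "h \<otimes> t \<otimes> inv h = v" by blast
          have "card {h \<in> carrier G. h \<otimes> t \<otimes> inv h = v} \<le> card (centralizer G t)"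
          proof (rule card_inj_on_le[of "\<lambda>h'. inv h \<otimes> h'"])
            show "inj_on (\<lambda>h'. inv h \<otimes> h') {h \<in> carrier G. h \<otimes> t \<otimes> inv h = v}" using h by (auto simp: inj_on_def)
            show "(\<lambda>h'. inv h \<otimes> h') ` {h \<in> carrier G. h \<otimes> t \<otimes> inv h = v} \<subseteq> centralizer G t"
            proof
              fix w assume "w \<in> (\<lambda>h'. inv h \<otimes> h') ` {h \<in> carrier G. h \<otimes> t \<otimes> inv h = v}"
              then obtain h' where h': "w = inv h \<otimes> h'" "h' \<in> carrier G" "h' \<otimes> t \<otimes> inv h' = v" by blast
              have "h \<otimes> t \<otimes> inv h = h' \<otimes> t \<otimes> inv h'" using h(2) h'(3) by simp
              then show "w \<in> centralizer G t" using conj_eq_iff[OF tc(1) h(1) h'(2)] h'(1) by blast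
            qed
          qed (rule finite_centralizer)
          then show ?thesis using tc by simp
        qed (metis (lifting) card.empty zero_le)
      qed
      also have "\<dots> = 12" using tc centralizer_one[OF tc(1)] finite_centralizer by simp
      finally have K12: "card K \<le> 12" .
      \<comment> \<open>\<open>K\<close> is the kernel of the action and hence contains all
        conjugates of \<open>g\<close>.\<close>
      have cl: "conj_class G g \<subseteq> K"
      proof
        fix h assume "h \<in> conj_class G g"
        then obtain y where y: "y \<in> carrier G" "h = y \<otimes> g \<otimes> inv y" by (auto simp: conj_class_def)
        have "(\<lambda>x. h \<otimes> x \<otimes> inv h) ` A = A" if A: "A \<in> ?F" for A
        proof -
          have Ac: "A \<subseteq> carrier G" using A by (auto simp: centralizer_def)
          define B where "B = (\<lambda>x. inv y \<otimes> x \<otimes> inv (inv y)) ` A"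
          have BF: "B \<in> ?F" unfolding B_def using A conj_centralizer[of _ "inv y"] Cd_conj[of _ _ "inv y"] y by (auto simp: Cd_mem)
          have "(\<lambda>x. h \<otimes> x \<otimes> inv h) ` A = (\<lambda>x. y \<otimes> x \<otimes> inv y) ` (\<lambda>x. g \<otimes> x \<otimes> inv g) ` B"
            unfolding B_def image_image y(2) using Ac y(1) g
            by (intro image_cong) (auto simp: m_assoc inv_mult_group subset_iff)
          also have "(\<lambda>x. g \<otimes> x \<otimes> inv g) ` B = B" using fixed[OF BF] .
          also have "(\<lambda>x. y \<otimes> x \<otimes> inv y) ` B = (\<lambda>x. x) ` A"
            unfolding B_def image_image using Ac y(1) by (intro image_cong) (auto simp: m_assoc subset_iff)
          finally show ?thesis by simp
        qed
        then show "h \<in> K" using y g by (simp add: K_def)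
      qed
      have "\<one> \<notin> conj_class G g"
      proof
        assume "\<one> \<in> conj_class G g"
        then obtain y where y: "y \<in> carrier G" "\<one> = y \<otimes> g \<otimes> inv y" by (auto simp: conj_class_def)
        have "inv y \<otimes> (y \<otimes> g \<otimes> inv y) \<otimes> y = g" using g y(1) by (simp add: m_assoc)
        then have "inv y \<otimes> \<one> \<otimes> y = g" unfolding y(2)[symmetric] .
        then show False using y(1) g1 by simp
      qed
      moreover have "\<one> \<in> K" unfolding K_def by (auto simp: centralizer_def image_iff)
      moreover have finK: "finite K" using fin by (simp add: K_def)
      ultimately have "card (insert \<one> (conj_class G g)) = Suc (card (conj_class G g))" "insert \<one> (conj_class G g) \<subseteq> K"
        using cl finite_subset[OF cl finK] by simp_all
      from this(1) card_mono[OF finK this(2)] have "card (conj_class G g) \<le> 11" using K12 by linarith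
      moreover have "card (centralizer G g) \<le> 5"
      proof -
        have "g \<in> Cd 3 \<or> g \<in> Cd 4 \<or> g \<in> Cd 5" using carrier_Cd E g g1 by blast
        then show ?thesis by (elim disjE) (simp_all add: Cd_mem)
      qed
      ultimately have "card (conj_class G g) * card (centralizer G g) \<le> 11 * 5" by (rule mult_le_mono)
      moreover have "card (conj_class G g) * card (centralizer G g) = 60" using card_conj_class[OF fin g] o by simp
      ultimately show False by simp
    qed
  qed (rule that)
  show ?thesis
  proof (rule iso_alt_groupI[OF \<phi>, of "Cd 3 \<union> Cd 5"])
    show "2 * order G = fact 5" using o by (simp add: fact_numeral)
    have "card (Cd 3 \<union> Cd 5) = 44" using c finite_Cd by (subst card_Un_disjoint) (auto simp: Cd_mem)
    then show "order G < 2 * card (Cd 3 \<union> Cd 5)" using o by simp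
    show "\<exists>k. odd k \<and> x [^] (k::nat) = \<one>" if "x \<in> Cd 3 \<union> Cd 5" for x
      using that Cd_odd(1)[of 3 x] Cd_odd(1)[of 5 x] by (auto intro: exI[of _ 3] exI[of _ 5])
  qed (auto simp: Cd_mem)
qed

lemma card_Z_1_cases:
  "G \<cong> sym_group 3 \<or> G \<cong> dihedral_group 5 \<or> G \<cong> alt_group 4 \<or> G \<cong> Sz_2 \<or> G \<cong> sym_group 4 \<or> G \<cong> alt_group 5"
  using order_cases order_6 order_10 order_12 order_20 order_24 order_40 order_60 by auto

end

section \<open>Permutations as lists, and the planarity of the symmetric and alternating
  groups\<close>

definition encode :: "nat \<Rightarrow> (nat \<Rightarrow> nat) \<Rightarrow> nat list" where
  "encode n p = map (\<lambda>i. p (Suc i) - 1) [0..<n]"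

definition list_commute :: "nat list \<Rightarrow> nat list \<Rightarrow> bool" where
  "list_commute l m \<longleftrightarrow> list_all (\<lambda>i. l ! (m ! i) = m ! (l ! i)) [0..<length l]"

text \<open>The group \<open>sym_group n\<close> permutes the numbers from 1 to \<open>n\<close>,
  whereas positions and entries of lists run from 0 to \<open>n - 1\<close>; the successors account
  for this shift.\<close>

lemma encode_nth:
  assumes "p permutes {1..n}" "i < n"
  shows "Suc (encode n p ! i) = p (Suc i)" "encode n p ! i < n"
proof -
  have "p (Suc i) \<in> {1..n}" using permutes_in_image[OF assms(1), of "Suc i"] assms(2) by simp
  then show "Suc (encode n p ! i) = p (Suc i)" "encode n p ! i < n" using assms(2) by (auto simp: encode_def)
qed

lemma length_encode [simp]: "length (encode n p) = n"
  by (simp add: encode_def)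

lemma encode_eqD:
  assumes "p permutes {1..n}" "q permutes {1..n}" "encode n p = encode n q"
  shows "p = q"
proof
  fix x
  show "p x = q x"
  proof (cases "x \<in> {1..n}")
    case True
    then have "x = Suc (x - 1)" "x - 1 < n" by auto
    then show ?thesis using encode_nth(1)[OF assms(1), of "x - 1"] encode_nth(1)[OF assms(2), of "x - 1"] assms(3) by simp
  next
    case False
    then show ?thesis using permutes_not_in[OF assms(1)] permutes_not_in[OF assms(2)] by simp
  qed
qed

lemma encode_comp:
  assumes "p permutes {1..n}" "q permutes {1..n}"
  shows "encode n (p \<circ> q) = map (\<lambda>i. encode n p ! i) (encode n q)"
proof (rule nth_equalityI)
  fix i assume "i < length (encode n (p \<circ> q))"
  then have i: "i < n" by simp
  have "Suc (encode n p ! (encode n q ! i)) = p (q (Suc i))"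
    using encode_nth[OF assms(2) i] encode_nth(1)[OF assms(1), of "encode n q ! i"] by simp
  moreover have "Suc (encode n (p \<circ> q) ! i) = p (q (Suc i))"
    using encode_nth(1)[OF permutes_compose[OF assms(2,1)] i] by simp
  ultimately show "encode n (p \<circ> q) ! i = map (\<lambda>i. encode n p ! i) (encode n q) ! i" using i by simp
qed simp

lemma list_commute_encode:
  assumes "p permutes {1..n}" "q permutes {1..n}" "p \<circ> q = q \<circ> p"
  shows "list_commute (encode n p) (encode n q)"
proof -
  have "encode n p ! (encode n q ! i) = encode n q ! (encode n p ! i)" if "i < n" for i
    using arg_cong[OF encode_comp[OF assms(1,2)], of "\<lambda>l. l ! i"] arg_cong[OF encode_comp[OF assms(2,1)], of "\<lambda>l. l ! i"]
      assms(3) that by simp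
  then show ?thesis by (simp add: list_commute_def list_all_iff)
qed

lemma encode_distinct:
  assumes "p permutes {1..n}"
  shows "distinct (encode n p)"
  unfolding distinct_conv_nth
proof (intro allI impI)
  fix i j assume ij: "i < length (encode n p)" "j < length (encode n p)" "i \<noteq> j"
  show "encode n p ! i \<noteq> encode n p ! j"
  proof
    assume "encode n p ! i = encode n p ! j"
    then have "p (Suc i) = p (Suc j)" using encode_nth(1)[OF assms, of i] encode_nth(1)[OF assms, of j] ij by simp
    then show False using permutes_inj[OF assms] ij(3) by (simp add: inj_eq)
  qed
qed

lemma encode_surj:
  assumes "length l = n" "distinct l" "\<And>x. x \<in> set l \<Longrightarrow> x < n"
  obtains p where "p permutes {1..n}" "encode n p = l"
proof
  let ?p = "\<lambda>x. if x \<in> {1..n} then Suc (l ! (x - 1)) else x"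
  have im: "?p ` {1..n} \<subseteq> {1..n}" using assms(1,3) nth_mem[of _ l] by (fastforce simp: less_eq_Suc_le[symmetric])
  have "inj_on ?p {1..n}"
  proof (rule inj_onI)
    fix x y assume xy: "x \<in> {1..n}" "y \<in> {1..n}" "?p x = ?p y"
    then have "l ! (x - 1) = l ! (y - 1)" by simp
    then have "x - 1 = y - 1" using nth_eq_iff_index_eq[OF assms(2), of "x - 1" "y - 1"] xy(1,2) assms(1) by auto
    then show "x = y" using xy(1,2) by auto
  qed
  then have "bij_betw ?p {1..n} {1..n}" using endo_inj_surj[OF _ im] by (simp add: bij_betw_def)
  then show "?p permutes {1..n}" by (rule bij_imp_permutes) auto
  show "encode n ?p = l" using assms(1) by (intro nth_equalityI) (simp_all add: encode_def)
qed

text \<open>The involutions of the Klein four-subgroup at positions 0, 5 and 10, each followed by the other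
  four elements of its centralizer; then the pairs of mutually inverse 3-cycles.\<close>

definition S4_order :: "nat list list" where
  "S4_order =
    [[1,0,3,2], [1,0,2,3], [0,1,3,2], [2,3,1,0], [3,2,0,1], [2,3,0,1], [2,1,0,3], [0,3,2,1],
     [1,2,3,0], [3,0,1,2], [3,2,1,0], [3,1,2,0], [0,2,1,3], [1,3,0,2], [2,0,3,1], [1,2,0,3],
     [2,0,1,3], [1,3,2,0], [3,0,2,1], [2,1,3,0], [3,1,0,2], [0,2,3,1], [0,3,1,2]]"

text \<open>The commuting pairs as positions in \<open>S4_order\<close>, the smaller one first. No
  two of them interleave, so a single page suffices: the triangle 0, 5, 10 is the Klein four-group,
  and two further triangles hang at each of its corners.\<close>

definition S4_edges :: "(nat \<times> nat) list" where
  "S4_edges =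
    [(0,1), (0,2), (0,3), (0,4), (0,5), (0,10), (1,2), (3,4), (5,6), (5,7), (5,8), (5,9),
     (5,10), (6,7), (8,9), (10,11), (10,12), (10,13), (10,14), (11,12), (13,14), (15,16),
     (17,18), (19,20), (21,22)]"

lemma S4_complete: "\<forall>l\<in>set (List.n_lists 4 [0..<4]). if distinct l then l \<in> set ([0..<4] # S4_order) else True"
  by code_simp

lemma S4_edges_complete:
  "\<forall>i\<in>set [0..<23]. \<forall>j\<in>set [0..<23]. if i < j then (if list_commute (S4_order ! i) (S4_order ! j) then (i, j) \<in> set S4_edges else True) else True"
  by code_simp

lemma S4_edges_no_crossing:
  "\<forall>e\<in>set S4_edges. \<forall>f\<in>set S4_edges. if fst e < fst f then (if fst f < snd e then \<not> snd e < snd f else True) else True"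
  by code_simp

lemma planar_sym_group_4: "planar (commuting_graph (sym_group 4))"
proof -
  let ?G = "sym_group 4"
  define V where "V = carrier ?G - group_center ?G"
  define E where "E = {{x, y} | x y. x \<in> V \<and> y \<in> V \<and> x \<noteq> y \<and> x \<otimes>\<^bsub>?G\<^esub> y = y \<otimes>\<^bsub>?G\<^esub> x}"
  define ix where "ix p = length (takeWhile (\<lambda>l. l \<noteq> encode 4 p) S4_order)" for p
  have len: "length S4_order = 23" by (simp add: S4_order_def)
  have perm: "p permutes {1..4}" if "p \<in> V" for p using that by (simp add: V_def sym_group_carrier)
  have ix: "ix p < 23" "S4_order ! ix p = encode 4 p" if p: "p \<in> V" for p
  proof -
    have "id \<in> group_center ?G" by (simp add: group_center_def sym_group_def permutes_id)
    then have "p \<noteq> id" using p by (auto simp: V_def)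
    then have "encode 4 p \<noteq> encode 4 id" using encode_eqD[OF perm[OF p] permutes_id] by blast
    moreover have "encode 4 id = [0..<4]" by (simp add: encode_def map_idI)
    moreover have "encode 4 p \<in> set (List.n_lists 4 [0..<4])"
      using encode_nth(2)[OF perm[OF p]] by (auto simp: set_n_lists in_set_conv_nth)
    ultimately have "encode 4 p \<in> set S4_order" using S4_complete encode_distinct[OF perm[OF p]] by auto
    then have "dropWhile (\<lambda>l. l \<noteq> encode 4 p) S4_order \<noteq> []" by simp
    then have "length (dropWhile (\<lambda>l. l \<noteq> encode 4 p) S4_order) > 0" by (simp only: length_greater_0_conv not_False_eq_True)
    then have "ix p < length S4_order" unfolding ix_def
      using arg_cong[OF takeWhile_dropWhile_id[of "\<lambda>l. l \<noteq> encode 4 p" S4_order], of length] by (simp only: length_append)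
    then show "ix p < 23" "S4_order ! ix p = encode 4 p"
      using nth_length_takeWhile[of "\<lambda>l. l \<noteq> encode 4 p" S4_order] len by (auto simp: ix_def)
  qed
  have edge: "x \<in> V" "y \<in> V" "list_commute (encode 4 x) (encode 4 y)" if "{x, y} \<in> E" for x y
    using that list_commute_encode perm by (auto simp: E_def doubleton_eq_iff sym_group_mult)
  have "planar (V, E)"
  proof (rule planar_two_pages[where pos = "\<lambda>p. real (ix p)" and page = "\<lambda>_. True"])
    show "inj_on (\<lambda>p. real (ix p)) V"
    proof (rule inj_onI)
      fix p q assume pq: "p \<in> V" "q \<in> V" "real (ix p) = real (ix q)"
      then have "encode 4 p = encode 4 q" using ix(2)[of p] ix(2)[of q] by simp
      then show "p = q" using encode_eqD perm pq by blast
    qed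
    show "E \<subseteq> {{x, y} | x y. x \<in> V \<and> y \<in> V \<and> x \<noteq> y}" by (auto simp: E_def)
    fix x y u v assume e: "{x, y} \<in> E" "{u, v} \<in> E" and lt: "real (ix x) < real (ix u)" "real (ix u) < real (ix y)" "real (ix y) < real (ix v)"
    have mem: "(ix a, ix b) \<in> set S4_edges" if "{a, b} \<in> E" "ix a < ix b" for a b
    proof -
      note ab = edge[OF that(1)]
      have "if ix a < ix b then (if list_commute (S4_order ! ix a) (S4_order ! ix b) then (ix a, ix b) \<in> set S4_edges else True) else True"
        using ix(1)[OF ab(1)] ix(1)[OF ab(2)] by (intro S4_edges_complete[rule_format]) (simp_all only: set_upt atLeastLessThan_iff zero_le simp_thms)
      then show ?thesis using that(2) ab(3) ix(2)[OF ab(1)] ix(2)[OF ab(2)] by simp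
    qed
    have "(ix x, ix y) \<in> set S4_edges" "(ix u, ix v) \<in> set S4_edges" using mem e lt by auto
    from S4_edges_no_crossing[THEN bspec, OF this(1), THEN bspec, OF this(2)] show False using lt by simp
  qed
  then show ?thesis by (simp add: commuting_graph_def V_def E_def Let_def)
qed

lemma planar_sym_group_3: "planar (commuting_graph (sym_group 3))"
proof (rule planar_inj_hom[OF sym_group_is_group sym_group_is_group _ _ planar_sym_group_4, where h = id])
  show "id \<in> hom (sym_group 3) (sym_group 4)"
    by (auto simp: hom_def sym_group_def intro: permutes_subset)
qed simp

lemma planar_alt_group_4: "planar (commuting_graph (alt_group 4))"
proof (rule planar_inj_hom[OF alt_group_is_group sym_group_is_group _ _ planar_sym_group_4, where h = id])
  show "id \<in> hom (alt_group 4) (sym_group 4)" by (auto simp: hom_def sym_group_def alt_group_def)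
qed simp

text \<open>Every element of \<open>A\<^sub>5\<close> is a square in \<open>S\<^sub>5\<close>: elements of odd order are squares, and a double
  transposition is the square of a 4-cycle. The list contains one square root of each element.\<close>

definition A5_roots :: "nat list list" where
  "A5_roots =
    [[0,1,2,3,4], [0,1,3,4,2], [0,1,4,2,3], [0,2,3,1,4], [0,2,3,4,1], [0,2,4,1,3], [0,2,4,3,1],
     [0,3,1,2,4], [0,3,2,4,1], [0,3,4,2,1], [0,4,1,3,2], [0,4,2,1,3], [1,2,0,3,4], [1,2,3,0,4],
     [1,2,3,4,0], [1,2,4,0,3], [1,2,4,3,0], [1,3,0,2,4], [1,3,0,4,2], [1,3,2,0,4], [1,3,2,4,0],
     [1,3,4,2,0], [1,4,0,2,3], [1,4,0,3,2], [1,4,2,0,3], [1,4,2,3,0], [1,4,3,0,2], [2,0,1,3,4],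
     [2,0,3,4,1], [2,0,4,1,3], [2,1,3,0,4], [2,1,3,4,0], [2,1,4,0,3], [2,1,4,3,0], [2,3,1,0,4],
     [2,3,1,4,0], [2,3,4,0,1], [2,4,1,0,3], [2,4,1,3,0], [2,4,3,1,0], [3,0,1,4,2], [3,0,2,1,4],
     [3,0,4,2,1], [3,1,0,2,4], [3,1,2,4,0], [3,1,4,2,0], [3,2,0,4,1], [3,2,4,1,0], [3,4,0,1,2],
     [3,4,1,2,0], [3,4,2,1,0], [4,0,1,2,3], [4,0,2,3,1], [4,0,3,1,2], [4,1,0,3,2], [4,1,2,0,3],
     [4,2,0,1,3], [4,2,3,0,1], [4,3,0,2,1], [4,3,1,0,2]]"

definition A5_lists :: "nat list list" where
  "A5_lists =
    [[0,1,2,3,4], [0,1,4,2,3], [0,1,3,4,2], [0,3,1,2,4], [0,3,4,1,2], [0,4,3,2,1], [0,4,1,3,2],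
     [0,2,3,1,4], [0,4,2,1,3], [0,2,1,4,3], [0,2,4,3,1], [0,3,2,4,1], [2,0,1,3,4], [2,3,0,1,4],
     [2,3,4,0,1], [2,4,3,1,0], [2,4,0,3,1], [3,2,1,0,4], [3,4,1,2,0], [3,0,2,1,4], [3,4,2,0,1],
     [3,2,0,4,1], [4,3,1,0,2], [4,2,1,3,0], [4,3,2,1,0], [4,0,2,3,1], [4,2,0,1,3], [1,2,0,3,4],
     [3,2,4,1,0], [4,2,3,0,1], [3,1,0,2,4], [3,1,4,0,2], [4,1,3,2,0], [4,1,0,3,2], [1,0,3,2,4],
     [1,4,3,0,2], [4,0,1,2,3], [1,3,4,2,0], [1,0,4,3,2], [3,0,1,4,2], [4,3,0,2,1], [1,3,2,0,4],
     [2,3,1,4,0], [2,1,3,0,4], [4,1,2,0,3], [2,1,0,4,3], [4,0,3,1,2], [1,4,0,2,3], [1,2,3,4,0],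
     [2,0,4,1,3], [1,0,2,4,3], [3,4,0,1,2], [1,4,2,3,0], [2,4,1,0,3], [2,1,4,3,0], [3,1,2,4,0],
     [3,0,4,2,1], [1,3,0,4,2], [1,2,4,0,3], [2,0,3,4,1]]"

lemma A5_lists_roots: "map (\<lambda>l. map (\<lambda>i. l ! i) l) A5_roots = A5_lists"
  by code_simp

lemma A5_roots_perm: "\<forall>l\<in>set A5_roots. length l = 5 \<and> distinct l \<and> list_all (\<lambda>x. x < 5) l"
  by code_simp

lemma distinct_A5_lists: "distinct A5_lists"
  by code_simp

lemma A5_centralizers: "\<forall>l\<in>set A5_lists. if l = [0..<5] then True else length (filter (list_commute l) A5_lists) \<le> 5"
  by code_simp

text \<open>Squares are even, so the 60 distinct lists encode elements of A_5; equality follows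
  because A_5 has 60 elements. Writing the elements as squares thus replaces an evaluation of their
  parity.\<close>

lemma encode_alt_group_5: "encode 5 ` carrier (alt_group 5) = set A5_lists"
proof (rule HOL.sym, rule card_subset_eq)
  have "2 * card (carrier (alt_group 5)) = fact 5" by (rule alt_group_card_carrier) simp
  then have c: "card (carrier (alt_group 5)) = 60" by (simp add: fact_numeral)
  then have "finite (carrier (alt_group 5))" using card.infinite by fastforce
  then show "finite (encode 5 ` carrier (alt_group 5))" by simp
  have "inj_on (encode 5) (carrier (alt_group 5))"
    by (rule inj_onI) (auto simp: alt_group_carrier intro: encode_eqD)
  moreover have "length A5_lists = 60" by (simp add: A5_lists_def)
  ultimately show "card (set A5_lists) = card (encode 5 ` carrier (alt_group 5))"
    using c distinct_card[OF distinct_A5_lists] by (simp add: card_image)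
  show "set A5_lists \<subseteq> encode 5 ` carrier (alt_group 5)"
  proof
    fix l assume "l \<in> set A5_lists"
    then obtain r where r: "r \<in> set A5_roots" "l = map (\<lambda>i. r ! i) r" unfolding A5_lists_roots[symmetric] by auto
    then obtain p where p: "p permutes {1..5}" "encode 5 p = r"
      using encode_surj[of r 5] A5_roots_perm by (auto simp: list_all_iff)
    have "permutation p" using p(1) permutation_permutes by blast
    then have "evenperm (p \<circ> p)" by (simp add: evenperm_comp)
    then have "p \<circ> p \<in> carrier (alt_group 5)" using permutes_compose[OF p(1) p(1)] by (simp add: alt_group_carrier)
    moreover have "l = encode 5 (p \<circ> p)" using encode_comp[OF p(1) p(1)] p(2) r(2) by simp
    ultimately show "l \<in> encode 5 ` carrier (alt_group 5)" by blast
  qed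
qed

lemma planar_alt_group_5: "planar (commuting_graph (alt_group 5))"
proof -
  interpret A: group "alt_group 5" by (rule alt_group_is_group)
  have fin: "finite (carrier (alt_group 5))"
    using alt_group_card_carrier[of 5] card.infinite by fastforce
  have perm: "p permutes {1..5}" if "p \<in> carrier (alt_group 5)" for p using that by (simp add: alt_group_carrier)
  show ?thesis
  proof (rule A.planar_commuting_graph[OF fin])
    fix x assume x: "x \<in> carrier (alt_group 5)" "x \<notin> group_center (alt_group 5)"
    have "id \<in> group_center (alt_group 5)" using subgroup.one_closed[OF A.center_subgroup] by (simp add: alt_group_one)
    then have "x \<noteq> id" using x by auto
    then have "encode 5 x \<noteq> encode 5 id" using encode_eqD[OF perm[OF x(1)] permutes_id] by blast
    moreover have "encode 5 id = [0..<5]" by (simp add: encode_def map_idI)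
    moreover have "encode 5 x \<in> set A5_lists" using x(1) encode_alt_group_5 by blast
    ultimately have 5: "length (filter (list_commute (encode 5 x)) A5_lists) \<le> 5" using A5_centralizers by fastforce
    have "card (centralizer (alt_group 5) x) \<le> card (set (filter (list_commute (encode 5 x)) A5_lists))"
    proof (rule card_inj_on_le[of "encode 5"])
      show "inj_on (encode 5) (centralizer (alt_group 5) x)"
        by (rule inj_onI) (auto simp: centralizer_def intro: encode_eqD perm)
      show "encode 5 ` centralizer (alt_group 5) x \<subseteq> set (filter (list_commute (encode 5 x)) A5_lists)"
      proof
        fix l assume "l \<in> encode 5 ` centralizer (alt_group 5) x"
        then obtain y where y: "l = encode 5 y" "y \<in> carrier (alt_group 5)" "x \<circ> y = y \<circ> x"
          by (auto simp: centralizer_def alt_group_mult)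
        have "l \<in> set A5_lists" using y encode_alt_group_5 by blast
        then show "l \<in> set (filter (list_commute (encode 5 x)) A5_lists)"
          using list_commute_encode[OF perm[OF x(1)] perm[OF y(2)] y(3)] y(1) by simp
      qed
    qed simp
    also have "\<dots> \<le> 5" using 5 card_length le_trans by blast
    finally show "card (centralizer (alt_group 5) x) \<le> card (group_center (alt_group 5)) + 4"
      using A.card_center_pos[OF fin] by simp
  qed
qed

section \<open>Planarity of the presented groups of the list\<close>

lemma planar_presented_group:
  assumes "\<And>f. satisfies (presented_group R) f R \<Longrightarrow> planar (commuting_graph (presented_group R))"
  shows "planar (commuting_graph (presented_group R))"
  using iso_presented_satisfies[OF group_presented_group iso_refl, of R] assms by blast

text \<open>The center has at least one element, so orders up to 2(1 + 4) = 10 are covered by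
  \<open>planar_order_bound\<close>.\<close>

lemma planar_dihedral_group:
  assumes "n \<in> {4, 5}"
  shows "planar (commuting_graph (dihedral_group n))"
  unfolding presented_defs
proof (rule planar_presented_group)
  fix f assume s: "satisfies (presented_group (dihedral_rels n)) f (dihedral_rels n)"
  interpret group "presented_group (dihedral_rels n)" by (rule group_presented_group)
  have "n > 0" "2 * n \<le> 10" using assms by auto
  then show "planar (commuting_graph (presented_group (dihedral_rels n)))"
    using dihedral_order[OF s] card_center_pos by (intro planar_order_bound) auto
qed

lemma planar_dicyclic_group_2: "planar (commuting_graph (dicyclic_group 2))"
  unfolding presented_defs
proof (rule planar_presented_group)
  fix f assume s: "satisfies (presented_group (dicyclic_rels 2)) f (dicyclic_rels 2)"
  interpret group "presented_group (dicyclic_rels 2)" by (rule group_presented_group)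
  show "planar (commuting_graph (presented_group (dicyclic_rels 2)))"
    using dicyclic_order[OF s] by (intro planar_order_bound) auto
qed

lemma planar_dihedral_group_6: "planar (commuting_graph (dihedral_group 6))"
  unfolding presented_defs
proof (rule planar_presented_group)
  let ?G = "presented_group (dihedral_rels 6)"
  fix f assume s: "satisfies ?G f (dihedral_rels 6)"
  interpret group ?G by (rule group_presented_group)
  note r = s[unfolded satisfies_rels]
  have "f A2 \<otimes>\<^bsub>?G\<^esub> f B2 = f B2 [^]\<^bsub>?G\<^esub> (5::nat) \<otimes>\<^bsub>?G\<^esub> f A2"
    using dihedral_metacyclic[of "f A2" "f B2" 6] r by simp
  then show "planar (commuting_graph ?G)"
    using r order_12_planar[of "f B2" "f A2" 0] by (simp add: insert_commute)
qed

lemma planar_dicyclic_group_3: "planar (commuting_graph (dicyclic_group 3))"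
  unfolding presented_defs
proof (rule planar_presented_group)
  let ?G = "presented_group (dicyclic_rels 3)"
  fix f assume s: "satisfies ?G f (dicyclic_rels 3)"
  interpret group ?G by (rule group_presented_group)
  note r = s[unfolded satisfies_rels]
  have "f A2 \<otimes>\<^bsub>?G\<^esub> f B2 = f B2 [^]\<^bsub>?G\<^esub> (5::nat) \<otimes>\<^bsub>?G\<^esub> f A2"
    using dihedral_metacyclic[of "f A2" "f B2" 6] r by simp
  then show "planar (commuting_graph ?G)"
    using r order_12_planar[of "f B2" "f A2" 3] by (simp add: insert_commute)
qed

lemma planar_Sz_2: "planar (commuting_graph Sz_2)"
  unfolding presented_defs
  by (rule planar_presented_group) (rule group.Sz_2_planar[OF group_presented_group])

lemma planar_SL_2_3: "planar (commuting_graph SL_2_3)"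
  unfolding presented_defs
  by (rule planar_presented_group)
    (meson binary_tetrahedral.planar group.SL_2_3_binary_tetrahedral group_presented_group)

lemma planar_groups_of_order_16:
  "planar (commuting_graph SG_16_3)" "planar (commuting_graph Z4_semidirect_Z4)"
  "planar (commuting_graph D8_central_Z4)" "planar (commuting_graph M_16)"
  unfolding presented_defs
  by (rule planar_presented_group, rule group.planar_order_16[OF group_presented_group];
      erule group.SG_16_3_order[OF group_presented_group] group.Z4_semidirect_Z4_order[OF group_presented_group]
        group.D8_central_Z4_order[OF group_presented_group] group.M_16_order[OF group_presented_group])+

lemma planar_Z2_DirProd_order_8:
  assumes "R = dihedral_rels 4 \<or> R = dicyclic_rels 2"
  shows "planar (commuting_graph (integer_mod_group 2 \<times>\<times> presented_group R))"
proof -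
  interpret group "presented_group R" by (rule group_presented_group)
  obtain f where "satisfies (presented_group R) f R" using iso_presented_satisfies[OF is_group iso_refl] by blast
  then have "satisfies (presented_group R) f (dihedral_rels 4) \<or> satisfies (presented_group R) f (dicyclic_rels 2)"
    using assms by auto
  then have "finite (carrier (presented_group R))" "order (presented_group R) \<le> 8"
    "order (presented_group R) \<le> 4 * card (group_center (presented_group R))"
    using dihedral_order[of f 4] dicyclic_order[of f 2] dihedral_4_dicyclic_2_center[of f] by auto
  then show ?thesis by (rule planar_Z2_DirProd[OF is_group])
qed

theorem theorem5p7:
  fixes G :: "('a, 'm) monoid_scheme"
  assumes "group G" and "finite (carrier G)" and "\<not> comm_group G"
  shows "planar (commuting_graph G) \<longleftrightarrow>
      G \<cong> sym_group 3 \<or>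
      G \<cong> dihedral_group 5 \<or>
      G \<cong> alt_group 4 \<or>
      G \<cong> Sz_2 \<or>
      G \<cong> sym_group 4 \<or>
      G \<cong> alt_group 5 \<or>
      G \<cong> dihedral_group 4 \<or>
      G \<cong> dicyclic_group 2 \<or>
      G \<cong> dihedral_group 6 \<or>
      G \<cong> dicyclic_group 3 \<or>
      G \<cong> SL_2_3 \<or>
      G \<cong> integer_mod_group 2 \<times>\<times> dihedral_group 4 \<or>
      G \<cong> integer_mod_group 2 \<times>\<times> dicyclic_group 2 \<or>
      G \<cong> SG_16_3 \<or>
      G \<cong> Z4_semidirect_Z4 \<or>
      G \<cong> D8_central_Z4 \<or>
      G \<cong> M_16"
  (is "_ \<longleftrightarrow> ?groups")
proof
  assume "planar (commuting_graph G)"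
  then interpret small_cliques G by (rule planar_small_cliques[OF assms])
  have "card (group_center G) \<in> {1, 2, 4}"
    using card_Z_le_4 card_Z_not_3 card_center_pos[OF fin] by auto
  then consider "card (group_center G) = 1" | "card (group_center G) = 2" | "card (group_center G) = 4" by blast
  then show ?groups
  proof cases
    case 1
    then interpret centerless_cliques G by unfold_locales
    show ?thesis using card_Z_1_cases by blast
  next
    case 2
    then show ?thesis using card_Z_2_cases by blast
  next
    case 3
    then show ?thesis using card_Z_4_cases by blast
  qed
next
  note planar = planar_sym_group_3 planar_sym_group_4 planar_alt_group_4 planar_alt_group_5
    planar_dihedral_group[of 4, simplified] planar_dihedral_group[of 5, simplified] planar_dihedral_group_6
    planar_dicyclic_group_2 planar_dicyclic_group_3 planar_Sz_2 planar_SL_2_3 planar_groups_of_order_16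
    planar_Z2_DirProd_order_8[of "dihedral_rels 4", folded presented_defs, simplified]
    planar_Z2_DirProd_order_8[of "dicyclic_rels 2", folded presented_defs, simplified]
  note groups = sym_group_is_group alt_group_is_group DirProd_group[OF group_integer_mod_group]
    group_presented_group[of "dihedral_rels n" for n, folded presented_defs]
    group_presented_group[of "dicyclic_rels n" for n, folded presented_defs]
    group_presented_group[of Sz_2_rels, folded presented_defs] group_presented_group[of SL_2_3_rels, folded presented_defs]
    group_presented_group[of SG_16_3_rels, folded presented_defs]
    group_presented_group[of Z4_semidirect_Z4_rels, folded presented_defs]
    group_presented_group[of D8_central_Z4_rels, folded presented_defs] group_presented_group[of M_16_rels, folded presented_defs]
  assume ?groups
  then show "planar (commuting_graph G)"
    by (elim disjE; elim planar_iso[OF assms(1), rotated]; intro planar groups)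
qed

end
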